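(* Let $k$ be a field and let $A=B\oplus M$ be a split extension of $k$-algebras. Then the following hold. (1) The sequence of $A$-bimodules $$\cdots\xrightarrow{d}A\otimes_B M^{\otimes_B n}\otimes_B A\xrightarrow{d}\cdots\xrightarrow{d}A\otimes_B M\otimes_B A\xrightarrow{d}A\otimes_B A\xrightarrow{d}A\to 0,$$ with $$d(a_0\otimes m_1\otimes\cdots\otimes m_n\otimes a_{n+1})=a_0m_1\otimes m_2\otimes\cdots\otimes a_{n+1}+\sum_{i=1}^{n-1}(-1)^i a_0\otimes m_1\otimes\cdots\otimes m_im_{i+1}\otimes\cdots\otimes a_{n+1}+(-1)^n a_0\otimes m_1\otimes\cdots\otimes m_{n-1}\otimes m_na_{n+1}$$ for $n\ge 1$, and with $A\otimes_B A\to A$ the multiplication, is a relative projective resolution of the $A$-bimodule $A$ with respect to the extension $B^e\subset A^e$ (the reduced relative bar resolution). (2) For every $A$-bimodule $X$, the homology of the chain complex $$C^M_*(A|B,X):\quad \cdots\xrightarrow{b}X\otimes_{B^e}M^{\otimes_B n}\xrightarrow{b}\cdots\xrightarrow{b}X\otimes_{B^e}M\xrightarrow{b}X_B\to 0$$ is $H_*(A|B,X)$, where $$b(x\otimes m_1\otimes\cdots\otimes m_n)=xm_1\otimes m_2\otimes\cdots\otimes m_n+\sum_{i=1}^{n-1}(-1)^i x\otimes m_1\otimes\cdots\otimes m_im_{i+1}\otimes\cdots\otimes m_n+(-1)^n m_nx\otimes m_1\otimes\cdots\otimes m_{n-1}.$$ (3) For every $A$-bimodule $X$, the cohomology of the cochain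 complex $$0\to X^B\xrightarrow{b}\mathrm{Hom}_{B^e}(M,X)\xrightarrow{b}\cdots\xrightarrow{b}\mathrm{Hom}_{B^e}(M^{\otimes_B n},X)\xrightarrow{b}\cdots$$ is $H^*(A|B,X)$, where for $x\in X^B$ one has $(bx)(m)=mx-xm$, and for $f\in\mathrm{Hom}_{B^e}(M^{\otimes_B n},X)$ with $n\geq 1$, $$(bf)(m_1\otimes\cdots\otimes m_{n+1})=m_1f(m_2\otimes\cdots\otimes m_{n+1})+\sum_{i=1}^{n}(-1)^if(m_1\otimes\cdots\otimes m_im_{i+1}\otimes\cdots\otimes m_{n+1})+(-1)^{n+1}f(m_1\otimes\cdots\otimes m_n)m_{n+1}.$$
   Context: Algebras are associative and unital over a field $k$. A split extension $A=B\oplus M$ is a $k$-algebra $A$ with a subalgebra $B$ and a two-sided ideal $M$ of $A$ such that $A=B\oplus M$ as vector spaces. For an algebra $A$, $A^e=A\otimes_k A^{op}$ is the enveloping algebra; $A$-bimodules are identified with left (or right) $A^e$-modules. Relative homological algebra (Hochschild). Let $S\subset R$ be an extension of algebras. An induced module is an $R$-module of the form $R\otimes_S N$ with $N$ a left $S$-module. An $R$-module is relative projective if it is an $R$-direct summand of an induced module. A relative projective resolution of an $R$-module $X$ is a sequence $\cdots\to P_1\to P_0\to X\to 0$ of $R$-morphisms $d$ with each $P_i$ relative projective, $d^2=0$, and admitting an $S$-linear contracting homotopy. The functors $\mathrm{Tor}^{R|S}_*$ and $\mathrm{Ext}^*_{R|S}$ are computed as usual using relative projective resolutions. For an extension $B\subset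 A$ and an $A$-bimodule $X$, relative Hochschild homology and cohomology are $$H_*(A|B,X)=\mathrm{Tor}^{A^e|B^e}_*(X,A),\qquad H^*(A|B,X)=\mathrm{Ext}^*_{A^e|B^e}(A,X).$$ Moreover $X_B=X\otimes_{B^e}B=X/\langle bx-xb\rangle$ and $X^B=\mathrm{Hom}_{B^e}(B,X)=\{x\in X\mid bx=xb\text{ for all }b\in B\}$. *)

theory Defs
  imports "HOL-Algebra.Module" "HOL-Algebra.Subrings" "HOL-Algebra.Ideal"
begin

section \<open>Modules over a (non-commutative) ring\<close>

text \<open>
  The locale \<^locale>\<open>module\<close> of the library requires a commutative ring of scalars, and so
  does \<open>algebra\<close>.  As for \<^locale>\<open>module\<close>, the multiplicative fields
  of the record of a module carry no information.  A right module over \<open>R\<close> is a left module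
  over \<open>opp R\<close>: its \<^const>\<open>smult\<close> applied to \<open>r\<close> and \<open>x\<close> is \<open>x r\<close>.
\<close>

locale left_module = R?: ring R + N?: abelian_group N
  for R :: "('r, 'i) ring_scheme" (structure) and N :: "('r, 'n, 'j) module_scheme" (structure) +
  assumes smult_closed: "\<lbrakk>r \<in> carrier R; x \<in> carrier N\<rbrakk> \<Longrightarrow> r \<odot>\<^bsub>N\<^esub> x \<in> carrier N"
    and smult_l_distr: "\<lbrakk>r \<in> carrier R; s \<in> carrier R; x \<in> carrier N\<rbrakk> \<Longrightarrow>
      (r \<oplus>\<^bsub>R\<^esub> s) \<odot>\<^bsub>N\<^esub> x = r \<odot>\<^bsub>N\<^esub> x \<oplus>\<^bsub>N\<^esub> s \<odot>\<^bsub>N\<^esub> x"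
    and smult_r_distr: "\<lbrakk>r \<in> carrier R; x \<in> carrier N; y \<in> carrier N\<rbrakk> \<Longrightarrow>
      r \<odot>\<^bsub>N\<^esub> (x \<oplus>\<^bsub>N\<^esub> y) = r \<odot>\<^bsub>N\<^esub> x \<oplus>\<^bsub>N\<^esub> r \<odot>\<^bsub>N\<^esub> y"
    and smult_assoc: "\<lbrakk>r \<in> carrier R; s \<in> carrier R; x \<in> carrier N\<rbrakk> \<Longrightarrow>
      (r \<otimes>\<^bsub>R\<^esub> s) \<odot>\<^bsub>N\<^esub> x = r \<odot>\<^bsub>N\<^esub> (s \<odot>\<^bsub>N\<^esub> x)"
    and smult_one: "x \<in> carrier N \<Longrightarrow> \<one>\<^bsub>R\<^esub> \<odot>\<^bsub>N\<^esub> x = x"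

definition linear_map ::
  "('r, 'i) ring_scheme \<Rightarrow> ('r, 'm, 'j) module_scheme \<Rightarrow> ('r, 'n, 'l) module_scheme \<Rightarrow> ('m \<Rightarrow> 'n) \<Rightarrow> bool"
  where "linear_map R N N' f \<longleftrightarrow>
    f \<in> carrier N \<rightarrow> carrier N' \<and>
    (\<forall>x\<in>carrier N. \<forall>y\<in>carrier N. f (x \<oplus>\<^bsub>N\<^esub> y) = f x \<oplus>\<^bsub>N'\<^esub> f y) \<and>
    (\<forall>r\<in>carrier R. \<forall>x\<in>carrier N. f (r \<odot>\<^bsub>N\<^esub> x) = r \<odot>\<^bsub>N'\<^esub> f x)"

definition module_iso ::
  "('r, 'i) ring_scheme \<Rightarrow> ('r, 'm, 'j) module_scheme \<Rightarrow> ('r, 'n, 'l) module_scheme \<Rightarrow> bool"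
  where "module_iso R N N' \<longleftrightarrow>
    (\<exists>f. linear_map R N N' f \<and> bij_betw f (carrier N) (carrier N'))"

definition restrict_scalars :: "('s \<Rightarrow> 'r) \<Rightarrow> ('r, 'n, 'j) module_scheme \<Rightarrow> ('s, 'n) module"
  where "restrict_scalars h N =
    \<lparr>carrier = carrier N, mult = mult N, one = one N, zero = zero N, add = add N,
     smult = \<lambda>s x. h s \<odot>\<^bsub>N\<^esub> x\<rparr>"

definition quot_module :: "('r, 'n, 'j) module_scheme \<Rightarrow> 'n set \<Rightarrow> ('r, 'n set) module"
  where "quot_module N H =
    \<lparr>carrier = a_rcosets\<^bsub>N\<^esub> H, mult = undefined, one = undefined,
     zero = H, add = set_add N, smult = \<lambda>r C. (\<Union>x\<in>C. H +>\<^bsub>N\<^esub> (r \<odot>\<^bsub>N\<^esub> x))\<rparr>"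

definition submodule_gen :: "('r, 'i) ring_scheme \<Rightarrow> ('r, 'n) module \<Rightarrow> 'n set \<Rightarrow> 'n set"
  where "submodule_gen R N E = \<Inter>{H. submodule H R N \<and> E \<subseteq> H}"

definition direct_summand ::
  "('r, 'i) ring_scheme \<Rightarrow> ('r, 'm, 'j) module_scheme \<Rightarrow> ('r, 'n) module \<Rightarrow> bool"
  where "direct_summand R P N \<longleftrightarrow>
    (\<exists>U V. submodule U R N \<and> submodule V R N \<and>
       U \<inter> V = {\<zero>\<^bsub>N\<^esub>} \<and> U <+>\<^bsub>N\<^esub> V = carrier N \<and>
       module_iso R P (N\<lparr>carrier := U\<rparr>))"


section \<open>Algebras, split extensions and bimodules\<close>

definition k_algebra :: "('k, 'i) ring_scheme \<Rightarrow> ('k, 'a) module \<Rightarrow> bool"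
  where "k_algebra k A \<longleftrightarrow>
    ring A \<and> module k A \<and>
    (\<forall>c\<in>carrier k. \<forall>x\<in>carrier A. \<forall>y\<in>carrier A.
       (c \<odot>\<^bsub>A\<^esub> x) \<otimes>\<^bsub>A\<^esub> y = c \<odot>\<^bsub>A\<^esub> (x \<otimes>\<^bsub>A\<^esub> y) \<and>
       x \<otimes>\<^bsub>A\<^esub> (c \<odot>\<^bsub>A\<^esub> y) = c \<odot>\<^bsub>A\<^esub> (x \<otimes>\<^bsub>A\<^esub> y))"

definition opp :: "('k, 'a) module \<Rightarrow> ('k, 'a) module"
  where "opp A = A\<lparr>mult := \<lambda>x y. y \<otimes>\<^bsub>A\<^esub> x\<rparr>"

definition ground :: "'k ring \<Rightarrow> ('k, 'k) module"
  where "ground k =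
    \<lparr>carrier = carrier k, mult = mult k, one = one k, zero = zero k, add = add k, smult = mult k\<rparr>"

abbreviation subalg :: "('k, 'a) module \<Rightarrow> 'a set \<Rightarrow> ('k, 'a) module"
  where "subalg A B \<equiv> A\<lparr>carrier := B\<rparr>"

text \<open>Here \<^locale>\<open>subring\<close> includes that \<open>B\<close> contains the unit of \<open>A\<close>.\<close>

definition split_extension :: "'k ring \<Rightarrow> ('k, 'a) module \<Rightarrow> 'a set \<Rightarrow> 'a set \<Rightarrow> bool"
  where "split_extension k A B M \<longleftrightarrow>
    k_algebra k A \<and>
    subring B A \<and> submodule B k A \<and>
    ideal M A \<and>
    B \<inter> M = {\<zero>\<^bsub>A\<^esub>} \<and> B <+>\<^bsub>A\<^esub> M = carrier A"

text \<open>The \<open>k\<close>-module underlying a (left or right) module over the \<open>k\<close>-algebra \<open>R\<close>.\<close>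

definition kmod :: "('k, 'r) module \<Rightarrow> ('r, 'n, 'j) module_scheme \<Rightarrow> ('k, 'n) module"
  where "kmod R N = restrict_scalars (\<lambda>c. c \<odot>\<^bsub>R\<^esub> \<one>\<^bsub>R\<^esub>) N"

text \<open>In a bimodule, \<^const>\<open>smult\<close> is the left action and \<open>rsmult\<close> the right action.\<close>

record ('a, 'x) bimodule = "('a, 'x) module" +
  rsmult :: "'x \<Rightarrow> 'a \<Rightarrow> 'x" (infixl \<open>\<triangleleft>\<index>\<close> 70)

definition right_part :: "('a, 'x) bimodule \<Rightarrow> ('a, 'x) module"
  where "right_part X =
    \<lparr>carrier = carrier X, mult = mult X, one = one X, zero = zero X, add = add X,
     smult = \<lambda>a x. x \<triangleleft>\<^bsub>X\<^esub> a\<rparr>"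

text \<open>The last clause, centrality of \<open>k\<close>, is what makes an \<open>A\<close>-bimodule an \<open>A\<^sup>e\<close>-module.\<close>

definition is_bimodule :: "'k ring \<Rightarrow> ('k, 'a) module \<Rightarrow> ('a, 'x) bimodule \<Rightarrow> bool"
  where "is_bimodule k A X \<longleftrightarrow>
    left_module A X \<and> left_module (opp A) (right_part X) \<and>
    (\<forall>a\<in>carrier A. \<forall>a'\<in>carrier A. \<forall>x\<in>carrier X.
       (a \<odot>\<^bsub>X\<^esub> x) \<triangleleft>\<^bsub>X\<^esub> a' = a \<odot>\<^bsub>X\<^esub> (x \<triangleleft>\<^bsub>X\<^esub> a')) \<and>
    (\<forall>c\<in>carrier k. \<forall>x\<in>carrier X.
       (c \<odot>\<^bsub>A\<^esub> \<one>\<^bsub>A\<^esub>) \<odot>\<^bsub>X\<^esub> x = x \<triangleleft>\<^bsub>X\<^esub> (c \<odot>\<^bsub>A\<^esub> \<one>\<^bsub>A\<^esub>))"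

definition self_bimodule :: "('k, 'a) module \<Rightarrow> ('a, 'a) bimodule"
  where "self_bimodule A =
    \<lparr>carrier = carrier A, mult = mult A, one = one A, zero = zero A, add = add A,
     smult = mult A, rsmult = mult A\<rparr>"


section \<open>Tensor products\<close>

text \<open>
  Tensor products are quotients of free \<open>k\<close>-modules; the free module on \<open>W\<close> consists of the
  finitely supported functions on \<open>W\<close>, extended by zero.
\<close>

definition free_module :: "'k ring \<Rightarrow> 'w set \<Rightarrow> ('k, 'w \<Rightarrow> 'k) module"
  where "free_module k W =
    \<lparr>carrier = {f. (\<forall>w. f w \<in> carrier k) \<and> (\<forall>w. w \<notin> W \<longrightarrow> f w = \<zero>\<^bsub>k\<^esub>) \<and> finite {w. f w \<noteq> \<zero>\<^bsub>k\<^esub>}},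
     mult = undefined, one = undefined,
     zero = (\<lambda>w. \<zero>\<^bsub>k\<^esub>), add = (\<lambda>f g w. f w \<oplus>\<^bsub>k\<^esub> g w), smult = (\<lambda>c f w. c \<otimes>\<^bsub>k\<^esub> f w)\<rparr>"

definition free_gen :: "'k ring \<Rightarrow> 'w \<Rightarrow> 'w \<Rightarrow> 'k"
  where "free_gen k w = (\<lambda>v. if v = w then \<one>\<^bsub>k\<^esub> else \<zero>\<^bsub>k\<^esub>)"

text \<open>
  The \<open>k\<close>-linear map out of a quotient of a free module that is given by \<open>\<phi>\<close> on generators:
  the linear extension of \<open>\<phi>\<close> takes one and the same value on all representatives of the
  coset \<open>C\<close> whenever \<open>\<phi>\<close> respects the relations.
\<close>

definition lin_ext :: "'k ring \<Rightarrow> ('k, 'n) module \<Rightarrow> ('w \<Rightarrow> 'n) \<Rightarrow> ('w \<Rightarrow> 'k) set \<Rightarrow> 'n"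
  where "lin_ext k N \<phi> C =
    the_elem ((\<lambda>f. \<Oplus>\<^bsub>N\<^esub>w\<in>{w. f w \<noteq> \<zero>\<^bsub>k\<^esub>}. f w \<odot>\<^bsub>N\<^esub> \<phi> w) ` C)"

subsection \<open>The tensor product of a right and a left module over a \<open>k\<close>-algebra\<close>

definition tensor_rels ::
  "'k ring \<Rightarrow> ('k, 'r) module \<Rightarrow> ('r, 'x) module \<Rightarrow> ('r, 'n) module \<Rightarrow> ('x \<times> 'n \<Rightarrow> 'k) set"
  where "tensor_rels k R X N =
    (let F = free_module k (carrier X \<times> carrier N) in
      {free_gen k (x \<oplus>\<^bsub>X\<^esub> x', y) \<ominus>\<^bsub>F\<^esub> (free_gen k (x, y) \<oplus>\<^bsub>F\<^esub> free_gen k (x', y)) | x x' y.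
         x \<in> carrier X \<and> x' \<in> carrier X \<and> y \<in> carrier N} \<union>
      {free_gen k (x, y \<oplus>\<^bsub>N\<^esub> y') \<ominus>\<^bsub>F\<^esub> (free_gen k (x, y) \<oplus>\<^bsub>F\<^esub> free_gen k (x, y')) | x y y'.
         x \<in> carrier X \<and> y \<in> carrier N \<and> y' \<in> carrier N} \<union>
      {free_gen k (x, c \<odot>\<^bsub>kmod R N\<^esub> y) \<ominus>\<^bsub>F\<^esub> c \<odot>\<^bsub>F\<^esub> free_gen k (x, y) | c x y.
         c \<in> carrier k \<and> x \<in> carrier X \<and> y \<in> carrier N} \<union>
      {free_gen k (r \<odot>\<^bsub>X\<^esub> x, y) \<ominus>\<^bsub>F\<^esub> free_gen k (x, r \<odot>\<^bsub>N\<^esub> y) | r x y.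
         r \<in> carrier R \<and> x \<in> carrier X \<and> y \<in> carrier N})"

definition tensor_null ::
  "'k ring \<Rightarrow> ('k, 'r) module \<Rightarrow> ('r, 'x) module \<Rightarrow> ('r, 'n) module \<Rightarrow> ('x \<times> 'n \<Rightarrow> 'k) set"
  where "tensor_null k R X N =
    submodule_gen k (free_module k (carrier X \<times> carrier N)) (tensor_rels k R X N)"

definition tensor ::
  "'k ring \<Rightarrow> ('k, 'r) module \<Rightarrow> ('r, 'x) module \<Rightarrow> ('r, 'n) module \<Rightarrow> ('k, ('x \<times> 'n \<Rightarrow> 'k) set) module"
  where "tensor k R X N =
    quot_module (free_module k (carrier X \<times> carrier N)) (tensor_null k R X N)"

definition tensor_pure ::
  "'k ring \<Rightarrow> ('k, 'r) module \<Rightarrow> ('r, 'x) module \<Rightarrow> ('r, 'n) module \<Rightarrow> 'x \<Rightarrow> 'n \<Rightarrow> ('x \<times> 'n \<Rightarrow> 'k) set"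
  where "tensor_pure k R X N x y =
    tensor_null k R X N +>\<^bsub>free_module k (carrier X \<times> carrier N)\<^esub> free_gen k (x, y)"

subsection \<open>Tensor products over \<open>B\<close> of finitely many \<open>B\<close>-sub-bimodules of \<open>A\<close>\<close>

text \<open>
  For a nonempty list \<open>[N\<^sub>1, \<dots>, N\<^sub>r]\<close> of \<open>B\<close>-sub-bimodules of \<open>A\<close>, the unbracketed tensor
  product of \<open>N\<^sub>1, \<dots>, N\<^sub>r\<close> over \<open>B\<close>, generated by words of length \<open>r\<close>.  Treating all
  lengths at once places the terms of the complexes below in a single type.
\<close>

definition ltensor_rels ::
  "'k ring \<Rightarrow> ('k, 'a) module \<Rightarrow> 'a set \<Rightarrow> 'a set list \<Rightarrow> ('a list \<Rightarrow> 'k) set"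
  where "ltensor_rels k A B Ns =
    (let W = listset Ns; F = free_module k W in
      {free_gen k (u @ (x \<oplus>\<^bsub>A\<^esub> y) # v) \<ominus>\<^bsub>F\<^esub> (free_gen k (u @ x # v) \<oplus>\<^bsub>F\<^esub> free_gen k (u @ y # v)) | u x y v.
         u @ x # v \<in> W \<and> u @ y # v \<in> W} \<union>
      {free_gen k (u @ (c \<odot>\<^bsub>A\<^esub> x) # v) \<ominus>\<^bsub>F\<^esub> c \<odot>\<^bsub>F\<^esub> free_gen k (u @ x # v) | c u x v.
         c \<in> carrier k \<and> u @ x # v \<in> W} \<union>
      {free_gen k (u @ (x \<otimes>\<^bsub>A\<^esub> b) # y # v) \<ominus>\<^bsub>F\<^esub> free_gen k (u @ x # (b \<otimes>\<^bsub>A\<^esub> y) # v) | b u x y v.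
         b \<in> B \<and> u @ x # y # v \<in> W})"

definition ltensor_null ::
  "'k ring \<Rightarrow> ('k, 'a) module \<Rightarrow> 'a set \<Rightarrow> 'a set list \<Rightarrow> ('a list \<Rightarrow> 'k) set"
  where "ltensor_null k A B Ns =
    submodule_gen k (free_module k (listset Ns)) (ltensor_rels k A B Ns)"

definition ltensor_pure ::
  "'k ring \<Rightarrow> ('k, 'a) module \<Rightarrow> 'a set \<Rightarrow> 'a set list \<Rightarrow> 'a list \<Rightarrow> ('a list \<Rightarrow> 'k) set"
  where "ltensor_pure k A B Ns w =
    ltensor_null k A B Ns +>\<^bsub>free_module k (listset Ns)\<^esub> free_gen k w"

text \<open>The outer actions are multiplication on the first and on the last letter.\<close>

definition ltensor ::
  "'k ring \<Rightarrow> ('k, 'a) module \<Rightarrow> 'a set \<Rightarrow> 'a set list \<Rightarrow> ('a, ('a list \<Rightarrow> 'k) set) bimodule"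
  where "ltensor k A B Ns =
    (let Q = quot_module (free_module k (listset Ns)) (ltensor_null k A B Ns) in
     \<lparr>carrier = carrier Q, mult = undefined, one = undefined, zero = zero Q, add = add Q,
      smult = (\<lambda>a. lin_ext k Q (\<lambda>w. ltensor_pure k A B Ns ((a \<otimes>\<^bsub>A\<^esub> hd w) # tl w))),
      rsmult = (\<lambda>C a. lin_ext k Q (\<lambda>w. ltensor_pure k A B Ns (butlast w @ [last w \<otimes>\<^bsub>A\<^esub> a])) C)\<rparr>)"


section \<open>Enveloping algebras\<close>

definition alg_tensor ::
  "'k ring \<Rightarrow> ('k, 'a) module \<Rightarrow> ('k, 'b) module \<Rightarrow> ('k, ('a \<times> 'b \<Rightarrow> 'k) set) module"
  where "alg_tensor k A A' =
    (let T = tensor k (ground k) A A'; p = tensor_pure k (ground k) A A' in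
     \<lparr>carrier = carrier T,
      mult = (\<lambda>C D. lin_ext k T (\<lambda>(a, a'). lin_ext k T (\<lambda>(b, b'). p (a \<otimes>\<^bsub>A\<^esub> b) (a' \<otimes>\<^bsub>A'\<^esub> b')) D) C),
      one = p \<one>\<^bsub>A\<^esub> \<one>\<^bsub>A'\<^esub>,
      zero = zero T, add = add T, smult = smult T\<rparr>)"

definition env :: "'k ring \<Rightarrow> ('k, 'a) module \<Rightarrow> ('k, ('a \<times> 'a \<Rightarrow> 'k) set) module"
  where "env k A = alg_tensor k A (opp A)"

text \<open>
  The algebra map \<open>B\<^sup>e \<rightarrow> A\<^sup>e\<close> induced by the inclusion of a subalgebra; it is injective because
  \<open>k\<close> is a field, and this is the extension \<open>B\<^sup>e \<subset> A\<^sup>e\<close>.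
\<close>

definition env_incl ::
  "'k ring \<Rightarrow> ('k, 'a) module \<Rightarrow> 'a set \<Rightarrow> ('a \<times> 'a \<Rightarrow> 'k) set \<Rightarrow> ('a \<times> 'a \<Rightarrow> 'k) set"
  where "env_incl k A B =
    lin_ext k (tensor k (ground k) A (opp A)) (\<lambda>(b, b'). tensor_pure k (ground k) A (opp A) b b')"

text \<open>
  A bimodule as a left and as a right module over the enveloping algebra:
  \<open>(a \<otimes> a') x = a x a'\<close> and \<open>x (a \<otimes> a') = a' x a\<close>.
\<close>

definition env_left ::
  "'k ring \<Rightarrow> ('k, 'a) module \<Rightarrow> ('a, 'x) bimodule \<Rightarrow> (('a \<times> 'a \<Rightarrow> 'k) set, 'x) module"
  where "env_left k A X =
    \<lparr>carrier = carrier X, mult = mult X, one = one X, zero = zero X, add = add X,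
     smult = \<lambda>C x. lin_ext k (kmod A X) (\<lambda>(a, a'). (a \<odot>\<^bsub>X\<^esub> x) \<triangleleft>\<^bsub>X\<^esub> a') C\<rparr>"

definition env_right ::
  "'k ring \<Rightarrow> ('k, 'a) module \<Rightarrow> ('a, 'x) bimodule \<Rightarrow> (('a \<times> 'a \<Rightarrow> 'k) set, 'x) module"
  where "env_right k A X =
    \<lparr>carrier = carrier X, mult = mult X, one = one X, zero = zero X, add = add X,
     smult = \<lambda>C x. lin_ext k (kmod A X) (\<lambda>(a, a'). (a' \<odot>\<^bsub>X\<^esub> x) \<triangleleft>\<^bsub>X\<^esub> a) C\<rparr>"


section \<open>Complexes of \<open>k\<close>-modules\<close>

text \<open>In a chain complex the differential \<open>d n\<close> leaves degree \<open>n\<close>; \<open>d 0\<close> is ignored.\<close>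

definition chain_complex :: "'k ring \<Rightarrow> (nat \<Rightarrow> ('k, 'c) module) \<Rightarrow> (nat \<Rightarrow> 'c \<Rightarrow> 'c) \<Rightarrow> bool"
  where "chain_complex k C d \<longleftrightarrow>
    (\<forall>n. module k (C n)) \<and>
    (\<forall>n. linear_map k (C (Suc n)) (C n) (d (Suc n))) \<and>
    (\<forall>n. \<forall>x\<in>carrier (C (Suc (Suc n))). d (Suc n) (d (Suc (Suc n)) x) = \<zero>\<^bsub>C n\<^esub>)"

definition homology ::
  "(nat \<Rightarrow> ('k, 'c) module) \<Rightarrow> (nat \<Rightarrow> 'c \<Rightarrow> 'c) \<Rightarrow> nat \<Rightarrow> ('k, 'c set) module"
  where "homology C d n =
    quot_module
      ((C n)\<lparr>carrier := {x \<in> carrier (C n). n > 0 \<longrightarrow> d n x = \<zero>\<^bsub>C (n - 1)\<^esub>}\<rparr>)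
      (d (Suc n) ` carrier (C (Suc n)))"

definition cochain_complex :: "'k ring \<Rightarrow> (nat \<Rightarrow> ('k, 'c) module) \<Rightarrow> (nat \<Rightarrow> 'c \<Rightarrow> 'c) \<Rightarrow> bool"
  where "cochain_complex k C d \<longleftrightarrow>
    (\<forall>n. module k (C n)) \<and>
    (\<forall>n. linear_map k (C n) (C (Suc n)) (d n)) \<and>
    (\<forall>n. \<forall>x\<in>carrier (C n). d (Suc n) (d n x) = \<zero>\<^bsub>C (Suc (Suc n))\<^esub>)"

definition cohomology ::
  "(nat \<Rightarrow> ('k, 'c) module) \<Rightarrow> (nat \<Rightarrow> 'c \<Rightarrow> 'c) \<Rightarrow> nat \<Rightarrow> ('k, 'c set) module"
  where "cohomology C d n =
    quot_module
      ((C n)\<lparr>carrier := {x \<in> carrier (C n). d n x = \<zero>\<^bsub>C (Suc n)\<^esub>}\<rparr>)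
      (if n = 0 then {\<zero>\<^bsub>C 0\<^esub>} else d (n - 1) ` carrier (C (n - 1)))"

text \<open>\<open>Hom\<^sub>R(N, N')\<close> as a \<open>k\<close>-module, for a \<open>k\<close>-algebra \<open>R\<close>.\<close>

definition hom_module ::
  "('k, 'r) module \<Rightarrow> ('r, 'm) module \<Rightarrow> ('r, 'n) module \<Rightarrow> ('k, 'm \<Rightarrow> 'n) module"
  where "hom_module R N N' =
    \<lparr>carrier = {f \<in> extensional (carrier N). linear_map R N N' f},
     mult = undefined, one = undefined,
     zero = (\<lambda>x\<in>carrier N. \<zero>\<^bsub>N'\<^esub>),
     add = (\<lambda>f g. \<lambda>x\<in>carrier N. f x \<oplus>\<^bsub>N'\<^esub> g x),
     smult = (\<lambda>c f. \<lambda>x\<in>carrier N. c \<odot>\<^bsub>kmod R N'\<^esub> f x)\<rparr>"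


section \<open>Relative homological algebra\<close>

text \<open>A ring extension \<open>S \<subset> R\<close> is given by the inclusion map \<open>\<iota>\<close>.\<close>

definition induced_module ::
  "'k ring \<Rightarrow> ('k, 'r) module \<Rightarrow> ('k, 's) module \<Rightarrow> ('s \<Rightarrow> 'r) \<Rightarrow> ('s, 'n) module
     \<Rightarrow> ('r, ('r \<times> 'n \<Rightarrow> 'k) set) module"
  where "induced_module k R S \<iota> N =
    (let RS = \<lparr>carrier = carrier R, mult = mult R, one = one R, zero = zero R, add = add R,
               smult = \<lambda>s r. r \<otimes>\<^bsub>R\<^esub> \<iota> s\<rparr>;
         T = tensor k S RS N in
     \<lparr>carrier = carrier T, mult = undefined, one = undefined, zero = zero T, add = add T,
      smult = \<lambda>r. lin_ext k T (\<lambda>(r', y). tensor_pure k S RS N (r \<otimes>\<^bsub>R\<^esub> r') y)\<rparr>)"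

text \<open>
  The \<open>S\<close>-module \<open>N\<close> ranges over modules with elements in the type of \<open>P\<close>.  This is no
  restriction: if \<open>P\<close> is a summand of some induced module, then it is one of
  \<open>R \<otimes>\<^sub>S P\<close>.
\<close>

definition rel_projective ::
  "'k ring \<Rightarrow> ('k, 'r) module \<Rightarrow> ('k, 's) module \<Rightarrow> ('s \<Rightarrow> 'r) \<Rightarrow> ('r, 'p) module \<Rightarrow> bool"
  where "rel_projective k R S \<iota> P \<longleftrightarrow>
    left_module R P \<and>
    (\<exists>N :: ('s, 'p) module. left_module S N \<and> direct_summand R P (induced_module k R S \<iota> N))"

definition rel_projective_resolution ::
  "'k ring \<Rightarrow> ('k, 'r) module \<Rightarrow> ('k, 's) module \<Rightarrow> ('s \<Rightarrow> 'r) \<Rightarrow> ('r, 'y) module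
     \<Rightarrow> (nat \<Rightarrow> ('r, 'p) module) \<Rightarrow> (nat \<Rightarrow> 'p \<Rightarrow> 'p) \<Rightarrow> ('p \<Rightarrow> 'y) \<Rightarrow> bool"
  where "rel_projective_resolution k R S \<iota> Y P d \<epsilon> \<longleftrightarrow>
    (\<forall>n. rel_projective k R S \<iota> (P n)) \<and>
    linear_map R (P 0) Y \<epsilon> \<and>
    (\<forall>n. linear_map R (P (Suc n)) (P n) (d (Suc n))) \<and>
    (\<forall>x\<in>carrier (P 1). \<epsilon> (d 1 x) = \<zero>\<^bsub>Y\<^esub>) \<and>
    (\<forall>n. \<forall>x\<in>carrier (P (Suc (Suc n))). d (Suc n) (d (Suc (Suc n)) x) = \<zero>\<^bsub>P n\<^esub>) \<and>
    (\<exists>\<eta> h.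
       linear_map S (restrict_scalars \<iota> Y) (restrict_scalars \<iota> (P 0)) \<eta> \<and>
       (\<forall>n. linear_map S (restrict_scalars \<iota> (P n)) (restrict_scalars \<iota> (P (Suc n))) (h n)) \<and>
       (\<forall>y\<in>carrier Y. \<epsilon> (\<eta> y) = y) \<and>
       (\<forall>x\<in>carrier (P 0). d 1 (h 0 x) \<oplus>\<^bsub>P 0\<^esub> \<eta> (\<epsilon> x) = x) \<and>
       (\<forall>n. \<forall>x\<in>carrier (P (Suc n)).
          d (Suc (Suc n)) (h (Suc n) x) \<oplus>\<^bsub>P (Suc n)\<^esub> h n (d (Suc n) x) = x))"

text \<open>
  \<open>Tor\<close> and \<open>Ext\<close> as computed from a relative projective resolution \<open>(P, d)\<close> of the other
  argument: the homology of \<open>X \<otimes>\<^sub>R P\<close> and the cohomology of \<open>Hom\<^sub>R(P, X)\<close>.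
\<close>

definition Tor_via ::
  "'k ring \<Rightarrow> ('k, 'r) module \<Rightarrow> ('r, 'x) module \<Rightarrow> (nat \<Rightarrow> ('r, 'p) module) \<Rightarrow> (nat \<Rightarrow> 'p \<Rightarrow> 'p)
     \<Rightarrow> nat \<Rightarrow> ('k, ('x \<times> 'p \<Rightarrow> 'k) set set) module"
  where "Tor_via k R X P d =
    homology (\<lambda>n. tensor k R X (P n))
      (\<lambda>n. lin_ext k (tensor k R X (P (n - 1))) (\<lambda>(x, y). tensor_pure k R X (P (n - 1)) x (d n y)))"

definition Ext_via ::
  "('k, 'r) module \<Rightarrow> (nat \<Rightarrow> ('r, 'p) module) \<Rightarrow> (nat \<Rightarrow> 'p \<Rightarrow> 'p) \<Rightarrow> ('r, 'x) module
     \<Rightarrow> nat \<Rightarrow> ('k, ('p \<Rightarrow> 'x) set) module"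
  where "Ext_via R P d X =
    cohomology (\<lambda>n. hom_module R (P n) X)
      (\<lambda>n f. \<lambda>y\<in>carrier (P (Suc n)). f (d (Suc n) y))"

text \<open>
  \<open>H\<^sub>n(A|B, X)\<close> and \<open>H\<^sup>n(A|B, X)\<close> are only defined up to isomorphism, independently
  of the resolution.  The predicates below say that a given graded \<open>k\<close>-module is isomorphic to
  what \<^emph>\<open>every\<close> relative projective resolution computes, with elements in an arbitrary type
  \<open>'p\<close>; this has content only for those \<open>'p\<close> that carry a resolution.
\<close>

definition Hochschild_resolution ::
  "'k ring \<Rightarrow> ('k, 'a) module \<Rightarrow> 'a set \<Rightarrow> (nat \<Rightarrow> (('a \<times> 'a \<Rightarrow> 'k) set, 'p) module)
     \<Rightarrow> (nat \<Rightarrow> 'p \<Rightarrow> 'p) \<Rightarrow> ('p \<Rightarrow> 'a) \<Rightarrow> bool"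
  where "Hochschild_resolution k A B =
    rel_projective_resolution k (env k A) (env k (subalg A B)) (env_incl k A B)
      (env_left k A (self_bimodule A))"

definition is_rel_Hochschild_homology ::
  "'p itself \<Rightarrow> 'k ring \<Rightarrow> ('k, 'a) module \<Rightarrow> 'a set \<Rightarrow> ('a, 'x) bimodule
     \<Rightarrow> (nat \<Rightarrow> ('k, 'h) module) \<Rightarrow> bool"
  where "is_rel_Hochschild_homology t k A B X H \<longleftrightarrow>
    (\<forall>(P :: nat \<Rightarrow> (('a \<times> 'a \<Rightarrow> 'k) set, 'p) module) d \<epsilon>. Hochschild_resolution k A B P d \<epsilon> \<longrightarrow>
       (\<forall>n. module_iso k (H n) (Tor_via k (env k A) (env_right k A X) P d n)))"

definition is_rel_Hochschild_cohomology ::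
  "'p itself \<Rightarrow> 'k ring \<Rightarrow> ('k, 'a) module \<Rightarrow> 'a set \<Rightarrow> ('a, 'x) bimodule
     \<Rightarrow> (nat \<Rightarrow> ('k, 'h) module) \<Rightarrow> bool"
  where "is_rel_Hochschild_cohomology t k A B X H \<longleftrightarrow>
    (\<forall>(P :: nat \<Rightarrow> (('a \<times> 'a \<Rightarrow> 'k) set, 'p) module) d \<epsilon>. Hochschild_resolution k A B P d \<epsilon> \<longrightarrow>
       (\<forall>n. module_iso k (H n) (Ext_via (env k A) P d (env_left k A X) n)))"


section \<open>The complexes attached to a split extension\<close>

definition alt_sign :: "('n, 'j) ring_scheme \<Rightarrow> nat \<Rightarrow> 'n \<Rightarrow> 'n"
  where "alt_sign N i x = (if even i then x else \<ominus>\<^bsub>N\<^esub> x)"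

text \<open>
  For \<open>w = [m\<^sub>1, \<dots>, m\<^sub>n]\<close>, the word \<open>contract_at A w i\<close> has \<open>m\<^sub>i m\<^sub>i\<^sub>+\<^sub>1\<close> in place of
  the letters number \<open>i\<close> and \<open>i + 1\<close>, counted from one.
\<close>

definition contract_at :: "('k, 'a) module \<Rightarrow> 'a list \<Rightarrow> nat \<Rightarrow> 'a list"
  where "contract_at A w i = take (i - 1) w @ (w ! (i - 1) \<otimes>\<^bsub>A\<^esub> w ! i) # drop (i + 1) w"

definition bar_factors :: "('k, 'a) module \<Rightarrow> 'a set \<Rightarrow> nat \<Rightarrow> 'a set list"
  where "bar_factors A M n = carrier A # replicate n M @ [carrier A]"

definition bar_bimodule :: "'k ring \<Rightarrow> ('k, 'a) module \<Rightarrow> 'a set \<Rightarrow> 'a set \<Rightarrow> nat \<Rightarrow> ('a, ('a list \<Rightarrow> 'k) set) bimodule"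
  where "bar_bimodule k A B M n = ltensor k A B (bar_factors A M n)"

definition bar_pure ::
  "'k ring \<Rightarrow> ('k, 'a) module \<Rightarrow> 'a set \<Rightarrow> 'a set \<Rightarrow> 'a \<Rightarrow> 'a list \<Rightarrow> 'a \<Rightarrow> ('a list \<Rightarrow> 'k) set"
  where "bar_pure k A B M a ms a' =
    ltensor_pure k A B (bar_factors A M (length ms)) (a # ms @ [a'])"

text \<open>
  The tensor power of \<open>M\<close> of exponent \<open>0\<close> is \<open>B\<close>, and its element \<open>1\<close> is the pure tensor of
  the empty word.
\<close>

definition pow_factors :: "'a set \<Rightarrow> 'a set \<Rightarrow> nat \<Rightarrow> 'a set list"
  where "pow_factors B M n = (if n = 0 then [B] else replicate n M)"

definition tpow :: "'k ring \<Rightarrow> ('k, 'a) module \<Rightarrow> 'a set \<Rightarrow> 'a set \<Rightarrow> nat \<Rightarrow> ('a, ('a list \<Rightarrow> 'k) set) bimodule"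
  where "tpow k A B M n = ltensor k A B (pow_factors B M n)"

definition tpow_pure ::
  "'k ring \<Rightarrow> ('k, 'a) module \<Rightarrow> 'a set \<Rightarrow> 'a set \<Rightarrow> 'a list \<Rightarrow> ('a list \<Rightarrow> 'k) set"
  where "tpow_pure k A B M ms =
    ltensor_pure k A B (pow_factors B M (length ms)) (if ms = [] then [\<one>\<^bsub>A\<^esub>] else ms)"

text \<open>
  \<open>X \<otimes> M\<^sup>\<otimes>\<^sup>n\<close> over \<open>B\<^sup>e\<close>.  In degree \<open>0\<close> this is \<open>X\<^sub>B = X \<otimes> B\<close>, in which the class of \<open>x\<close>
  is \<open>x \<otimes> 1\<close>.
\<close>

definition rel_chains ::
  "'k ring \<Rightarrow> ('k, 'a) module \<Rightarrow> 'a set \<Rightarrow> 'a set \<Rightarrow> ('a, 'x) bimodule \<Rightarrow> nat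
     \<Rightarrow> ('k, ('x \<times> ('a list \<Rightarrow> 'k) set \<Rightarrow> 'k) set) module"
  where "rel_chains k A B M X n =
    tensor k (env k (subalg A B)) (env_right k (subalg A B) X)
      (env_left k (subalg A B) (tpow k A B M n))"

definition chain_pure ::
  "'k ring \<Rightarrow> ('k, 'a) module \<Rightarrow> 'a set \<Rightarrow> 'a set \<Rightarrow> ('a, 'x) bimodule \<Rightarrow> 'x \<Rightarrow> 'a list
     \<Rightarrow> ('x \<times> ('a list \<Rightarrow> 'k) set \<Rightarrow> 'k) set"
  where "chain_pure k A B M X x ms =
    tensor_pure k (env k (subalg A B)) (env_right k (subalg A B) X)
      (env_left k (subalg A B) (tpow k A B M (length ms))) x (tpow_pure k A B M ms)"

text \<open>
  \<open>Hom(M\<^sup>\<otimes>\<^sup>n, X)\<close> over \<open>B\<^sup>e\<close>.  In degree \<open>0\<close> this is \<open>X\<^sup>B = Hom(B, X)\<close>, where \<open>f\<close> corresponds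
  to the element \<open>x = f 1\<close>.
\<close>

definition rel_cochains ::
  "'k ring \<Rightarrow> ('k, 'a) module \<Rightarrow> 'a set \<Rightarrow> 'a set \<Rightarrow> ('a, 'x) bimodule \<Rightarrow> nat
     \<Rightarrow> ('k, ('a list \<Rightarrow> 'k) set \<Rightarrow> 'x) module"
  where "rel_cochains k A B M X n =
    hom_module (env k (subalg A B)) (env_left k (subalg A B) (tpow k A B M n))
      (env_left k (subalg A B) X)"

end

theory Submission
  imports Defs
begin

text \<open>
  Let \<open>p : A \<rightarrow> M\<close> be the projection along \<open>B\<close>, a map of \<open>B\<close>-bimodules. The map
  \<open>a\<^sub>0 \<otimes> m\<^sub>1 \<otimes> \<dots> \<otimes> a\<^sub>n\<^sub>+\<^sub>1 \<mapsto> 1 \<otimes> p a\<^sub>0 \<otimes> m\<^sub>1 \<otimes> \<dots> \<otimes> a\<^sub>n\<^sub>+\<^sub>1\<close> is a \<open>B\<^sup>e\<close>-linear contracting homotopy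
  of the reduced bar complex: the part \<open>b = a\<^sub>0 - p a\<^sub>0\<close> is lost by the first summand
  of \<open>d h\<close> and is restored by \<open>h d\<close>, since \<open>p (a\<^sub>0 m\<^sub>1) = p a\<^sub>0 m\<^sub>1 + b m\<^sub>1\<close>. The identity \<open>d d = 0\<close> is a
  consequence of \<open>d h + h d = 1\<close>, because the image of \<open>h\<close> generates. In degree \<open>n\<close> the
  complex is \<open>A\<^sup>e \<otimes> M\<^sup>\<otimes>\<^sup>n\<close> over \<open>B\<^sup>e\<close>, so it consists of induced modules, and
  \<open>X \<otimes> Bar n\<close> and \<open>Hom(Bar n, X)\<close> over \<open>A\<^sup>e\<close> become \<open>X \<otimes> M\<^sup>\<otimes>\<^sup>n\<close> and
  \<open>Hom(M\<^sup>\<otimes>\<^sup>n, X)\<close> over \<open>B\<^sup>e\<close>. By the comparison theorem any relative projective resolution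
  is homotopy equivalent to this one and computes the same \<open>Tor\<close> and \<open>Ext\<close>.
\<close>

section \<open>Modules, linear maps and quotients\<close>

text \<open>Almost every map used here leaves a module given by generators and relations, so each
  formula of the theorem carries the obligation to respect relations. For the bar differential this
  is paid once, face by face. The differentials \<open>b\<close> with coefficients are not defined
  by their formulas: the right-hand factor of \<open>X \<otimes> M^n\<close> is itself a tensor
  product, and the cyclic last term moves \<open>m_n\<close> to the other side of \<open>x\<close>.
  They are transported from \<open>X \<otimes> Bar n\<close> and \<open>Hom(Bar n, X)\<close>
  through the base change isomorphisms, which gives well-definedness and \<open>b b = 0\<close> at
  once; the formulas are then read off on pure tensors. The ideal property of \<open>M\<close>
  enters twice: it keeps inner letters in \<open>M\<close> when neighbours are multiplied, and it
  makes \<open>p\<close> fix the product \<open>a_0 m_1\<close>. Together with the closure of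
  \<open>B\<close> under products it also makes \<open>p\<close> linear over \<open>B\<close> on
  both sides, which the homotopy needs in order to be well defined and \<open>B^e\<close>-linear.
  Degree 0 is exceptional throughout: the power \<open>M^0\<close> is \<open>B\<close>, so its words
  have one letter and not none.\<close>

lemma left_moduleI:
  assumes "ring R" "abelian_group N"
    and "\<And>r x. \<lbrakk>r \<in> carrier R; x \<in> carrier N\<rbrakk> \<Longrightarrow> r \<odot>\<^bsub>N\<^esub> x \<in> carrier N"
    and "\<And>r s x. \<lbrakk>r \<in> carrier R; s \<in> carrier R; x \<in> carrier N\<rbrakk> \<Longrightarrow>
      (r \<oplus>\<^bsub>R\<^esub> s) \<odot>\<^bsub>N\<^esub> x = r \<odot>\<^bsub>N\<^esub> x \<oplus>\<^bsub>N\<^esub> s \<odot>\<^bsub>N\<^esub> x"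
    and "\<And>r x y. \<lbrakk>r \<in> carrier R; x \<in> carrier N; y \<in> carrier N\<rbrakk> \<Longrightarrow>
      r \<odot>\<^bsub>N\<^esub> (x \<oplus>\<^bsub>N\<^esub> y) = r \<odot>\<^bsub>N\<^esub> x \<oplus>\<^bsub>N\<^esub> r \<odot>\<^bsub>N\<^esub> y"
    and "\<And>r s x. \<lbrakk>r \<in> carrier R; s \<in> carrier R; x \<in> carrier N\<rbrakk> \<Longrightarrow>
      (r \<otimes>\<^bsub>R\<^esub> s) \<odot>\<^bsub>N\<^esub> x = r \<odot>\<^bsub>N\<^esub> (s \<odot>\<^bsub>N\<^esub> x)"
    and "\<And>x. x \<in> carrier N \<Longrightarrow> \<one>\<^bsub>R\<^esub> \<odot>\<^bsub>N\<^esub> x = x"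
  shows "left_module R N"
  using assms by (intro left_module.intro left_module_axioms.intro)

text \<open>The complexes in the statement consist of instances of \<open>module\<close>, whose
  scalars commute, whereas enveloping algebras need not be commutative. All arguments therefore run
  in \<open>left_module\<close>, and this equivalence returns to \<open>module\<close> over
  \<open>k\<close>.\<close>

lemma module_iff_left_module: "module R N \<longleftrightarrow> cring R \<and> left_module R N"
proof
  assume "module R N"
  then interpret module R N .
  show "cring R \<and> left_module R N"
    by (auto intro!: left_moduleI smult_l_distr smult_r_distr smult_assoc1
        R.ring_axioms M.abelian_group_axioms R.is_cring)
next
  assume "cring R \<and> left_module R N"
  then interpret cring R + left_module R N by auto
  show "module R N"
    by (intro moduleI is_cring N.abelian_group_axioms smult_closed smult_l_distr smult_r_distr
        smult_assoc smult_one)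
qed

section \<open>Submodules and quotient modules\<close>

context left_module
begin

lemma lmult_zero [simp]: "r \<in> carrier R \<Longrightarrow> r \<odot>\<^bsub>N\<^esub> \<zero>\<^bsub>N\<^esub> = \<zero>\<^bsub>N\<^esub>"
  by (metis N.add.r_cancel_one' N.l_zero N.zero_closed smult_closed smult_r_distr)

lemma zero_lmult [simp]: "x \<in> carrier N \<Longrightarrow> \<zero>\<^bsub>R\<^esub> \<odot>\<^bsub>N\<^esub> x = \<zero>\<^bsub>N\<^esub>"
  by (metis N.add.r_cancel_one' R.l_zero R.zero_closed smult_closed smult_l_distr)

lemma lmult_minus: "\<lbrakk>r \<in> carrier R; x \<in> carrier N\<rbrakk> \<Longrightarrow> r \<odot>\<^bsub>N\<^esub> (\<ominus>\<^bsub>N\<^esub> x) = \<ominus>\<^bsub>N\<^esub> (r \<odot>\<^bsub>N\<^esub> x)"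
  by (metis N.a_inv_closed N.l_neg N.minus_equality lmult_zero smult_closed smult_r_distr)

lemma minus_one_lmult: "x \<in> carrier N \<Longrightarrow> (\<ominus>\<^bsub>R\<^esub> \<one>\<^bsub>R\<^esub>) \<odot>\<^bsub>N\<^esub> x = \<ominus>\<^bsub>N\<^esub> x"
  by (metis N.minus_equality R.a_inv_closed R.l_neg R.one_closed smult_closed smult_l_distr
      smult_one zero_lmult)

text \<open>Closure under negation comes from the action of the scalar \<ominus>\<one>.\<close>

lemma submoduleI':
  assumes "H \<subseteq> carrier N" "\<zero>\<^bsub>N\<^esub> \<in> H"
    and "\<And>x y. \<lbrakk>x \<in> H; y \<in> H\<rbrakk> \<Longrightarrow> x \<oplus>\<^bsub>N\<^esub> y \<in> H"
    and "\<And>r x. \<lbrakk>r \<in> carrier R; x \<in> H\<rbrakk> \<Longrightarrow> r \<odot>\<^bsub>N\<^esub> x \<in> H"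
  shows "submodule H R N"
proof -
  have "\<ominus>\<^bsub>N\<^esub> x \<in> H" if "x \<in> H" for x
    using assms(1,4) that minus_one_lmult R.a_inv_closed R.one_closed by (metis subsetD)
  then show ?thesis
    using assms by (intro submodule.intro subgroup.intro submodule_axioms.intro) (auto simp: a_inv_def)
qed

lemma submoduleD:
  assumes "submodule H R N"
  shows "H \<subseteq> carrier N" "\<zero>\<^bsub>N\<^esub> \<in> H"
    and "\<And>x y. \<lbrakk>x \<in> H; y \<in> H\<rbrakk> \<Longrightarrow> x \<oplus>\<^bsub>N\<^esub> y \<in> H"
    and "\<And>r x. \<lbrakk>r \<in> carrier R; x \<in> H\<rbrakk> \<Longrightarrow> r \<odot>\<^bsub>N\<^esub> x \<in> H"
    and "\<And>x. x \<in> H \<Longrightarrow> \<ominus>\<^bsub>N\<^esub> x \<in> H"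
    and "\<And>x y. \<lbrakk>x \<in> H; y \<in> H\<rbrakk> \<Longrightarrow> x \<ominus>\<^bsub>N\<^esub> y \<in> H"
proof -
  interpret H: submodule H R N by fact
  show "H \<subseteq> carrier N" "\<zero>\<^bsub>N\<^esub> \<in> H"
    "\<And>x y. \<lbrakk>x \<in> H; y \<in> H\<rbrakk> \<Longrightarrow> x \<oplus>\<^bsub>N\<^esub> y \<in> H"
    "\<And>r x. \<lbrakk>r \<in> carrier R; x \<in> H\<rbrakk> \<Longrightarrow> r \<odot>\<^bsub>N\<^esub> x \<in> H"
    "\<And>x. x \<in> H \<Longrightarrow> \<ominus>\<^bsub>N\<^esub> x \<in> H"
    using H.subset H.one_closed H.m_closed H.smult_closed H.m_inv_closed by (auto simp: a_inv_def)
  then show "\<And>x y. \<lbrakk>x \<in> H; y \<in> H\<rbrakk> \<Longrightarrow> x \<ominus>\<^bsub>N\<^esub> y \<in> H"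
    by (simp add: a_minus_def)
qed

lemma left_module_carrier_update:
  assumes "submodule H R N"
  shows "left_module R (N\<lparr>carrier := H\<rparr>)"
proof -
  note H = submoduleD[OF assms]
  show ?thesis
  proof (rule left_moduleI)
    show "abelian_group (N\<lparr>carrier := H\<rparr>)"
    proof (rule abelian_groupI)
      show "\<exists>y\<in>carrier (N\<lparr>carrier := H\<rparr>). y \<oplus>\<^bsub>N\<lparr>carrier := H\<rparr>\<^esub> x = \<zero>\<^bsub>N\<lparr>carrier := H\<rparr>\<^esub>"
        if "x \<in> carrier (N\<lparr>carrier := H\<rparr>)" for x
        using that H N.l_neg by (intro bexI[of _ "\<ominus>\<^bsub>N\<^esub> x"]) auto
    qed (use H in \<open>auto simp: subset_iff N.a_ac\<close>)
  qed (use H in \<open>auto simp: subset_iff smult_l_distr smult_r_distr smult_assoc smult_one R.ring_axioms\<close>)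
qed

lemma abelian_subgroup_submodule: "submodule H R N \<Longrightarrow> abelian_subgroup H N"
  by (intro abelian_subgroupI3 N.abelian_group_axioms additive_subgroup.intro submodule.axioms(1))

lemma quot_eq_iff:
  assumes "submodule H R N" "x \<in> carrier N" "y \<in> carrier N"
  shows "H +>\<^bsub>N\<^esub> x = H +>\<^bsub>N\<^esub> y \<longleftrightarrow> x \<ominus>\<^bsub>N\<^esub> y \<in> H"
proof -
  interpret H: abelian_subgroup H N by (rule abelian_subgroup_submodule) fact
  show ?thesis
    using assms(2,3) H.a_rcos_module_minus[OF ring.intro] H.a_repr_independence'
      H.a_repr_independenceD H.a_rcos_module a_minus_def by metis
qed

lemma quot_carrier: "carrier (quot_module N H) = (\<lambda>x. H +>\<^bsub>N\<^esub> x) ` carrier N"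
  by (auto simp: quot_module_def A_RCOSETS_def')

lemma quot_add:
  assumes "submodule H R N" "x \<in> carrier N" "y \<in> carrier N"
  shows "(H +>\<^bsub>N\<^esub> x) \<oplus>\<^bsub>quot_module N H\<^esub> (H +>\<^bsub>N\<^esub> y) = H +>\<^bsub>N\<^esub> (x \<oplus>\<^bsub>N\<^esub> y)"
proof -
  interpret H: abelian_subgroup H N by (rule abelian_subgroup_submodule) fact
  show ?thesis using assms H.a_rcos_sum by (simp add: quot_module_def)
qed

text \<open>The action of \<open>quot_module\<close> is a union over all representatives. Two
  representatives differ by an element of \<open>H\<close>, which \<open>r\<close> keeps in
  \<open>H\<close>, so all members of the union are the same coset.\<close>

lemma quot_smult:
  assumes "submodule H R N" "x \<in> carrier N" "r \<in> carrier R"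
  shows "r \<odot>\<^bsub>quot_module N H\<^esub> (H +>\<^bsub>N\<^esub> x) = H +>\<^bsub>N\<^esub> (r \<odot>\<^bsub>N\<^esub> x)"
proof -
  interpret H: abelian_subgroup H N by (rule abelian_subgroup_submodule) fact
  note HD = submoduleD[OF assms(1)]
  have "H +>\<^bsub>N\<^esub> (r \<odot>\<^bsub>N\<^esub> y) = H +>\<^bsub>N\<^esub> (r \<odot>\<^bsub>N\<^esub> x)" if y: "y \<in> H +>\<^bsub>N\<^esub> x" for y
  proof -
    obtain h where h: "h \<in> H" "y = h \<oplus>\<^bsub>N\<^esub> x" using y by (auto simp: a_r_coset_def')
    then have hc: "h \<in> carrier N" using HD(1) by auto
    have "r \<odot>\<^bsub>N\<^esub> y \<ominus>\<^bsub>N\<^esub> r \<odot>\<^bsub>N\<^esub> x = r \<odot>\<^bsub>N\<^esub> h"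
      using h hc assms by (simp add: smult_r_distr a_minus_def N.a_assoc N.r_neg smult_closed)
    moreover have "r \<odot>\<^bsub>N\<^esub> h \<in> H" using HD(4) h assms(3) by blast
    moreover have "y \<in> carrier N" using h hc assms by simp
    ultimately show ?thesis
      using quot_eq_iff[OF assms(1)] assms smult_closed by simp
  qed
  moreover have "x \<in> H +>\<^bsub>N\<^esub> x" using H.a_rcos_self assms by blast
  ultimately have "(\<Union>y\<in>H +>\<^bsub>N\<^esub> x. H +>\<^bsub>N\<^esub> (r \<odot>\<^bsub>N\<^esub> y)) = H +>\<^bsub>N\<^esub> (r \<odot>\<^bsub>N\<^esub> x)"
    by blast
  then show ?thesis by (simp add: quot_module_def)
qed

lemma quot_zero: "submodule H R N \<Longrightarrow> \<zero>\<^bsub>quot_module N H\<^esub> = H +>\<^bsub>N\<^esub> \<zero>\<^bsub>N\<^esub>"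
  by (simp add: quot_module_def submoduleD(1))

lemma quot_left_module:
  assumes "submodule H R N"
  shows "left_module R (quot_module N H)"
proof (rule left_moduleI)
  show "abelian_group (quot_module N H)"
  proof (rule abelian_groupI)
    show "\<exists>y\<in>carrier (quot_module N H). y \<oplus>\<^bsub>quot_module N H\<^esub> x = \<zero>\<^bsub>quot_module N H\<^esub>"
      if "x \<in> carrier (quot_module N H)" for x
    proof -
      obtain z where z: "z \<in> carrier N" "x = H +>\<^bsub>N\<^esub> z"
        using \<open>x \<in> carrier (quot_module N H)\<close> unfolding quot_carrier by blast
      then show ?thesis
        by (intro bexI[of _ "H +>\<^bsub>N\<^esub> (\<ominus>\<^bsub>N\<^esub> z)"])
          (simp_all add: quot_carrier quot_add[OF assms] quot_zero[OF assms] N.l_neg)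
    qed
  qed (auto simp: quot_carrier quot_add[OF assms] quot_zero[OF assms] N.a_ac)
qed (auto simp: quot_carrier quot_add[OF assms] quot_smult[OF assms] R.ring_axioms smult_closed
    smult_l_distr smult_r_distr smult_assoc smult_one)

end

section \<open>Linear maps and isomorphisms of quotients\<close>

lemma linear_mapI:
  assumes "\<And>x. x \<in> carrier N \<Longrightarrow> f x \<in> carrier N'"
    and "\<And>x y. \<lbrakk>x \<in> carrier N; y \<in> carrier N\<rbrakk> \<Longrightarrow> f (x \<oplus>\<^bsub>N\<^esub> y) = f x \<oplus>\<^bsub>N'\<^esub> f y"
    and "\<And>r x. \<lbrakk>r \<in> carrier R; x \<in> carrier N\<rbrakk> \<Longrightarrow> f (r \<odot>\<^bsub>N\<^esub> x) = r \<odot>\<^bsub>N'\<^esub> f x"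
  shows "linear_map R N N' f"
  using assms by (auto simp: linear_map_def)

lemma linear_mapD:
  assumes "linear_map R N N' f"
  shows "x \<in> carrier N \<Longrightarrow> f x \<in> carrier N'"
    and "\<lbrakk>x \<in> carrier N; y \<in> carrier N\<rbrakk> \<Longrightarrow> f (x \<oplus>\<^bsub>N\<^esub> y) = f x \<oplus>\<^bsub>N'\<^esub> f y"
    and "\<lbrakk>r \<in> carrier R; x \<in> carrier N\<rbrakk> \<Longrightarrow> f (r \<odot>\<^bsub>N\<^esub> x) = r \<odot>\<^bsub>N'\<^esub> f x"
  using assms by (auto simp: linear_map_def)

lemma abelian_group_hom_linear_map:
  assumes "linear_map R N N' f" "abelian_group N" "abelian_group N'"
  shows "abelian_group_hom N N' f"
proof -
  interpret N: abelian_group N by fact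
  interpret N': abelian_group N' by fact
  show ?thesis
    using linear_mapD(1,2)[OF assms(1)]
    by (intro abelian_group_homI N.abelian_group_axioms N'.abelian_group_axioms) (auto simp: hom_def
        intro!: group_hom.intro N.a_group N'.a_group group_hom_axioms.intro)
qed

lemma linear_map_zero:
  assumes "linear_map R N N' f" "abelian_group N" "abelian_group N'"
  shows "f \<zero>\<^bsub>N\<^esub> = \<zero>\<^bsub>N'\<^esub>"
  using abelian_group_hom.hom_zero[OF abelian_group_hom_linear_map[OF assms]] .

lemma linear_map_minus:
  assumes "linear_map R N N' f" "abelian_group N" "abelian_group N'" "x \<in> carrier N"
  shows "f (\<ominus>\<^bsub>N\<^esub> x) = \<ominus>\<^bsub>N'\<^esub> f x"
  using abelian_group_hom.hom_a_inv[OF abelian_group_hom_linear_map[OF assms(1-3)] assms(4)] .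

lemma linear_map_diff:
  assumes "linear_map R N N' f" "abelian_group N" "abelian_group N'" "x \<in> carrier N" "y \<in> carrier N"
  shows "f (x \<ominus>\<^bsub>N\<^esub> y) = f x \<ominus>\<^bsub>N'\<^esub> f y"
  using assms linear_map_minus[OF assms(1-3)]
  by (simp add: a_minus_def linear_mapD(2)[OF assms(1)] abelian_group.a_inv_closed)

lemma linear_map_finsum:
  assumes "linear_map R N N' f" "abelian_group N" "abelian_group N'" "finite I"
    and "g \<in> I \<rightarrow> carrier N"
  shows "f (\<Oplus>\<^bsub>N\<^esub>i\<in>I. g i) = (\<Oplus>\<^bsub>N'\<^esub>i\<in>I. f (g i))"
proof -
  interpret N: abelian_group N by fact
  interpret N': abelian_group N' by fact
  from assms(4,5) show ?thesis
  proof (induction I)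
    case empty
    then show ?case using linear_map_zero[OF assms(1-3)] by simp
  next
    case (insert i I)
    then have "f (g j) \<in> carrier N'" if "j \<in> insert i I" for j
      using that linear_mapD(1)[OF assms(1)] by blast
    moreover have "g \<in> I \<rightarrow> carrier N" "g i \<in> carrier N" using insert by auto
    ultimately show ?case
      using insert linear_mapD(2)[OF assms(1), of "g i" "finsum N g I"]
      by (simp add: Pi_def N.finsum_closed N.finsum_insert N'.finsum_insert)
  qed
qed

lemma linear_map_comp:
  assumes "linear_map R N N' f" "linear_map R N' N'' g"
  shows "linear_map R N N'' (\<lambda>x. g (f x))"
  using assms by (auto simp: linear_map_def Pi_iff)

lemma linear_map_id: "linear_map R N N (\<lambda>x. x)"
  by (auto simp: linear_map_def)

lemma linear_map_const_zero:
  assumes "left_module R N'" shows "linear_map R N N' (\<lambda>x. \<zero>\<^bsub>N'\<^esub>)"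
proof -
  interpret N': left_module R N' by fact
  show ?thesis by (auto intro!: linear_mapI)
qed

lemma linear_map_add:
  assumes "left_module R N'" "linear_map R N N' f" "linear_map R N N' g"
  shows "linear_map R N N' (\<lambda>x. f x \<oplus>\<^bsub>N'\<^esub> g x)"
proof -
  interpret N': left_module R N' by fact
  show ?thesis
    using linear_mapD[OF assms(2)] linear_mapD[OF assms(3)]
    by (auto intro!: linear_mapI simp: N'.smult_r_distr N'.N.a_ac)
qed

lemma linear_map_uminus:
  assumes "left_module R N'" "linear_map R N N' f"
  shows "linear_map R N N' (\<lambda>x. \<ominus>\<^bsub>N'\<^esub> f x)"
proof -
  interpret N': left_module R N' by fact
  show ?thesis
    using linear_mapD[OF assms(2)]
    by (auto intro!: linear_mapI simp: N'.lmult_minus N'.N.minus_add)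
qed

lemma linear_map_sub:
  assumes "left_module R N'" "linear_map R N N' f" "linear_map R N N' g"
  shows "linear_map R N N' (\<lambda>x. f x \<ominus>\<^bsub>N'\<^esub> g x)"
  unfolding a_minus_def by (intro linear_map_add linear_map_uminus assms)

lemma linear_map_cong:
  assumes "linear_map R N N' f" "left_module R N" "\<And>x. x \<in> carrier N \<Longrightarrow> g x = f x"
  shows "linear_map R N N' g"
proof -
  interpret N: left_module R N by fact
  show ?thesis
    using linear_mapD[OF assms(1)] by (auto intro!: linear_mapI simp: assms(3) N.smult_closed)
qed

lemma linear_map_inv_into:
  assumes "linear_map R N N' f" "left_module R N" "bij_betw f (carrier N) (carrier N')"
  shows "linear_map R N' N (inv_into (carrier N) f)"
proof -
  interpret N: left_module R N by fact
  have inj: "inj_on f (carrier N)" using assms(3) by (rule bij_betw_imp_inj_on)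
  have cl: "inv_into (carrier N) f y \<in> carrier N" "f (inv_into (carrier N) f y) = y"
    if "y \<in> carrier N'" for y
    using that assms(3) by (auto simp: bij_betw_def inv_into_into f_inv_into_f)
  show ?thesis
  proof (rule linear_mapI)
    fix x y assume "x \<in> carrier N'" "y \<in> carrier N'"
    then show "inv_into (carrier N) f (x \<oplus>\<^bsub>N'\<^esub> y) =
      inv_into (carrier N) f x \<oplus>\<^bsub>N\<^esub> inv_into (carrier N) f y"
      using cl linear_mapD(2)[OF assms(1)] inj
      by (intro inv_into_f_eq) auto
  next
    fix r x assume "r \<in> carrier R" "x \<in> carrier N'"
    then show "inv_into (carrier N) f (r \<odot>\<^bsub>N'\<^esub> x) = r \<odot>\<^bsub>N\<^esub> inv_into (carrier N) f x"
      using cl linear_mapD(3)[OF assms(1)] inj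
      by (intro inv_into_f_eq) (auto simp: N.smult_closed)
  qed (use cl in auto)
qed

lemma module_isoI:
  assumes "linear_map R N N' f"
    and "\<And>x. x \<in> carrier N \<Longrightarrow> g (f x) = x"
    and "\<And>y. y \<in> carrier N' \<Longrightarrow> g y \<in> carrier N \<and> f (g y) = y"
  shows "module_iso R N N'"
  unfolding module_iso_def
proof (intro exI conjI)
  show "bij_betw f (carrier N) (carrier N')"
    using assms linear_mapD(1)[OF assms(1)] by (intro bij_betw_byWitness[of _ g]) auto
qed fact

lemma module_iso_trans:
  assumes "module_iso R N N'" "module_iso R N' N''"
  shows "module_iso R N N''"
proof -
  obtain f g where "linear_map R N N' f" "bij_betw f (carrier N) (carrier N')"
    "linear_map R N' N'' g" "bij_betw g (carrier N') (carrier N'')"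
    using assms unfolding module_iso_def by blast
  then show ?thesis
    using linear_map_comp[of R N N' f N'' g] bij_betw_trans[of f _ _ g]
    unfolding module_iso_def comp_def by blast
qed

text \<open>The maps \<open>u\<close> and \<open>v\<close> need only be inverse to each other modulo
  \<open>H\<close> and \<open>H'\<close>. This is how a chain homotopy equivalence acts on cycles
  modulo boundaries.\<close>

lemma module_iso_quot:
  assumes N: "left_module R N" "submodule H R N" and N': "left_module R N'" "submodule H' R N'"
    and u: "linear_map R N N' u" and v: "linear_map R N' N v"
    and uH: "\<And>x. x \<in> H \<Longrightarrow> u x \<in> H'" and vH: "\<And>y. y \<in> H' \<Longrightarrow> v y \<in> H"
    and vu: "\<And>x. x \<in> carrier N \<Longrightarrow> v (u x) \<ominus>\<^bsub>N\<^esub> x \<in> H"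
    and uv: "\<And>y. y \<in> carrier N' \<Longrightarrow> u (v y) \<ominus>\<^bsub>N'\<^esub> y \<in> H'"
  shows "module_iso R (quot_module N H) (quot_module N' H')"
proof -
  interpret N: left_module R N by fact
  interpret N': left_module R N' by fact
  note uD = linear_mapD[OF u] and vD = linear_mapD[OF v]
  \<comment> \<open>The value on a coset is read off from all representatives at once; their image
    is shown to be a singleton, so no representative has to be chosen.\<close>
  define U where "U C = the_elem ((\<lambda>x. H' +>\<^bsub>N'\<^esub> u x) ` C)" for C
  define V where "V C = the_elem ((\<lambda>x. H +>\<^bsub>N\<^esub> v x) ` C)" for C
  have U: "U (H +>\<^bsub>N\<^esub> x) = H' +>\<^bsub>N'\<^esub> u x" if "x \<in> carrier N" for x
  proof -
    have "H' +>\<^bsub>N'\<^esub> u y = H' +>\<^bsub>N'\<^esub> u x" if y: "y \<in> H +>\<^bsub>N\<^esub> x" for y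
    proof -
      obtain h where h: "h \<in> H" "y = h \<oplus>\<^bsub>N\<^esub> x" using y by (auto simp: a_r_coset_def')
      then have hc: "h \<in> carrier N" using N.submoduleD(1)[OF N(2)] by auto
      have "u y \<ominus>\<^bsub>N'\<^esub> u x = u h"
        using h hc \<open>x \<in> carrier N\<close> uD by (simp add: a_minus_def N'.N.a_assoc N'.N.r_neg)
      then show ?thesis
        using N'.quot_eq_iff[OF N'(2), of "u y" "u x"] uH[OF h(1)] uD h hc \<open>x \<in> carrier N\<close> by simp
    qed
    moreover have "x \<in> H +>\<^bsub>N\<^esub> x"
      using abelian_subgroup.a_rcos_self[OF N.abelian_subgroup_submodule[OF N(2)]] that by blast
    ultimately have "(\<lambda>x. H' +>\<^bsub>N'\<^esub> u x) ` (H +>\<^bsub>N\<^esub> x) = {H' +>\<^bsub>N'\<^esub> u x}" by blast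
    then show ?thesis by (simp add: U_def)
  qed
  have V: "V (H' +>\<^bsub>N'\<^esub> x) = H +>\<^bsub>N\<^esub> v x" if "x \<in> carrier N'" for x
  proof -
    have "H +>\<^bsub>N\<^esub> v y = H +>\<^bsub>N\<^esub> v x" if y: "y \<in> H' +>\<^bsub>N'\<^esub> x" for y
    proof -
      obtain h where h: "h \<in> H'" "y = h \<oplus>\<^bsub>N'\<^esub> x" using y by (auto simp: a_r_coset_def')
      then have hc: "h \<in> carrier N'" using N'.submoduleD(1)[OF N'(2)] by auto
      have "v y \<ominus>\<^bsub>N\<^esub> v x = v h"
        using h hc \<open>x \<in> carrier N'\<close> vD by (simp add: a_minus_def N.N.a_assoc N.N.r_neg)
      then show ?thesis
        using N.quot_eq_iff[OF N(2), of "v y" "v x"] vH[OF h(1)] vD h hc \<open>x \<in> carrier N'\<close> by simp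
    qed
    moreover have "x \<in> H' +>\<^bsub>N'\<^esub> x"
      using abelian_subgroup.a_rcos_self[OF N'.abelian_subgroup_submodule[OF N'(2)]] that by blast
    ultimately have "(\<lambda>x. H +>\<^bsub>N\<^esub> v x) ` (H' +>\<^bsub>N'\<^esub> x) = {H +>\<^bsub>N\<^esub> v x}" by blast
    then show ?thesis by (simp add: V_def)
  qed
  show ?thesis
  proof (rule module_isoI[of _ _ _ U V])
    show "linear_map R (quot_module N H) (quot_module N' H') U"
      by (rule linear_mapI) (auto simp: N.quot_carrier N'.quot_carrier N.quot_add[OF N(2)]
          N'.quot_add[OF N'(2)] N.quot_smult[OF N(2)] N'.quot_smult[OF N'(2)] U uD N.smult_closed)
  next
    fix C assume "C \<in> carrier (quot_module N H)"
    then obtain x where x: "x \<in> carrier N" "C = H +>\<^bsub>N\<^esub> x" unfolding N.quot_carrier by blast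
    then show "V (U C) = C" using uD vD vu N.quot_eq_iff[OF N(2)] by (simp add: U V)
  next
    fix C assume "C \<in> carrier (quot_module N' H')"
    then obtain x where x: "x \<in> carrier N'" "C = H' +>\<^bsub>N'\<^esub> x" unfolding N'.quot_carrier by blast
    then show "V C \<in> carrier (quot_module N H) \<and> U (V C) = C"
      using uD vD uv N'.quot_eq_iff[OF N'(2)] by (simp add: U V N.quot_carrier)
  qed
qed

section \<open>Modules presented by generators and relations\<close>

lemma submodule_gen:
  assumes "left_module R N" "E \<subseteq> carrier N"
  shows submodule_submodule_gen: "submodule (submodule_gen R N E) R N"
    and submodule_gen_incl: "E \<subseteq> submodule_gen R N E"
    and submodule_gen_least: "\<lbrakk>submodule H R N; E \<subseteq> H\<rbrakk> \<Longrightarrow> submodule_gen R N E \<subseteq> H"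
proof -
  interpret left_module R N by fact
  \<comment> \<open>The whole module belongs to the intersected family, which keeps the intersection
    inside \<open>carrier N\<close>.\<close>
  have "submodule (carrier N) R N" by (rule submoduleI') (auto simp: smult_closed)
  then have "submodule_gen R N E \<subseteq> carrier N" using assms by (auto simp: submodule_gen_def)
  then show "submodule (submodule_gen R N E) R N"
    by (rule submoduleI') (auto simp: submodule_gen_def intro: submoduleD)
qed (use assms in \<open>auto simp: submodule_gen_def\<close>)

lemma kernel_submodule:
  assumes "left_module R N" "left_module R N'" "linear_map R N N' f"
  shows "submodule {x \<in> carrier N. f x = \<zero>\<^bsub>N'\<^esub>} R N"
proof -
  interpret N: left_module R N by fact
  interpret N': left_module R N' by fact
  note f = linear_mapD[OF assms(3)]
  show ?thesis
    using linear_map_zero[OF assms(3) N.N.abelian_group_axioms N'.N.abelian_group_axioms]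
    by (intro N.submoduleI') (auto simp: f N.smult_closed)
qed

lemma image_submodule:
  assumes "left_module R N" "left_module R N'" "linear_map R N N' f"
  shows "submodule (f ` carrier N) R N'"
proof -
  interpret N: left_module R N by fact
  interpret N': left_module R N' by fact
  note f = linear_mapD[OF assms(3)]
  have z: "f \<zero>\<^bsub>N\<^esub> = \<zero>\<^bsub>N'\<^esub>"
    by (rule linear_map_zero[OF assms(3) N.N.abelian_group_axioms N'.N.abelian_group_axioms])
  show ?thesis
  proof (rule N'.submoduleI')
    fix x y assume "x \<in> f ` carrier N" "y \<in> f ` carrier N"
    then show "x \<oplus>\<^bsub>N'\<^esub> y \<in> f ` carrier N"
      by (auto simp flip: f(2))
  next
    fix r x assume "r \<in> carrier R" "x \<in> f ` carrier N"
    then show "r \<odot>\<^bsub>N'\<^esub> x \<in> f ` carrier N"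
      by (auto simp: N.smult_closed simp flip: f(3))
  qed (use f(1) z in \<open>auto intro!: image_eqI[of _ f "\<zero>\<^bsub>N\<^esub>"]\<close>)
qed

text \<open>The linear extension of \<open>\<phi>\<close> to the free module, before any relation is
  imposed; \<open>lin_ext\<close> is its common value on a coset.\<close>

definition fext :: "'k ring \<Rightarrow> ('k, 'n, 'j) module_scheme \<Rightarrow> ('w \<Rightarrow> 'n) \<Rightarrow> ('w \<Rightarrow> 'k) \<Rightarrow> 'n"
  where "fext k N \<phi> f = (\<Oplus>\<^bsub>N\<^esub>w\<in>{w. f w \<noteq> \<zero>\<^bsub>k\<^esub>}. f w \<odot>\<^bsub>N\<^esub> \<phi> w)"

text \<open>Both tensor constructions of the statement, the one over an algebra and the unbracketed
  one over \<open>B\<close>, are instances, so generation and the universal property are proved only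
  once.\<close>

definition presented :: "'k ring \<Rightarrow> 'w set \<Rightarrow> ('w \<Rightarrow> 'k) set \<Rightarrow> ('k, ('w \<Rightarrow> 'k) set) module"
  where "presented k W E = quot_module (free_module k W) (submodule_gen k (free_module k W) E)"

definition pgen :: "'k ring \<Rightarrow> 'w set \<Rightarrow> ('w \<Rightarrow> 'k) set \<Rightarrow> 'w \<Rightarrow> ('w \<Rightarrow> 'k) set"
  where "pgen k W E w = submodule_gen k (free_module k W) E +>\<^bsub>free_module k W\<^esub> free_gen k w"

locale base_ring = k?: cring k for k :: "'k ring"
begin

lemma free_module_simps [simp]:
  "\<zero>\<^bsub>free_module k W\<^esub> = (\<lambda>w. \<zero>\<^bsub>k\<^esub>)"
  "f \<oplus>\<^bsub>free_module k W\<^esub> g = (\<lambda>w. f w \<oplus>\<^bsub>k\<^esub> g w)"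
  "c \<odot>\<^bsub>free_module k W\<^esub> f = (\<lambda>w. c \<otimes>\<^bsub>k\<^esub> f w)"
  by (simp_all add: free_module_def)

lemma free_module_carrier:
  "f \<in> carrier (free_module k W) \<longleftrightarrow>
    (\<forall>w. f w \<in> carrier k) \<and> (\<forall>w. w \<notin> W \<longrightarrow> f w = \<zero>\<^bsub>k\<^esub>) \<and> finite {w. f w \<noteq> \<zero>\<^bsub>k\<^esub>}"
  by (simp add: free_module_def)

lemma free_left_module: "left_module k (free_module k W)"
proof (rule left_moduleI)
  have fin: "finite {w. f w \<oplus>\<^bsub>k\<^esub> g w \<noteq> \<zero>\<^bsub>k\<^esub>}"
    if "finite {w. f w \<noteq> \<zero>\<^bsub>k\<^esub>}" "finite {w. g w \<noteq> \<zero>\<^bsub>k\<^esub>}" for f g :: "'b \<Rightarrow> 'k"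
    by (rule finite_subset[OF _ finite_UnI[OF that]]) auto
  have fin': "finite {w. c \<otimes>\<^bsub>k\<^esub> g w \<noteq> \<zero>\<^bsub>k\<^esub>}"
    if "c \<in> carrier k" "finite {w. g w \<noteq> \<zero>\<^bsub>k\<^esub>}" for c and g :: "'b \<Rightarrow> 'k"
    using that by (auto intro: finite_subset[OF _ that(2)])
  show "abelian_group (free_module k W)"
  proof (rule abelian_groupI)
    fix f assume f: "f \<in> carrier (free_module k W)"
    then have "(\<lambda>w. \<ominus>\<^bsub>k\<^esub> f w) \<in> carrier (free_module k W)"
      by (auto simp: free_module_carrier elim!: finite_subset[rotated])
    then show "\<exists>g\<in>carrier (free_module k W). g \<oplus>\<^bsub>free_module k W\<^esub> f = \<zero>\<^bsub>free_module k W\<^esub>"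
      using f by (intro bexI[of _ "\<lambda>w. \<ominus>\<^bsub>k\<^esub> f w"]) (auto simp: free_module_carrier k.l_neg)
  qed (auto simp: free_module_carrier fin k.a_ac)
  show "c \<odot>\<^bsub>free_module k W\<^esub> f \<in> carrier (free_module k W)"
    if "c \<in> carrier k" "f \<in> carrier (free_module k W)" for c f
    using that by (auto simp: free_module_carrier fin')
qed (auto simp: free_module_carrier k.ring_axioms k.l_distr k.r_distr k.m_assoc)

lemma free_gen_closed: "w \<in> W \<Longrightarrow> free_gen k w \<in> carrier (free_module k W)"
  by (auto simp: free_module_carrier free_gen_def)

text \<open>Each sum runs over the support of its own function. Adding functions requires a common
  index set, and enlarging the support contributes only zero terms.\<close>

lemma fext_superset:
  assumes "left_module k N" "finite T" "{w. f w \<noteq> \<zero>\<^bsub>k\<^esub>} \<subseteq> T" "\<And>w. f w \<in> carrier k"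
    and "\<And>w. w \<in> T \<Longrightarrow> \<phi> w \<in> carrier N"
  shows "fext k N \<phi> f = (\<Oplus>\<^bsub>N\<^esub>w\<in>T. f w \<odot>\<^bsub>N\<^esub> \<phi> w)"
proof -
  interpret N: left_module k N by fact
  show ?thesis
    unfolding fext_def using assms
    by (intro N.N.add.finprod_mono_neutral_cong_left) (auto simp: N.smult_closed)
qed

lemma fext_linear:
  assumes "left_module k N" "\<And>w. w \<in> W \<Longrightarrow> \<phi> w \<in> carrier N"
  shows "linear_map k (free_module k W) N (fext k N \<phi>)"
proof -
  interpret N: left_module k N by fact
  interpret F: left_module k "free_module k W" by (rule free_left_module)
  have cl: "f w \<odot>\<^bsub>N\<^esub> \<phi> w \<in> carrier N" if "f \<in> carrier (free_module k W)" "w \<in> W" for f w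
    using that assms(2) by (auto simp: free_module_carrier N.smult_closed)
  have sub: "{w. f w \<noteq> \<zero>\<^bsub>k\<^esub>} \<subseteq> W" "finite {w. f w \<noteq> \<zero>\<^bsub>k\<^esub>}" "\<And>w. f w \<in> carrier k"
    if "f \<in> carrier (free_module k W)" for f
    using that by (auto simp: free_module_carrier)
  show ?thesis
  proof (rule linear_mapI)
    fix f assume f: "f \<in> carrier (free_module k W)"
    show "fext k N \<phi> f \<in> carrier N"
      unfolding fext_def using sub[OF f] cl[OF f] by (intro N.N.finsum_closed) auto
  next
    fix f g assume f: "f \<in> carrier (free_module k W)" and g: "g \<in> carrier (free_module k W)"
    define T where "T = {w. f w \<noteq> \<zero>\<^bsub>k\<^esub>} \<union> {w. g w \<noteq> \<zero>\<^bsub>k\<^esub>}"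
    have T: "finite T" "T \<subseteq> W" using sub[OF f] sub[OF g] by (auto simp: T_def)
    have \<phi>: "\<phi> w \<in> carrier N" if "w \<in> T" for w using T assms(2) that by auto
    have eq: "fext k N \<phi> h = (\<Oplus>\<^bsub>N\<^esub>w\<in>T. h w \<odot>\<^bsub>N\<^esub> \<phi> w)"
      if "h \<in> carrier (free_module k W)" "{w. h w \<noteq> \<zero>\<^bsub>k\<^esub>} \<subseteq> T" for h
      using T \<phi> that sub[OF that(1)] by (intro fext_superset assms(1)) auto
    have fg: "f \<oplus>\<^bsub>free_module k W\<^esub> g \<in> carrier (free_module k W)" using f g by (rule F.N.a_closed)
    have "fext k N \<phi> (f \<oplus>\<^bsub>free_module k W\<^esub> g) =
        (\<Oplus>\<^bsub>N\<^esub>w\<in>T. f w \<odot>\<^bsub>N\<^esub> \<phi> w \<oplus>\<^bsub>N\<^esub> g w \<odot>\<^bsub>N\<^esub> \<phi> w)"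
      using sub[OF f] sub[OF g] \<phi> cl[OF f] cl[OF g] T
      by (subst eq[OF fg]) (auto simp: T_def N.smult_l_distr intro!: N.N.finsum_cong')
    also have "\<dots> = fext k N \<phi> f \<oplus>\<^bsub>N\<^esub> fext k N \<phi> g"
      using cl[OF f] cl[OF g] T eq[OF f] eq[OF g]
      by (subst N.N.finsum_addf) (auto simp: T_def)
    finally show "fext k N \<phi> (f \<oplus>\<^bsub>free_module k W\<^esub> g) = fext k N \<phi> f \<oplus>\<^bsub>N\<^esub> fext k N \<phi> g" .
  next
    fix c f assume c: "c \<in> carrier k" and f: "f \<in> carrier (free_module k W)"
    define T where "T = {w. f w \<noteq> \<zero>\<^bsub>k\<^esub>}"
    have T: "finite T" "T \<subseteq> W" using sub[OF f] by (auto simp: T_def)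
    have \<phi>: "\<phi> w \<in> carrier N" if "w \<in> T" for w using T assms(2) that by auto
    have mult: "linear_map k N N (\<lambda>x. c \<odot>\<^bsub>N\<^esub> x)"
      using c by (auto intro!: linear_mapI simp: N.smult_closed N.smult_r_distr
          simp flip: N.smult_assoc simp: k.m_comm)
    have "fext k N \<phi> (c \<odot>\<^bsub>free_module k W\<^esub> f) = (\<Oplus>\<^bsub>N\<^esub>w\<in>T. (c \<odot>\<^bsub>free_module k W\<^esub> f) w \<odot>\<^bsub>N\<^esub> \<phi> w)"
      using sub[OF f] c T \<phi> by (intro fext_superset assms(1)) (auto simp: T_def)
    also have "\<dots> = (\<Oplus>\<^bsub>N\<^esub>w\<in>T. c \<odot>\<^bsub>N\<^esub> (f w \<odot>\<^bsub>N\<^esub> \<phi> w))"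
      using sub[OF f] c \<phi> by (intro N.N.finsum_cong') (auto simp: N.smult_assoc N.smult_closed)
    also have "\<dots> = c \<odot>\<^bsub>N\<^esub> fext k N \<phi> f"
      unfolding fext_def T_def[symmetric] using cl[OF f] T
      by (subst linear_map_finsum[OF mult]) (auto simp: N.N.abelian_group_axioms)
    finally show "fext k N \<phi> (c \<odot>\<^bsub>free_module k W\<^esub> f) = c \<odot>\<^bsub>N\<^esub> fext k N \<phi> f" .
  qed
qed

lemma fext_free_gen:
  assumes "left_module k N" "\<phi> w \<in> carrier N"
  shows "fext k N \<phi> (free_gen k w) = \<phi> w"
proof -
  interpret N: left_module k N by fact
  show ?thesis
    using assms by (subst fext_superset[where T = "{w}"])
      (auto simp: free_gen_def N.smult_one N.smult_closed)
qed

section \<open>Generation and universal property of a presented module\<close>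

context
  fixes W :: "'w set" and E :: "('w \<Rightarrow> 'k) set"
  assumes E: "E \<subseteq> carrier (free_module k W)"
begin

interpretation F: left_module k "free_module k W" by (rule free_left_module)

lemmas null = submodule_submodule_gen[OF free_left_module E]

lemma presented_left_module: "left_module k (presented k W E)"
  unfolding presented_def by (rule F.quot_left_module[OF null])

lemma pgen_closed: "w \<in> W \<Longrightarrow> pgen k W E w \<in> carrier (presented k W E)"
  unfolding presented_def pgen_def F.quot_carrier by (blast intro: free_gen_closed)

text \<open>Finite support makes every class a finite combination of generators; the induction
  removes one point at a time from a finite set containing the support.\<close>

lemma presented_submodule:
  assumes H: "submodule H k (presented k W E)" and gen: "\<And>w. w \<in> W \<Longrightarrow> pgen k W E w \<in> H"
  shows "H = carrier (presented k W E)"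
proof
  let ?Q = "presented k W E" and ?cl = "\<lambda>f. submodule_gen k (free_module k W) E +>\<^bsub>free_module k W\<^esub> f"
  interpret Q: left_module k ?Q by (rule presented_left_module)
  note HD = Q.submoduleD[OF H]
  show "H \<subseteq> carrier ?Q" by (rule HD)
  have "?cl f \<in> H" if "finite T" "{w. f w \<noteq> \<zero>\<^bsub>k\<^esub>} \<subseteq> T" "f \<in> carrier (free_module k W)" for T f
    using that
  proof (induction T arbitrary: f)
    case empty
    then have "f = \<zero>\<^bsub>free_module k W\<^esub>" by auto
    then show ?case using HD(2) F.quot_zero[OF null] by (simp add: presented_def)
  next
    case (insert w T)
    \<comment> \<open>Erasing the coefficient at \<open>w\<close> leaves a function supported in
      \<open>T\<close>. If \<open>w\<close> lies in \<open>W\<close>, then \<open>f\<close> is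
      recovered by adding \<open>f w\<close> times the generator; otherwise nothing was
      erased.\<close>
    define g where "g = f(w := \<zero>\<^bsub>k\<^esub>)"
    have fw: "f w \<in> carrier k" using insert.prems by (auto simp: free_module_carrier)
    have g: "g \<in> carrier (free_module k W)"
      using insert.prems by (auto simp: g_def free_module_carrier elim!: finite_subset[rotated])
    have "{v. g v \<noteq> \<zero>\<^bsub>k\<^esub>} \<subseteq> T" using insert.prems by (auto simp: g_def)
    then have gT: "?cl g \<in> H" using g by (rule insert.IH)
    show ?case
    proof (cases "w \<in> W")
      case False
      then have "g = f" using insert.prems by (auto simp: g_def free_module_carrier)
      then show ?thesis using gT by simp
    next
      case True
      have feq: "f = g \<oplus>\<^bsub>free_module k W\<^esub> (f w \<odot>\<^bsub>free_module k W\<^esub> free_gen k w)"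
        using insert.prems fw by (auto simp: g_def free_gen_def free_module_carrier)
      have "?cl f = ?cl g \<oplus>\<^bsub>?Q\<^esub> (f w \<odot>\<^bsub>?Q\<^esub> pgen k W E w)"
        using F.quot_add[OF null g F.smult_closed[OF fw free_gen_closed[OF True]]]
          F.quot_smult[OF null free_gen_closed[OF True] fw] feq
        by (simp add: presented_def pgen_def)
      then show ?thesis using HD gT gen[OF True] fw by simp
    qed
  qed
  then show "carrier ?Q \<subseteq> H"
    by (auto simp: presented_def F.quot_carrier free_module_carrier)
qed

lemma presented_ext:
  assumes "left_module k N" "linear_map k (presented k W E) N f" "linear_map k (presented k W E) N g"
    and "\<And>w. w \<in> W \<Longrightarrow> f (pgen k W E w) = g (pgen k W E w)"
    and "C \<in> carrier (presented k W E)"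
  shows "f C = g C"
proof -
  interpret Q: left_module k "presented k W E" by (rule presented_left_module)
  interpret N: left_module k N by fact
  have "submodule {C \<in> carrier (presented k W E). f C = g C} k (presented k W E)"
    using linear_mapD[OF assms(2)] linear_mapD[OF assms(3)]
      linear_map_zero[OF assms(2)] linear_map_zero[OF assms(3)]
    by (intro Q.submoduleI') (auto simp: Q.smult_closed Q.N.abelian_group_axioms N.N.abelian_group_axioms)
  from presented_submodule[OF this] show ?thesis
    using assms(4,5) pgen_closed by blast
qed

lemma pgen_eqI:
  assumes "free_gen k w \<ominus>\<^bsub>free_module k W\<^esub> f \<in> E" "w \<in> W" "f \<in> carrier (free_module k W)"
  shows "pgen k W E w = submodule_gen k (free_module k W) E +>\<^bsub>free_module k W\<^esub> f"
  using F.quot_eq_iff[OF null free_gen_closed[OF assms(2)] assms(3)] submodule_gen_incl[OF free_left_module E] assms(1)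
  by (auto simp: pgen_def)

lemma pgen_add:
  assumes "free_gen k w \<ominus>\<^bsub>free_module k W\<^esub> (free_gen k u \<oplus>\<^bsub>free_module k W\<^esub> free_gen k v) \<in> E"
    "w \<in> W" "u \<in> W" "v \<in> W"
  shows "pgen k W E w = pgen k W E u \<oplus>\<^bsub>presented k W E\<^esub> pgen k W E v"
  using pgen_eqI[OF assms(1,2)] F.N.a_closed[OF free_gen_closed free_gen_closed, OF assms(3,4)]
    F.quot_add[OF null free_gen_closed free_gen_closed, OF assms(3,4)]
  by (simp add: presented_def pgen_def)

lemma pgen_smult:
  assumes "free_gen k w \<ominus>\<^bsub>free_module k W\<^esub> c \<odot>\<^bsub>free_module k W\<^esub> free_gen k u \<in> E"
    "w \<in> W" "u \<in> W" "c \<in> carrier k"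
  shows "pgen k W E w = c \<odot>\<^bsub>presented k W E\<^esub> pgen k W E u"
  using pgen_eqI[OF assms(1,2)] F.smult_closed[OF assms(4) free_gen_closed, OF assms(3)]
    F.quot_smult[OF null free_gen_closed, OF assms(3,4)]
  by (simp add: presented_def pgen_def)

lemma pgen_eq:
  assumes "free_gen k w \<ominus>\<^bsub>free_module k W\<^esub> free_gen k u \<in> E" "w \<in> W" "u \<in> W"
  shows "pgen k W E w = pgen k W E u"
  using pgen_eqI[OF assms(1,2)] free_gen_closed[OF assms(3)] by (simp add: pgen_def)

text \<open>The kernel of \<open>fext\<close> is a submodule, so once it contains the relations it
  contains everything they generate. Hence \<open>fext\<close> is constant on cosets, and the set
  from which \<open>lin_ext\<close> takes its element is a singleton.\<close>

lemma presented_lift: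
  assumes N: "left_module k N" and \<phi>: "\<And>w. w \<in> W \<Longrightarrow> \<phi> w \<in> carrier N"
    and rel: "\<And>e. e \<in> E \<Longrightarrow> fext k N \<phi> e = \<zero>\<^bsub>N\<^esub>"
  shows lin_ext_linear: "linear_map k (presented k W E) N (lin_ext k N \<phi>)"
    and lin_ext_pgen: "w \<in> W \<Longrightarrow> lin_ext k N \<phi> (pgen k W E w) = \<phi> w"
proof -
  interpret N: left_module k N by fact
  let ?cl = "\<lambda>f. submodule_gen k (free_module k W) E +>\<^bsub>free_module k W\<^esub> f"
  have lin: "linear_map k (free_module k W) N (fext k N \<phi>)" by (rule fext_linear[OF N \<phi>])
  note linD = linear_mapD[OF lin]
  have "submodule_gen k (free_module k W) E \<subseteq> {x \<in> carrier (free_module k W). fext k N \<phi> x = \<zero>\<^bsub>N\<^esub>}"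
    using E rel by (intro submodule_gen_least[OF free_left_module E] kernel_submodule lin N free_left_module) auto
  then have ker: "h \<in> carrier (free_module k W)" "fext k N \<phi> h = \<zero>\<^bsub>N\<^esub>"
    if "h \<in> submodule_gen k (free_module k W) E" for h using that by auto
  have val: "lin_ext k N \<phi> (?cl f) = fext k N \<phi> f" if f: "f \<in> carrier (free_module k W)" for f
  proof -
    have "fext k N \<phi> g = fext k N \<phi> f" if g: "g \<in> ?cl f" for g
    proof -
      obtain h where h: "h \<in> submodule_gen k (free_module k W) E" "g = h \<oplus>\<^bsub>free_module k W\<^esub> f"
        using g by (auto simp: a_r_coset_def')
      then show ?thesis
        using linD(2)[OF ker(1)[OF h(1)] f] ker(2)[OF h(1)] linD(1)[OF f] by simp
    qed
    moreover have "f \<in> ?cl f"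
      using abelian_subgroup.a_rcos_self[OF F.abelian_subgroup_submodule[OF null]] f by blast
    ultimately have "fext k N \<phi> ` ?cl f = {fext k N \<phi> f}" by blast
    then show ?thesis by (simp add: lin_ext_def fext_def[abs_def])
  qed
  show "linear_map k (presented k W E) N (lin_ext k N \<phi>)"
  proof (rule linear_mapI)
    fix C assume "C \<in> carrier (presented k W E)"
    then obtain f where "f \<in> carrier (free_module k W)" "C = ?cl f"
      unfolding presented_def F.quot_carrier by blast
    then show "lin_ext k N \<phi> C \<in> carrier N" using val linD by simp
  next
    fix C D assume "C \<in> carrier (presented k W E)" "D \<in> carrier (presented k W E)"
    then obtain f g where fg: "f \<in> carrier (free_module k W)" "C = ?cl f"
      "g \<in> carrier (free_module k W)" "D = ?cl g"
      unfolding presented_def F.quot_carrier by blast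
    then show "lin_ext k N \<phi> (C \<oplus>\<^bsub>presented k W E\<^esub> D) = lin_ext k N \<phi> C \<oplus>\<^bsub>N\<^esub> lin_ext k N \<phi> D"
      using F.quot_add[OF null fg(1,3)] val linD(2)[OF fg(1,3)] F.N.a_closed[OF fg(1,3)]
      by (simp add: presented_def)
  next
    fix c C assume c: "c \<in> carrier k" and "C \<in> carrier (presented k W E)"
    then obtain f where f: "f \<in> carrier (free_module k W)" "C = ?cl f"
      unfolding presented_def F.quot_carrier by blast
    then show "lin_ext k N \<phi> (c \<odot>\<^bsub>presented k W E\<^esub> C) = c \<odot>\<^bsub>N\<^esub> lin_ext k N \<phi> C"
      using F.quot_smult[OF null f(1) c] val linD(3)[OF c f(1)] F.smult_closed[OF c f(1)]
      by (simp add: presented_def)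
  qed
  show "lin_ext k N \<phi> (pgen k W E w) = \<phi> w" if "w \<in> W"
    using val[OF free_gen_closed[OF that]] fext_free_gen[where \<phi> = \<phi>, OF N \<phi>[OF that]] by (simp add: pgen_def)
qed

end

text \<open>Relations come in three shapes: a sum of two generators, a scalar multiple, an equality
  of generators. Each time the vanishing of \<open>fext\<close> is reduced to the corresponding
  identity between values of \<open>\<phi>\<close>.\<close>

lemma fext_relations:
  assumes N: "left_module k N" and \<phi>: "\<And>w. w \<in> W \<Longrightarrow> \<phi> w \<in> carrier N"
    and "w \<in> W" "u \<in> W"
  shows "\<lbrakk>v \<in> W; \<phi> w = \<phi> u \<oplus>\<^bsub>N\<^esub> \<phi> v\<rbrakk> \<Longrightarrow>
      fext k N \<phi> (free_gen k w \<ominus>\<^bsub>free_module k W\<^esub> (free_gen k u \<oplus>\<^bsub>free_module k W\<^esub> free_gen k v)) = \<zero>\<^bsub>N\<^esub>"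
    and "\<lbrakk>c \<in> carrier k; \<phi> w = c \<odot>\<^bsub>N\<^esub> \<phi> u\<rbrakk> \<Longrightarrow>
      fext k N \<phi> (free_gen k w \<ominus>\<^bsub>free_module k W\<^esub> c \<odot>\<^bsub>free_module k W\<^esub> free_gen k u) = \<zero>\<^bsub>N\<^esub>"
    and "\<phi> w = \<phi> u \<Longrightarrow>
      fext k N \<phi> (free_gen k w \<ominus>\<^bsub>free_module k W\<^esub> free_gen k u) = \<zero>\<^bsub>N\<^esub>"
proof -
  interpret N: left_module k N by fact
  interpret F: left_module k "free_module k W" by (rule free_left_module)
  have lin: "linear_map k (free_module k W) N (fext k N \<phi>)" by (rule fext_linear[OF N \<phi>])
  note D = linear_map_diff[OF lin F.N.abelian_group_axioms N.N.abelian_group_axioms free_gen_closed[OF \<open>w \<in> W\<close>]]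
  note val = fext_free_gen[where \<phi> = \<phi>, OF N \<phi>]
  show "fext k N \<phi> (free_gen k w \<ominus>\<^bsub>free_module k W\<^esub> (free_gen k u \<oplus>\<^bsub>free_module k W\<^esub> free_gen k v)) = \<zero>\<^bsub>N\<^esub>"
    if "v \<in> W" "\<phi> w = \<phi> u \<oplus>\<^bsub>N\<^esub> \<phi> v"
    using D[OF F.N.a_closed[OF free_gen_closed free_gen_closed], OF \<open>u \<in> W\<close> \<open>v \<in> W\<close>]
      linear_mapD(2)[OF lin free_gen_closed free_gen_closed, OF \<open>u \<in> W\<close> \<open>v \<in> W\<close>]
      val assms(3,4) that \<phi>
    by (simp add: N.N.r_neg a_minus_def del: free_module_simps)
  show "fext k N \<phi> (free_gen k w \<ominus>\<^bsub>free_module k W\<^esub> c \<odot>\<^bsub>free_module k W\<^esub> free_gen k u) = \<zero>\<^bsub>N\<^esub>"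
    if "c \<in> carrier k" "\<phi> w = c \<odot>\<^bsub>N\<^esub> \<phi> u"
    using D[OF F.smult_closed[OF _ free_gen_closed], OF \<open>c \<in> carrier k\<close> \<open>u \<in> W\<close>]
      linear_mapD(3)[OF lin _ free_gen_closed, OF \<open>c \<in> carrier k\<close> \<open>u \<in> W\<close>]
      val assms(3,4) that \<phi>
    by (simp add: N.N.r_neg a_minus_def N.smult_closed del: free_module_simps)
  show "fext k N \<phi> (free_gen k w \<ominus>\<^bsub>free_module k W\<^esub> free_gen k u) = \<zero>\<^bsub>N\<^esub>" if "\<phi> w = \<phi> u"
    using D[OF free_gen_closed[OF \<open>u \<in> W\<close>]] val assms(3,4) that \<phi>
    by (simp add: N.N.r_neg a_minus_def del: free_module_simps)
qed

end

section \<open>Tensor products over an algebra\<close>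

lemma abelian_group_cong:
  assumes "abelian_group N" "carrier N' = carrier N" "add N' = add N" "zero N' = zero N"
  shows "abelian_group N'"
proof -
  interpret abelian_group N by fact
  show ?thesis
    by (rule abelian_groupI) (auto simp: assms a_ac intro!: bexI[of _ "\<ominus>\<^bsub>N\<^esub> x" for x] l_neg)
qed

lemma left_module_cong:
  assumes "left_module R N" "carrier N' = carrier N" "add N' = add N" "zero N' = zero N"
    and "\<And>r x. \<lbrakk>r \<in> carrier R; x \<in> carrier N\<rbrakk> \<Longrightarrow> r \<odot>\<^bsub>N'\<^esub> x = r \<odot>\<^bsub>N\<^esub> x"
  shows "left_module R N'"
proof -
  interpret left_module R N by fact
  show ?thesis
    by (rule left_moduleI)
      (auto simp: assms smult_closed smult_l_distr smult_r_distr smult_assoc smult_one R.ring_axioms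
        intro: abelian_group_cong[OF N.abelian_group_axioms])
qed

lemma restrict_scalars_simps [simp]:
  "carrier (restrict_scalars h N) = carrier N" "add (restrict_scalars h N) = add N"
  "zero (restrict_scalars h N) = zero N" "s \<odot>\<^bsub>restrict_scalars h N\<^esub> x = h s \<odot>\<^bsub>N\<^esub> x"
  by (simp_all add: restrict_scalars_def)

lemma restrict_scalars_left_module:
  assumes "left_module R N" "ring S" "h \<in> ring_hom S R"
  shows "left_module S (restrict_scalars h N)"
proof -
  interpret left_module R N by fact
  interpret S: ring S by fact
  show ?thesis
    using assms(3) ring_hom_closed[OF assms(3)]
    by (intro left_moduleI) (auto simp: smult_closed smult_l_distr smult_r_distr smult_assoc smult_one
        S.ring_axioms ring_hom_add ring_hom_mult ring_hom_one
        intro: abelian_group_cong[OF N.abelian_group_axioms])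
qed

lemma opp_simps [simp]:
  "carrier (opp A) = carrier A" "add (opp A) = add A" "zero (opp A) = zero A"
  "one (opp A) = one A" "smult (opp A) = smult A" "x \<otimes>\<^bsub>opp A\<^esub> y = y \<otimes>\<^bsub>A\<^esub> x"
  by (simp_all add: opp_def)

lemma kmod_simps [simp]:
  "carrier (kmod R N) = carrier N" "add (kmod R N) = add N"
  "zero (kmod R N) = zero N" "c \<odot>\<^bsub>kmod R N\<^esub> x = (c \<odot>\<^bsub>R\<^esub> \<one>\<^bsub>R\<^esub>) \<odot>\<^bsub>N\<^esub> x"
  by (simp_all add: kmod_def)

lemma right_part_simps [simp]:
  "carrier (right_part X) = carrier X" "add (right_part X) = add X"
  "zero (right_part X) = zero X" "a \<odot>\<^bsub>right_part X\<^esub> x = x \<triangleleft>\<^bsub>X\<^esub> a"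
  by (simp_all add: right_part_def)

lemma ground_simps [simp]:
  "carrier (ground k) = carrier k" "add (ground k) = add k" "zero (ground k) = zero k"
  "one (ground k) = one k" "mult (ground k) = mult k" "smult (ground k) = mult k"
  by (simp_all add: ground_def)

lemma ring_cong:
  assumes "ring R" "carrier R' = carrier R" "add R' = add R" "zero R' = zero R" "mult R' = mult R"
    "one R' = one R"
  shows "ring R'"
proof -
  interpret ring R by fact
  show ?thesis
    by (rule ringI) (auto simp: assms m_assoc l_distr r_distr
        intro: abelian_group_cong[OF abelian_group_axioms] monoidI)
qed

lemma ring_opp: "ring A \<Longrightarrow> ring (opp A)"
proof -
  assume "ring A"
  then interpret ring A .
  show ?thesis
    by (rule ringI) (auto simp: m_assoc l_distr r_distr
        intro: abelian_group_cong[OF abelian_group_axioms] monoidI)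
qed

text \<open>The clauses after the first match the four families of \<open>tensor_rels\<close>.
  Linearity over \<open>k\<close> is asked in the second variable; in the first it results from
  moving the element \<open>c \<odot> \<one>\<close> of \<open>R\<close> across.\<close>

definition bilinear ::
  "'k ring \<Rightarrow> ('k, 'r) module \<Rightarrow> ('r, 'x) module \<Rightarrow> ('r, 'n) module \<Rightarrow> ('k, 'z, 'j) module_scheme
     \<Rightarrow> ('x \<Rightarrow> 'n \<Rightarrow> 'z) \<Rightarrow> bool"
  where "bilinear k R X N Z \<phi> \<longleftrightarrow>
    (\<forall>x\<in>carrier X. \<forall>y\<in>carrier N. \<phi> x y \<in> carrier Z) \<and>
    (\<forall>x\<in>carrier X. \<forall>x'\<in>carrier X. \<forall>y\<in>carrier N. \<phi> (x \<oplus>\<^bsub>X\<^esub> x') y = \<phi> x y \<oplus>\<^bsub>Z\<^esub> \<phi> x' y) \<and>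
    (\<forall>x\<in>carrier X. \<forall>y\<in>carrier N. \<forall>y'\<in>carrier N. \<phi> x (y \<oplus>\<^bsub>N\<^esub> y') = \<phi> x y \<oplus>\<^bsub>Z\<^esub> \<phi> x y') \<and>
    (\<forall>c\<in>carrier k. \<forall>x\<in>carrier X. \<forall>y\<in>carrier N. \<phi> x ((c \<odot>\<^bsub>R\<^esub> \<one>\<^bsub>R\<^esub>) \<odot>\<^bsub>N\<^esub> y) = c \<odot>\<^bsub>Z\<^esub> \<phi> x y) \<and>
    (\<forall>r\<in>carrier R. \<forall>x\<in>carrier X. \<forall>y\<in>carrier N. \<phi> (r \<odot>\<^bsub>X\<^esub> x) y = \<phi> x (r \<odot>\<^bsub>N\<^esub> y))"

lemma bilinearI:
  assumes "\<And>x y. \<lbrakk>x \<in> carrier X; y \<in> carrier N\<rbrakk> \<Longrightarrow> \<phi> x y \<in> carrier Z"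
    and "\<And>x x' y. \<lbrakk>x \<in> carrier X; x' \<in> carrier X; y \<in> carrier N\<rbrakk> \<Longrightarrow> \<phi> (x \<oplus>\<^bsub>X\<^esub> x') y = \<phi> x y \<oplus>\<^bsub>Z\<^esub> \<phi> x' y"
    and "\<And>x y y'. \<lbrakk>x \<in> carrier X; y \<in> carrier N; y' \<in> carrier N\<rbrakk> \<Longrightarrow> \<phi> x (y \<oplus>\<^bsub>N\<^esub> y') = \<phi> x y \<oplus>\<^bsub>Z\<^esub> \<phi> x y'"
    and "\<And>c x y. \<lbrakk>c \<in> carrier k; x \<in> carrier X; y \<in> carrier N\<rbrakk> \<Longrightarrow>
      \<phi> x ((c \<odot>\<^bsub>R\<^esub> \<one>\<^bsub>R\<^esub>) \<odot>\<^bsub>N\<^esub> y) = c \<odot>\<^bsub>Z\<^esub> \<phi> x y"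
    and "\<And>r x y. \<lbrakk>r \<in> carrier R; x \<in> carrier X; y \<in> carrier N\<rbrakk> \<Longrightarrow> \<phi> (r \<odot>\<^bsub>X\<^esub> x) y = \<phi> x (r \<odot>\<^bsub>N\<^esub> y)"
  shows "bilinear k R X N Z \<phi>"
  using assms unfolding bilinear_def by blast

lemma bilinearD:
  assumes "bilinear k R X N Z \<phi>"
  shows "\<lbrakk>x \<in> carrier X; y \<in> carrier N\<rbrakk> \<Longrightarrow> \<phi> x y \<in> carrier Z"
    and "\<lbrakk>x \<in> carrier X; x' \<in> carrier X; y \<in> carrier N\<rbrakk> \<Longrightarrow> \<phi> (x \<oplus>\<^bsub>X\<^esub> x') y = \<phi> x y \<oplus>\<^bsub>Z\<^esub> \<phi> x' y"
    and "\<lbrakk>x \<in> carrier X; y \<in> carrier N; y' \<in> carrier N\<rbrakk> \<Longrightarrow> \<phi> x (y \<oplus>\<^bsub>N\<^esub> y') = \<phi> x y \<oplus>\<^bsub>Z\<^esub> \<phi> x y'"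
    and "\<lbrakk>c \<in> carrier k; x \<in> carrier X; y \<in> carrier N\<rbrakk> \<Longrightarrow>
      \<phi> x ((c \<odot>\<^bsub>R\<^esub> \<one>\<^bsub>R\<^esub>) \<odot>\<^bsub>N\<^esub> y) = c \<odot>\<^bsub>Z\<^esub> \<phi> x y"
    and "\<lbrakk>r \<in> carrier R; x \<in> carrier X; y \<in> carrier N\<rbrakk> \<Longrightarrow> \<phi> (r \<odot>\<^bsub>X\<^esub> x) y = \<phi> x (r \<odot>\<^bsub>N\<^esub> y)"
  using assms unfolding bilinear_def by blast+

section \<open>Algebras over the base ring\<close>

locale base_algebra = base_ring k for k :: "'k ring" +
  fixes R :: "('k, 'r) module"
  assumes alg: "k_algebra k R"
begin

sublocale R: ring R using alg by (simp add: k_algebra_def)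

sublocale Rk: left_module k R
  using alg by (simp add: k_algebra_def module_iff_left_module)

lemma smult_mult:
  "\<lbrakk>c \<in> carrier k; x \<in> carrier R; y \<in> carrier R\<rbrakk> \<Longrightarrow> (c \<odot>\<^bsub>R\<^esub> x) \<otimes>\<^bsub>R\<^esub> y = c \<odot>\<^bsub>R\<^esub> (x \<otimes>\<^bsub>R\<^esub> y)"
  "\<lbrakk>c \<in> carrier k; x \<in> carrier R; y \<in> carrier R\<rbrakk> \<Longrightarrow> x \<otimes>\<^bsub>R\<^esub> (c \<odot>\<^bsub>R\<^esub> y) = c \<odot>\<^bsub>R\<^esub> (x \<otimes>\<^bsub>R\<^esub> y)"
  using alg by (auto simp: k_algebra_def)

lemma scalar_closed: "c \<in> carrier k \<Longrightarrow> c \<odot>\<^bsub>R\<^esub> \<one>\<^bsub>R\<^esub> \<in> carrier R"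
  by (simp add: Rk.smult_closed)

lemma scalar_central:
  "\<lbrakk>c \<in> carrier k; x \<in> carrier R\<rbrakk> \<Longrightarrow> (c \<odot>\<^bsub>R\<^esub> \<one>\<^bsub>R\<^esub>) \<otimes>\<^bsub>R\<^esub> x = c \<odot>\<^bsub>R\<^esub> x"
  "\<lbrakk>c \<in> carrier k; x \<in> carrier R\<rbrakk> \<Longrightarrow> x \<otimes>\<^bsub>R\<^esub> (c \<odot>\<^bsub>R\<^esub> \<one>\<^bsub>R\<^esub>) = c \<odot>\<^bsub>R\<^esub> x"
  by (simp_all add: smult_mult)

lemma scalar_hom: "(\<lambda>c. c \<odot>\<^bsub>R\<^esub> \<one>\<^bsub>R\<^esub>) \<in> ring_hom k R"
  by (rule ring_hom_memI)
    (simp_all add: Rk.smult_closed Rk.smult_l_distr Rk.smult_one smult_mult(1) Rk.smult_assoc)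

lemma kmod_left_module: "left_module R N \<Longrightarrow> left_module k (kmod R N)"
  unfolding kmod_def by (rule restrict_scalars_left_module[OF _ k.ring_axioms scalar_hom])

lemma opp_algebra: "k_algebra k (opp R)"
  using left_module_cong[OF Rk.left_module_axioms, of "opp R"]
  by (simp add: k_algebra_def ring_opp R.ring_axioms module_iff_left_module smult_mult k.is_cring)

end

section \<open>The tensor product over an algebra and its universal property\<close>

locale tensor_data = base_algebra k R for k :: "'k ring" and R :: "('k, 'r) module" +
  fixes X :: "('r, 'x) module" and N :: "('r, 'n) module"
  assumes X: "left_module (opp R) X" and N: "left_module R N"
begin

sublocale X: left_module "opp R" X by (rule X)
sublocale N: left_module R N by (rule N)

abbreviation "T \<equiv> tensor k R X N"
abbreviation tpure :: "'x \<Rightarrow> 'n \<Rightarrow> ('x \<times> 'n \<Rightarrow> 'k) set" where "tpure \<equiv> tensor_pure k R X N"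

lemma tensor_presented: "T = presented k (carrier X \<times> carrier N) (tensor_rels k R X N)"
  by (simp add: tensor_def tensor_null_def presented_def)

lemma tensor_pure_pgen: "tpure x y = pgen k (carrier X \<times> carrier N) (tensor_rels k R X N) (x, y)"
  by (simp add: tensor_pure_def tensor_null_def pgen_def)

lemma scalar_smult_closed: "\<lbrakk>c \<in> carrier k; y \<in> carrier N\<rbrakk> \<Longrightarrow> (c \<odot>\<^bsub>R\<^esub> \<one>\<^bsub>R\<^esub>) \<odot>\<^bsub>N\<^esub> y \<in> carrier N"
  by (simp add: N.smult_closed scalar_closed)

lemma X_smult_closed: "\<lbrakk>r \<in> carrier R; x \<in> carrier X\<rbrakk> \<Longrightarrow> r \<odot>\<^bsub>X\<^esub> x \<in> carrier X"
  using X.smult_closed by simp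

lemma tensor_rels_carrier: "tensor_rels k R X N \<subseteq> carrier (free_module k (carrier X \<times> carrier N))"
proof -
  interpret F: left_module k "free_module k (carrier X \<times> carrier N)" by (rule free_left_module)
  have g: "free_gen k (x, y) \<in> carrier (free_module k (carrier X \<times> carrier N))"
    if "x \<in> carrier X" "y \<in> carrier N" for x y using that by (intro free_gen_closed) auto
  show ?thesis
    unfolding tensor_rels_def Let_def
    by (auto simp del: free_module_simps simp: N.smult_closed scalar_closed X_smult_closed
        intro!: F.N.minus_closed F.N.a_closed F.smult_closed g)
qed

lemmas tensor_left_module = presented_left_module[OF tensor_rels_carrier, folded tensor_presented]

sublocale T: left_module k "tensor k R X N" by (rule tensor_left_module)

lemma tensor_pure_closed: "\<lbrakk>x \<in> carrier X; y \<in> carrier N\<rbrakk> \<Longrightarrow> tpure x y \<in> carrier T"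
  using pgen_closed[OF tensor_rels_carrier] by (simp add: tensor_presented tensor_pure_pgen)

lemma tensor_rels_mem:
  fixes F defines "F \<equiv> free_module k (carrier X \<times> carrier N)"
  shows "\<lbrakk>x \<in> carrier X; x' \<in> carrier X; y \<in> carrier N\<rbrakk> \<Longrightarrow>
      free_gen k (x \<oplus>\<^bsub>X\<^esub> x', y) \<ominus>\<^bsub>F\<^esub> (free_gen k (x, y) \<oplus>\<^bsub>F\<^esub> free_gen k (x', y)) \<in> tensor_rels k R X N"
    and "\<lbrakk>x \<in> carrier X; y \<in> carrier N; y' \<in> carrier N\<rbrakk> \<Longrightarrow>
      free_gen k (x, y \<oplus>\<^bsub>N\<^esub> y') \<ominus>\<^bsub>F\<^esub> (free_gen k (x, y) \<oplus>\<^bsub>F\<^esub> free_gen k (x, y')) \<in> tensor_rels k R X N"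
    and "\<lbrakk>c \<in> carrier k; x \<in> carrier X; y \<in> carrier N\<rbrakk> \<Longrightarrow>
      free_gen k (x, c \<odot>\<^bsub>kmod R N\<^esub> y) \<ominus>\<^bsub>F\<^esub> c \<odot>\<^bsub>F\<^esub> free_gen k (x, y) \<in> tensor_rels k R X N"
    and "\<lbrakk>r \<in> carrier R; x \<in> carrier X; y \<in> carrier N\<rbrakk> \<Longrightarrow>
      free_gen k (r \<odot>\<^bsub>X\<^esub> x, y) \<ominus>\<^bsub>F\<^esub> free_gen k (x, r \<odot>\<^bsub>N\<^esub> y) \<in> tensor_rels k R X N"
  unfolding tensor_rels_def Let_def F_def
  by (rule UnI1, rule UnI1, rule UnI1, rule CollectI, intro exI conjI, rule refl, assumption+)
    (rule UnI1, rule UnI1, rule UnI2, rule CollectI, intro exI conjI, rule refl, assumption+,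
      rule UnI1, rule UnI2, rule CollectI, intro exI conjI, rule refl, assumption+,
      rule UnI2, rule CollectI, intro exI conjI, rule refl, assumption+)

lemma tensor_pure_bilinear: "bilinear k R X N T tpure"
proof (rule bilinearI)
  fix x x' y assume "x \<in> carrier X" "x' \<in> carrier X" "y \<in> carrier N"
  then show "tpure (x \<oplus>\<^bsub>X\<^esub> x') y = tpure x y \<oplus>\<^bsub>T\<^esub> tpure x' y"
    unfolding tensor_presented tensor_pure_pgen
    by (intro pgen_add[OF tensor_rels_carrier tensor_rels_mem(1)]) auto
next
  fix x y y' assume "x \<in> carrier X" "y \<in> carrier N" "y' \<in> carrier N"
  then show "tpure x (y \<oplus>\<^bsub>N\<^esub> y') = tpure x y \<oplus>\<^bsub>T\<^esub> tpure x y'"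
    unfolding tensor_presented tensor_pure_pgen
    by (intro pgen_add[OF tensor_rels_carrier tensor_rels_mem(2)]) auto
next
  fix c x y assume "c \<in> carrier k" "x \<in> carrier X" "y \<in> carrier N"
  then show "tpure x ((c \<odot>\<^bsub>R\<^esub> \<one>\<^bsub>R\<^esub>) \<odot>\<^bsub>N\<^esub> y) = c \<odot>\<^bsub>T\<^esub> tpure x y"
    unfolding tensor_presented tensor_pure_pgen
    by (intro pgen_smult[OF tensor_rels_carrier tensor_rels_mem(3), simplified kmod_simps])
      (auto simp: scalar_smult_closed)
next
  fix r x y assume "r \<in> carrier R" "x \<in> carrier X" "y \<in> carrier N"
  then show "tpure (r \<odot>\<^bsub>X\<^esub> x) y = tpure x (r \<odot>\<^bsub>N\<^esub> y)"
    unfolding tensor_presented tensor_pure_pgen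
    by (intro pgen_eq[OF tensor_rels_carrier tensor_rels_mem(4)])
      (auto simp: X_smult_closed N.smult_closed)
qed (rule tensor_pure_closed)

lemmas tensor_pure_add_left = bilinearD(2)[OF tensor_pure_bilinear]
  and tensor_pure_add_right = bilinearD(3)[OF tensor_pure_bilinear]
  and tensor_pure_scalar = bilinearD(4)[OF tensor_pure_bilinear]
  and tensor_pure_balanced = bilinearD(5)[OF tensor_pure_bilinear]

lemma tensor_pure_right_linear: "x \<in> carrier X \<Longrightarrow> linear_map k (kmod R N) T (tpure x)"
  by (rule linear_mapI) (simp_all add: tensor_pure_closed tensor_pure_add_right tensor_pure_scalar)

lemma tensor_pure_zero: "x \<in> carrier X \<Longrightarrow> tpure x \<zero>\<^bsub>N\<^esub> = \<zero>\<^bsub>T\<^esub>"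
  using linear_map_zero[OF tensor_pure_right_linear] T.N.abelian_group_axioms
    kmod_left_module[OF N] by (simp add: left_module_def)

lemma tensor_ext:
  assumes "left_module k Z" "linear_map k T Z f" "linear_map k T Z g"
    and "\<And>x y. \<lbrakk>x \<in> carrier X; y \<in> carrier N\<rbrakk> \<Longrightarrow> f (tpure x y) = g (tpure x y)" "C \<in> carrier T"
  shows "f C = g C"
  using assms(2-5) unfolding tensor_presented tensor_pure_pgen
  by (auto intro: presented_ext[OF tensor_rels_carrier assms(1), of f g])

text \<open>Scalars need no case of their own: a multiple of a pure tensor is again pure, because
  the second factor absorbs the scalar.\<close>

lemma tensor_induct [consumes 1, case_names pure add]:
  assumes "C \<in> carrier T"
    and pure: "\<And>x y. \<lbrakk>x \<in> carrier X; y \<in> carrier N\<rbrakk> \<Longrightarrow> P (tpure x y)"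
    and add: "\<And>C D. \<lbrakk>C \<in> carrier T; D \<in> carrier T; P C; P D\<rbrakk> \<Longrightarrow> P (C \<oplus>\<^bsub>T\<^esub> D)"
  shows "P C"
proof -
  \<comment> \<open>Demanding \<open>P\<close> for all multiples makes \<open>G\<close> a submodule,
    although \<open>P\<close> itself is not assumed to be stable under scalars.\<close>
  define G where "G = {C \<in> carrier T. \<forall>c\<in>carrier k. P (c \<odot>\<^bsub>T\<^esub> C)}"
  have "submodule G k T"
  proof (rule T.submoduleI')
    show "\<zero>\<^bsub>T\<^esub> \<in> G"
      using pure[OF X.N.zero_closed N.N.zero_closed] by (simp add: G_def tensor_pure_zero)
    show "C \<oplus>\<^bsub>T\<^esub> D \<in> G" if "C \<in> G" "D \<in> G" for C D
      using that add by (auto simp: G_def T.smult_r_distr T.smult_closed)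
    show "c \<odot>\<^bsub>T\<^esub> C \<in> G" if "c \<in> carrier k" "C \<in> G" for c C
      using that by (auto simp: G_def T.smult_closed simp flip: T.smult_assoc)
  qed (auto simp: G_def)
  moreover have "tpure x y \<in> G" if "x \<in> carrier X" "y \<in> carrier N" for x y
    using that by (auto simp: G_def tensor_pure_closed scalar_smult_closed pure
        simp flip: tensor_pure_scalar)
  ultimately have "G = carrier T"
    unfolding tensor_presented tensor_pure_pgen
    by (intro presented_submodule[OF tensor_rels_carrier]) auto
  then have "P (\<one>\<^bsub>k\<^esub> \<odot>\<^bsub>T\<^esub> C)" using assms(1) by (auto simp: G_def)
  then show ?thesis using assms(1) by (simp add: T.smult_one)
qed

lemma tensor_lift:
  assumes Z: "left_module k Z" and \<phi>: "bilinear k R X N Z \<phi>"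
  shows tensor_lift_linear: "linear_map k T Z (lin_ext k Z (\<lambda>(x, y). \<phi> x y))"
    and tensor_lift_pure:
      "\<lbrakk>x \<in> carrier X; y \<in> carrier N\<rbrakk> \<Longrightarrow> lin_ext k Z (\<lambda>(x, y). \<phi> x y) (tpure x y) = \<phi> x y"
proof -
  note D = bilinearD[OF \<phi>]
  have cl: "(\<lambda>(x, y). \<phi> x y) w \<in> carrier Z" if "w \<in> carrier X \<times> carrier N" for w
    using that D(1) by auto
  note rel = fext_relations[OF Z cl]
  have "fext k Z (\<lambda>(x, y). \<phi> x y) e = \<zero>\<^bsub>Z\<^esub>" if "e \<in> tensor_rels k R X N" for e
    using that unfolding tensor_rels_def Let_def
    by (elim UnE CollectE exE conjE; simp only:; intro rel)
      (auto simp: D N.smult_closed scalar_closed X_smult_closed)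
  note lift = presented_lift[where \<phi> = "\<lambda>(x, y). \<phi> x y", OF tensor_rels_carrier Z cl this]
  show "linear_map k T Z (lin_ext k Z (\<lambda>(x, y). \<phi> x y))"
    using lift(1) by (simp add: tensor_presented)
  show "lin_ext k Z (\<lambda>(x, y). \<phi> x y) (tpure x y) = \<phi> x y" if "x \<in> carrier X" "y \<in> carrier N"
    using lift(2)[of "(x, y)"] that by (simp add: tensor_pure_pgen)
qed

end

lemma (in base_algebra) tensor_dataI:
  "left_module (opp R) X \<Longrightarrow> left_module R N \<Longrightarrow> tensor_data k R X N"
  by (intro tensor_data.intro base_algebra_axioms tensor_data_axioms.intro)

section \<open>Enveloping algebras\<close>

context base_ring
begin

lemma ground_algebra: "k_algebra k (ground k)"
proof -
  have "left_module k (ground k)"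
    by (rule left_moduleI) (auto simp: k.ring_axioms k.l_distr k.r_distr k.m_assoc
        intro: abelian_group_cong[OF k.abelian_group_axioms])
  moreover have "ring (ground k)" by (rule ring_cong[OF k.ring_axioms]) auto
  ultimately show ?thesis
    by (simp add: k_algebra_def module_iff_left_module k.is_cring k.m_assoc k.m_lcomm)
qed

text \<open>Commutativity of \<open>k\<close> lets a \<open>k\<close>-module stand on either side,
  so that the tensor product over \<open>k\<close> becomes an instance of the one over an
  algebra.\<close>

lemma left_module_ground:
  assumes "left_module k N"
  shows "left_module (ground k) N" "left_module (opp (ground k)) N"
proof -
  interpret left_module k N by fact
  interpret G: base_algebra k "ground k"
    by (intro base_algebra.intro base_algebra_axioms.intro base_ring_axioms ground_algebra)
  show "left_module (ground k) N"
    by (rule left_moduleI) (auto simp: smult_closed smult_l_distr smult_r_distr smult_assoc smult_one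
        G.R.ring_axioms N.abelian_group_axioms)
  show "left_module (opp (ground k)) N"
    using k.m_comm
    by (intro left_moduleI) (auto simp: smult_closed smult_l_distr smult_r_distr smult_one
        ring_opp[OF G.R.ring_axioms] N.abelian_group_axioms simp flip: smult_assoc)
qed

lemma base_algebraI: "k_algebra k A \<Longrightarrow> base_algebra k A"
  by (intro base_algebra.intro base_algebra_axioms.intro base_ring_axioms)

end

section \<open>The tensor product of two algebras over \<open>k\<close>\<close>

locale two_algebras = A: base_algebra k A + A': base_algebra k A'
  for k :: "'k ring" and A :: "('k, 'a) module" and A' :: "('k, 'b) module"
begin

sublocale G: base_algebra k "ground k"
  by (intro A.base_algebraI A.ground_algebra)

sublocale AA: tensor_data k "ground k" A A'
  by (intro G.tensor_dataI A.left_module_ground A.Rk.left_module_axioms A'.Rk.left_module_axioms)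

abbreviation "AT \<equiv> alg_tensor k A A'"

lemma alg_tensor_simps [simp]:
  "carrier AT = carrier AA.T" "add AT = add AA.T" "zero AT = zero AA.T" "smult AT = smult AA.T"
  "\<one>\<^bsub>AT\<^esub> = AA.tpure \<one>\<^bsub>A\<^esub> \<one>\<^bsub>A'\<^esub>"
  by (simp_all add: alg_tensor_def Let_def)

lemma AA_bilinearI:
  assumes "\<And>x y. \<lbrakk>x \<in> carrier A; y \<in> carrier A'\<rbrakk> \<Longrightarrow> \<phi> x y \<in> carrier Z"
    and "\<And>x x' y. \<lbrakk>x \<in> carrier A; x' \<in> carrier A; y \<in> carrier A'\<rbrakk> \<Longrightarrow> \<phi> (x \<oplus>\<^bsub>A\<^esub> x') y = \<phi> x y \<oplus>\<^bsub>Z\<^esub> \<phi> x' y"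
    and "\<And>x y y'. \<lbrakk>x \<in> carrier A; y \<in> carrier A'; y' \<in> carrier A'\<rbrakk> \<Longrightarrow> \<phi> x (y \<oplus>\<^bsub>A'\<^esub> y') = \<phi> x y \<oplus>\<^bsub>Z\<^esub> \<phi> x y'"
    and "\<And>c x y. \<lbrakk>c \<in> carrier k; x \<in> carrier A; y \<in> carrier A'\<rbrakk> \<Longrightarrow> \<phi> x (c \<odot>\<^bsub>A'\<^esub> y) = c \<odot>\<^bsub>Z\<^esub> \<phi> x y"
    and "\<And>c x y. \<lbrakk>c \<in> carrier k; x \<in> carrier A; y \<in> carrier A'\<rbrakk> \<Longrightarrow> \<phi> (c \<odot>\<^bsub>A\<^esub> x) y = c \<odot>\<^bsub>Z\<^esub> \<phi> x y"
  shows "bilinear k (ground k) A A' Z \<phi>"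
  using assms by (intro bilinearI) simp_all

lemma AA_pure_smult:
  assumes "c \<in> carrier k" "x \<in> carrier A" "y \<in> carrier A'"
  shows "AA.tpure (c \<odot>\<^bsub>A\<^esub> x) y = c \<odot>\<^bsub>AA.T\<^esub> AA.tpure x y"
    "AA.tpure x (c \<odot>\<^bsub>A'\<^esub> y) = c \<odot>\<^bsub>AA.T\<^esub> AA.tpure x y"
  using AA.tensor_pure_scalar[of c x y] AA.tensor_pure_balanced[of c x y] assms by simp_all

text \<open>Left multiplication by \<open>a \<otimes> a'\<close>: the inner of the two nested
  extensions that define the product of \<open>alg_tensor\<close>.\<close>

definition lm :: "'a \<Rightarrow> 'b \<Rightarrow> ('a \<times> 'b \<Rightarrow> 'k) set \<Rightarrow> ('a \<times> 'b \<Rightarrow> 'k) set"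
  where "lm a a' = lin_ext k AA.T (\<lambda>(b, b'). AA.tpure (a \<otimes>\<^bsub>A\<^esub> b) (a' \<otimes>\<^bsub>A'\<^esub> b'))"

lemma lm:
  assumes "a \<in> carrier A" "a' \<in> carrier A'"
  shows lm_linear: "linear_map k AA.T AA.T (lm a a')"
    and lm_pure: "\<lbrakk>b \<in> carrier A; b' \<in> carrier A'\<rbrakk> \<Longrightarrow>
      lm a a' (AA.tpure b b') = AA.tpure (a \<otimes>\<^bsub>A\<^esub> b) (a' \<otimes>\<^bsub>A'\<^esub> b')"
proof -
  have "bilinear k (ground k) A A' AA.T (\<lambda>b b'. AA.tpure (a \<otimes>\<^bsub>A\<^esub> b) (a' \<otimes>\<^bsub>A'\<^esub> b'))"
    using assms by (intro AA_bilinearI)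
      (simp_all add: AA.tensor_pure_closed A.R.r_distr A'.R.r_distr AA.tensor_pure_add_left
        AA.tensor_pure_add_right AA_pure_smult A.smult_mult A'.smult_mult)
  note l = AA.tensor_lift[OF AA.tensor_left_module this]
  show "linear_map k AA.T AA.T (lm a a')"
    "\<lbrakk>b \<in> carrier A; b' \<in> carrier A'\<rbrakk> \<Longrightarrow>
      lm a a' (AA.tpure b b') = AA.tpure (a \<otimes>\<^bsub>A\<^esub> b) (a' \<otimes>\<^bsub>A'\<^esub> b')"
    unfolding lm_def using l by auto
qed

lemma AA_smult_linear: "c \<in> carrier k \<Longrightarrow> linear_map k AA.T AA.T (\<lambda>D. c \<odot>\<^bsub>AA.T\<^esub> D)"
  by (auto intro!: linear_mapI simp: AA.T.smult_closed AA.T.smult_r_distr A.k.m_comm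
      simp flip: AA.T.smult_assoc)

text \<open>The outer extension is legitimate once \<open>lm a a' D\<close> is bilinear in
  \<open>a\<close> and \<open>a'\<close> for each fixed \<open>D\<close>. With the letters fixed,
  both sides of each identity are linear in \<open>D\<close>, so pure \<open>D\<close>
  suffice.\<close>

lemma lm_bilinear:
  assumes D: "D \<in> carrier AA.T"
  shows "bilinear k (ground k) A A' AA.T (\<lambda>a a'. lm a a' D)"
proof (rule AA_bilinearI)
  note ext = AA.tensor_ext[OF AA.tensor_left_module _ _ _ D]
  note add = linear_map_add[OF AA.tensor_left_module]
  fix a a' assume a: "a \<in> carrier A" "a' \<in> carrier A'"
  then show "lm a a' D \<in> carrier AA.T" by (intro linear_mapD(1)[OF lm_linear] D)
  { fix b assume b: "b \<in> carrier A"
    show "lm (a \<oplus>\<^bsub>A\<^esub> b) a' D = lm a a' D \<oplus>\<^bsub>AA.T\<^esub> lm b a' D"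
      using a b by (intro ext[where f = "lm (a \<oplus>\<^bsub>A\<^esub> b) a'"] add lm_linear)
        (simp_all add: lm_pure A.R.l_distr AA.tensor_pure_add_left) }
  { fix b assume b: "b \<in> carrier A'"
    show "lm a (a' \<oplus>\<^bsub>A'\<^esub> b) D = lm a a' D \<oplus>\<^bsub>AA.T\<^esub> lm a b D"
      using a b by (intro ext[where f = "lm a (a' \<oplus>\<^bsub>A'\<^esub> b)"] add lm_linear)
        (simp_all add: lm_pure A'.R.l_distr AA.tensor_pure_add_right) }
  fix c assume c: "c \<in> carrier k"
  show "lm a (c \<odot>\<^bsub>A'\<^esub> a') D = c \<odot>\<^bsub>AA.T\<^esub> lm a a' D"
    using a c by (intro ext[where f = "lm a (c \<odot>\<^bsub>A'\<^esub> a')"] linear_map_comp[OF _ AA_smult_linear] lm_linear)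
      (simp_all add: lm_pure A'.smult_mult AA_pure_smult A'.Rk.smult_closed)
  show "lm (c \<odot>\<^bsub>A\<^esub> a) a' D = c \<odot>\<^bsub>AA.T\<^esub> lm a a' D"
    using a c by (intro ext[where f = "lm (c \<odot>\<^bsub>A\<^esub> a) a'"] linear_map_comp[OF _ AA_smult_linear] lm_linear)
      (simp_all add: lm_pure A.smult_mult AA_pure_smult A.Rk.smult_closed)
qed

lemma alg_tensor_mult_def: "C \<otimes>\<^bsub>AT\<^esub> D = lin_ext k AA.T (\<lambda>(a, a'). lm a a' D) C"
  by (simp add: alg_tensor_def Let_def lm_def)

lemma alg_tensor_mult_left: "D \<in> carrier AA.T \<Longrightarrow> linear_map k AA.T AA.T (\<lambda>C. C \<otimes>\<^bsub>AT\<^esub> D)"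
  using AA.tensor_lift_linear[OF AA.tensor_left_module lm_bilinear] by (simp add: alg_tensor_mult_def)

lemma alg_tensor_mult_pure:
  "\<lbrakk>a \<in> carrier A; a' \<in> carrier A'; D \<in> carrier AA.T\<rbrakk> \<Longrightarrow> AA.tpure a a' \<otimes>\<^bsub>AT\<^esub> D = lm a a' D"
  using AA.tensor_lift_pure[OF AA.tensor_left_module lm_bilinear] by (simp add: alg_tensor_mult_def)

lemma alg_tensor_mult_pure_pure:
  "\<lbrakk>a \<in> carrier A; a' \<in> carrier A'; b \<in> carrier A; b' \<in> carrier A'\<rbrakk> \<Longrightarrow>
    AA.tpure a a' \<otimes>\<^bsub>AT\<^esub> AA.tpure b b' = AA.tpure (a \<otimes>\<^bsub>A\<^esub> b) (a' \<otimes>\<^bsub>A'\<^esub> b')"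
  by (simp add: alg_tensor_mult_pure lm_pure AA.tensor_pure_closed)

lemma alg_tensor_mult_closed:
  "\<lbrakk>C \<in> carrier AA.T; D \<in> carrier AA.T\<rbrakk> \<Longrightarrow> C \<otimes>\<^bsub>AT\<^esub> D \<in> carrier AA.T"
  by (rule linear_mapD(1)[OF alg_tensor_mult_left])

lemma alg_tensor_l_distr:
  "\<lbrakk>C \<in> carrier AA.T; C' \<in> carrier AA.T; D \<in> carrier AA.T\<rbrakk> \<Longrightarrow>
    (C \<oplus>\<^bsub>AA.T\<^esub> C') \<otimes>\<^bsub>AT\<^esub> D = C \<otimes>\<^bsub>AT\<^esub> D \<oplus>\<^bsub>AA.T\<^esub> C' \<otimes>\<^bsub>AT\<^esub> D"
  by (rule linear_mapD(2)[OF alg_tensor_mult_left])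

text \<open>Linearity in the left argument is built into the outer extension; in the right argument
  it is inherited from \<open>lm\<close> by induction over the left one.\<close>

lemma alg_tensor_mult_right:
  assumes C: "C \<in> carrier AA.T"
  shows "linear_map k AA.T AA.T (\<lambda>D. C \<otimes>\<^bsub>AT\<^esub> D)"
  using C
proof (induction rule: AA.tensor_induct)
  case (pure a a')
  show ?case
    using pure
    by (intro linear_map_cong[OF lm_linear[OF pure] AA.tensor_left_module]) (simp add: alg_tensor_mult_pure)
next
  case (add C D)
  show ?case
    using add
    by (intro linear_map_cong[OF linear_map_add[OF AA.tensor_left_module add(3,4)] AA.tensor_left_module])
      (simp add: alg_tensor_l_distr)
qed

lemma alg_tensor_r_distr:
  "\<lbrakk>C \<in> carrier AA.T; D \<in> carrier AA.T; D' \<in> carrier AA.T\<rbrakk> \<Longrightarrow>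
    C \<otimes>\<^bsub>AT\<^esub> (D \<oplus>\<^bsub>AA.T\<^esub> D') = C \<otimes>\<^bsub>AT\<^esub> D \<oplus>\<^bsub>AA.T\<^esub> C \<otimes>\<^bsub>AT\<^esub> D'"
  by (rule linear_mapD(2)[OF alg_tensor_mult_right])

lemma alg_tensor_assoc:
  assumes "C \<in> carrier AA.T" "D \<in> carrier AA.T" "E \<in> carrier AA.T"
  shows "(C \<otimes>\<^bsub>AT\<^esub> D) \<otimes>\<^bsub>AT\<^esub> E = C \<otimes>\<^bsub>AT\<^esub> (D \<otimes>\<^bsub>AT\<^esub> E)"
  using assms(1)
proof (induction rule: AA.tensor_induct)
  case (pure a a')
  note C = this
  show ?case using assms(2)
  proof (induction rule: AA.tensor_induct)
    case (pure b b')
    note D = this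
    show ?case using assms(3)
    proof (induction rule: AA.tensor_induct)
      case (pure c c')
      then show ?case using C D
        by (simp add: alg_tensor_mult_pure_pure A.R.m_assoc A'.R.m_assoc)
    next
      case (add E E')
      then show ?case using C D
        by (simp add: alg_tensor_r_distr alg_tensor_mult_closed AA.tensor_pure_closed)
    qed
  next
    case (add D D')
    then show ?case using C assms(3)
      by (simp add: alg_tensor_r_distr alg_tensor_l_distr alg_tensor_mult_closed AA.tensor_pure_closed)
  qed
next
  case (add C C')
  then show ?case using assms(2,3)
    by (simp add: alg_tensor_l_distr alg_tensor_mult_closed)
qed

lemma alg_tensor_one:
  assumes "C \<in> carrier AA.T"
  shows "\<one>\<^bsub>AT\<^esub> \<otimes>\<^bsub>AT\<^esub> C = C" "C \<otimes>\<^bsub>AT\<^esub> \<one>\<^bsub>AT\<^esub> = C"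
  using assms
  by (induction rule: AA.tensor_induct)
    (simp_all add: alg_tensor_mult_pure_pure alg_tensor_r_distr alg_tensor_l_distr AA.tensor_pure_closed)

lemma alg_tensor_algebra: "k_algebra k AT"
proof -
  have "ring AT"
    by (rule ringI) (auto simp: alg_tensor_mult_closed alg_tensor_assoc
        alg_tensor_one[unfolded alg_tensor_simps] alg_tensor_l_distr alg_tensor_r_distr AA.tensor_pure_closed
        intro!: monoidI intro: abelian_group_cong[OF AA.T.N.abelian_group_axioms])
  moreover have "left_module k AT" by (rule left_module_cong[OF AA.tensor_left_module]) auto
  ultimately show ?thesis
    using linear_mapD(3)[OF alg_tensor_mult_left] linear_mapD(3)[OF alg_tensor_mult_right]
    by (simp add: k_algebra_def module_iff_left_module A.k.is_cring)
qed

end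

section \<open>The enveloping algebra and its pure tensors\<close>

locale env_data = base_algebra k A for k :: "'k ring" and A :: "('k, 'a) module"
begin

sublocale AO: base_algebra k "opp A" by (intro base_algebraI opp_algebra)
sublocale TA: two_algebras k A "opp A" ..
sublocale env: base_algebra k "env k A"
  unfolding env_def by (intro base_algebraI TA.alg_tensor_algebra)

abbreviation epure :: "'a \<Rightarrow> 'a \<Rightarrow> ('a \<times> 'a \<Rightarrow> 'k) set" where "epure \<equiv> tensor_pure k (ground k) A (opp A)"

lemma env_simps [simp]:
  "carrier (env k A) = carrier TA.AA.T" "add (env k A) = add TA.AA.T"
  "zero (env k A) = zero TA.AA.T" "smult (env k A) = smult TA.AA.T"
  "\<one>\<^bsub>env k A\<^esub> = epure \<one>\<^bsub>A\<^esub> \<one>\<^bsub>A\<^esub>"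
  by (simp_all add: env_def)

lemma epure_closed: "\<lbrakk>a \<in> carrier A; a' \<in> carrier A\<rbrakk> \<Longrightarrow> epure a a' \<in> carrier TA.AA.T"
  using TA.AA.tensor_pure_closed by simp

lemma epure_mult:
  "\<lbrakk>a \<in> carrier A; a' \<in> carrier A; b \<in> carrier A; b' \<in> carrier A\<rbrakk> \<Longrightarrow>
    epure a a' \<otimes>\<^bsub>env k A\<^esub> epure b b' = epure (a \<otimes>\<^bsub>A\<^esub> b) (b' \<otimes>\<^bsub>A\<^esub> a')"
  using TA.alg_tensor_mult_pure_pure by (simp add: env_def)

lemma epure_add:
  "\<lbrakk>a \<in> carrier A; b \<in> carrier A; a' \<in> carrier A\<rbrakk> \<Longrightarrow>
    epure (a \<oplus>\<^bsub>A\<^esub> b) a' = epure a a' \<oplus>\<^bsub>TA.AA.T\<^esub> epure b a'"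
  "\<lbrakk>a \<in> carrier A; b \<in> carrier A; a' \<in> carrier A\<rbrakk> \<Longrightarrow>
    epure a (a' \<oplus>\<^bsub>A\<^esub> b) = epure a a' \<oplus>\<^bsub>TA.AA.T\<^esub> epure a b"
  using TA.AA.tensor_pure_add_left TA.AA.tensor_pure_add_right by simp_all

lemma epure_smult:
  "\<lbrakk>c \<in> carrier k; a \<in> carrier A; a' \<in> carrier A\<rbrakk> \<Longrightarrow> epure (c \<odot>\<^bsub>A\<^esub> a) a' = c \<odot>\<^bsub>TA.AA.T\<^esub> epure a a'"
  "\<lbrakk>c \<in> carrier k; a \<in> carrier A; a' \<in> carrier A\<rbrakk> \<Longrightarrow> epure a (c \<odot>\<^bsub>A\<^esub> a') = c \<odot>\<^bsub>TA.AA.T\<^esub> epure a a'"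
  using TA.AA_pure_smult by simp_all

end

subsection \<open>Bimodules\<close>

locale bimod = env_data k A for k :: "'k ring" and A :: "('k, 'a) module" +
  fixes X :: "('a, 'x) bimodule"
  assumes bimod: "is_bimodule k A X"
begin

sublocale L: left_module A X using bimod by (simp add: is_bimodule_def)

lemma right: "left_module (opp A) (right_part X)" using bimod by (simp add: is_bimodule_def)

lemmas lact = L.smult_closed L.smult_l_distr L.smult_r_distr L.smult_assoc L.smult_one

lemma ract:
  "\<lbrakk>a \<in> carrier A; x \<in> carrier X\<rbrakk> \<Longrightarrow> x \<triangleleft>\<^bsub>X\<^esub> a \<in> carrier X"
  "\<lbrakk>a \<in> carrier A; b \<in> carrier A; x \<in> carrier X\<rbrakk> \<Longrightarrow> x \<triangleleft>\<^bsub>X\<^esub> (a \<oplus>\<^bsub>A\<^esub> b) = x \<triangleleft>\<^bsub>X\<^esub> a \<oplus>\<^bsub>X\<^esub> x \<triangleleft>\<^bsub>X\<^esub> b"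
  "\<lbrakk>a \<in> carrier A; x \<in> carrier X; y \<in> carrier X\<rbrakk> \<Longrightarrow> (x \<oplus>\<^bsub>X\<^esub> y) \<triangleleft>\<^bsub>X\<^esub> a = x \<triangleleft>\<^bsub>X\<^esub> a \<oplus>\<^bsub>X\<^esub> y \<triangleleft>\<^bsub>X\<^esub> a"
  "\<lbrakk>a \<in> carrier A; b \<in> carrier A; x \<in> carrier X\<rbrakk> \<Longrightarrow> x \<triangleleft>\<^bsub>X\<^esub> (a \<otimes>\<^bsub>A\<^esub> b) = (x \<triangleleft>\<^bsub>X\<^esub> a) \<triangleleft>\<^bsub>X\<^esub> b"
  "x \<in> carrier X \<Longrightarrow> x \<triangleleft>\<^bsub>X\<^esub> \<one>\<^bsub>A\<^esub> = x"
  using left_module.smult_closed[OF right] left_module.smult_l_distr[OF right]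
    left_module.smult_r_distr[OF right] left_module.smult_assoc[OF right, of b a x]
    left_module.smult_one[OF right]
  by simp_all

lemma lract: "\<lbrakk>a \<in> carrier A; a' \<in> carrier A; x \<in> carrier X\<rbrakk> \<Longrightarrow> (a \<odot>\<^bsub>X\<^esub> x) \<triangleleft>\<^bsub>X\<^esub> a' = a \<odot>\<^bsub>X\<^esub> (x \<triangleleft>\<^bsub>X\<^esub> a')"
  using bimod by (simp add: is_bimodule_def)

lemma scalar_lr: "\<lbrakk>c \<in> carrier k; x \<in> carrier X\<rbrakk> \<Longrightarrow>
    x \<triangleleft>\<^bsub>X\<^esub> (c \<odot>\<^bsub>A\<^esub> \<one>\<^bsub>A\<^esub>) = (c \<odot>\<^bsub>A\<^esub> \<one>\<^bsub>A\<^esub>) \<odot>\<^bsub>X\<^esub> x"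
  using bimod by (simp add: is_bimodule_def)

sublocale Xk: left_module k "kmod A X" by (rule kmod_left_module[OF L.left_module_axioms])

lemma lact_scalar: "\<lbrakk>c \<in> carrier k; a \<in> carrier A; x \<in> carrier X\<rbrakk> \<Longrightarrow>
    (c \<odot>\<^bsub>A\<^esub> a) \<odot>\<^bsub>X\<^esub> x = (c \<odot>\<^bsub>A\<^esub> \<one>\<^bsub>A\<^esub>) \<odot>\<^bsub>X\<^esub> (a \<odot>\<^bsub>X\<^esub> x)"
  by (simp add: scalar_central scalar_closed flip: lact(4))

text \<open>Centrality of \<open>k\<close> in the bimodule, in the form \<open>scalar_lr\<close>,
  lets a scalar on the right letter act from the left. This makes
  \<open>(a, a') \<mapsto> a x a'\<close> bilinear over \<open>k\<close>, as the action of the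
  enveloping algebra requires.\<close>

lemma ract_scalar: "\<lbrakk>c \<in> carrier k; a \<in> carrier A; x \<in> carrier X\<rbrakk> \<Longrightarrow>
    x \<triangleleft>\<^bsub>X\<^esub> (c \<odot>\<^bsub>A\<^esub> a) = (c \<odot>\<^bsub>A\<^esub> \<one>\<^bsub>A\<^esub>) \<odot>\<^bsub>X\<^esub> (x \<triangleleft>\<^bsub>X\<^esub> a)"
  by (metis ract(1,4) scalar_central(2) scalar_closed scalar_lr)

lemma lact_scalar': "\<lbrakk>c \<in> carrier k; a \<in> carrier A; a' \<in> carrier A; x \<in> carrier X\<rbrakk> \<Longrightarrow>
    ((c \<odot>\<^bsub>A\<^esub> a) \<odot>\<^bsub>X\<^esub> x) \<triangleleft>\<^bsub>X\<^esub> a' = (c \<odot>\<^bsub>A\<^esub> \<one>\<^bsub>A\<^esub>) \<odot>\<^bsub>X\<^esub> ((a \<odot>\<^bsub>X\<^esub> x) \<triangleleft>\<^bsub>X\<^esub> a')"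
  by (subst lact_scalar) (simp_all add: lract lact(1) scalar_closed)

lemma env_left_simps [simp]:
  "carrier (env_left k A X) = carrier X" "add (env_left k A X) = add X"
  "zero (env_left k A X) = zero X"
  by (simp_all add: env_left_def)

lemma env_right_simps [simp]:
  "carrier (env_right k A X) = carrier X" "add (env_right k A X) = add X"
  "zero (env_right k A X) = zero X"
  by (simp_all add: env_right_def)

lemma env_left_action:
  assumes "x \<in> carrier X"
  shows env_left_action_linear: "linear_map k TA.AA.T (kmod A X) (\<lambda>C. C \<odot>\<^bsub>env_left k A X\<^esub> x)"
    and env_left_pure: "\<lbrakk>a \<in> carrier A; a' \<in> carrier A\<rbrakk> \<Longrightarrow>
      epure a a' \<odot>\<^bsub>env_left k A X\<^esub> x = (a \<odot>\<^bsub>X\<^esub> x) \<triangleleft>\<^bsub>X\<^esub> a'"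
proof -
  have "bilinear k (ground k) A (opp A) (kmod A X) (\<lambda>a a'. (a \<odot>\<^bsub>X\<^esub> x) \<triangleleft>\<^bsub>X\<^esub> a')"
    using assms by (intro TA.AA_bilinearI)
      (simp_all add: lact(1-3) ract(1-3) ract_scalar lact_scalar' scalar_closed)
  note l = TA.AA.tensor_lift[OF Xk.left_module_axioms this]
  show "linear_map k TA.AA.T (kmod A X) (\<lambda>C. C \<odot>\<^bsub>env_left k A X\<^esub> x)"
    using l(1) by (simp add: env_left_def)
  show "\<lbrakk>a \<in> carrier A; a' \<in> carrier A\<rbrakk> \<Longrightarrow>
      epure a a' \<odot>\<^bsub>env_left k A X\<^esub> x = (a \<odot>\<^bsub>X\<^esub> x) \<triangleleft>\<^bsub>X\<^esub> a'"
    using l(2) by (simp add: env_left_def)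
qed

lemma env_right_action:
  assumes "x \<in> carrier X"
  shows env_right_action_linear: "linear_map k TA.AA.T (kmod A X) (\<lambda>C. C \<odot>\<^bsub>env_right k A X\<^esub> x)"
    and env_right_pure: "\<lbrakk>a \<in> carrier A; a' \<in> carrier A\<rbrakk> \<Longrightarrow>
      epure a a' \<odot>\<^bsub>env_right k A X\<^esub> x = (a' \<odot>\<^bsub>X\<^esub> x) \<triangleleft>\<^bsub>X\<^esub> a"
proof -
  have "bilinear k (ground k) A (opp A) (kmod A X) (\<lambda>a a'. (a' \<odot>\<^bsub>X\<^esub> x) \<triangleleft>\<^bsub>X\<^esub> a)"
    using assms by (intro TA.AA_bilinearI)
      (simp_all add: lact(1-3) ract(1-3) ract_scalar lact_scalar' scalar_closed)
  note l = TA.AA.tensor_lift[OF Xk.left_module_axioms this]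
  show "linear_map k TA.AA.T (kmod A X) (\<lambda>C. C \<odot>\<^bsub>env_right k A X\<^esub> x)"
    using l(1) by (simp add: env_right_def)
  show "\<lbrakk>a \<in> carrier A; a' \<in> carrier A\<rbrakk> \<Longrightarrow>
      epure a a' \<odot>\<^bsub>env_right k A X\<^esub> x = (a' \<odot>\<^bsub>X\<^esub> x) \<triangleleft>\<^bsub>X\<^esub> a"
    using l(2) by (simp add: env_right_def)
qed

lemma env_left_module: "left_module (env k A) (env_left k A X)"
proof (rule left_moduleI)
  show "abelian_group (env_left k A X)"
    by (rule abelian_group_cong[OF L.N.abelian_group_axioms]) auto
  note D = linear_mapD[OF env_left_action_linear, simplified]
  show cl: "C \<odot>\<^bsub>env_left k A X\<^esub> x \<in> carrier (env_left k A X)"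
    if "C \<in> carrier (env k A)" "x \<in> carrier (env_left k A X)" for C x
    using that D(1) by simp
  show ladd: "(C \<oplus>\<^bsub>env k A\<^esub> D) \<odot>\<^bsub>env_left k A X\<^esub> x =
      C \<odot>\<^bsub>env_left k A X\<^esub> x \<oplus>\<^bsub>env_left k A X\<^esub> D \<odot>\<^bsub>env_left k A X\<^esub> x"
    if "C \<in> carrier (env k A)" "D \<in> carrier (env k A)" "x \<in> carrier (env_left k A X)" for C D x
    using that D(2) by simp
  show radd: "C \<odot>\<^bsub>env_left k A X\<^esub> (x \<oplus>\<^bsub>env_left k A X\<^esub> y) =
      C \<odot>\<^bsub>env_left k A X\<^esub> x \<oplus>\<^bsub>env_left k A X\<^esub> C \<odot>\<^bsub>env_left k A X\<^esub> y"
    if "C \<in> carrier (env k A)" "x \<in> carrier (env_left k A X)" "y \<in> carrier (env_left k A X)" for C x y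
  proof -
    have "C \<in> carrier TA.AA.T" using that by simp
    then show ?thesis
      using that(2,3)
      by (induction rule: TA.AA.tensor_induct) (simp_all add: env_left_pure lact ract D L.N.a_ac)
  qed
  show "\<one>\<^bsub>env k A\<^esub> \<odot>\<^bsub>env_left k A X\<^esub> x = x" if "x \<in> carrier (env_left k A X)" for x
    using that by (simp add: env_left_pure lact ract)
  fix C D x assume C: "C \<in> carrier (env k A)" and D: "D \<in> carrier (env k A)"
    and x: "x \<in> carrier (env_left k A X)"
  from C have "C \<in> carrier TA.AA.T" by simp
  then show "(C \<otimes>\<^bsub>env k A\<^esub> D) \<odot>\<^bsub>env_left k A X\<^esub> x =
      C \<odot>\<^bsub>env_left k A X\<^esub> (D \<odot>\<^bsub>env_left k A X\<^esub> x)"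
  proof (induction rule: TA.AA.tensor_induct)
    case (pure a a')
    note C = this
    from D have "D \<in> carrier TA.AA.T" by simp
    then show ?case
    proof (induction rule: TA.AA.tensor_induct)
      case (pure b b')
      then show ?case using C x
        by (simp add: epure_mult env_left_pure lact ract lract)
    next
      case (add D D')
      then show ?case
        using C x env.R.r_distr[of D D' "epure a a'"] env.R.m_closed[of "epure a a'"]
          epure_closed[of a a'] radd[of "epure a a'"] cl ladd by simp
    qed
  next
    case (add C C')
    then show ?case
      using D x env.R.l_distr[of C C' D] env.R.m_closed[of _ D] cl ladd by simp
  qed
qed (rule env.R.ring_axioms)

lemma env_right_module: "left_module (opp (env k A)) (env_right k A X)"
proof (rule left_moduleI)
  show "abelian_group (env_right k A X)"
    by (rule abelian_group_cong[OF L.N.abelian_group_axioms]) auto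
  note D = linear_mapD[OF env_right_action_linear, simplified]
  show cl: "C \<odot>\<^bsub>env_right k A X\<^esub> x \<in> carrier (env_right k A X)"
    if "C \<in> carrier (opp (env k A))" "x \<in> carrier (env_right k A X)" for C x
    using that D(1) by simp
  show ladd: "(C \<oplus>\<^bsub>opp (env k A)\<^esub> D) \<odot>\<^bsub>env_right k A X\<^esub> x =
      C \<odot>\<^bsub>env_right k A X\<^esub> x \<oplus>\<^bsub>env_right k A X\<^esub> D \<odot>\<^bsub>env_right k A X\<^esub> x"
    if "C \<in> carrier (opp (env k A))" "D \<in> carrier (opp (env k A))" "x \<in> carrier (env_right k A X)" for C D x
    using that D(2) by simp
  show radd: "C \<odot>\<^bsub>env_right k A X\<^esub> (x \<oplus>\<^bsub>env_right k A X\<^esub> y) =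
      C \<odot>\<^bsub>env_right k A X\<^esub> x \<oplus>\<^bsub>env_right k A X\<^esub> C \<odot>\<^bsub>env_right k A X\<^esub> y"
    if "C \<in> carrier (opp (env k A))" "x \<in> carrier (env_right k A X)" "y \<in> carrier (env_right k A X)" for C x y
  proof -
    have "C \<in> carrier TA.AA.T" using that by simp
    then show ?thesis
      using that(2,3)
      by (induction rule: TA.AA.tensor_induct) (simp_all add: env_right_pure lact ract D L.N.a_ac)
  qed
  show "\<one>\<^bsub>opp (env k A)\<^esub> \<odot>\<^bsub>env_right k A X\<^esub> x = x" if "x \<in> carrier (env_right k A X)" for x
    using that by (simp add: env_right_pure lact ract)
  fix C D x assume C: "C \<in> carrier (opp (env k A))" and D: "D \<in> carrier (opp (env k A))"
    and x: "x \<in> carrier (env_right k A X)"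
  from C have "C \<in> carrier TA.AA.T" by simp
  then show "(C \<otimes>\<^bsub>opp (env k A)\<^esub> D) \<odot>\<^bsub>env_right k A X\<^esub> x =
      C \<odot>\<^bsub>env_right k A X\<^esub> (D \<odot>\<^bsub>env_right k A X\<^esub> x)"
  proof (induction rule: TA.AA.tensor_induct)
    case (pure a a')
    note C = this
    from D have "D \<in> carrier TA.AA.T" by simp
    then show ?case
    proof (induction rule: TA.AA.tensor_induct)
      case (pure b b')
      then show ?case using C x
        by (simp add: epure_mult env_right_pure lact ract lract)
    next
      case (add D D')
      then show ?case
        using C x env.R.l_distr[of D D' "epure a a'"] env.R.m_closed[of _ "epure a a'"]
          epure_closed[of a a'] radd[of "epure a a'"] cl ladd by simp
    qed
  next
    case (add C C')
    then show ?case
      using D x env.R.r_distr[of C C' D] env.R.m_closed[of D] cl ladd by simp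
  qed
qed (rule ring_opp[OF env.R.ring_axioms])


text \<open>A tensor product over the enveloping algebra sees scalars through that algebra, while a
  word of letters sees them through \<open>A\<close>; the comparison is needed when a scalar leaves
  a word.\<close>

lemma env_left_scalar:
  assumes "c \<in> carrier k" "x \<in> carrier X"
  shows "(c \<odot>\<^bsub>env k A\<^esub> \<one>\<^bsub>env k A\<^esub>) \<odot>\<^bsub>env_left k A X\<^esub> x = (c \<odot>\<^bsub>A\<^esub> \<one>\<^bsub>A\<^esub>) \<odot>\<^bsub>X\<^esub> x"
  using linear_mapD(3)[OF env_left_action_linear[OF assms(2)] assms(1)] assms
  by (simp add: env_left_pure epure_closed lact ract)

text \<open>Pure tensors generate the enveloping algebra additively, so compatibility with the
  two-sided action of letters is enough.\<close>

lemma env_linear_mapI: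
  assumes "left_module (env k A) Z" and cl: "\<And>x. x \<in> carrier X \<Longrightarrow> f x \<in> carrier Z"
    and add: "\<And>x y. \<lbrakk>x \<in> carrier X; y \<in> carrier X\<rbrakk> \<Longrightarrow> f (x \<oplus>\<^bsub>X\<^esub> y) = f x \<oplus>\<^bsub>Z\<^esub> f y"
    and act: "\<And>a a' x. \<lbrakk>a \<in> carrier A; a' \<in> carrier A; x \<in> carrier X\<rbrakk> \<Longrightarrow>
      f ((a \<odot>\<^bsub>X\<^esub> x) \<triangleleft>\<^bsub>X\<^esub> a') = epure a a' \<odot>\<^bsub>Z\<^esub> f x"
  shows "linear_map (env k A) (env_left k A X) Z f"
proof -
  interpret Z: left_module "env k A" Z by fact
  interpret EL: left_module "env k A" "env_left k A X" by (rule env_left_module)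
  have "f (C \<odot>\<^bsub>env_left k A X\<^esub> x) = C \<odot>\<^bsub>Z\<^esub> f x"
    if "C \<in> carrier TA.AA.T" "x \<in> carrier X" for C x
    using that(1)
  proof (induction rule: TA.AA.tensor_induct)
    case (pure a a')
    then show ?case using that(2) by (simp add: env_left_pure act)
  next
    case (add C D)
    then show ?case
      using that(2) assms(3)[of "C \<odot>\<^bsub>env_left k A X\<^esub> x" "D \<odot>\<^bsub>env_left k A X\<^esub> x"] EL.smult_closed[of _ x]
        EL.smult_l_distr[of C D x] Z.smult_l_distr[of C D "f x"] cl
      by simp
  qed
  then show ?thesis using cl add by (intro linear_mapI) simp_all
qed

end

section \<open>Relative projective modules\<close>

text \<open>The right \<open>S\<close>-module \<open>R\<close>, as the record that
  \<open>induced_module\<close> builds inline.\<close>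

definition right_via :: "('k, 'r) module \<Rightarrow> ('s \<Rightarrow> 'r) \<Rightarrow> ('s, 'r) module"
  where "right_via R \<iota> = \<lparr>carrier = carrier R, mult = mult R, one = one R, zero = zero R, add = add R,
    smult = \<lambda>s r. r \<otimes>\<^bsub>R\<^esub> \<iota> s\<rparr>"

lemma right_via_simps [simp]:
  "carrier (right_via R \<iota>) = carrier R" "add (right_via R \<iota>) = add R" "zero (right_via R \<iota>) = zero R"
  "s \<odot>\<^bsub>right_via R \<iota>\<^esub> r = r \<otimes>\<^bsub>R\<^esub> \<iota> s"
  by (simp_all add: right_via_def)

lemma (in abelian_group) minus_eq_zeroD:
  assumes "x \<ominus> y = \<zero>" "x \<in> carrier G" "y \<in> carrier G"
  shows "x = y"
proof -
  have "x = (x \<ominus> y) \<oplus> y" using assms(2,3) by (simp add: a_minus_def a_assoc l_neg)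
  then show ?thesis using assms by simp
qed

text \<open>Serves twice: over \<open>R\<close> for a summand of an induced module, and over
  \<open>k\<close> for \<open>A\<close> as the sum of \<open>M\<close> and \<open>B\<close>.\<close>

lemma direct_sum_projection:
  assumes N: "left_module R N" and U: "submodule U R N" and V: "submodule V R N"
    and UV: "U \<inter> V = {\<zero>\<^bsub>N\<^esub>}" "U <+>\<^bsub>N\<^esub> V = carrier N"
  obtains pr where "linear_map R N (N\<lparr>carrier := U\<rparr>) pr"
    "\<And>u v. \<lbrakk>u \<in> U; v \<in> V\<rbrakk> \<Longrightarrow> pr (u \<oplus>\<^bsub>N\<^esub> v) = u"
proof -
  interpret N: left_module R N by fact
  note UD = N.submoduleD[OF U] and VD = N.submoduleD[OF V]
  define pr where "pr x = (THE u. u \<in> U \<and> (\<exists>v\<in>V. x = u \<oplus>\<^bsub>N\<^esub> v))" for x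
  have pr: "pr (u \<oplus>\<^bsub>N\<^esub> v) = u" if u: "u \<in> U" and v: "v \<in> V" for u v
    unfolding pr_def
  proof (rule the_equality)
    fix u' assume "u' \<in> U \<and> (\<exists>v'\<in>V. u \<oplus>\<^bsub>N\<^esub> v = u' \<oplus>\<^bsub>N\<^esub> v')"
    then obtain v' where u': "u' \<in> U" and v': "v' \<in> V" and eq: "u \<oplus>\<^bsub>N\<^esub> v = u' \<oplus>\<^bsub>N\<^esub> v'" by blast
    have c: "u \<in> carrier N" "v \<in> carrier N" "u' \<in> carrier N" "v' \<in> carrier N"
      using u v u' v' UD(1) VD(1) by auto
    \<comment> \<open>Two decompositions give \<open>u' - u = v - v'\<close>, an element of the
      trivial intersection of \<open>U\<close> and \<open>V\<close>.\<close>
    have "u' \<ominus>\<^bsub>N\<^esub> u = (u' \<oplus>\<^bsub>N\<^esub> v') \<ominus>\<^bsub>N\<^esub> v' \<ominus>\<^bsub>N\<^esub> u"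
      using c by (simp add: a_minus_def N.N.a_assoc N.N.r_neg)
    also have "\<dots> = (u \<oplus>\<^bsub>N\<^esub> v) \<ominus>\<^bsub>N\<^esub> v' \<ominus>\<^bsub>N\<^esub> u" by (simp add: eq)
    also have "\<dots> = (u \<ominus>\<^bsub>N\<^esub> u) \<oplus>\<^bsub>N\<^esub> (v \<ominus>\<^bsub>N\<^esub> v')" using c by (simp add: a_minus_def N.N.a_ac)
    also have "\<dots> = v \<ominus>\<^bsub>N\<^esub> v'" using c by (simp add: a_minus_def N.N.r_neg)
    finally have "u' \<ominus>\<^bsub>N\<^esub> u \<in> U \<inter> V" using UD(6)[OF u' u] VD(6)[OF v v'] by simp
    then show "u' = u" using UV c N.N.minus_eq_zeroD by simp
  qed (use u v in blast)
  have dec: "\<exists>u\<in>U. \<exists>v\<in>V. x = u \<oplus>\<^bsub>N\<^esub> v" if "x \<in> carrier N" for x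
    using that unfolding UV(2)[symmetric] set_add_def' by blast
  have prl: "linear_map R N (N\<lparr>carrier := U\<rparr>) pr"
  proof (rule linear_mapI)
    fix x assume "x \<in> carrier N"
    then obtain u v where "u \<in> U" "v \<in> V" "x = u \<oplus>\<^bsub>N\<^esub> v" using dec by metis
    then show "pr x \<in> carrier (N\<lparr>carrier := U\<rparr>)" using pr by simp
  next
    fix x y assume "x \<in> carrier N" "y \<in> carrier N"
    then obtain u v u' v' where d: "u \<in> U" "v \<in> V" "x = u \<oplus>\<^bsub>N\<^esub> v" "u' \<in> U" "v' \<in> V" "y = u' \<oplus>\<^bsub>N\<^esub> v'"
      using dec by metis
    have c: "u \<in> carrier N" "v \<in> carrier N" "u' \<in> carrier N" "v' \<in> carrier N"
      using d UD(1) VD(1) by auto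
    have "x \<oplus>\<^bsub>N\<^esub> y = (u \<oplus>\<^bsub>N\<^esub> u') \<oplus>\<^bsub>N\<^esub> (v \<oplus>\<^bsub>N\<^esub> v')" using d(3,6) c by (simp add: N.N.a_ac)
    then show "pr (x \<oplus>\<^bsub>N\<^esub> y) = pr x \<oplus>\<^bsub>N\<lparr>carrier := U\<rparr>\<^esub> pr y"
      using d pr UD(3) VD(3) by simp
  next
    fix r x assume r: "r \<in> carrier R" and "x \<in> carrier N"
    then obtain u v where d: "u \<in> U" "v \<in> V" "x = u \<oplus>\<^bsub>N\<^esub> v" using dec by metis
    have "u \<in> carrier N" "v \<in> carrier N" using d UD(1) VD(1) by auto
    then have "r \<odot>\<^bsub>N\<^esub> x = r \<odot>\<^bsub>N\<^esub> u \<oplus>\<^bsub>N\<^esub> r \<odot>\<^bsub>N\<^esub> v" using d r by (simp add: N.smult_r_distr)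
    then show "pr (r \<odot>\<^bsub>N\<^esub> x) = r \<odot>\<^bsub>N\<lparr>carrier := U\<rparr>\<^esub> pr x"
      using d r pr UD(4) VD(4) by simp
  qed
  show ?thesis using prl pr by (rule that)
qed

lemma direct_summand_retract:
  assumes N: "left_module R N" and P: "left_module R P" and "direct_summand R P N"
  obtains i q where "linear_map R P N i" "linear_map R N P q" "\<And>x. x \<in> carrier P \<Longrightarrow> q (i x) = x"
proof -
  interpret N: left_module R N by fact
  interpret P: left_module R P by fact
  obtain U V i where U: "submodule U R N" and V: "submodule V R N" and UV: "U \<inter> V = {\<zero>\<^bsub>N\<^esub>}"
    "U <+>\<^bsub>N\<^esub> V = carrier N" and i: "linear_map R P (N\<lparr>carrier := U\<rparr>) i"
    "bij_betw i (carrier P) (carrier (N\<lparr>carrier := U\<rparr>))"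
    using assms(3) unfolding direct_summand_def module_iso_def by blast
  note UD = N.submoduleD[OF U] and VD = N.submoduleD[OF V]
  obtain pr where prl: "linear_map R N (N\<lparr>carrier := U\<rparr>) pr"
    and pr: "\<And>u v. \<lbrakk>u \<in> U; v \<in> V\<rbrakk> \<Longrightarrow> pr (u \<oplus>\<^bsub>N\<^esub> v) = u"
    using direct_sum_projection[OF N U V UV] by blast
  show ?thesis
  proof (rule that)
    show "linear_map R P N i"
      using linear_mapD[OF i(1)] UD(1) by (intro linear_mapI) auto
    show "linear_map R N P (\<lambda>x. inv_into (carrier P) i (pr x))"
      by (rule linear_map_comp[OF prl linear_map_inv_into[OF i(1) P i(2)]])
    fix x assume x: "x \<in> carrier P"
    have "pr (i x) = i x"
      using pr[of "i x" "\<zero>\<^bsub>N\<^esub>"] linear_mapD(1)[OF i(1) x] UD(1) VD(2) by auto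
    then show "inv_into (carrier P) i (pr (i x)) = x"
      using i(2) x by (simp add: bij_betw_imp_inj_on)
  qed
qed

lemma direct_summand_iso:
  assumes "left_module R N" "module_iso R P N"
  shows "direct_summand R P N"
proof -
  interpret left_module R N by fact
  have "submodule (carrier N) R N" by (rule submoduleI') (auto simp: smult_closed)
  moreover have "submodule {\<zero>\<^bsub>N\<^esub>} R N" by (rule submoduleI') auto
  moreover have "carrier N <+>\<^bsub>N\<^esub> {\<zero>\<^bsub>N\<^esub>} = carrier N" by (auto simp: set_add_def')
  ultimately show ?thesis
    using assms(2) unfolding direct_summand_def
    by (intro exI[of _ "carrier N"] exI[of _ "{\<zero>\<^bsub>N\<^esub>}"] conjI) simp_all
qed

section \<open>Extensions of algebras and induced modules\<close>

locale rel_ext = R: base_algebra k R + S: base_algebra k S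
  for k :: "'k ring" and R :: "('k, 'r) module" and S :: "('k, 's) module" +
  fixes \<iota> :: "'s \<Rightarrow> 'r"
  assumes \<iota>: "\<iota> \<in> ring_hom S R" and \<iota>_smult: "\<lbrakk>c \<in> carrier k; s \<in> carrier S\<rbrakk> \<Longrightarrow> \<iota> (c \<odot>\<^bsub>S\<^esub> s) = c \<odot>\<^bsub>R\<^esub> \<iota> s"
begin

lemma \<iota>_simps:
  "s \<in> carrier S \<Longrightarrow> \<iota> s \<in> carrier R"
  "\<lbrakk>s \<in> carrier S; t \<in> carrier S\<rbrakk> \<Longrightarrow> \<iota> (s \<oplus>\<^bsub>S\<^esub> t) = \<iota> s \<oplus>\<^bsub>R\<^esub> \<iota> t"
  "\<lbrakk>s \<in> carrier S; t \<in> carrier S\<rbrakk> \<Longrightarrow> \<iota> (s \<otimes>\<^bsub>S\<^esub> t) = \<iota> s \<otimes>\<^bsub>R\<^esub> \<iota> t"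
  "\<iota> \<one>\<^bsub>S\<^esub> = \<one>\<^bsub>R\<^esub>"
  using \<iota> by (auto simp: ring_hom_def)

lemma \<iota>_scalar: "c \<in> carrier k \<Longrightarrow> \<iota> (c \<odot>\<^bsub>S\<^esub> \<one>\<^bsub>S\<^esub>) = c \<odot>\<^bsub>R\<^esub> \<one>\<^bsub>R\<^esub>"
  by (simp add: \<iota>_smult \<iota>_simps)

lemma restrict_left_module: "left_module R N \<Longrightarrow> left_module S (restrict_scalars \<iota> N)"
  by (rule restrict_scalars_left_module[OF _ S.R.ring_axioms \<iota>])

lemma restrict_linear: "linear_map R N N' f \<Longrightarrow> linear_map S (restrict_scalars \<iota> N) (restrict_scalars \<iota> N') f"
  by (auto simp: linear_map_def \<iota>_simps)

lemma right_via_left_module: "left_module (opp S) (right_via R \<iota>)"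
  by (rule left_moduleI) (auto simp: \<iota>_simps R.R.l_distr R.R.r_distr R.R.m_assoc ring_opp[OF S.R.ring_axioms]
      intro: abelian_group_cong[OF R.R.abelian_group_axioms])

end

locale induced = rel_ext k R S \<iota>
  for k :: "'k ring" and R :: "('k, 'r) module" and S :: "('k, 's) module" and \<iota> :: "'s \<Rightarrow> 'r" +
  fixes N :: "('s, 'n) module"
  assumes SN: "left_module S N"
begin

sublocale IT: tensor_data k S "right_via R \<iota>" N
  by (intro S.tensor_dataI right_via_left_module SN)

abbreviation "IM \<equiv> induced_module k R S \<iota> N"
abbreviation "ipure \<equiv> tensor_pure k S (right_via R \<iota>) N"

lemma IM_simps [simp]:
  "carrier IM = carrier IT.T" "add IM = add IT.T" "zero IM = zero IT.T"
  by (simp_all add: induced_module_def Let_def right_via_def)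

lemmas ipure_add_left = IT.tensor_pure_add_left[simplified]

lemma IM_action_eq: "r \<odot>\<^bsub>IM\<^esub> C = lin_ext k IT.T (\<lambda>(r', y). ipure (r \<otimes>\<^bsub>R\<^esub> r') y) C"
  by (simp add: induced_module_def Let_def right_via_def)

lemma IM_action:
  assumes "r \<in> carrier R"
  shows IM_action_linear: "linear_map k IT.T IT.T (\<lambda>C. r \<odot>\<^bsub>IM\<^esub> C)"
    and IM_action_pure: "\<lbrakk>r' \<in> carrier R; y \<in> carrier N\<rbrakk> \<Longrightarrow> r \<odot>\<^bsub>IM\<^esub> ipure r' y = ipure (r \<otimes>\<^bsub>R\<^esub> r') y"
proof -
  have "bilinear k S (right_via R \<iota>) N IT.T (\<lambda>r' y. ipure (r \<otimes>\<^bsub>R\<^esub> r') y)"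
    using assms IT.tensor_pure_balanced
    by (intro bilinearI) (simp_all add: IT.tensor_pure_closed ipure_add_left R.R.r_distr
        IT.tensor_pure_add_right IT.tensor_pure_scalar \<iota>_simps flip: R.R.m_assoc)
  note l = IT.tensor_lift[OF IT.tensor_left_module this]
  show "linear_map k IT.T IT.T (\<lambda>C. r \<odot>\<^bsub>IM\<^esub> C)"
    "\<lbrakk>r' \<in> carrier R; y \<in> carrier N\<rbrakk> \<Longrightarrow> r \<odot>\<^bsub>IM\<^esub> ipure r' y = ipure (r \<otimes>\<^bsub>R\<^esub> r') y"
    unfolding IM_action_eq using l by auto
qed

lemma ipure_closed: "\<lbrakk>r \<in> carrier R; y \<in> carrier N\<rbrakk> \<Longrightarrow> ipure r y \<in> carrier IT.T"
  using IT.tensor_pure_closed by simp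

lemma IM_left_module: "left_module R IM"
proof (rule left_moduleI)
  show "abelian_group IM" by (rule abelian_group_cong[OF IT.T.N.abelian_group_axioms]) auto
  note D = linear_mapD[OF IM_action_linear]
  show cl: "r \<odot>\<^bsub>IM\<^esub> C \<in> carrier IM" if "r \<in> carrier R" "C \<in> carrier IM" for r C
    using that D(1) by simp
  show rd: "r \<odot>\<^bsub>IM\<^esub> (C \<oplus>\<^bsub>IM\<^esub> D) = r \<odot>\<^bsub>IM\<^esub> C \<oplus>\<^bsub>IM\<^esub> r \<odot>\<^bsub>IM\<^esub> D"
    if "r \<in> carrier R" "C \<in> carrier IM" "D \<in> carrier IM" for r C D
    using that D(2) by simp
  show "(r \<oplus>\<^bsub>R\<^esub> s) \<odot>\<^bsub>IM\<^esub> C = r \<odot>\<^bsub>IM\<^esub> C \<oplus>\<^bsub>IM\<^esub> s \<odot>\<^bsub>IM\<^esub> C"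
    if "r \<in> carrier R" "s \<in> carrier R" "C \<in> carrier IM" for r s C
  proof -
    have "C \<in> carrier IT.T" using that by simp
    then show ?thesis
    proof (induction rule: IT.tensor_induct)
      case (pure r' y)
      then show ?case
        using that by (simp add: IM_action_pure R.R.l_distr ipure_add_left)
    next
      case (add C D)
      then show ?case using that cl by (simp add: D IT.T.N.a_ac)
    qed
  qed
  show "(r \<otimes>\<^bsub>R\<^esub> s) \<odot>\<^bsub>IM\<^esub> C = r \<odot>\<^bsub>IM\<^esub> (s \<odot>\<^bsub>IM\<^esub> C)"
    if "r \<in> carrier R" "s \<in> carrier R" "C \<in> carrier IM" for r s C
  proof -
    have "C \<in> carrier IT.T" using that by simp
    then show ?thesis
      using that(1,2) cl
      by (induction rule: IT.tensor_induct) (simp_all add: IM_action_pure R.R.m_assoc D)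
  qed
  show "\<one>\<^bsub>R\<^esub> \<odot>\<^bsub>IM\<^esub> C = C" if "C \<in> carrier IM" for C
  proof -
    have "C \<in> carrier IT.T" using that by simp
    then show ?thesis by (induction rule: IT.tensor_induct) (simp_all add: IM_action_pure D)
  qed
qed (rule R.R.ring_axioms)

sublocale IM: left_module R IM by (rule IM_left_module)

lemma ipure_one_linear: "linear_map S N (restrict_scalars \<iota> IM) (\<lambda>y. ipure \<one>\<^bsub>R\<^esub> y)"
proof (rule linear_mapI)
  fix s y assume "s \<in> carrier S" "y \<in> carrier N"
  then show "ipure \<one>\<^bsub>R\<^esub> (s \<odot>\<^bsub>N\<^esub> y) = s \<odot>\<^bsub>restrict_scalars \<iota> IM\<^esub> ipure \<one>\<^bsub>R\<^esub> y"
    using IT.tensor_pure_balanced[of s "\<one>\<^bsub>R\<^esub>" y] by (simp add: IM_action_pure \<iota>_simps)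
qed (simp_all add: ipure_closed IT.tensor_pure_add_right)

lemma ipure_eq: "\<lbrakk>r \<in> carrier R; y \<in> carrier N\<rbrakk> \<Longrightarrow> ipure r y = r \<odot>\<^bsub>IM\<^esub> ipure \<one>\<^bsub>R\<^esub> y"
  by (simp add: IM_action_pure)

text \<open>The \<open>R\<close>-linear extension of an \<open>S\<close>-linear map out of
  \<open>N\<close>: one direction of the adjunction between induction and restriction of
  scalars.\<close>

definition iext :: "('r, 'z) module \<Rightarrow> ('n \<Rightarrow> 'z) \<Rightarrow> ('r \<times> 'n \<Rightarrow> 'k) set \<Rightarrow> 'z"
  where "iext Z g = lin_ext k (kmod R Z) (\<lambda>(r, y). r \<odot>\<^bsub>Z\<^esub> g y)"

lemma iext:
  assumes Z: "left_module R Z" and g: "linear_map S N (restrict_scalars \<iota> Z) g"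
  shows iext_pure: "\<lbrakk>r \<in> carrier R; y \<in> carrier N\<rbrakk> \<Longrightarrow> iext Z g (ipure r y) = r \<odot>\<^bsub>Z\<^esub> g y"
    and iext_linear: "linear_map R IM Z (iext Z g)"
proof -
  interpret Z: left_module R Z by fact
  interpret kZ: left_module k "kmod R Z" by (rule R.kmod_left_module[OF Z])
  note gD = linear_mapD[OF g, simplified]
  have "bilinear k S (right_via R \<iota>) N (kmod R Z) (\<lambda>r y. r \<odot>\<^bsub>Z\<^esub> g y)"
  proof (rule bilinearI)
    fix c r y assume "c \<in> carrier k" "r \<in> carrier (right_via R \<iota>)" "y \<in> carrier N"
    then show "r \<odot>\<^bsub>Z\<^esub> g ((c \<odot>\<^bsub>S\<^esub> \<one>\<^bsub>S\<^esub>) \<odot>\<^bsub>N\<^esub> y) = c \<odot>\<^bsub>kmod R Z\<^esub> (r \<odot>\<^bsub>Z\<^esub> g y)"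
      by (simp add: gD S.scalar_closed \<iota>_scalar R.scalar_closed R.scalar_central flip: Z.smult_assoc)
  qed (simp_all add: gD Z.smult_closed Z.smult_l_distr Z.smult_r_distr Z.smult_assoc \<iota>_simps)
  note l = IT.tensor_lift[OF kZ.left_module_axioms this]
  show val: "iext Z g (ipure r y) = r \<odot>\<^bsub>Z\<^esub> g y" if "r \<in> carrier R" "y \<in> carrier N" for r y
    using l(2) that by (simp add: iext_def)
  note D = linear_mapD[OF l(1), folded iext_def, simplified]
  show "linear_map R IM Z (iext Z g)"
  proof (rule linear_mapI)
    fix r C assume r: "r \<in> carrier R" and "C \<in> carrier IM"
    then have "C \<in> carrier IT.T" by simp
    then show "iext Z g (r \<odot>\<^bsub>IM\<^esub> C) = r \<odot>\<^bsub>Z\<^esub> iext Z g C"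
    proof (induction rule: IT.tensor_induct)
      case (pure r' y)
      then show ?case using r gD by (simp add: IM_action_pure val Z.smult_assoc)
    next
      case (add C D)
      then show ?case
        using r IM.smult_r_distr[of r C D] IM.smult_closed[of r] by (simp add: D Z.smult_r_distr)
    qed
  qed (simp_all add: D)
qed

text \<open>The elements \<open>1 \<otimes> y\<close> generate the induced module over
  \<open>R\<close>, which makes the extension \<open>iext\<close> unique.\<close>

lemma IM_ext:
  assumes Z: "left_module R Z" and f: "linear_map R IM Z f" and g: "linear_map R IM Z g"
    and eq: "\<And>y. y \<in> carrier N \<Longrightarrow> f (ipure \<one>\<^bsub>R\<^esub> y) = g (ipure \<one>\<^bsub>R\<^esub> y)"
    and C: "C \<in> carrier IM"
  shows "f C = g C"
proof -
  note fD = linear_mapD[OF f, simplified] and gD = linear_mapD[OF g, simplified]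
  from C have "C \<in> carrier IT.T" by simp
  then show ?thesis
  proof (induction rule: IT.tensor_induct)
    case (pure r y)
    then have "f (r \<odot>\<^bsub>IM\<^esub> ipure \<one>\<^bsub>R\<^esub> y) = g (r \<odot>\<^bsub>IM\<^esub> ipure \<one>\<^bsub>R\<^esub> y)"
      by (simp add: fD(3) gD(3) eq ipure_closed)
    then show ?case using pure by (simp add: ipure_eq[of r y])
  next
    case (add C D)
    then show ?case by (simp add: fD gD)
  qed
qed

end

section \<open>The relative lifting property\<close>

context rel_ext
begin

lemma inducedI: "left_module S N \<Longrightarrow> induced k R S \<iota> N"
  by (intro induced.intro induced_axioms.intro rel_ext_axioms)

text \<open>The inducing module must have its elements in the type of \<open>P\<close>. In the
  application both the bar bimodule and the tensor power of \<open>M\<close> consist of sets of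
  functions on words, so this constraint is met.\<close>

lemma rel_projective_iso:
  fixes P :: "(_, 'p) module" and N :: "(_, 'p) module"
  assumes "left_module R P" "left_module S N" "module_iso R P (induced_module k R S \<iota> N)"
  shows "rel_projective k R S \<iota> P"
proof -
  interpret I: induced k R S \<iota> N by (rule inducedI) fact
  show ?thesis
    unfolding rel_projective_def using assms direct_summand_iso[OF I.IM_left_module assms(3)] by blast
qed

text \<open>The section \<open>\<sigma>\<close> is only \<open>S\<close>-linear, so composing it
  with \<open>f\<close> does not give an \<open>R\<close>-linear lift. It is applied to the
  generators \<open>1 \<otimes> y\<close> of an induced module with \<open>P\<close> as a summand,
  and the adjunction turns the outcome into an \<open>R\<close>-linear map. The section has to split
  \<open>p\<close> only over the image of \<open>f\<close>.\<close>

lemma rel_projective_lift: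
  fixes P :: "(_, 'p) module" and Y :: "(_, 'y) module" and Z :: "(_, 'z) module"
  assumes P: "rel_projective k R S \<iota> P" and Y: "left_module R Y" and Z: "left_module R Z"
    and p: "linear_map R Y Z p" and f: "linear_map R P Z f"
    and \<sigma>: "linear_map S (restrict_scalars \<iota> Z) (restrict_scalars \<iota> Y) \<sigma>"
    and sec: "\<And>x. x \<in> carrier P \<Longrightarrow> p (\<sigma> (f x)) = f x"
  shows "\<exists>g. linear_map R P Y g \<and> (\<forall>x\<in>carrier P. p (g x) = f x)"
proof -
  obtain N :: "(_, 'p) module" where N: "left_module S N" "direct_summand R P (induced_module k R S \<iota> N)"
    and Pm: "left_module R P"
    using P unfolding rel_projective_def by blast
  interpret I: induced k R S \<iota> N by (rule inducedI) fact
  obtain i q where i: "linear_map R P I.IM i" and q: "linear_map R I.IM P q"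
    and qi: "\<And>x. x \<in> carrier P \<Longrightarrow> q (i x) = x"
    using direct_summand_retract[OF I.IM_left_module Pm N(2)] by blast
  define g0 where "g0 y = \<sigma> (f (q (I.ipure \<one>\<^bsub>R\<^esub> y)))" for y
  have g0: "linear_map S N (restrict_scalars \<iota> Y) g0"
    unfolding g0_def
    by (rule linear_map_comp[OF linear_map_comp[OF linear_map_comp[OF I.ipure_one_linear
          restrict_linear[OF q]] restrict_linear[OF f]] \<sigma>])
  note g = I.iext_linear[OF Y g0]
  have "p (I.iext Y g0 C) = f (q C)" if "C \<in> carrier I.IM" for C
  proof (rule I.IM_ext[OF Z linear_map_comp[OF g p] linear_map_comp[OF q f] _ that])
    fix y assume y: "y \<in> carrier N"
    then have c: "I.ipure \<one>\<^bsub>R\<^esub> y \<in> carrier I.IM" by (simp add: I.ipure_closed)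
    have "I.iext Y g0 (I.ipure \<one>\<^bsub>R\<^esub> y) = g0 y"
      using I.iext_pure[OF Y g0 _ y] linear_mapD(1)[OF g0 y] left_module.smult_one[OF Y] by simp
    then show "p (I.iext Y g0 (I.ipure \<one>\<^bsub>R\<^esub> y)) = f (q (I.ipure \<one>\<^bsub>R\<^esub> y))"
      using sec[OF linear_mapD(1)[OF q c]] by (simp add: g0_def)
  qed
  then show ?thesis
    using linear_map_comp[OF i g] linear_mapD(1)[OF i] qi
    by (intro exI[of _ "\<lambda>x. I.iext Y g0 (i x)"]) auto
qed

end

subsection \<open>Comparison of relative resolutions\<close>

text \<open>What remains of a resolution when projectivity and the contracting homotopy are dropped;
  the functors \<open>X \<otimes> -\<close> and \<open>Hom(-, X)\<close> turn this much into
  complexes.\<close>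

definition aug_complex ::
  "('r, 'i) ring_scheme \<Rightarrow> ('r, 'y) module \<Rightarrow> (nat \<Rightarrow> ('r, 'p) module) \<Rightarrow> (nat \<Rightarrow> 'p \<Rightarrow> 'p) \<Rightarrow> ('p \<Rightarrow> 'y) \<Rightarrow> bool"
  where "aug_complex R Y P d \<epsilon> \<longleftrightarrow>
    (\<forall>n. left_module R (P n)) \<and> left_module R Y \<and> linear_map R (P 0) Y \<epsilon> \<and>
    (\<forall>n. linear_map R (P (Suc n)) (P n) (d (Suc n))) \<and>
    (\<forall>x\<in>carrier (P 1). \<epsilon> (d 1 x) = \<zero>\<^bsub>Y\<^esub>) \<and>
    (\<forall>n. \<forall>x\<in>carrier (P (Suc (Suc n))). d (Suc n) (d (Suc (Suc n)) x) = \<zero>\<^bsub>P n\<^esub>)"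

text \<open>Cycles of the augmented complex: in degree 0 the condition is the vanishing of
  \<open>\<epsilon>\<close>, so that lifting against a resolution has the same form in all
  degrees.\<close>

definition aug_cycle ::
  "('r, 'y) module \<Rightarrow> (nat \<Rightarrow> ('r, 'p) module) \<Rightarrow> (nat \<Rightarrow> 'p \<Rightarrow> 'p) \<Rightarrow> ('p \<Rightarrow> 'y) \<Rightarrow> nat \<Rightarrow> 'p \<Rightarrow> bool"
  where "aug_cycle Y P d \<epsilon> n x \<longleftrightarrow>
    x \<in> carrier (P n) \<and> (case n of 0 \<Rightarrow> \<epsilon> x = \<zero>\<^bsub>Y\<^esub> | Suc m \<Rightarrow> d n x = \<zero>\<^bsub>P m\<^esub>)"

lemma aug_cycle_boundary:
  assumes "aug_complex R Y P d \<epsilon>" "x \<in> carrier (P (Suc n))"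
  shows "aug_cycle Y P d \<epsilon> n (d (Suc n) x)"
  using assms linear_mapD(1)[of R "P (Suc n)" "P n" "d (Suc n)" x]
  by (auto simp: aug_complex_def aug_cycle_def split: nat.split)

definition chain_map ::
  "('r, 'i) ring_scheme \<Rightarrow> (nat \<Rightarrow> ('r, 'p) module) \<Rightarrow> (nat \<Rightarrow> 'p \<Rightarrow> 'p) \<Rightarrow> (nat \<Rightarrow> ('r, 'q) module) \<Rightarrow> (nat \<Rightarrow> 'q \<Rightarrow> 'q)
     \<Rightarrow> (nat \<Rightarrow> 'p \<Rightarrow> 'q) \<Rightarrow> bool"
  where "chain_map R P d Q e f \<longleftrightarrow>
    (\<forall>n. linear_map R (P n) (Q n) (f n)) \<and>
    (\<forall>n. \<forall>x\<in>carrier (P (Suc n)). e (Suc n) (f (Suc n) x) = f n (d (Suc n) x))"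

definition chain_homotopy ::
  "('r, 'i) ring_scheme \<Rightarrow> (nat \<Rightarrow> ('r, 'p) module) \<Rightarrow> (nat \<Rightarrow> 'p \<Rightarrow> 'p) \<Rightarrow> (nat \<Rightarrow> ('r, 'q) module) \<Rightarrow> (nat \<Rightarrow> 'q \<Rightarrow> 'q)
     \<Rightarrow> (nat \<Rightarrow> 'p \<Rightarrow> 'q) \<Rightarrow> (nat \<Rightarrow> 'p \<Rightarrow> 'q) \<Rightarrow> (nat \<Rightarrow> 'p \<Rightarrow> 'q) \<Rightarrow> bool"
  where "chain_homotopy R P d Q e f g s \<longleftrightarrow>
    (\<forall>n. linear_map R (P n) (Q (Suc n)) (s n)) \<and>
    (\<forall>x\<in>carrier (P 0). e 1 (s 0 x) = f 0 x \<ominus>\<^bsub>Q 0\<^esub> g 0 x) \<and>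
    (\<forall>n. \<forall>x\<in>carrier (P (Suc n)).
      e (Suc (Suc n)) (s (Suc n) x) \<oplus>\<^bsub>Q (Suc n)\<^esub> s n (d (Suc n) x) = f (Suc n) x \<ominus>\<^bsub>Q (Suc n)\<^esub> g (Suc n) x)"

context rel_ext
begin

lemma resolution_aug_complex:
  "rel_projective_resolution k R S \<iota> Y P d \<epsilon> \<Longrightarrow> left_module R Y \<Longrightarrow> aug_complex R Y P d \<epsilon>"
  unfolding rel_projective_resolution_def aug_complex_def rel_projective_def by blast

text \<open>On a cycle the identity \<open>d h + h d = 1\<close> reads \<open>d h x = x\<close>.
  Thus \<open>h\<close> is an \<open>S\<close>-linear section of the next differential over the
  cycles, and relative projectivity lifts every map with values in cycles.\<close>

lemma resolution_lift:
  assumes res: "rel_projective_resolution k R S \<iota> Y Q e \<epsilon>'" and Y: "left_module R Y"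
    and P: "rel_projective k R S \<iota> P" and f: "linear_map R P (Q n) f"
    and cyc: "\<And>x. x \<in> carrier P \<Longrightarrow> aug_cycle Y Q e \<epsilon>' n (f x)"
  shows "\<exists>g. linear_map R P (Q (Suc n)) g \<and> (\<forall>x\<in>carrier P. e (Suc n) (g x) = f x)"
proof -
  have Q: "left_module R (Q n)" for n
    using resolution_aug_complex[OF res Y] by (simp add: aug_complex_def)
  obtain \<eta> h where \<eta>: "linear_map S (restrict_scalars \<iota> Y) (restrict_scalars \<iota> (Q 0)) \<eta>"
    and h: "\<And>n. linear_map S (restrict_scalars \<iota> (Q n)) (restrict_scalars \<iota> (Q (Suc n))) (h n)"
    and h0: "\<And>x. x \<in> carrier (Q 0) \<Longrightarrow> e 1 (h 0 x) \<oplus>\<^bsub>Q 0\<^esub> \<eta> (\<epsilon>' x) = x"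
    and hS: "\<And>n x. x \<in> carrier (Q (Suc n)) \<Longrightarrow>
      e (Suc (Suc n)) (h (Suc n) x) \<oplus>\<^bsub>Q (Suc n)\<^esub> h n (e (Suc n) x) = x"
    and e: "\<And>n. linear_map R (Q (Suc n)) (Q n) (e (Suc n))"
    using res unfolding rel_projective_resolution_def by blast
  have ab: "abelian_group (restrict_scalars \<iota> N)" if "left_module R N" for N :: "(_, 'z) module"
    using restrict_left_module[OF that] by (simp add: left_module_def)
  have e': "e (Suc m) (h m x) \<in> carrier (Q m)" if "x \<in> carrier (Q m)" for m x
    using linear_mapD(1)[OF e] linear_mapD(1)[OF h] that by simp
  have sec: "e (Suc n) (h n x) = x" if x: "aug_cycle Y Q e \<epsilon>' n x" for x
  proof -
    interpret Qn: left_module R "Q n" by (rule Q)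
    show ?thesis
    proof (cases n)
      case 0
      have "\<eta> \<zero>\<^bsub>Y\<^esub> = \<zero>\<^bsub>Q 0\<^esub>" using linear_map_zero[OF \<eta> ab[OF Y] ab[OF Q]] by simp
      then show ?thesis
        using x h0[of x] e'[of x n] Qn.N.r_zero 0 by (simp add: aug_cycle_def)
    next
      case (Suc m)
      have "h m \<zero>\<^bsub>Q m\<^esub> = \<zero>\<^bsub>Q (Suc m)\<^esub>" using linear_map_zero[OF h ab[OF Q] ab[OF Q]] by simp
      then show ?thesis
        using x hS[of x m] e'[of x n] Qn.N.r_zero Suc by (simp add: aug_cycle_def)
    qed
  qed
  show ?thesis
    by (rule rel_projective_lift[OF P Q Q e f h]) (rule sec[OF cyc])
qed

text \<open>The source contributes relative projectivity and the target its contracting homotopy;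
  the lifts are built degree by degree above the identity of \<open>Y\<close>.\<close>

lemma comparison_map:
  assumes P: "\<And>n. rel_projective k R S \<iota> (P n)" "aug_complex R Y P d \<epsilon>"
    and res: "rel_projective_resolution k R S \<iota> Y Q e \<epsilon>'" and Y: "left_module R Y"
  shows "\<exists>f. chain_map R P d Q e f \<and> (\<forall>x\<in>carrier (P 0). \<epsilon>' (f 0 x) = \<epsilon> x)"
proof -
  have acQ: "aug_complex R Y Q e \<epsilon>'" by (rule resolution_aug_complex[OF res Y])
  have Pm: "left_module R (P n)" and Qm: "left_module R (Q n)" for n
    using P(2) acQ by (simp_all add: aug_complex_def)
  have d: "linear_map R (P (Suc n)) (P n) (d (Suc n))" for n using P(2) by (simp add: aug_complex_def)
  have \<epsilon>: "linear_map R (P 0) Y \<epsilon>" using P(2) by (simp add: aug_complex_def)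
  obtain \<eta> where \<eta>: "linear_map S (restrict_scalars \<iota> Y) (restrict_scalars \<iota> (Q 0)) \<eta>"
      "\<And>y. y \<in> carrier Y \<Longrightarrow> \<epsilon>' (\<eta> y) = y" and \<epsilon>': "linear_map R (Q 0) Y \<epsilon>'"
    using res unfolding rel_projective_resolution_def by blast
  \<comment> \<open>Each step uses of the preceding one that it carries cycles to cycles, which is
    therefore the invariant of the dependent choice.\<close>
  define good where "good n f \<longleftrightarrow> linear_map R (P n) (Q n) f \<and>
      (n = 0 \<longrightarrow> (\<forall>x\<in>carrier (P 0). \<epsilon>' (f x) = \<epsilon> x)) \<and>
      (\<forall>x. aug_cycle Y P d \<epsilon> n x \<longrightarrow> aug_cycle Y Q e \<epsilon>' n (f x))" for n f
  define nxt where "nxt n f g \<longleftrightarrow> (\<forall>x\<in>carrier (P (Suc n)). e (Suc n) (g x) = f (d (Suc n) x))"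
    for n f g
  have "\<exists>f. \<forall>n. good n (f n) \<and> nxt n (f n) (f (Suc n))"
  proof (rule dependent_nat_choice)
    obtain f where "linear_map R (P 0) (Q 0) f" "\<forall>x\<in>carrier (P 0). \<epsilon>' (f x) = \<epsilon> x"
      using rel_projective_lift[OF P(1) Qm Y \<epsilon>' \<epsilon> \<eta>(1)] \<eta>(2) linear_mapD(1)[OF \<epsilon>] by blast
    then show "\<exists>f. good 0 f"
      using linear_mapD(1)[of R "P 0" "Q 0" f] by (intro exI[of _ f]) (auto simp: good_def aug_cycle_def)
  next
    fix f n assume f: "good n f"
    then have fl: "linear_map R (P n) (Q n) f" by (simp add: good_def)
    have "\<exists>g. linear_map R (P (Suc n)) (Q (Suc n)) g \<and>
        (\<forall>x\<in>carrier (P (Suc n)). e (Suc n) (g x) = f (d (Suc n) x))"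
      using f aug_cycle_boundary[OF P(2)]
      by (intro resolution_lift[OF res Y P(1) linear_map_comp[OF d fl]]) (auto simp: good_def)
    then obtain g where g: "linear_map R (P (Suc n)) (Q (Suc n)) g"
      "\<And>x. x \<in> carrier (P (Suc n)) \<Longrightarrow> e (Suc n) (g x) = f (d (Suc n) x)" by blast
    \<comment> \<open>Hence \<open>g\<close> again preserves cycles: if \<open>d x\<close> is zero,
      then \<open>e (g x) = f (d x)\<close> is zero.\<close>
    moreover have "f \<zero>\<^bsub>P n\<^esub> = \<zero>\<^bsub>Q n\<^esub>"
      using linear_map_zero[OF fl] Pm Qm by (simp add: left_module_def)
    ultimately show "\<exists>g. good (Suc n) g \<and> nxt n f g"
      using linear_mapD(1)[OF g(1)]
      by (intro exI[of _ g]) (auto simp: good_def nxt_def aug_cycle_def)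
  qed
  then obtain f where "good n (f n)" "nxt n (f n) (f (Suc n))" for n by blast
  then show ?thesis by (intro exI[of _ f]) (simp add: good_def nxt_def chain_map_def)
qed

text \<open>With \<open>\<delta> = f - g\<close>, the map \<open>\<delta> - s d\<close> takes values
  in cycles, and lifting it gives the next term of the homotopy.\<close>

lemma comparison_homotopy:
  assumes P: "\<And>n. rel_projective k R S \<iota> (P n)" "aug_complex R Y P d \<epsilon>"
    and res: "rel_projective_resolution k R S \<iota> Y Q e \<epsilon>'" and Y: "left_module R Y"
    and f: "chain_map R P d Q e f" "\<And>x. x \<in> carrier (P 0) \<Longrightarrow> \<epsilon>' (f 0 x) = \<epsilon> x"
    and g: "chain_map R P d Q e g" "\<And>x. x \<in> carrier (P 0) \<Longrightarrow> \<epsilon>' (g 0 x) = \<epsilon> x"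
  shows "\<exists>s. chain_homotopy R P d Q e f g s"
proof -
  have acQ: "aug_complex R Y Q e \<epsilon>'" by (rule resolution_aug_complex[OF res Y])
  have Pm: "left_module R (P n)" and Qm: "left_module R (Q n)" for n
    using P(2) acQ by (simp_all add: aug_complex_def)
  have ab: "abelian_group (P n)" "abelian_group (Q n)" "abelian_group Y" for n
    using Pm Qm Y by (simp_all add: left_module_def)
  have d: "linear_map R (P (Suc n)) (P n) (d (Suc n))" for n using P(2) by (simp add: aug_complex_def)
  have e: "linear_map R (Q (Suc n)) (Q n) (e (Suc n))" for n using acQ by (simp add: aug_complex_def)
  have \<epsilon>': "linear_map R (Q 0) Y \<epsilon>'" using acQ by (simp add: aug_complex_def)
  have \<epsilon>: "linear_map R (P 0) Y \<epsilon>" using P(2) by (simp add: aug_complex_def)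
  have dd: "d (Suc n) (d (Suc (Suc n)) x) = \<zero>\<^bsub>P n\<^esub>" if "x \<in> carrier (P (Suc (Suc n)))" for n x
    using P(2) that by (simp add: aug_complex_def)
  have fl: "linear_map R (P n) (Q n) (f n)" and gl: "linear_map R (P n) (Q n) (g n)" for n
    using f(1) g(1) by (simp_all add: chain_map_def)
  define \<delta> where "\<delta> n x = f n x \<ominus>\<^bsub>Q n\<^esub> g n x" for n x
  have \<delta>: "linear_map R (P n) (Q n) (\<delta> n)" for n
    unfolding \<delta>_def by (rule linear_map_sub[OF Qm fl gl])
  have \<delta>e: "e (Suc n) (\<delta> (Suc n) x) = \<delta> n (d (Suc n) x)" if "x \<in> carrier (P (Suc n))" for n x
    using linear_map_diff[OF e ab(2) ab(2)] linear_mapD(1)[OF fl] linear_mapD(1)[OF gl] f(1) g(1) that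
    by (simp add: \<delta>_def chain_map_def)
  have \<delta>0: "aug_cycle Y Q e \<epsilon>' 0 (\<delta> 0 x)" if "x \<in> carrier (P 0)" for x
    using linear_map_diff[OF \<epsilon>' ab(2,3)] linear_mapD(1)[OF fl] linear_mapD(1)[OF gl] that
      linear_mapD(1)[OF \<delta>, of x 0] linear_mapD(1)[OF \<epsilon> that] abelian_group.r_neg[OF ab(3)]
    by (simp add: \<delta>_def aug_cycle_def f(2) g(2) a_minus_def)
  \<comment> \<open>The last clause, \<open>e s d = \<delta> d\<close>, is the homotopy identity of
    degree \<open>n\<close> evaluated on boundaries, where the term through degree
    \<open>n - 1\<close> disappears. It is exactly what makes the next correction a cycle.\<close>
  define good where "good n s \<longleftrightarrow> linear_map R (P n) (Q (Suc n)) s \<and>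
      (n = 0 \<longrightarrow> (\<forall>x\<in>carrier (P 0). e 1 (s x) = \<delta> 0 x)) \<and>
      (\<forall>x\<in>carrier (P (Suc n)). e (Suc n) (s (d (Suc n) x)) = \<delta> n (d (Suc n) x))" for n s
  define nxt where "nxt n s t \<longleftrightarrow> (\<forall>x\<in>carrier (P (Suc n)).
      e (Suc (Suc n)) (t x) \<oplus>\<^bsub>Q (Suc n)\<^esub> s (d (Suc n) x) = \<delta> (Suc n) x)" for n s t
  have "\<exists>s. \<forall>n. good n (s n) \<and> nxt n (s n) (s (Suc n))"
  proof (rule dependent_nat_choice)
    have "\<exists>s. linear_map R (P 0) (Q (Suc 0)) s \<and> (\<forall>x\<in>carrier (P 0). e (Suc 0) (s x) = \<delta> 0 x)"
      by (rule resolution_lift[OF res Y P(1) \<delta> \<delta>0])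
    then show "\<exists>s. good 0 s"
      using linear_mapD(1)[OF d] by (auto simp: good_def)
  next
    fix s n assume s: "good n s"
    then have sl: "linear_map R (P n) (Q (Suc n)) s" by (simp add: good_def)
    interpret Qn: left_module R "Q (Suc n)" by (rule Qm)
    interpret Qn': left_module R "Q n" by (rule Qm)
    let ?\<phi> = "\<lambda>x. \<delta> (Suc n) x \<ominus>\<^bsub>Q (Suc n)\<^esub> s (d (Suc n) x)"
    have \<phi>: "linear_map R (P (Suc n)) (Q (Suc n)) ?\<phi>"
      by (rule linear_map_sub[OF Qm \<delta> linear_map_comp[OF d sl]])
    have c: "\<delta> (Suc n) x \<in> carrier (Q (Suc n))" "s (d (Suc n) x) \<in> carrier (Q (Suc n))"
      if "x \<in> carrier (P (Suc n))" for x
      using linear_mapD(1)[OF \<delta>] linear_mapD(1)[OF sl] linear_mapD(1)[OF d] that by blast+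
    have "aug_cycle Y Q e \<epsilon>' (Suc n) (?\<phi> x)" if x: "x \<in> carrier (P (Suc n))" for x
      using linear_mapD(1)[OF \<phi> x] linear_map_diff[OF e ab(2) ab(2) c[OF x]] s \<delta>e[OF x] x
        linear_mapD(1)[OF \<delta> linear_mapD(1)[OF d x]] Qn'.N.r_neg
      by (simp add: aug_cycle_def good_def a_minus_def)
    then obtain t where t: "linear_map R (P (Suc n)) (Q (Suc (Suc n))) t"
      "\<And>x. x \<in> carrier (P (Suc n)) \<Longrightarrow> e (Suc (Suc n)) (t x) = ?\<phi> x"
      using resolution_lift[OF res Y P(1) \<phi>] by blast
    have "e (Suc (Suc n)) (t (d (Suc (Suc n)) x)) = \<delta> (Suc n) (d (Suc (Suc n)) x)"
      if x: "x \<in> carrier (P (Suc (Suc n)))" for x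
    proof -
      have "s \<zero>\<^bsub>P n\<^esub> = \<zero>\<^bsub>Q (Suc n)\<^esub>" by (rule linear_map_zero[OF sl ab(1,2)])
      then show ?thesis
        using t(2)[OF linear_mapD(1)[OF d x]] dd[OF x] c(1)[OF linear_mapD(1)[OF d x]]
        by (simp add: a_minus_def)
    qed
    moreover have "e (Suc (Suc n)) (t x) \<oplus>\<^bsub>Q (Suc n)\<^esub> s (d (Suc n) x) = \<delta> (Suc n) x"
      if x: "x \<in> carrier (P (Suc n))" for x
      using t(2)[OF x] c[OF x] by (simp add: a_minus_def Qn.N.a_assoc Qn.N.l_neg)
    ultimately show "\<exists>t. good (Suc n) t \<and> nxt n s t"
      using t(1) by (intro exI[of _ t]) (simp add: good_def nxt_def)
  qed
  then obtain s where s: "good n (s n)" "nxt n (s n) (s (Suc n))" for n by blast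
  then show ?thesis
    using s(1)[of 0] by (intro exI[of _ s]) (simp add: good_def nxt_def chain_homotopy_def \<delta>_def)
qed

end

section \<open>Homology of complexes\<close>

lemma submodule_carrier_update:
  assumes "left_module R N" "submodule Z R N" "submodule B R N" "B \<subseteq> Z"
  shows "submodule B R (N\<lparr>carrier := Z\<rparr>)"
proof -
  interpret N: left_module R N by fact
  interpret Z: left_module R "N\<lparr>carrier := Z\<rparr>" by (rule N.left_module_carrier_update) fact
  show ?thesis
    using N.submoduleD[OF assms(3)] assms(4) by (intro Z.submoduleI') auto
qed

text \<open>Inverses are defined relative to the carrier, so restricting to the cycles might change
  what negation means; uniqueness of inverses rules this out.\<close>

lemma a_inv_carrier_update:
  assumes "left_module R N" "submodule Z R N" "x \<in> Z"
  shows "\<ominus>\<^bsub>N\<lparr>carrier := Z\<rparr>\<^esub> x = \<ominus>\<^bsub>N\<^esub> x"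
proof -
  interpret N: left_module R N by fact
  interpret Z: left_module R "N\<lparr>carrier := Z\<rparr>" by (rule N.left_module_carrier_update) fact
  note ZD = N.submoduleD[OF assms(2)]
  have "\<ominus>\<^bsub>N\<^esub> x \<oplus>\<^bsub>N\<lparr>carrier := Z\<rparr>\<^esub> x = \<zero>\<^bsub>N\<lparr>carrier := Z\<rparr>\<^esub>"
    using ZD(1) assms(3) N.N.l_neg by auto
  then show ?thesis using Z.N.minus_equality[of "\<ominus>\<^bsub>N\<^esub> x" x] ZD(5) assms(3) by simp
qed

lemma subquotient_iso:
  assumes N: "left_module R N" "submodule Z R N" "submodule B R N" "B \<subseteq> Z"
    and N': "left_module R N'" "submodule Z' R N'" "submodule B' R N'" "B' \<subseteq> Z'"
    and u: "linear_map R N N' u" "u ` Z \<subseteq> Z'" "u ` B \<subseteq> B'"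
    and v: "linear_map R N' N v" "v ` Z' \<subseteq> Z" "v ` B' \<subseteq> B"
    and vu: "\<And>x. x \<in> Z \<Longrightarrow> v (u x) \<ominus>\<^bsub>N\<^esub> x \<in> B"
    and uv: "\<And>y. y \<in> Z' \<Longrightarrow> u (v y) \<ominus>\<^bsub>N'\<^esub> y \<in> B'"
  shows "module_iso R (quot_module (N\<lparr>carrier := Z\<rparr>) B) (quot_module (N'\<lparr>carrier := Z'\<rparr>) B')"
proof -
  interpret N: left_module R N by fact
  interpret N': left_module R N' by fact
  note ZD = N.submoduleD[OF N(2)] and ZD' = N'.submoduleD[OF N'(2)]
  show ?thesis
  proof (rule module_iso_quot[where u = u and v = v])
    show "left_module R (N\<lparr>carrier := Z\<rparr>)" by (rule N.left_module_carrier_update) fact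
    show "left_module R (N'\<lparr>carrier := Z'\<rparr>)" by (rule N'.left_module_carrier_update) fact
    show "submodule B R (N\<lparr>carrier := Z\<rparr>)" by (rule submodule_carrier_update) fact+
    show "submodule B' R (N'\<lparr>carrier := Z'\<rparr>)" by (rule submodule_carrier_update) fact+
    show "linear_map R (N\<lparr>carrier := Z\<rparr>) (N'\<lparr>carrier := Z'\<rparr>) u"
      using linear_mapD[OF u(1)] u(2) ZD(1)
      by (intro linear_mapI) (auto simp: subset_iff image_subset_iff)
    show "linear_map R (N'\<lparr>carrier := Z'\<rparr>) (N\<lparr>carrier := Z\<rparr>) v"
      using linear_mapD[OF v(1)] v(2) ZD'(1)
      by (intro linear_mapI) (auto simp: subset_iff image_subset_iff)
    show "v (u x) \<ominus>\<^bsub>N\<lparr>carrier := Z\<rparr>\<^esub> x \<in> B" if "x \<in> carrier (N\<lparr>carrier := Z\<rparr>)" for x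
      using that vu a_inv_carrier_update[OF N(1,2)] by (simp add: a_minus_def)
    show "u (v x) \<ominus>\<^bsub>N'\<lparr>carrier := Z'\<rparr>\<^esub> x \<in> B'" if "x \<in> carrier (N'\<lparr>carrier := Z'\<rparr>)" for x
      using that uv a_inv_carrier_update[OF N'(1,2)] by (simp add: a_minus_def)
  qed (use u v in auto)
qed

section \<open>Chain complexes, chain equivalences and transport\<close>

lemma chain_complexD:
  assumes "chain_complex k C d"
  shows "cring k" "left_module k (C n)" "linear_map k (C (Suc n)) (C n) (d (Suc n))"
    "x \<in> carrier (C (Suc (Suc n))) \<Longrightarrow> d (Suc n) (d (Suc (Suc n)) x) = \<zero>\<^bsub>C n\<^esub>"
  using assms by (simp_all add: chain_complex_def module_iff_left_module)

lemma chain_complexI: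
  assumes "cring k" "\<And>n. left_module k (C n)" "\<And>n. linear_map k (C (Suc n)) (C n) (d (Suc n))"
    "\<And>n x. x \<in> carrier (C (Suc (Suc n))) \<Longrightarrow> d (Suc n) (d (Suc (Suc n)) x) = \<zero>\<^bsub>C n\<^esub>"
  shows "chain_complex k C d"
  using assms by (simp add: chain_complex_def module_iff_left_module)

text \<open>A homotopy to the identity shows that a composite moves each cycle by a boundary, which
  is the hypothesis of \<open>subquotient_iso\<close>.\<close>

lemma homology_iso:
  assumes C: "chain_complex k C d" and D: "chain_complex k D e"
    and u: "chain_map k C d D e u" and v: "chain_map k D e C d v"
    and s: "chain_homotopy k C d C d (\<lambda>n x. v n (u n x)) (\<lambda>n x. x) s"
    and t: "chain_homotopy k D e D e (\<lambda>n x. u n (v n x)) (\<lambda>n x. x) t"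
  shows "module_iso k (homology C d n) (homology D e n)"
proof -
  \<comment> \<open>Stated for an arbitrary complex because it is needed for \<open>C\<close> and
    for \<open>D\<close>, whose elements may have different types.\<close>
  have Z: "submodule {x \<in> carrier (C n). n > 0 \<longrightarrow> d n x = \<zero>\<^bsub>C (n - 1)\<^esub>} k (C n) \<and>
      submodule (d (Suc n) ` carrier (C (Suc n))) k (C n) \<and>
      d (Suc n) ` carrier (C (Suc n)) \<subseteq> {x \<in> carrier (C n). n > 0 \<longrightarrow> d n x = \<zero>\<^bsub>C (n - 1)\<^esub>}"
    if C: "chain_complex k C d" for C :: "nat \<Rightarrow> ('a, 'z) module" and d
  proof -
    note CD = chain_complexD[OF C]
    interpret left_module k "C n" by (rule CD)
    have "submodule (carrier (C n)) k (C n)" by (rule submoduleI') (auto simp: smult_closed)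
    then have "submodule {x \<in> carrier (C n). n > 0 \<longrightarrow> d n x = \<zero>\<^bsub>C (n - 1)\<^esub>} k (C n)"
      using kernel_submodule[OF CD(2,2,3)] by (cases n) simp_all
    moreover have "submodule (d (Suc n) ` carrier (C (Suc n))) k (C n)"
      by (rule image_submodule[OF CD(2,2,3)])
    moreover have "d (Suc n) ` carrier (C (Suc n)) \<subseteq> {x \<in> carrier (C n). n > 0 \<longrightarrow> d n x = \<zero>\<^bsub>C (n - 1)\<^esub>}"
      using linear_mapD(1)[OF CD(3)] CD(4) by (cases n) auto
    ultimately show ?thesis by blast
  qed
  have uZ: "u n ` {x \<in> carrier (C n). n > 0 \<longrightarrow> d n x = \<zero>\<^bsub>C (n - 1)\<^esub>} \<subseteq>
        {x \<in> carrier (D n). n > 0 \<longrightarrow> e n x = \<zero>\<^bsub>D (n - 1)\<^esub>} \<and>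
      u n ` d (Suc n) ` carrier (C (Suc n)) \<subseteq> e (Suc n) ` carrier (D (Suc n)) \<and>
      linear_map k (C n) (D n) (u n)"
    if C: "chain_complex k C d" and D: "chain_complex k D e" and u: "chain_map k C d D e u"
    for C :: "nat \<Rightarrow> ('a, 'z) module" and d and D :: "nat \<Rightarrow> ('a, 'y) module" and e u
  proof -
    have ul: "linear_map k (C n) (D n) (u n)"
      and ue: "\<And>x. x \<in> carrier (C (Suc n)) \<Longrightarrow> e (Suc n) (u (Suc n) x) = u n (d (Suc n) x)" for n
      using u by (simp_all add: chain_map_def)
    have "u n \<zero>\<^bsub>C n\<^esub> = \<zero>\<^bsub>D n\<^esub>" for n
      using linear_map_zero[OF ul] chain_complexD(2)[OF C] chain_complexD(2)[OF D]
      by (simp add: left_module_def)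
    then have "e n (u n x) = \<zero>\<^bsub>D (n - 1)\<^esub>" if "x \<in> carrier (C n)" "n > 0" "d n x = \<zero>\<^bsub>C (n - 1)\<^esub>" for x
      using ue that by (cases n) auto
    moreover have "u n (d (Suc n) x) \<in> e (Suc n) ` carrier (D (Suc n))" if "x \<in> carrier (C (Suc n))" for x
      using ue[OF that] linear_mapD(1)[OF ul that] by (metis imageI)
    ultimately show ?thesis using ul linear_mapD(1)[OF ul] by auto
  qed
  have hom: "f n x \<ominus>\<^bsub>C n\<^esub> x \<in> d (Suc n) ` carrier (C (Suc n))"
    if C: "chain_complex k C d" and s: "chain_homotopy k C d C d f (\<lambda>n x. x) s"
      and x: "x \<in> {x \<in> carrier (C n). n > 0 \<longrightarrow> d n x = \<zero>\<^bsub>C (n - 1)\<^esub>}"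
    for C :: "nat \<Rightarrow> ('a, 'z) module" and d f s x
  proof -
    note CD = chain_complexD[OF C]
    interpret left_module k "C n" by (rule CD)
    have sl: "linear_map k (C n) (C (Suc n)) (s n)" for n using s by (simp add: chain_homotopy_def)
    have "f n x \<ominus>\<^bsub>C n\<^esub> x = d (Suc n) (s n x)"
    proof (cases n)
      case 0
      then show ?thesis using s x by (simp add: chain_homotopy_def)
    next
      case (Suc m)
      have s0: "s m \<zero>\<^bsub>C m\<^esub> = \<zero>\<^bsub>C n\<^esub>"
        using linear_map_zero[OF sl] CD(2) Suc by (simp add: left_module_def)
      have cl: "d (Suc n) (s n x) \<in> carrier (C n)"
        using linear_mapD(1)[OF CD(3)] linear_mapD(1)[OF sl] x by blast
      have "d (Suc n) (s n x) \<oplus>\<^bsub>C n\<^esub> s m (d n x) = f n x \<ominus>\<^bsub>C n\<^esub> x"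
        using s x unfolding chain_homotopy_def Suc by blast
      moreover have "d n x = \<zero>\<^bsub>C m\<^esub>" using x Suc by simp
      ultimately show ?thesis using s0 N.r_zero[OF cl] by simp
    qed
    then show ?thesis using linear_mapD(1)[OF sl] x by blast
  qed
  show ?thesis
    unfolding homology_def
    using Z[OF C] Z[OF D] uZ[OF C D u] uZ[OF D C v]
    by (elim conjE, intro subquotient_iso[where u = "u n" and v = "v n"]
        chain_complexD(2)[OF C] chain_complexD(2)[OF D]) (assumption | rule hom[OF C s] hom[OF D t])+
qed

text \<open>Makes strict isomorphisms of complexes acceptable to \<open>homology_iso\<close>: their
  homotopies are zero.\<close>

lemma chain_homotopy_zero:
  assumes C: "chain_complex k C d" and f: "\<And>n x. x \<in> carrier (C n) \<Longrightarrow> f n x = x"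
  shows "chain_homotopy k C d C d f (\<lambda>n x. x) (\<lambda>n x. \<zero>\<^bsub>C (Suc n)\<^esub>)"
proof -
  note CD = chain_complexD[OF C]
  have ab: "abelian_group (C n)" for n using CD(2) by (simp add: left_module_def)
  have z: "d (Suc n) \<zero>\<^bsub>C (Suc n)\<^esub> = \<zero>\<^bsub>C n\<^esub>" for n by (rule linear_map_zero[OF CD(3) ab ab])
  show ?thesis
    unfolding chain_homotopy_def
    using z[of 0] z f abelian_group.r_neg[OF ab] abelian_groupE(2)[OF ab] abelian_groupE(5)[OF ab]
    by (intro conjI allI ballI linear_map_const_zero CD(2)) (simp_all add: a_minus_def)
qed

text \<open>Only \<open>D\<close> is assumed to be a complex. The conjugated differential on
  \<open>C\<close> squares to zero because the inner \<open>u v\<close> cancels, so a differential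
  obtained in this way needs no check by formulas.\<close>

lemma chain_complex_transport:
  assumes D: "chain_complex k D e" and C: "\<And>n. left_module k (C n)"
    and u: "\<And>n. linear_map k (C n) (D n) (u n)" and v: "\<And>n. linear_map k (D n) (C n) (v n)"
    and vu: "\<And>n x. x \<in> carrier (C n) \<Longrightarrow> v n (u n x) = x"
    and uv: "\<And>n y. y \<in> carrier (D n) \<Longrightarrow> u n (v n y) = y"
  shows "chain_complex k C (\<lambda>n x. v (n - 1) (e n (u n x)))"
    and "module_iso k (homology C (\<lambda>n x. v (n - 1) (e n (u n x))) n) (homology D e n)"
proof -
  note DD = chain_complexD[OF D]
  have ab: "abelian_group (C n)" "abelian_group (D n)" for n using C DD(2) by (simp_all add: left_module_def)
  show C': "chain_complex k C (\<lambda>n x. v (n - 1) (e n (u n x)))"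
  proof (rule chain_complexI[OF DD(1) C])
    show "linear_map k (C (Suc n)) (C n) (\<lambda>x. v (Suc n - 1) (e (Suc n) (u (Suc n) x)))" for n
      using linear_map_comp[OF linear_map_comp[OF u DD(3)] v] by simp
    show "v (Suc n - 1) (e (Suc n) (u (Suc n) (v (Suc (Suc n) - 1) (e (Suc (Suc n)) (u (Suc (Suc n)) x))))) = \<zero>\<^bsub>C n\<^esub>"
      if "x \<in> carrier (C (Suc (Suc n)))" for n x
      using DD(4)[OF linear_mapD(1)[OF u that]] linear_map_zero[OF v ab(2,1)]
        uv[OF linear_mapD(1)[OF DD(3) linear_mapD(1)[OF u that]]] by simp
  qed
  show "module_iso k (homology C (\<lambda>n x. v (n - 1) (e n (u n x))) n) (homology D e n)"
    by (rule homology_iso[OF C' D _ _ chain_homotopy_zero[OF C' vu] chain_homotopy_zero[OF D uv]])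
      (use u v vu uv linear_mapD(1)[OF DD(3)] linear_mapD(1)[OF u] linear_mapD(1)[OF v]
        in \<open>auto simp: chain_map_def\<close>)
qed

section \<open>Cochain complexes\<close>

lemma cochain_complexD:
  assumes "cochain_complex k C d"
  shows "cring k" "left_module k (C n)" "linear_map k (C n) (C (Suc n)) (d n)"
    "x \<in> carrier (C n) \<Longrightarrow> d (Suc n) (d n x) = \<zero>\<^bsub>C (Suc (Suc n))\<^esub>"
  using assms by (simp_all add: cochain_complex_def module_iff_left_module)

lemma cochain_complexI:
  assumes "cring k" "\<And>n. left_module k (C n)" "\<And>n. linear_map k (C n) (C (Suc n)) (d n)"
    "\<And>n x. x \<in> carrier (C n) \<Longrightarrow> d (Suc n) (d n x) = \<zero>\<^bsub>C (Suc (Suc n))\<^esub>"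
  shows "cochain_complex k C d"
  using assms by (simp add: cochain_complex_def module_iff_left_module)

text \<open>In place of cochain homotopies only their effect is assumed: on cocycles, the composites
  differ from the identity by coboundaries, which in degree 0 means not at all.\<close>

lemma cohomology_iso:
  assumes C: "cochain_complex k C d" and D: "cochain_complex k D e"
    and u: "\<And>n. linear_map k (C n) (D n) (u n)" "\<And>n x. x \<in> carrier (C n) \<Longrightarrow> e n (u n x) = u (Suc n) (d n x)"
    and v: "\<And>n. linear_map k (D n) (C n) (v n)" "\<And>n y. y \<in> carrier (D n) \<Longrightarrow> d n (v n y) = v (Suc n) (e n y)"
    and s: "\<And>n x. x \<in> carrier (C n) \<Longrightarrow> d n x = \<zero>\<^bsub>C (Suc n)\<^esub> \<Longrightarrow>
      v n (u n x) \<ominus>\<^bsub>C n\<^esub> x \<in> (if n = 0 then {\<zero>\<^bsub>C 0\<^esub>} else d (n - 1) ` carrier (C (n - 1)))"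
    and t: "\<And>n x. x \<in> carrier (D n) \<Longrightarrow> e n x = \<zero>\<^bsub>D (Suc n)\<^esub> \<Longrightarrow>
      u n (v n x) \<ominus>\<^bsub>D n\<^esub> x \<in> (if n = 0 then {\<zero>\<^bsub>D 0\<^esub>} else e (n - 1) ` carrier (D (n - 1)))"
  shows "module_iso k (cohomology C d n) (cohomology D e n)"
proof -
  have Z: "submodule {x \<in> carrier (C n). d n x = \<zero>\<^bsub>C (Suc n)\<^esub>} k (C n) \<and>
      submodule (if n = 0 then {\<zero>\<^bsub>C 0\<^esub>} else d (n - 1) ` carrier (C (n - 1))) k (C n) \<and>
      (if n = 0 then {\<zero>\<^bsub>C 0\<^esub>} else d (n - 1) ` carrier (C (n - 1))) \<subseteq>
        {x \<in> carrier (C n). d n x = \<zero>\<^bsub>C (Suc n)\<^esub>}"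
    if C: "cochain_complex k C d" for C :: "nat \<Rightarrow> ('a, 'z) module" and d
  proof -
    note CD = cochain_complexD[OF C]
    interpret left_module k "C n" by (rule CD)
    have ab: "abelian_group (C n)" for n using CD(2) by (simp add: left_module_def)
    have "submodule {\<zero>\<^bsub>C n\<^esub>} k (C n)" by (rule submoduleI') auto
    then have "submodule (if n = 0 then {\<zero>\<^bsub>C 0\<^esub>} else d (n - 1) ` carrier (C (n - 1))) k (C n)"
      using image_submodule[OF CD(2,2,3)] by (cases n) auto
    moreover have "(if n = 0 then {\<zero>\<^bsub>C 0\<^esub>} else d (n - 1) ` carrier (C (n - 1))) \<subseteq>
        {x \<in> carrier (C n). d n x = \<zero>\<^bsub>C (Suc n)\<^esub>}"
      using linear_mapD(1)[OF CD(3)] CD(4) linear_map_zero[OF CD(3) ab ab] N.zero_closed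
      by (cases n) auto
    ultimately show ?thesis using kernel_submodule[OF CD(2,2,3)] by blast
  qed
  have uZ: "u n ` {x \<in> carrier (C n). d n x = \<zero>\<^bsub>C (Suc n)\<^esub>} \<subseteq> {x \<in> carrier (D n). e n x = \<zero>\<^bsub>D (Suc n)\<^esub>} \<and>
      u n ` (if n = 0 then {\<zero>\<^bsub>C 0\<^esub>} else d (n - 1) ` carrier (C (n - 1))) \<subseteq>
        (if n = 0 then {\<zero>\<^bsub>D 0\<^esub>} else e (n - 1) ` carrier (D (n - 1)))"
    if C: "cochain_complex k C d" and D: "cochain_complex k D e" and ul: "\<And>n. linear_map k (C n) (D n) (u n)"
      and ue: "\<And>n x. x \<in> carrier (C n) \<Longrightarrow> e n (u n x) = u (Suc n) (d n x)"
    for C :: "nat \<Rightarrow> ('a, 'z) module" and d and D :: "nat \<Rightarrow> ('a, 'y) module" and e u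
  proof -
    have z: "u n \<zero>\<^bsub>C n\<^esub> = \<zero>\<^bsub>D n\<^esub>" for n
      using linear_map_zero[OF ul] cochain_complexD(2)[OF C] cochain_complexD(2)[OF D]
      by (simp add: left_module_def)
    have "u n (d (n - 1) x) \<in> e (n - 1) ` carrier (D (n - 1))" if "x \<in> carrier (C (n - 1))" "n \<noteq> 0" for x
      using ue[OF that(1)] linear_mapD(1)[OF ul that(1)] that(2)
      by (auto simp: gr0_conv_Suc intro!: image_eqI[of _ _ "u (n - 1) x"])
    then show ?thesis using linear_mapD(1)[OF ul] z ue by (auto split: if_splits)
  qed
  show ?thesis
    unfolding cohomology_def
    using Z[OF C] Z[OF D] uZ[OF C D u] uZ[OF D C v]
    by (elim conjE, intro subquotient_iso[where u = "u n" and v = "v n"] cochain_complexD(2)[OF C]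
        cochain_complexD(2)[OF D] u(1) v(1)) (assumption | rule s t | simp)+
qed

lemma cochain_complex_transport:
  assumes D: "cochain_complex k D e" and C: "\<And>n. left_module k (C n)"
    and u: "\<And>n. linear_map k (C n) (D n) (u n)" and v: "\<And>n. linear_map k (D n) (C n) (v n)"
    and vu: "\<And>n x. x \<in> carrier (C n) \<Longrightarrow> v n (u n x) = x"
    and uv: "\<And>n y. y \<in> carrier (D n) \<Longrightarrow> u n (v n y) = y"
  shows "cochain_complex k C (\<lambda>n x. v (Suc n) (e n (u n x)))"
    and "module_iso k (cohomology C (\<lambda>n x. v (Suc n) (e n (u n x))) n) (cohomology D e n)"
proof -
  note DD = cochain_complexD[OF D]
  have ab: "abelian_group (C n)" "abelian_group (D n)" for n using C DD(2) by (simp_all add: left_module_def)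
  show C': "cochain_complex k C (\<lambda>n x. v (Suc n) (e n (u n x)))"
  proof (rule cochain_complexI[OF DD(1) C])
    show "linear_map k (C n) (C (Suc n)) (\<lambda>x. v (Suc n) (e n (u n x)))" for n
      by (rule linear_map_comp[OF linear_map_comp[OF u DD(3)] v])
    show "v (Suc (Suc n)) (e (Suc n) (u (Suc n) (v (Suc n) (e n (u n x))))) = \<zero>\<^bsub>C (Suc (Suc n))\<^esub>"
      if "x \<in> carrier (C n)" for n x
      using DD(4)[OF linear_mapD(1)[OF u that]] linear_map_zero[OF v ab(2,1)]
        uv[OF linear_mapD(1)[OF DD(3) linear_mapD(1)[OF u that]]] by simp
  qed
  \<comment> \<open>For strict inverses all differences vanish, so zero has to be recognised as a
    coboundary in every degree.\<close>
  have mem: "\<zero>\<^bsub>N n\<^esub> \<in> (if n = 0 then {\<zero>\<^bsub>N 0\<^esub>} else f (n - 1) ` carrier (N (n - 1)))"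
    if "cochain_complex k N f" for N :: "nat \<Rightarrow> ('a, 'z) module" and f and n
  proof -
    note ND = cochain_complexD[OF that]
    have ab: "abelian_group (N n)" for n using ND(2) by (simp add: left_module_def)
    show ?thesis
      using linear_map_zero[OF ND(3) ab ab] abelian_groupE(2)[OF ab]
      by (cases n) (auto intro!: image_eqI[of _ _ "\<zero>\<^bsub>N (n - 1)\<^esub>"])
  qed
  show "module_iso k (cohomology C (\<lambda>n x. v (Suc n) (e n (u n x))) n) (cohomology D e n)"
    by (rule cohomology_iso[OF C' D u _ v])
      (use vu uv linear_mapD(1)[OF DD(3)] linear_mapD(1)[OF u] linear_mapD(1)[OF v]
        mem[OF D] mem[OF C'] abelian_group.r_neg[OF ab(1)] abelian_group.r_neg[OF ab(2)]
        in \<open>simp_all add: a_minus_def\<close>)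
qed

section \<open>Tor and Ext are independent of the resolution\<close>

text \<open>The map \<open>1 \<otimes> f\<close>, in the form in which \<open>Tor_via\<close> writes
  its differentials.\<close>

definition tmap ::
  "'k ring \<Rightarrow> ('k, 'r) module \<Rightarrow> ('r, 'x) module \<Rightarrow> ('r, 'q) module \<Rightarrow> ('p \<Rightarrow> 'q)
     \<Rightarrow> ('x \<times> 'p \<Rightarrow> 'k) set \<Rightarrow> ('x \<times> 'q \<Rightarrow> 'k) set"
  where "tmap k R X Q f = lin_ext k (tensor k R X Q) (\<lambda>(x, y). tensor_pure k R X Q x (f y))"

text \<open>Precomposition with \<open>f\<close>, cut off outside the carrier because the elements
  of \<open>hom_module\<close> are extensional.\<close>

definition hmap :: "('r, 'p) module \<Rightarrow> ('p \<Rightarrow> 'q) \<Rightarrow> ('q \<Rightarrow> 'x) \<Rightarrow> 'p \<Rightarrow> 'x"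
  where "hmap P f g = (\<lambda>y\<in>carrier P. g (f y))"

section \<open>Tensor products and homomorphisms applied to complexes\<close>

context base_algebra
begin

lemma tmap:
  assumes X: "left_module (opp R) X" and P: "left_module R P" and Q: "left_module R Q"
    and f: "linear_map R P Q f"
  shows tmap_linear: "linear_map k (tensor k R X P) (tensor k R X Q) (tmap k R X Q f)"
    and tmap_pure: "\<lbrakk>x \<in> carrier X; y \<in> carrier P\<rbrakk> \<Longrightarrow>
      tmap k R X Q f (tensor_pure k R X P x y) = tensor_pure k R X Q x (f y)"
proof -
  interpret P: tensor_data k R X P by (rule tensor_dataI) fact+
  interpret Q: tensor_data k R X Q by (rule tensor_dataI) fact+
  note fD = linear_mapD[OF f]
  have "bilinear k R X P Q.T (\<lambda>x y. Q.tpure x (f y))"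
    by (rule bilinearI) (simp_all add: fD Q.tensor_pure_closed Q.tensor_pure_add_left
        Q.tensor_pure_add_right Q.tensor_pure_scalar Q.tensor_pure_balanced scalar_closed)
  note l = P.tensor_lift[OF Q.tensor_left_module this]
  show "linear_map k P.T Q.T (tmap k R X Q f)" unfolding tmap_def by (rule l(1))
  show "tmap k R X Q f (P.tpure x y) = Q.tpure x (f y)" if "x \<in> carrier X" "y \<in> carrier P"
    unfolding tmap_def using that by (rule l(2))
qed

lemma tensor_chain_complex:
  assumes X: "left_module (opp R) X" and P: "aug_complex R Y P d \<epsilon>"
  shows "chain_complex k (\<lambda>n. tensor k R X (P n)) (\<lambda>n. tmap k R X (P (n - 1)) (d n))"
proof -
  have Pm: "left_module R (P n)" and d: "linear_map R (P (Suc n)) (P n) (d (Suc n))"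
    and dd: "x \<in> carrier (P (Suc (Suc n))) \<Longrightarrow> d (Suc n) (d (Suc (Suc n)) x) = \<zero>\<^bsub>P n\<^esub>" for n x
    using P by (simp_all add: aug_complex_def)
  have td: "tensor_data k R X (P n)" for n by (rule tensor_dataI[OF X Pm])
  note tm = tensor_data.tensor_left_module[OF td]
  note tl = tmap_linear[OF X Pm Pm d]
  show ?thesis
  proof (rule chain_complexI[OF k.is_cring tm])
    show "linear_map k (tensor k R X (P (Suc n))) (tensor k R X (P n)) (tmap k R X (P (Suc n - 1)) (d (Suc n)))" for n
      using tl by simp
    fix n z assume z: "z \<in> carrier (tensor k R X (P (Suc (Suc n))))"
    show "tmap k R X (P (Suc n - 1)) (d (Suc n)) (tmap k R X (P (Suc (Suc n) - 1)) (d (Suc (Suc n))) z) =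
        \<zero>\<^bsub>tensor k R X (P n)\<^esub>"
      using tensor_data.tensor_ext[OF td tm linear_map_comp[OF tl tl] linear_map_const_zero[OF tm] _ z]
      by (simp add: tmap_pure[OF X Pm Pm d] linear_mapD(1)[OF d] dd tensor_data.tensor_pure_zero[OF td])
  qed
qed

lemma tensor_chain_map:
  assumes X: "left_module (opp R) X" and P: "aug_complex R Y P d \<epsilon>" and Q: "aug_complex R Y' Q e \<epsilon>'"
    and f: "chain_map R P d Q e f"
  shows "chain_map k (\<lambda>n. tensor k R X (P n)) (\<lambda>n. tmap k R X (P (n - 1)) (d n))
    (\<lambda>n. tensor k R X (Q n)) (\<lambda>n. tmap k R X (Q (n - 1)) (e n)) (\<lambda>n. tmap k R X (Q n) (f n))"
proof -
  have Pm: "left_module R (P n)" and d: "linear_map R (P (Suc n)) (P n) (d (Suc n))" for n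
    using P by (simp_all add: aug_complex_def)
  have Qm: "left_module R (Q n)" and e: "linear_map R (Q (Suc n)) (Q n) (e (Suc n))" for n
    using Q by (simp_all add: aug_complex_def)
  have fl: "linear_map R (P n) (Q n) (f n)"
    and ef: "x \<in> carrier (P (Suc n)) \<Longrightarrow> e (Suc n) (f (Suc n) x) = f n (d (Suc n) x)" for n x
    using f by (simp_all add: chain_map_def)
  have tP: "tensor_data k R X (P n)" and tQ: "tensor_data k R X (Q n)" for n
    by (rule tensor_dataI[OF X Pm], rule tensor_dataI[OF X Qm])
  have "tmap k R X (Q n) (e (Suc n)) (tmap k R X (Q (Suc n)) (f (Suc n)) z) =
      tmap k R X (Q n) (f n) (tmap k R X (P n) (d (Suc n)) z)"
    if "z \<in> carrier (tensor k R X (P (Suc n)))" for n z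
    by (rule tensor_data.tensor_ext[OF tP tensor_data.tensor_left_module[OF tQ]
          linear_map_comp[OF tmap_linear[OF X Pm Qm fl] tmap_linear[OF X Qm Qm e]]
          linear_map_comp[OF tmap_linear[OF X Pm Pm d] tmap_linear[OF X Pm Qm fl]] _ that])
      (simp add: tmap_pure[OF X Pm Pm d] tmap_pure[OF X Qm Qm e] tmap_pure[OF X Pm Qm fl]
        linear_mapD(1)[OF d] linear_mapD(1)[OF fl] ef)
  then show ?thesis by (simp add: chain_map_def tmap_linear[OF X Pm Qm fl])
qed

lemma tensor_chain_homotopy:
  assumes X: "left_module (opp R) X" and P: "aug_complex R Y P d \<epsilon>" and Q: "aug_complex R Y' Q e \<epsilon>'"
    and f: "chain_map R P d Q e f" and g: "chain_map R Q e P d g"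
    and s: "chain_homotopy R P d P d (\<lambda>n x. g n (f n x)) (\<lambda>n x. x) s"
  shows "chain_homotopy k (\<lambda>n. tensor k R X (P n)) (\<lambda>n. tmap k R X (P (n - 1)) (d n))
    (\<lambda>n. tensor k R X (P n)) (\<lambda>n. tmap k R X (P (n - 1)) (d n))
    (\<lambda>n z. tmap k R X (P n) (g n) (tmap k R X (Q n) (f n) z)) (\<lambda>n z. z) (\<lambda>n. tmap k R X (P (Suc n)) (s n))"
proof -
  have Pm: "left_module R (P n)" and d: "linear_map R (P (Suc n)) (P n) (d (Suc n))" for n
    using P by (simp_all add: aug_complex_def)
  have Qm: "left_module R (Q n)" for n using Q by (simp add: aug_complex_def)
  have fl: "linear_map R (P n) (Q n) (f n)" and gl: "linear_map R (Q n) (P n) (g n)" for n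
    using f g by (simp_all add: chain_map_def)
  have sl: "linear_map R (P n) (P (Suc n)) (s n)"
    and s0: "x \<in> carrier (P 0) \<Longrightarrow> d (Suc 0) (s 0 x) = g 0 (f 0 x) \<ominus>\<^bsub>P 0\<^esub> x"
    and sS: "x \<in> carrier (P (Suc n)) \<Longrightarrow> d (Suc (Suc n)) (s (Suc n) x) \<oplus>\<^bsub>P (Suc n)\<^esub> s n (d (Suc n) x) =
      g (Suc n) (f (Suc n) x) \<ominus>\<^bsub>P (Suc n)\<^esub> x" for n x
    using s by (simp_all add: chain_homotopy_def)
  have tP: "tensor_data k R X (P n)" for n by (rule tensor_dataI[OF X Pm])
  note tm = tensor_data.tensor_left_module[OF tP]
  note tdl = tmap_linear[OF X Pm Pm d] and tsl = tmap_linear[OF X Pm Pm sl]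
  note gfl = linear_map_comp[OF tmap_linear[OF X Pm Qm fl] tmap_linear[OF X Qm Pm gl]]
  note pure = tmap_pure[OF X Pm Pm d] tmap_pure[OF X Pm Pm sl] tmap_pure[OF X Pm Qm fl] tmap_pure[OF X Qm Pm gl]
    linear_mapD(1)[OF d] linear_mapD(1)[OF sl] linear_mapD(1)[OF fl] linear_mapD(1)[OF gl]
  \<comment> \<open>Linearity of a pure tensor in its second factor is known over
    \<open>kmod R (P n)\<close>, the homotopy identity speaks of \<open>P n\<close>; the two records
    have the same negation.\<close>
  have diff: "tensor_pure k R X (P n) x (y \<ominus>\<^bsub>P n\<^esub> z) =
      tensor_pure k R X (P n) x y \<ominus>\<^bsub>tensor k R X (P n)\<^esub> tensor_pure k R X (P n) x z"
    if "x \<in> carrier X" "y \<in> carrier (P n)" "z \<in> carrier (P n)" for n x y z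
  proof -
    interpret T: tensor_data k R X "P n" by (rule tP)
    interpret kP: left_module k "kmod R (P n)" by (rule kmod_left_module[OF Pm])
    have "\<ominus>\<^bsub>kmod R (P n)\<^esub> z = \<ominus>\<^bsub>P n\<^esub> z"
      using kP.N.minus_equality[of "\<ominus>\<^bsub>P n\<^esub> z" z] that T.N.N.l_neg by simp
    then show ?thesis
      using linear_map_diff[OF T.tensor_pure_right_linear[OF that(1)] _ T.T.N.abelian_group_axioms, of y z] that
        kmod_left_module[OF Pm] by (simp add: left_module_def a_minus_def)
  qed
  have h0: "tmap k R X (P 0) (d (Suc 0)) (tmap k R X (P (Suc 0)) (s 0) z) =
      tmap k R X (P 0) (g 0) (tmap k R X (Q 0) (f 0) z) \<ominus>\<^bsub>tensor k R X (P 0)\<^esub> z"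
    if "z \<in> carrier (tensor k R X (P 0))" for z
    by (rule tensor_data.tensor_ext[OF tP tm linear_map_comp[OF tsl tdl] linear_map_sub[OF tm gfl linear_map_id] _ that])
      (simp add: pure s0 diff)
  have hS: "tmap k R X (P (Suc n)) (d (Suc (Suc n))) (tmap k R X (P (Suc (Suc n))) (s (Suc n)) z)
      \<oplus>\<^bsub>tensor k R X (P (Suc n))\<^esub> tmap k R X (P (Suc n)) (s n) (tmap k R X (P n) (d (Suc n)) z) =
      tmap k R X (P (Suc n)) (g (Suc n)) (tmap k R X (Q (Suc n)) (f (Suc n)) z) \<ominus>\<^bsub>tensor k R X (P (Suc n))\<^esub> z"
    if "z \<in> carrier (tensor k R X (P (Suc n)))" for n z
    by (rule tensor_data.tensor_ext[OF tP tm linear_map_add[OF tm linear_map_comp[OF tsl tdl] linear_map_comp[OF tdl tsl]]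
          linear_map_sub[OF tm gfl linear_map_id] _ that])
      (simp add: pure sS diff flip: tensor_data.tensor_pure_add_right[OF tP])
  show ?thesis using h0 hS tsl by (simp add: chain_homotopy_def)
qed

lemma Tor_iso_chain_equivalence:
  assumes X: "left_module (opp R) X" and P: "aug_complex R Y P d \<epsilon>" and Q: "aug_complex R Y' Q e \<epsilon>'"
    and f: "chain_map R P d Q e f" and g: "chain_map R Q e P d g"
    and s: "chain_homotopy R P d P d (\<lambda>n x. g n (f n x)) (\<lambda>n x. x) s"
    and t: "chain_homotopy R Q e Q e (\<lambda>n x. f n (g n x)) (\<lambda>n x. x) t"
  shows "module_iso k (Tor_via k R X P d n) (Tor_via k R X Q e n)"
  unfolding Tor_via_def tmap_def[symmetric]
  by (rule homology_iso[OF tensor_chain_complex[OF X P] tensor_chain_complex[OF X Q]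
        tensor_chain_map[OF X P Q f] tensor_chain_map[OF X Q P g]
        tensor_chain_homotopy[OF X P Q f g s] tensor_chain_homotopy[OF X Q P g f t]])

lemma hom_module_simps [simp]:
  "f \<in> carrier (hom_module R N N') \<longleftrightarrow> f \<in> extensional (carrier N) \<and> linear_map R N N' f"
  "\<zero>\<^bsub>hom_module R N N'\<^esub> = (\<lambda>x\<in>carrier N. \<zero>\<^bsub>N'\<^esub>)"
  "f \<oplus>\<^bsub>hom_module R N N'\<^esub> g = (\<lambda>x\<in>carrier N. f x \<oplus>\<^bsub>N'\<^esub> g x)"
  "c \<odot>\<^bsub>hom_module R N N'\<^esub> f = (\<lambda>x\<in>carrier N. (c \<odot>\<^bsub>R\<^esub> \<one>\<^bsub>R\<^esub>) \<odot>\<^bsub>N'\<^esub> f x)"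
  by (simp_all add: hom_module_def)

lemma hom_left_module:
  assumes N: "left_module R N" and X: "left_module R X"
  shows "left_module k (hom_module R N X)"
proof -
  interpret N: left_module R N by fact
  interpret X: left_module R X by fact
  interpret kX: left_module k "kmod R X" by (rule kmod_left_module) fact
  have res: "linear_map R N X (\<lambda>x\<in>carrier N. f x)" if "linear_map R N X f" for f
    by (rule linear_map_cong[OF that N]) simp
  have scal: "linear_map R X X (\<lambda>x. (c \<odot>\<^bsub>R\<^esub> \<one>\<^bsub>R\<^esub>) \<odot>\<^bsub>X\<^esub> x)" if "c \<in> carrier k" for c
    using that by (intro linear_mapI)
      (simp_all add: X.smult_closed scalar_closed X.smult_r_distr scalar_central flip: X.smult_assoc)
  have cl: "f x \<in> carrier X" if "linear_map R N X f" "x \<in> carrier N" for f x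
    using that by (rule linear_mapD(1))
  show ?thesis
  proof (rule left_moduleI[OF k.ring_axioms])
    show "abelian_group (hom_module R N X)"
    proof (rule abelian_groupI)
      fix f assume f: "f \<in> carrier (hom_module R N X)"
      then have "(\<lambda>x\<in>carrier N. \<ominus>\<^bsub>X\<^esub> f x) \<in> carrier (hom_module R N X)"
        using res[OF linear_map_uminus[OF X, of N f]] by simp
      moreover have "(\<lambda>x\<in>carrier N. \<ominus>\<^bsub>X\<^esub> f x) \<oplus>\<^bsub>hom_module R N X\<^esub> f = \<zero>\<^bsub>hom_module R N X\<^esub>"
        using f cl by (auto simp: X.N.l_neg intro!: restrict_ext)
      ultimately show "\<exists>g\<in>carrier (hom_module R N X). g \<oplus>\<^bsub>hom_module R N X\<^esub> f = \<zero>\<^bsub>hom_module R N X\<^esub>"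
        by blast
    qed (auto simp: linear_map_add[OF X] linear_map_const_zero[OF X] res cl X.N.a_ac
        intro!: restrict_ext extensionalityI[where A = "carrier N"])
  qed (auto simp: res linear_map_comp[OF _ scal] cl kX.smult_l_distr[simplified] kX.smult_r_distr[simplified]
      kX.smult_assoc[simplified] kX.smult_one[simplified]
      intro!: restrict_ext extensionalityI[where A = "carrier N"])
qed

lemma hmap_linear:
  assumes P: "left_module R P" and Q: "left_module R Q" and X: "left_module R X" and f: "linear_map R P Q f"
  shows "linear_map k (hom_module R Q X) (hom_module R P X) (hmap P f)"
proof (rule linear_mapI)
  interpret X: left_module R X by fact
  show "hmap P f g \<in> carrier (hom_module R P X)" if "g \<in> carrier (hom_module R Q X)" for g
    using that linear_map_cong[OF linear_map_comp[OF f, of X g] P] by (simp add: hmap_def)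
qed (use linear_mapD(1)[OF f] in \<open>auto simp: hmap_def intro!: restrict_ext\<close>)

lemma hom_cochain_complex:
  assumes X: "left_module R X" and P: "aug_complex R Y P d \<epsilon>"
  shows "cochain_complex k (\<lambda>n. hom_module R (P n) X) (\<lambda>n. hmap (P (Suc n)) (d (Suc n)))"
proof -
  have Pm: "left_module R (P n)" and d: "linear_map R (P (Suc n)) (P n) (d (Suc n))"
    and dd: "x \<in> carrier (P (Suc (Suc n))) \<Longrightarrow> d (Suc n) (d (Suc (Suc n)) x) = \<zero>\<^bsub>P n\<^esub>" for n x
    using P by (simp_all add: aug_complex_def)
  show ?thesis
  proof (rule cochain_complexI)
    show "cring k" by (rule k.is_cring)
    show "left_module k (hom_module R (P n) X)" for n by (rule hom_left_module[OF Pm X])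
    show "linear_map k (hom_module R (P n) X) (hom_module R (P (Suc n)) X) (hmap (P (Suc n)) (d (Suc n)))" for n
      by (rule hmap_linear[OF Pm Pm X d])
    fix n g assume g: "g \<in> carrier (hom_module R (P n) X)"
    then have "g \<zero>\<^bsub>P n\<^esub> = \<zero>\<^bsub>X\<^esub>"
      using linear_map_zero[of R "P n" X g] Pm X by (simp add: left_module_def)
    then show "hmap (P (Suc (Suc n))) (d (Suc (Suc n))) (hmap (P (Suc n)) (d (Suc n)) g) =
        \<zero>\<^bsub>hom_module R (P (Suc (Suc n))) X\<^esub>"
      using linear_mapD(1)[OF d] dd by (auto simp: hmap_def intro!: restrict_ext)
  qed
qed

text \<open>For a cocycle \<open>\<phi> d = 0\<close>, hence
  \<open>\<phi> (g f - 1) = \<phi> (d s + s d) = \<phi> s d\<close>, the coboundary of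
  \<open>\<phi> s\<close>. In degree 0 the term \<open>s d\<close> is absent and the difference is
  zero.\<close>

lemma hom_homotopy:
  assumes X: "left_module R X" and P: "aug_complex R Y P d \<epsilon>" and Q: "aug_complex R Y' Q e \<epsilon>'"
    and f: "chain_map R P d Q e f" and g: "chain_map R Q e P d g"
    and s: "chain_homotopy R P d P d (\<lambda>n x. g n (f n x)) (\<lambda>n x. x) s"
    and \<phi>: "\<phi> \<in> carrier (hom_module R (P n) X)" "hmap (P (Suc n)) (d (Suc n)) \<phi> = \<zero>\<^bsub>hom_module R (P (Suc n)) X\<^esub>"
  shows "hmap (P n) (f n) (hmap (Q n) (g n) \<phi>) \<ominus>\<^bsub>hom_module R (P n) X\<^esub> \<phi> \<in>
    (if n = 0 then {\<zero>\<^bsub>hom_module R (P 0) X\<^esub>} else hmap (P (Suc (n - 1))) (d (Suc (n - 1))) ` carrier (hom_module R (P (n - 1)) X))"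
proof -
  have Pm: "left_module R (P n)" and d: "linear_map R (P (Suc n)) (P n) (d (Suc n))" for n
    using P by (simp_all add: aug_complex_def)
  have fl: "linear_map R (P n) (Q n) (f n)" and gl: "linear_map R (Q n) (P n) (g n)" for n
    using f g by (simp_all add: chain_map_def)
  have sl: "linear_map R (P n) (P (Suc n)) (s n)"
    and s0: "x \<in> carrier (P 0) \<Longrightarrow> d (Suc 0) (s 0 x) = g 0 (f 0 x) \<ominus>\<^bsub>P 0\<^esub> x"
    and sS: "x \<in> carrier (P (Suc n)) \<Longrightarrow> d (Suc (Suc n)) (s (Suc n) x) \<oplus>\<^bsub>P (Suc n)\<^esub> s n (d (Suc n) x) =
      g (Suc n) (f (Suc n) x) \<ominus>\<^bsub>P (Suc n)\<^esub> x" for n x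
    using s by (simp_all add: chain_homotopy_def)
  interpret X: left_module R X by fact
  have \<phi>l: "linear_map R (P n) X \<phi>" using \<phi> by simp
  have ab: "abelian_group (P n)" for n using Pm by (simp add: left_module_def)
  interpret H: left_module k "hom_module R (P n) X" by (rule hom_left_module[OF Pm X])
  let ?\<psi> = "hmap (P n) (f n) (hmap (Q n) (g n) \<phi>)"
  have Qm: "left_module R (Q n)" for n using Q by (simp add: aug_complex_def)
  have \<psi>: "?\<psi> \<in> carrier (hom_module R (P n) X)"
    using linear_mapD(1)[OF hmap_linear[OF Pm Qm X fl]] linear_mapD(1)[OF hmap_linear[OF Qm Pm X gl]] \<phi>(1) by blast
  have eq0: "\<phi> (d (Suc n) y) = \<zero>\<^bsub>X\<^esub>" if "y \<in> carrier (P (Suc n))" for y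
    using fun_cong[OF \<phi>(2), of y] that by (simp add: hmap_def)
  have \<psi>\<phi>: "?\<psi> x = \<phi> (g n (f n x) \<ominus>\<^bsub>P n\<^esub> x) \<oplus>\<^bsub>X\<^esub> \<phi> x" if x: "x \<in> carrier (P n)" for x
    using x linear_map_diff[OF \<phi>l ab X.N.abelian_group_axioms, of "g n (f n x)" x]
      linear_mapD(1)[OF fl x] linear_mapD(1)[OF gl linear_mapD(1)[OF fl x]]
      linear_mapD(1)[OF \<phi>l]
    by (simp add: hmap_def a_minus_def X.N.a_assoc X.N.l_neg)
  \<comment> \<open>Turns a pointwise identity on \<open>P n\<close> into an equality of extensional
    functions.\<close>
  have key: "?\<psi> \<ominus>\<^bsub>hom_module R (P n) X\<^esub> \<phi> = \<chi>"
    if \<chi>: "\<chi> \<in> carrier (hom_module R (P n) X)"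
      and "\<And>x. x \<in> carrier (P n) \<Longrightarrow> \<phi> (g n (f n x) \<ominus>\<^bsub>P n\<^esub> x) = \<chi> x" for \<chi>
  proof -
    have "?\<psi> = \<chi> \<oplus>\<^bsub>hom_module R (P n) X\<^esub> \<phi>"
      using that \<psi> \<psi>\<phi> by (intro extensionalityI[where A = "carrier (P n)"]) auto
    then show ?thesis using \<phi>(1) \<chi> by (simp add: a_minus_def H.N.a_assoc H.N.r_neg del: hom_module_simps)
  qed
  show ?thesis
  proof (cases n)
    case 0
    have "?\<psi> \<ominus>\<^bsub>hom_module R (P n) X\<^esub> \<phi> = \<zero>\<^bsub>hom_module R (P n) X\<^esub>"
      using s0 eq0 linear_mapD(1)[OF sl, of _ 0] 0 by (intro key H.N.zero_closed) (simp flip: s0)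
    then show ?thesis using 0 by simp
  next
    case (Suc m)
    have "?\<psi> \<ominus>\<^bsub>hom_module R (P n) X\<^esub> \<phi> = hmap (P (Suc m)) (d (Suc m)) (hmap (P m) (s m) \<phi>)"
    proof (rule key)
      have "hmap (P m) (s m) \<phi> \<in> carrier (hom_module R (P m) X)"
        using linear_mapD(1)[OF hmap_linear[OF Pm Pm X sl]] \<phi>(1) Suc by blast
      then show "hmap (P (Suc m)) (d (Suc m)) (hmap (P m) (s m) \<phi>) \<in> carrier (hom_module R (P n) X)"
        using linear_mapD(1)[OF hmap_linear[OF Pm Pm X d]] Suc by blast
      fix x assume x: "x \<in> carrier (P n)"
      have c: "s n x \<in> carrier (P (Suc n))" "d (Suc m) x \<in> carrier (P m)"
        "s m (d (Suc m) x) \<in> carrier (P n)" "d (Suc n) (s n x) \<in> carrier (P n)"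
        using x Suc linear_mapD(1)[OF sl] linear_mapD(1)[OF d] by metis+
      show "\<phi> (g n (f n x) \<ominus>\<^bsub>P n\<^esub> x) = hmap (P (Suc m)) (d (Suc m)) (hmap (P m) (s m) \<phi>) x"
        using sS[of x m, symmetric] x Suc c linear_mapD(2)[OF \<phi>l c(4,3)] eq0[OF c(1)] linear_mapD(1)[OF \<phi>l c(3)]
        by (simp add: hmap_def)
    qed
    moreover have "hmap (P m) (s m) \<phi> \<in> carrier (hom_module R (P m) X)"
      using linear_mapD(1)[OF hmap_linear[OF Pm Pm X sl]] \<phi>(1) Suc by blast
    ultimately show ?thesis using Suc by (simp del: hom_module_simps)
  qed
qed

lemma Ext_iso_chain_equivalence:
  assumes X: "left_module R X" and P: "aug_complex R Y P d \<epsilon>" and Q: "aug_complex R Y' Q e \<epsilon>'"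
    and f: "chain_map R P d Q e f" and g: "chain_map R Q e P d g"
    and s: "chain_homotopy R P d P d (\<lambda>n x. g n (f n x)) (\<lambda>n x. x) s"
    and t: "chain_homotopy R Q e Q e (\<lambda>n x. f n (g n x)) (\<lambda>n x. x) t"
  shows "module_iso k (Ext_via R P d X n) (Ext_via R Q e X n)"
proof -
  have Pm: "left_module R (P n)" and Qm: "left_module R (Q n)"
    and d: "linear_map R (P (Suc n)) (P n) (d (Suc n))" and e: "linear_map R (Q (Suc n)) (Q n) (e (Suc n))"
    and fl: "linear_map R (P n) (Q n) (f n)" and gl: "linear_map R (Q n) (P n) (g n)"
    and ef: "x \<in> carrier (P (Suc n)) \<Longrightarrow> e (Suc n) (f (Suc n) x) = f n (d (Suc n) x)"
    and dg: "y \<in> carrier (Q (Suc n)) \<Longrightarrow> d (Suc n) (g (Suc n) y) = g n (e (Suc n) y)" for n x y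
    using P Q f g by (simp_all add: aug_complex_def chain_map_def)
  \<comment> \<open>Precomposition reverses arrows: the map from \<open>Hom(P, X)\<close> to
    \<open>Hom(Q, X)\<close> is induced by \<open>g\<close>, and the one back by
    \<open>f\<close>.\<close>
  show ?thesis
    unfolding Ext_via_def hmap_def[symmetric]
    by (rule cohomology_iso[where u = "\<lambda>n. hmap (Q n) (g n)" and v = "\<lambda>n. hmap (P n) (f n)",
          OF hom_cochain_complex[OF X P] hom_cochain_complex[OF X Q]
            hmap_linear[OF Qm Pm X gl] _ hmap_linear[OF Pm Qm X fl] _
            hom_homotopy[OF X P Q f g s] hom_homotopy[OF X Q P g f t]])
      (assumption | (unfold hmap_def; auto simp: ef dg linear_mapD(1)[OF d] linear_mapD(1)[OF e]
        linear_mapD(1)[OF fl] linear_mapD(1)[OF gl] intro!: restrict_ext))+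
qed

end

section \<open>Independence of the resolution\<close>

context rel_ext
begin

text \<open>The composites \<open>g f\<close> and \<open>f g\<close> and the two identities all lie
  over the identity of \<open>Y\<close>, so comparison maps being unique up to homotopy yields both
  homotopies.\<close>

lemma resolutions_equivalent:
  assumes P: "rel_projective_resolution k R S \<iota> Y P d \<epsilon>" and Q: "rel_projective_resolution k R S \<iota> Y Q e \<epsilon>'"
    and Y: "left_module R Y"
  obtains f g s t where "chain_map R P d Q e f" "chain_map R Q e P d g"
    "chain_homotopy R P d P d (\<lambda>n x. g n (f n x)) (\<lambda>n x. x) s"
    "chain_homotopy R Q e Q e (\<lambda>n x. f n (g n x)) (\<lambda>n x. x) t"
proof -
  have pP: "rel_projective k R S \<iota> (P n)" and pQ: "rel_projective k R S \<iota> (Q n)" for n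
    using P Q by (simp_all add: rel_projective_resolution_def)
  note aP = resolution_aug_complex[OF P Y] and aQ = resolution_aug_complex[OF Q Y]
  obtain f where f: "chain_map R P d Q e f" "\<And>x. x \<in> carrier (P 0) \<Longrightarrow> \<epsilon>' (f 0 x) = \<epsilon> x"
    using comparison_map[OF pP aP Q Y] by blast
  obtain g where g: "chain_map R Q e P d g" "\<And>x. x \<in> carrier (Q 0) \<Longrightarrow> \<epsilon> (g 0 x) = \<epsilon>' x"
    using comparison_map[OF pQ aQ P Y] by blast
  have comp: "chain_map R P d P d (\<lambda>n x. g n (f n x))"
    if f: "chain_map R P d Q e f" and g: "chain_map R Q e P d g"
    for P :: "nat \<Rightarrow> (_, 'x) module" and d and Q :: "nat \<Rightarrow> (_, 'y) module" and e f g
  proof -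
    have fl: "linear_map R (P n) (Q n) (f n)" and gl: "linear_map R (Q n) (P n) (g n)" for n
      using f g by (simp_all add: chain_map_def)
    have "d (Suc n) (g (Suc n) (f (Suc n) x)) = g n (f n (d (Suc n) x))" if "x \<in> carrier (P (Suc n))" for n x
      using f g linear_mapD(1)[OF fl that] that by (simp add: chain_map_def)
    then show ?thesis unfolding chain_map_def using linear_map_comp[OF fl gl] by blast
  qed
  have id: "chain_map R P d P d (\<lambda>n x. x)" for P :: "nat \<Rightarrow> (_, 'x) module" and d
    by (simp add: chain_map_def linear_map_id)
  have f0: "f 0 x \<in> carrier (Q 0)" if "x \<in> carrier (P 0)" for x
    using f(1) that linear_mapD(1) unfolding chain_map_def by metis
  have g0: "g 0 x \<in> carrier (P 0)" if "x \<in> carrier (Q 0)" for x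
    using g(1) that linear_mapD(1) unfolding chain_map_def by metis
  obtain s where "chain_homotopy R P d P d (\<lambda>n x. g n (f n x)) (\<lambda>n x. x) s"
    using comparison_homotopy[OF pP aP P Y comp[OF f(1) g(1)] _ id] f(2) g(2) f0 by auto
  moreover obtain t where "chain_homotopy R Q e Q e (\<lambda>n x. f n (g n x)) (\<lambda>n x. x) t"
    using comparison_homotopy[OF pQ aQ Q Y comp[OF g(1) f(1)] _ id] f(2) g(2) g0 by auto
  ultimately show ?thesis using that f(1) g(1) by blast
qed

theorem Tor_independent:
  assumes P: "rel_projective_resolution k R S \<iota> Y P d \<epsilon>" and Q: "rel_projective_resolution k R S \<iota> Y Q e \<epsilon>'"
    and Y: "left_module R Y" and X: "left_module (opp R) X"
  shows "module_iso k (Tor_via k R X P d n) (Tor_via k R X Q e n)"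
  by (rule resolutions_equivalent[OF P Q Y])
    (rule R.Tor_iso_chain_equivalence[OF X resolution_aug_complex[OF P Y] resolution_aug_complex[OF Q Y]])

theorem Ext_independent:
  assumes P: "rel_projective_resolution k R S \<iota> Y P d \<epsilon>" and Q: "rel_projective_resolution k R S \<iota> Y Q e \<epsilon>'"
    and Y: "left_module R Y" and X: "left_module R X"
  shows "module_iso k (Ext_via R P d X n) (Ext_via R Q e X n)"
  by (rule resolutions_equivalent[OF P Q Y])
    (rule R.Ext_iso_chain_equivalence[OF X resolution_aug_complex[OF P Y] resolution_aug_complex[OF Q Y]])

end

section \<open>Base change along induced modules\<close>

lemma linear_map_inverse:
  assumes "linear_map R N N' f" "left_module R N"
    and g: "\<And>y. y \<in> carrier N' \<Longrightarrow> g y \<in> carrier N \<and> f (g y) = y"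
    and gf: "\<And>x. x \<in> carrier N \<Longrightarrow> g (f x) = x"
  shows "linear_map R N' N g"
proof -
  interpret left_module R N by fact
  note D = linear_mapD[OF assms(1)]
  show ?thesis
  proof (rule linear_mapI)
    fix x y assume "x \<in> carrier N'" "y \<in> carrier N'"
    then show "g (x \<oplus>\<^bsub>N'\<^esub> y) = g x \<oplus>\<^bsub>N\<^esub> g y"
      using gf[of "g x \<oplus>\<^bsub>N\<^esub> g y"] g by (simp add: D)
  next
    fix r y assume "r \<in> carrier R" "y \<in> carrier N'"
    then show "g (r \<odot>\<^bsub>N'\<^esub> y) = r \<odot>\<^bsub>N\<^esub> g y"
      using gf[of "r \<odot>\<^bsub>N\<^esub> g y"] g by (simp add: D smult_closed)
  qed (use g in blast)
qed

text \<open>The module \<open>P\<close> is induced only up to the isomorphism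
  \<open>\<theta>\<close>. Base change is stated in this generality because the bar bimodules
  consist of words and are not literally of the form \<open>R \<otimes> N\<close>.\<close>

locale induced_iso = induced k R S \<iota> N
  for k :: "'k ring" and R :: "('k, 'r) module" and S :: "('k, 's) module" and \<iota> :: "'s \<Rightarrow> 'r"
    and N :: "('s, 'n) module" +
  fixes P :: "('r, 'p) module" and \<theta> :: "('r \<times> 'n \<Rightarrow> 'k) set \<Rightarrow> 'p"
  assumes P: "left_module R P" and \<theta>: "linear_map R IM P \<theta>"
    and \<theta>_bij: "bij_betw \<theta> (carrier IM) (carrier P)"
begin

sublocale P: left_module R P by (rule P)

definition unit where "unit y = \<theta> (ipure \<one>\<^bsub>R\<^esub> y)"
definition \<theta>' where "\<theta>' = inv_into (carrier IM) \<theta>"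

lemma \<theta>': "p \<in> carrier P \<Longrightarrow> \<theta>' p \<in> carrier IT.T" "p \<in> carrier P \<Longrightarrow> \<theta> (\<theta>' p) = p"
  "w \<in> carrier IT.T \<Longrightarrow> \<theta>' (\<theta> w) = w"
  using \<theta>_bij unfolding \<theta>'_def bij_betw_def by (auto simp: inv_into_into f_inv_into_f)

lemma \<theta>'_linear: "linear_map R P IM \<theta>'"
  unfolding \<theta>'_def by (rule linear_map_inv_into[OF \<theta> IM_left_module \<theta>_bij])

lemma unit_closed: "y \<in> carrier N \<Longrightarrow> unit y \<in> carrier P"
  using linear_mapD(1)[OF \<theta>] by (simp add: unit_def ipure_closed)

lemma \<theta>_ipure: "\<lbrakk>r \<in> carrier R; y \<in> carrier N\<rbrakk> \<Longrightarrow> \<theta> (ipure r y) = r \<odot>\<^bsub>P\<^esub> unit y"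
  using linear_mapD(3)[OF \<theta>, of r "ipure \<one>\<^bsub>R\<^esub> y"] by (simp add: unit_def ipure_closed IM_action_pure)

lemma unit_linear: "linear_map S N (restrict_scalars \<iota> P) unit"
  unfolding unit_def by (rule linear_map_comp[OF ipure_one_linear restrict_linear[OF \<theta>]])

text \<open>On the left the scalar multiplies \<open>R\<close>; in the tensor product over
  \<open>S\<close> it enters through \<open>N\<close>. As \<open>c \<odot> \<one>\<close> is central
  in \<open>R\<close> and comes from \<open>S\<close>, it can be moved from one place to the
  other.\<close>

lemma IM_scalar:
  assumes c: "c \<in> carrier k" and "w \<in> carrier IT.T"
  shows "(c \<odot>\<^bsub>R\<^esub> \<one>\<^bsub>R\<^esub>) \<odot>\<^bsub>IM\<^esub> w = c \<odot>\<^bsub>IT.T\<^esub> w"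
  using assms(2)
proof (induction rule: IT.tensor_induct)
  case (pure r y)
  have "ipure (r \<otimes>\<^bsub>R\<^esub> \<iota> (c \<odot>\<^bsub>S\<^esub> \<one>\<^bsub>S\<^esub>)) y = c \<odot>\<^bsub>IT.T\<^esub> ipure r y"
    using IT.tensor_pure_balanced[of "c \<odot>\<^bsub>S\<^esub> \<one>\<^bsub>S\<^esub>" r y] pure c IT.tensor_pure_scalar[of c r y]
    by (simp add: S.scalar_closed)
  then show ?case
    using pure c by (simp add: IM_action_pure R.scalar_closed R.scalar_central \<iota>_scalar)
next
  case (add C D)
  then show ?case
    using c IM.smult_r_distr[of "c \<odot>\<^bsub>R\<^esub> \<one>\<^bsub>R\<^esub>" C D] by (simp add: R.scalar_closed IT.T.smult_r_distr)
qed

end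

text \<open>Base change \<open>X \<otimes> N\<close>, over \<open>S\<close>, to
  \<open>X \<otimes> P\<close>, over \<open>R\<close>. The module \<open>X'\<close> is
  \<open>X\<close> with restricted scalars, but agreement is required on carriers only, because the
  two enveloping algebras act through separately defined linear extensions.\<close>

locale tensor_base_change = induced_iso k R S \<iota> N P \<theta>
  for k :: "'k ring" and R :: "('k, 'r) module" and S :: "('k, 's) module" and \<iota> :: "'s \<Rightarrow> 'r"
    and N :: "('s, 'n) module" and P :: "('r, 'p) module" and \<theta> +
  fixes X :: "('r, 'x) module" and X' :: "('s, 'x) module"
  assumes X: "left_module (opp R) X" and X': "left_module (opp S) X'"
    and X'_eq: "carrier X' = carrier X" "add X' = add X"
      "\<And>s x. \<lbrakk>s \<in> carrier S; x \<in> carrier X\<rbrakk> \<Longrightarrow> s \<odot>\<^bsub>X'\<^esub> x = \<iota> s \<odot>\<^bsub>X\<^esub> x"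
begin

sublocale XN: tensor_data k S X' N by (rule S.tensor_dataI[OF X' SN])
sublocale XP: tensor_data k R X P by (rule R.tensor_dataI[OF X P])

text \<open>The map \<open>x \<otimes> y \<mapsto> x \<otimes> (1 \<otimes> y)\<close>. Its inverse
  is built in two stages, since an element of \<open>P\<close> has no preferred expression by
  generators: \<open>\<chi> x\<close> sends \<open>r \<otimes> y\<close> to
  \<open>x r \<otimes> y\<close>, and \<open>\<Psi>\<close> applies it after undoing
  \<open>\<theta>\<close>.\<close>

definition \<Phi> where "\<Phi> = lin_ext k XP.T (\<lambda>(x, y). XP.tpure x (unit y))"
definition \<chi> where "\<chi> x = lin_ext k XN.T (\<lambda>(r, y). XN.tpure (r \<odot>\<^bsub>X\<^esub> x) y)"
definition \<Psi> where "\<Psi> = lin_ext k XN.T (\<lambda>(x, p). \<chi> x (\<theta>' p))"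

lemma X_assoc: "\<lbrakk>r \<in> carrier R; s \<in> carrier R; x \<in> carrier X\<rbrakk> \<Longrightarrow> (r \<otimes>\<^bsub>R\<^esub> s) \<odot>\<^bsub>X\<^esub> x = s \<odot>\<^bsub>X\<^esub> (r \<odot>\<^bsub>X\<^esub> x)"
  using left_module.smult_assoc[OF X, of s r x] by simp

lemmas X_distr = left_module.smult_l_distr[OF X, simplified] left_module.smult_r_distr[OF X, simplified]
  and X_one = left_module.smult_one[OF X, simplified]

lemma XN_pure_closed: "\<lbrakk>x \<in> carrier X; y \<in> carrier N\<rbrakk> \<Longrightarrow> XN.tpure x y \<in> carrier XN.T"
  using XN.tensor_pure_closed by (simp add: X'_eq)

lemma XN_pure_add: "\<lbrakk>x \<in> carrier X; x' \<in> carrier X; y \<in> carrier N\<rbrakk> \<Longrightarrow>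
    XN.tpure (x \<oplus>\<^bsub>X\<^esub> x') y = XN.tpure x y \<oplus>\<^bsub>XN.T\<^esub> XN.tpure x' y"
  using XN.tensor_pure_add_left by (simp add: X'_eq)

lemma XN_pure_balanced: "\<lbrakk>s \<in> carrier S; x \<in> carrier X; y \<in> carrier N\<rbrakk> \<Longrightarrow>
    XN.tpure (\<iota> s \<odot>\<^bsub>X\<^esub> x) y = XN.tpure x (s \<odot>\<^bsub>N\<^esub> y)"
  using XN.tensor_pure_balanced by (simp add: X'_eq)

lemma \<Phi>: "linear_map k XN.T XP.T \<Phi>"
  "\<lbrakk>x \<in> carrier X; y \<in> carrier N\<rbrakk> \<Longrightarrow> \<Phi> (XN.tpure x y) = XP.tpure x (unit y)"
proof -
  note D = linear_mapD[OF unit_linear, simplified]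
  have "bilinear k S X' N XP.T (\<lambda>x y. XP.tpure x (unit y))"
    by (rule bilinearI) (simp_all add: X'_eq D XP.tensor_pure_closed XP.tensor_pure_add_left
        XP.tensor_pure_add_right S.scalar_closed \<iota>_scalar \<iota>_simps XP.tensor_pure_scalar XP.tensor_pure_balanced)
  note l = XN.tensor_lift[OF XP.tensor_left_module this]
  show "linear_map k XN.T XP.T \<Phi>" unfolding \<Phi>_def by (rule l(1))
  show "\<Phi> (XN.tpure x y) = XP.tpure x (unit y)" if "x \<in> carrier X" "y \<in> carrier N"
    unfolding \<Phi>_def using l(2) that by (simp add: X'_eq)
qed

lemma \<chi>:
  assumes x: "x \<in> carrier X"
  shows "linear_map k IT.T XN.T (\<chi> x)"
    and "\<lbrakk>r \<in> carrier R; y \<in> carrier N\<rbrakk> \<Longrightarrow> \<chi> x (ipure r y) = XN.tpure (r \<odot>\<^bsub>X\<^esub> x) y"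
proof -
  have "bilinear k S (right_via R \<iota>) N XN.T (\<lambda>r y. XN.tpure (r \<odot>\<^bsub>X\<^esub> x) y)"
  proof (rule bilinearI)
    fix c r y assume "c \<in> carrier k" "r \<in> carrier (right_via R \<iota>)" "y \<in> carrier N"
    then show "XN.tpure (r \<odot>\<^bsub>X\<^esub> x) ((c \<odot>\<^bsub>S\<^esub> \<one>\<^bsub>S\<^esub>) \<odot>\<^bsub>N\<^esub> y) = c \<odot>\<^bsub>XN.T\<^esub> XN.tpure (r \<odot>\<^bsub>X\<^esub> x) y"
      using x XN.tensor_pure_scalar[of c "r \<odot>\<^bsub>X\<^esub> x" y] XP.X_smult_closed by (simp add: X'_eq)
  next
    fix r x' y assume "r \<in> carrier (right_via R \<iota>)" "x' \<in> carrier (right_via R \<iota>)" "y \<in> carrier N"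
    then show "XN.tpure ((r \<oplus>\<^bsub>right_via R \<iota>\<^esub> x') \<odot>\<^bsub>X\<^esub> x) y =
        XN.tpure (r \<odot>\<^bsub>X\<^esub> x) y \<oplus>\<^bsub>XN.T\<^esub> XN.tpure (x' \<odot>\<^bsub>X\<^esub> x) y"
      using x by (simp add: X_distr XN_pure_add XP.X_smult_closed)
  next
    fix r y y' assume "r \<in> carrier (right_via R \<iota>)" "y \<in> carrier N" "y' \<in> carrier N"
    then show "XN.tpure (r \<odot>\<^bsub>X\<^esub> x) (y \<oplus>\<^bsub>N\<^esub> y') =
        XN.tpure (r \<odot>\<^bsub>X\<^esub> x) y \<oplus>\<^bsub>XN.T\<^esub> XN.tpure (r \<odot>\<^bsub>X\<^esub> x) y'"
      using x XP.X_smult_closed XN.tensor_pure_add_right by (simp add: X'_eq)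
  qed (use x in \<open>simp_all add: XN_pure_closed XP.X_smult_closed X_assoc \<iota>_simps XN_pure_balanced\<close>)
  note l = IT.tensor_lift[OF XN.tensor_left_module this]
  show "linear_map k IT.T XN.T (\<chi> x)" unfolding \<chi>_def by (rule l(1))
  show "\<chi> x (ipure r y) = XN.tpure (r \<odot>\<^bsub>X\<^esub> x) y" if "r \<in> carrier R" "y \<in> carrier N"
    unfolding \<chi>_def using l(2) that by simp
qed

lemma \<chi>_add:
  assumes "x \<in> carrier X" "x' \<in> carrier X" "w \<in> carrier IT.T"
  shows "\<chi> (x \<oplus>\<^bsub>X\<^esub> x') w = \<chi> x w \<oplus>\<^bsub>XN.T\<^esub> \<chi> x' w"
  by (rule IT.tensor_ext[OF XN.tensor_left_module \<chi>(1) linear_map_add[OF XN.tensor_left_module \<chi>(1) \<chi>(1)] _ assms(3)])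
    (use assms(1,2) in \<open>simp_all add: \<chi>(2) X_distr XN_pure_add XP.X_smult_closed\<close>)

text \<open>The relation over \<open>R\<close> that \<open>\<Psi>\<close> has to respect; it rests
  on \<open>x (r r') = (x r) r'\<close>.\<close>

lemma \<chi>_balanced:
  assumes r: "r \<in> carrier R" and x: "x \<in> carrier X" and w: "w \<in> carrier IT.T"
  shows "\<chi> (r \<odot>\<^bsub>X\<^esub> x) w = \<chi> x (r \<odot>\<^bsub>IM\<^esub> w)"
  by (rule IT.tensor_ext[OF XN.tensor_left_module \<chi>(1) linear_map_comp[OF IM_action_linear[OF r] \<chi>(1)] _ w])
    (use r x in \<open>simp_all add: \<chi>(2) IM_action_pure X_assoc XP.X_smult_closed\<close>)

lemma \<Psi>: "linear_map k XP.T XN.T \<Psi>"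
  "\<lbrakk>x \<in> carrier X; p \<in> carrier P\<rbrakk> \<Longrightarrow> \<Psi> (XP.tpure x p) = \<chi> x (\<theta>' p)"
proof -
  note D = linear_mapD[OF \<theta>'_linear, simplified]
  have "bilinear k R X P XN.T (\<lambda>x p. \<chi> x (\<theta>' p))"
    by (rule bilinearI) (simp_all add: D linear_mapD[OF \<chi>(1)] \<chi>_add \<chi>_balanced IM_scalar R.scalar_closed)
  note l = XP.tensor_lift[OF XN.tensor_left_module this]
  show "linear_map k XP.T XN.T \<Psi>" unfolding \<Psi>_def by (rule l(1))
  show "\<Psi> (XP.tpure x p) = \<chi> x (\<theta>' p)" if "x \<in> carrier X" "p \<in> carrier P"
    unfolding \<Psi>_def using l(2) that by simp
qed

lemma \<Psi>_pure:
  "\<lbrakk>x \<in> carrier X; r \<in> carrier R; y \<in> carrier N\<rbrakk> \<Longrightarrow>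
    \<Psi> (XP.tpure x (r \<odot>\<^bsub>P\<^esub> unit y)) = XN.tpure (r \<odot>\<^bsub>X\<^esub> x) y"
  using linear_mapD(1)[OF \<theta>, of "ipure r y"]
  by (simp add: \<Psi>(2) \<chi>(2) \<theta>' ipure_closed flip: \<theta>_ipure)

lemma \<Psi>\<Phi>: "z \<in> carrier XN.T \<Longrightarrow> \<Psi> (\<Phi> z) = z"
proof -
  assume z: "z \<in> carrier XN.T"
  show ?thesis
  proof (rule XN.tensor_ext[OF XN.tensor_left_module linear_map_comp[OF \<Phi>(1) \<Psi>(1)] linear_map_id _ z])
    fix x y assume "x \<in> carrier X'" "y \<in> carrier N"
    then show "\<Psi> (\<Phi> (XN.tpure x y)) = XN.tpure x y"
      using \<Psi>_pure[of x "\<one>\<^bsub>R\<^esub>" y] by (simp add: X'_eq \<Phi>(2) P.smult_one unit_closed X_one)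
  qed
qed

lemma \<Phi>\<Psi>: "z \<in> carrier XP.T \<Longrightarrow> \<Phi> (\<Psi> z) = z"
proof -
  assume z: "z \<in> carrier XP.T"
  show ?thesis
  proof (rule XP.tensor_ext[OF XP.tensor_left_module linear_map_comp[OF \<Psi>(1) \<Phi>(1)] linear_map_id _ z])
    fix x p assume x: "x \<in> carrier X" and p: "p \<in> carrier P"
    \<comment> \<open>A general \<open>p\<close> is the image under \<open>\<theta>\<close> of a sum
      of pure tensors, so the identity is proved for every \<open>w\<close> by induction.\<close>
    have "\<Phi> (\<chi> x w) = XP.tpure x (\<theta> w)" if "w \<in> carrier IT.T" for w
      using that
    proof (induction rule: IT.tensor_induct)
      case (pure r y)
      then show ?case
        using x by (simp add: \<chi>(2) \<Phi>(2) XP.X_smult_closed \<theta>_ipure unit_closed XP.tensor_pure_balanced)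
    next
      case (add C D)
      then show ?case
        using x linear_mapD(1,2)[OF \<theta>, simplified]
        by (simp add: linear_mapD[OF \<chi>(1)] linear_mapD[OF \<Phi>(1)] XP.tensor_pure_add_right)
    qed
    then show "\<Phi> (\<Psi> (XP.tpure x p)) = XP.tpure x p" using x p by (simp add: \<Psi>(2) \<theta>')
  qed
qed

end

text \<open>The adjunction between induction and restriction: restricting along \<open>unit\<close>
  and extending by \<open>iext\<close> are inverse to each other.\<close>

locale hom_base_change = induced_iso k R S \<iota> N P \<theta>
  for k :: "'k ring" and R :: "('k, 'r) module" and S :: "('k, 's) module" and \<iota> :: "'s \<Rightarrow> 'r"
    and N :: "('s, 'n) module" and P :: "('r, 'p) module" and \<theta> +
  fixes X :: "('r, 'x) module" and X' :: "('s, 'x) module"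
  assumes X: "left_module R X" and X': "left_module S X'"
    and X'_eq: "carrier X' = carrier X" "add X' = add X"
      "\<And>s x. \<lbrakk>s \<in> carrier S; x \<in> carrier X\<rbrakk> \<Longrightarrow> s \<odot>\<^bsub>X'\<^esub> x = \<iota> s \<odot>\<^bsub>X\<^esub> x"
begin

sublocale X: left_module R X by (rule X)

definition \<Phi>\<^sub>h where "\<Phi>\<^sub>h f = (\<lambda>y\<in>carrier N. f (unit y))"
definition \<Psi>\<^sub>h where "\<Psi>\<^sub>h g = (\<lambda>p\<in>carrier P. iext X g (\<theta>' p))"

lemma linear_restrict: "linear_map S N X' g \<longleftrightarrow> linear_map S N (restrict_scalars \<iota> X) g"
  by (auto simp: linear_map_def X'_eq Pi_iff)

lemma \<Phi>\<^sub>h_linear: "linear_map k (hom_module R P X) (hom_module S N X') \<Phi>\<^sub>h"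
proof (rule linear_mapI)
  note D = linear_mapD[OF unit_linear, simplified]
  show "\<Phi>\<^sub>h f \<in> carrier (hom_module S N X')" if "f \<in> carrier (hom_module R P X)" for f
    using that linear_map_comp[OF unit_linear restrict_linear[of P X f]]
      linear_map_cong[of S N X' "\<lambda>y. f (unit y)" "\<Phi>\<^sub>h f"] SN
    by (simp add: \<Phi>\<^sub>h_def R.hom_module_simps S.hom_module_simps linear_restrict)
  show "\<Phi>\<^sub>h (f \<oplus>\<^bsub>hom_module R P X\<^esub> g) = \<Phi>\<^sub>h f \<oplus>\<^bsub>hom_module S N X'\<^esub> \<Phi>\<^sub>h g" for f g
    by (auto simp: \<Phi>\<^sub>h_def R.hom_module_simps S.hom_module_simps X'_eq D intro!: restrict_ext)
  show "\<Phi>\<^sub>h (c \<odot>\<^bsub>hom_module R P X\<^esub> f) = c \<odot>\<^bsub>hom_module S N X'\<^esub> \<Phi>\<^sub>h f"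
    if "c \<in> carrier k" "f \<in> carrier (hom_module R P X)" for c f
    using that linear_mapD(1)[of R P X f]
    by (auto simp: \<Phi>\<^sub>h_def R.hom_module_simps S.hom_module_simps X'_eq D \<iota>_scalar S.scalar_closed
        intro!: restrict_ext)
qed

lemma \<Psi>\<^sub>h:
  assumes "g \<in> carrier (hom_module S N X')"
  shows "\<Psi>\<^sub>h g \<in> carrier (hom_module R P X)"
    and "\<lbrakk>r \<in> carrier R; y \<in> carrier N\<rbrakk> \<Longrightarrow> \<Psi>\<^sub>h g (r \<odot>\<^bsub>P\<^esub> unit y) = r \<odot>\<^bsub>X\<^esub> g y"
    and "\<Phi>\<^sub>h (\<Psi>\<^sub>h g) = g"
proof -
  have g: "linear_map S N (restrict_scalars \<iota> X) g" and ext: "g \<in> extensional (carrier N)"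
    using assms by (simp_all add: S.hom_module_simps linear_restrict)
  show "\<Psi>\<^sub>h g \<in> carrier (hom_module R P X)"
    using linear_map_cong[OF linear_map_comp[OF \<theta>'_linear iext_linear[OF X g]] P, of "\<Psi>\<^sub>h g"]
    by (simp add: \<Psi>\<^sub>h_def R.hom_module_simps)
  show val: "\<Psi>\<^sub>h g (r \<odot>\<^bsub>P\<^esub> unit y) = r \<odot>\<^bsub>X\<^esub> g y" if "r \<in> carrier R" "y \<in> carrier N" for r y
    using that linear_mapD(1)[OF \<theta>, of "ipure r y"] iext_pure[OF X g]
    by (simp add: \<Psi>\<^sub>h_def \<theta>' ipure_closed flip: \<theta>_ipure)
  have "\<Phi>\<^sub>h (\<Psi>\<^sub>h g) y = g y" if "y \<in> carrier N" for y
    using val[OF _ that, of "\<one>\<^bsub>R\<^esub>"] that linear_mapD(1)[OF g that]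
    by (simp add: \<Phi>\<^sub>h_def P.smult_one unit_closed X.smult_one)
  then show "\<Phi>\<^sub>h (\<Psi>\<^sub>h g) = g"
    using ext by (intro extensionalityI[where A = "carrier N"]) (auto simp: \<Phi>\<^sub>h_def)
qed

lemma \<Psi>\<^sub>h\<Phi>\<^sub>h:
  assumes f: "f \<in> carrier (hom_module R P X)"
  shows "\<Psi>\<^sub>h (\<Phi>\<^sub>h f) = f"
proof -
  have fl: "linear_map R P X f" and ext: "f \<in> extensional (carrier P)"
    using f by (simp_all add: R.hom_module_simps)
  have gl: "linear_map S N (restrict_scalars \<iota> X) (\<Phi>\<^sub>h f)"
    using linear_mapD(1)[OF \<Phi>\<^sub>h_linear f] by (simp add: S.hom_module_simps linear_restrict)
  have "iext X (\<Phi>\<^sub>h f) w = f (\<theta> w)" if "w \<in> carrier IM" for w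
    by (rule IM_ext[OF X iext_linear[OF X gl] linear_map_comp[OF \<theta> fl] _ that])
      (use iext_pure[OF X gl] linear_mapD(1)[OF fl unit_closed]
        in \<open>simp add: \<Phi>\<^sub>h_def X.smult_one flip: unit_def\<close>)
  then have "\<Psi>\<^sub>h (\<Phi>\<^sub>h f) p = f p" if "p \<in> carrier P" for p using that by (simp add: \<Psi>\<^sub>h_def \<theta>')
  then show ?thesis
    using ext by (intro extensionalityI[where A = "carrier P"]) (auto simp: \<Psi>\<^sub>h_def)
qed

lemma \<Psi>\<^sub>h_linear: "linear_map k (hom_module S N X') (hom_module R P X) \<Psi>\<^sub>h"
  by (rule linear_map_inverse[OF \<Phi>\<^sub>h_linear R.hom_left_module[OF P X]]) (simp_all add: \<Psi>\<^sub>h \<Psi>\<^sub>h\<Phi>\<^sub>h del: R.hom_module_simps)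

end

section \<open>Tensor products of sub-bimodules\<close>

lemma listset_iff: "w \<in> listset Ns \<longleftrightarrow> list_all2 (\<in>) w Ns"
  by (induction Ns arbitrary: w) (auto simp: set_Cons_def list_all2_Cons2)

lemma listset_split:
  "u @ x # v \<in> listset Ns \<longleftrightarrow> (\<exists>Us N Vs. Ns = Us @ N # Vs \<and> u \<in> listset Us \<and> x \<in> N \<and> v \<in> listset Vs)"
  (is "_ \<longleftrightarrow> ?r")
proof
  show ?r if "u @ x # v \<in> listset Ns"
    using that unfolding listset_iff list_all2_append1 list_all2_Cons1 by blast
  show "u @ x # v \<in> listset Ns" if ?r
    using that unfolding listset_iff by (auto intro!: list_all2_appendI)
qed

lemma listset_exchange:
  assumes "u @ x # v \<in> listset Ns" "\<And>N. N \<in> set Ns \<Longrightarrow> x \<in> N \<Longrightarrow> x' \<in> N"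
  shows "u @ x' # v \<in> listset Ns"
  using assms unfolding listset_split by fastforce

text \<open>The letters \<open>x\<close> and \<open>y\<close> stand at the same position, fixed by
  the length of \<open>u\<close>, hence in the same factor; this makes it possible to replace them
  by their sum.\<close>

lemma listset_exchange2:
  assumes "u @ x # v \<in> listset Ns" "u @ y # v \<in> listset Ns"
    "\<And>N. N \<in> set Ns \<Longrightarrow> x \<in> N \<Longrightarrow> y \<in> N \<Longrightarrow> z \<in> N"
  shows "u @ z # v \<in> listset Ns"
proof -
  obtain Us N Vs where 1: "Ns = Us @ N # Vs" "u \<in> listset Us" "x \<in> N" "v \<in> listset Vs"
    using assms(1) unfolding listset_split by blast
  obtain Us' N' Vs' where 2: "Ns = Us' @ N' # Vs'" "u \<in> listset Us'" "y \<in> N'" "v \<in> listset Vs'"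
    using assms(2) unfolding listset_split by blast
  have "length Us = length Us'"
    using 1(2) 2(2) unfolding listset_iff by (metis list_all2_lengthD)
  then have "N = N'" using 1(1) 2(1) by simp
  then show ?thesis using assms(3)[of N] 1 2 unfolding listset_split by auto
qed

lemma listset_set: "\<lbrakk>w \<in> listset Ns; x \<in> set w\<rbrakk> \<Longrightarrow> \<exists>N\<in>set Ns. x \<in> N"
  unfolding listset_iff by (metis list_all2_conv_all_nth in_set_conv_nth)

text \<open>Linearity in each letter and balance over \<open>B\<close> between neighbours: the
  conditions under which a linear extension vanishes on \<open>ltensor_rels\<close>, as
  \<open>bilinear\<close> is for \<open>tensor_rels\<close>.\<close>

definition balanced ::
  "'k ring \<Rightarrow> ('k, 'a) module \<Rightarrow> 'a set \<Rightarrow> 'a set list \<Rightarrow> ('k, 'z, 'j) module_scheme \<Rightarrow> ('a list \<Rightarrow> 'z) \<Rightarrow> bool"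
  where "balanced k A B Ns Z \<phi> \<longleftrightarrow>
    (\<forall>w\<in>listset Ns. \<phi> w \<in> carrier Z) \<and>
    (\<forall>u x y v. u @ x # v \<in> listset Ns \<longrightarrow> u @ y # v \<in> listset Ns \<longrightarrow>
       \<phi> (u @ (x \<oplus>\<^bsub>A\<^esub> y) # v) = \<phi> (u @ x # v) \<oplus>\<^bsub>Z\<^esub> \<phi> (u @ y # v)) \<and>
    (\<forall>c\<in>carrier k. \<forall>u x v. u @ x # v \<in> listset Ns \<longrightarrow>
       \<phi> (u @ (c \<odot>\<^bsub>A\<^esub> x) # v) = c \<odot>\<^bsub>Z\<^esub> \<phi> (u @ x # v)) \<and>
    (\<forall>b\<in>B. \<forall>u x y v. u @ x # y # v \<in> listset Ns \<longrightarrow>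
       \<phi> (u @ (x \<otimes>\<^bsub>A\<^esub> b) # y # v) = \<phi> (u @ x # (b \<otimes>\<^bsub>A\<^esub> y) # v))"

lemma balancedI:
  assumes "\<And>w. w \<in> listset Ns \<Longrightarrow> \<phi> w \<in> carrier Z"
    and "\<And>u x y v. \<lbrakk>u @ x # v \<in> listset Ns; u @ y # v \<in> listset Ns\<rbrakk> \<Longrightarrow>
       \<phi> (u @ (x \<oplus>\<^bsub>A\<^esub> y) # v) = \<phi> (u @ x # v) \<oplus>\<^bsub>Z\<^esub> \<phi> (u @ y # v)"
    and "\<And>c u x v. \<lbrakk>c \<in> carrier k; u @ x # v \<in> listset Ns\<rbrakk> \<Longrightarrow>
       \<phi> (u @ (c \<odot>\<^bsub>A\<^esub> x) # v) = c \<odot>\<^bsub>Z\<^esub> \<phi> (u @ x # v)"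
    and "\<And>b u x y v. \<lbrakk>b \<in> B; u @ x # y # v \<in> listset Ns\<rbrakk> \<Longrightarrow>
       \<phi> (u @ (x \<otimes>\<^bsub>A\<^esub> b) # y # v) = \<phi> (u @ x # (b \<otimes>\<^bsub>A\<^esub> y) # v)"
  shows "balanced k A B Ns Z \<phi>"
  using assms unfolding balanced_def by blast

lemma balancedD:
  assumes "balanced k A B Ns Z \<phi>"
  shows "w \<in> listset Ns \<Longrightarrow> \<phi> w \<in> carrier Z"
    and "\<lbrakk>u @ x # v \<in> listset Ns; u @ y # v \<in> listset Ns\<rbrakk> \<Longrightarrow>
       \<phi> (u @ (x \<oplus>\<^bsub>A\<^esub> y) # v) = \<phi> (u @ x # v) \<oplus>\<^bsub>Z\<^esub> \<phi> (u @ y # v)"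
    and "\<lbrakk>c \<in> carrier k; u @ x # v \<in> listset Ns\<rbrakk> \<Longrightarrow>
       \<phi> (u @ (c \<odot>\<^bsub>A\<^esub> x) # v) = c \<odot>\<^bsub>Z\<^esub> \<phi> (u @ x # v)"
    and "\<lbrakk>b \<in> B; u @ x # y # v \<in> listset Ns\<rbrakk> \<Longrightarrow>
       \<phi> (u @ (x \<otimes>\<^bsub>A\<^esub> b) # y # v) = \<phi> (u @ x # (b \<otimes>\<^bsub>A\<^esub> y) # v)"
  using assms unfolding balanced_def by blast+

section \<open>Words with letters in \<open>B\<close>-sub-bimodules of \<open>A\<close>\<close>

locale sub_algebra = env_data k A for k :: "'k ring" and A :: "('k, 'a) module" +
  fixes B :: "'a set"
  assumes B: "subring B A" "submodule B k A"
begin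

lemma B_simps:
  "b \<in> B \<Longrightarrow> b \<in> carrier A" "\<one>\<^bsub>A\<^esub> \<in> B" "\<zero>\<^bsub>A\<^esub> \<in> B"
  "\<lbrakk>b \<in> B; b' \<in> B\<rbrakk> \<Longrightarrow> b \<otimes>\<^bsub>A\<^esub> b' \<in> B" "\<lbrakk>b \<in> B; b' \<in> B\<rbrakk> \<Longrightarrow> b \<oplus>\<^bsub>A\<^esub> b' \<in> B"
  "\<lbrakk>c \<in> carrier k; b \<in> B\<rbrakk> \<Longrightarrow> c \<odot>\<^bsub>A\<^esub> b \<in> B"
  using subringE[OF B(1)] Rk.submoduleD(4)[OF B(2)] by auto

definition factor :: "'a set \<Rightarrow> bool"
  where "factor N \<longleftrightarrow> submodule N k A \<and> (\<forall>b\<in>B. \<forall>x\<in>N. b \<otimes>\<^bsub>A\<^esub> x \<in> N \<and> x \<otimes>\<^bsub>A\<^esub> b \<in> N)"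

lemma factorD:
  assumes "factor N"
  shows "x \<in> N \<Longrightarrow> x \<in> carrier A" "\<zero>\<^bsub>A\<^esub> \<in> N" "\<lbrakk>x \<in> N; y \<in> N\<rbrakk> \<Longrightarrow> x \<oplus>\<^bsub>A\<^esub> y \<in> N"
    "\<lbrakk>c \<in> carrier k; x \<in> N\<rbrakk> \<Longrightarrow> c \<odot>\<^bsub>A\<^esub> x \<in> N"
    "\<lbrakk>b \<in> B; x \<in> N\<rbrakk> \<Longrightarrow> b \<otimes>\<^bsub>A\<^esub> x \<in> N" "\<lbrakk>b \<in> B; x \<in> N\<rbrakk> \<Longrightarrow> x \<otimes>\<^bsub>A\<^esub> b \<in> N"
  using assms Rk.submoduleD[of N] unfolding factor_def by blast+

end

locale ltensor_data = sub_algebra k A B for k :: "'k ring" and A :: "('k, 'a) module" and B +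
  fixes Ns :: "'a set list"
  assumes Ns: "\<And>N. N \<in> set Ns \<Longrightarrow> factor N" and nonempty: "Ns \<noteq> []"
begin

abbreviation "W \<equiv> listset Ns"
abbreviation "LT \<equiv> ltensor k A B Ns"
abbreviation "lpure \<equiv> ltensor_pure k A B Ns"
abbreviation "LQ \<equiv> presented k W (ltensor_rels k A B Ns)"

lemma W_nonempty: "w \<in> W \<Longrightarrow> w \<noteq> []"
  using nonempty by (auto simp: listset_iff)

lemma W_letter: "w \<in> W \<Longrightarrow> x \<in> set w \<Longrightarrow> x \<in> carrier A"
  by (drule (1) listset_set) (auto intro: factorD(1)[OF Ns])

lemma W_carrier: "u @ x # v \<in> W \<Longrightarrow> x \<in> carrier A" by (rule W_letter) auto

lemma W_add: "\<lbrakk>u @ x # v \<in> W; u @ y # v \<in> W\<rbrakk> \<Longrightarrow> u @ (x \<oplus>\<^bsub>A\<^esub> y) # v \<in> W"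
  by (erule listset_exchange2, assumption) (rule factorD(3)[OF Ns])

lemma W_smult: "\<lbrakk>c \<in> carrier k; u @ x # v \<in> W\<rbrakk> \<Longrightarrow> u @ (c \<odot>\<^bsub>A\<^esub> x) # v \<in> W"
  by (erule listset_exchange) (rule factorD(4)[OF Ns])

lemma W_mult_left: "\<lbrakk>b \<in> B; u @ x # v \<in> W\<rbrakk> \<Longrightarrow> u @ (b \<otimes>\<^bsub>A\<^esub> x) # v \<in> W"
  by (erule listset_exchange) (rule factorD(5)[OF Ns])

lemma W_mult_right: "\<lbrakk>b \<in> B; u @ x # v \<in> W\<rbrakk> \<Longrightarrow> u @ (x \<otimes>\<^bsub>A\<^esub> b) # v \<in> W"
  by (erule listset_exchange) (rule factorD(6)[OF Ns])

lemma W_mult_left2: "\<lbrakk>b \<in> B; u @ x # y # v \<in> W\<rbrakk> \<Longrightarrow> u @ x # (b \<otimes>\<^bsub>A\<^esub> y) # v \<in> W"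
  using W_mult_left[of b "u @ [x]" y v] by simp

lemma ltensor_simps [simp]:
  "carrier LT = carrier LQ" "add LT = add LQ" "zero LT = zero LQ"
  by (simp_all add: ltensor_def ltensor_null_def presented_def Let_def)

lemma lpure_pgen: "lpure w = pgen k W (ltensor_rels k A B Ns) w"
  by (simp add: ltensor_pure_def ltensor_null_def pgen_def)

lemma ltensor_rels_carrier: "ltensor_rels k A B Ns \<subseteq> carrier (free_module k W)"
proof -
  interpret F: left_module k "free_module k W" by (rule free_left_module)
  show ?thesis
    unfolding ltensor_rels_def Let_def
    by (auto simp del: free_module_simps simp: W_add W_smult W_mult_right W_mult_left2
        intro!: F.N.minus_closed F.N.a_closed F.smult_closed free_gen_closed)
qed

lemma ltensor_rels_mem:
  "\<lbrakk>u @ x # v \<in> W; u @ y # v \<in> W\<rbrakk> \<Longrightarrow>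
    free_gen k (u @ (x \<oplus>\<^bsub>A\<^esub> y) # v) \<ominus>\<^bsub>free_module k W\<^esub> (free_gen k (u @ x # v) \<oplus>\<^bsub>free_module k W\<^esub> free_gen k (u @ y # v))
      \<in> ltensor_rels k A B Ns"
  "\<lbrakk>c \<in> carrier k; u @ x # v \<in> W\<rbrakk> \<Longrightarrow>
    free_gen k (u @ (c \<odot>\<^bsub>A\<^esub> x) # v) \<ominus>\<^bsub>free_module k W\<^esub> c \<odot>\<^bsub>free_module k W\<^esub> free_gen k (u @ x # v) \<in> ltensor_rels k A B Ns"
  "\<lbrakk>b \<in> B; u @ x # y # v \<in> W\<rbrakk> \<Longrightarrow>
    free_gen k (u @ (x \<otimes>\<^bsub>A\<^esub> b) # y # v) \<ominus>\<^bsub>free_module k W\<^esub> free_gen k (u @ x # (b \<otimes>\<^bsub>A\<^esub> y) # v) \<in> ltensor_rels k A B Ns"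
  unfolding ltensor_rels_def Let_def
  by (rule UnI1, rule UnI1, rule CollectI, intro exI conjI, rule refl, assumption+)
    (rule UnI1, rule UnI2, rule CollectI, intro exI conjI, rule refl, assumption+,
      rule UnI2, rule CollectI, intro exI conjI, rule refl, assumption+)

lemmas LQ_left_module = presented_left_module[OF ltensor_rels_carrier]

sublocale LQ: left_module k LQ by (rule LQ_left_module)

lemma lpure_closed: "w \<in> W \<Longrightarrow> lpure w \<in> carrier LQ"
  unfolding lpure_pgen by (rule pgen_closed[OF ltensor_rels_carrier])

lemma lpure_balanced: "balanced k A B Ns LQ lpure"
proof (rule balancedI)
  show "lpure (u @ (x \<oplus>\<^bsub>A\<^esub> y) # v) = lpure (u @ x # v) \<oplus>\<^bsub>LQ\<^esub> lpure (u @ y # v)"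
    if "u @ x # v \<in> W" "u @ y # v \<in> W" for u x y v
    unfolding lpure_pgen
    using that by (intro pgen_add[OF ltensor_rels_carrier ltensor_rels_mem(1)] W_add)
  show "lpure (u @ (c \<odot>\<^bsub>A\<^esub> x) # v) = c \<odot>\<^bsub>LQ\<^esub> lpure (u @ x # v)"
    if "c \<in> carrier k" "u @ x # v \<in> W" for c u x v
    unfolding lpure_pgen
    using that by (intro pgen_smult[OF ltensor_rels_carrier ltensor_rels_mem(2)] W_smult)
  show "lpure (u @ (x \<otimes>\<^bsub>A\<^esub> b) # y # v) = lpure (u @ x # (b \<otimes>\<^bsub>A\<^esub> y) # v)"
    if "b \<in> B" "u @ x # y # v \<in> W" for b u x y v
    unfolding lpure_pgen
    using that by (intro pgen_eq[OF ltensor_rels_carrier ltensor_rels_mem(3)] W_mult_right W_mult_left2)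
qed (rule lpure_closed)

lemmas lpure_rel = balancedD(2-4)[OF lpure_balanced]

lemma lift:
  assumes Z: "left_module k Z" and \<phi>: "balanced k A B Ns Z \<phi>"
  shows lift_linear: "linear_map k LQ Z (lin_ext k Z \<phi>)"
    and lift_pure: "w \<in> W \<Longrightarrow> lin_ext k Z \<phi> (lpure w) = \<phi> w"
proof -
  note D = balancedD[OF \<phi>]
  note rel = fext_relations[where \<phi> = \<phi>, OF Z D(1)]
  have "fext k Z \<phi> e = \<zero>\<^bsub>Z\<^esub>" if "e \<in> ltensor_rels k A B Ns" for e
    using that unfolding ltensor_rels_def Let_def
    by (elim UnE CollectE exE conjE; simp only:; intro rel)
      (auto simp: D W_add W_smult W_mult_right W_mult_left2)
  note l = presented_lift[where \<phi> = \<phi>, OF ltensor_rels_carrier Z D(1) this]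
  show "linear_map k LQ Z (lin_ext k Z \<phi>)" by (rule l(1))
  show "lin_ext k Z \<phi> (lpure w) = \<phi> w" if "w \<in> W" unfolding lpure_pgen by (intro l(2) that)
qed

lemma ltensor_ext:
  assumes "left_module k Z" "linear_map k LQ Z f" "linear_map k LQ Z g"
    and "\<And>w. w \<in> W \<Longrightarrow> f (lpure w) = g (lpure w)" "t \<in> carrier LQ"
  shows "f t = g t"
  using assms(2-5) unfolding lpure_pgen
  by (auto intro: presented_ext[OF ltensor_rels_carrier assms(1), of f g])

text \<open>As in \<open>tensor_induct\<close> a scalar is absorbed, here by the first letter, which
  exists because the list of factors is nonempty.\<close>

lemma ltensor_induct [consumes 1, case_names pure add]:
  assumes "t \<in> carrier LQ"
    and pure: "\<And>w. w \<in> W \<Longrightarrow> P (lpure w)"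
    and add: "\<And>s t. \<lbrakk>s \<in> carrier LQ; t \<in> carrier LQ; P s; P t\<rbrakk> \<Longrightarrow> P (s \<oplus>\<^bsub>LQ\<^esub> t)"
  shows "P t"
proof -
  define G where "G = {C \<in> carrier LQ. \<forall>c\<in>carrier k. P (c \<odot>\<^bsub>LQ\<^esub> C)}"
  have sm: "P (c \<odot>\<^bsub>LQ\<^esub> lpure w)" if "w \<in> W" "c \<in> carrier k" for c w
    using pure[OF W_smult[of c "[]" "hd w" "tl w"]] lpure_rel(2)[of c "[]" "hd w" "tl w"] W_nonempty that by simp
  \<comment> \<open>The word of zeros shows that there are words at all; the multiple of its class
    by the scalar zero is the zero element, which \<open>G\<close> has to contain.\<close>
  obtain w where w: "w \<in> W"
  proof -
    have "list_all2 (\<in>) (map (\<lambda>_. \<zero>\<^bsub>A\<^esub>) Ns) Ns"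
      using factorD(2)[OF Ns] by (simp add: list_all2_map1 list_all2_same)
    then show ?thesis using that by (simp add: listset_iff)
  qed
  have "submodule G k LQ"
  proof (rule LQ.submoduleI')
    show "\<zero>\<^bsub>LQ\<^esub> \<in> G"
      using sm[OF w k.zero_closed] lpure_closed[OF w] by (simp add: G_def)
    show "C \<oplus>\<^bsub>LQ\<^esub> D \<in> G" if "C \<in> G" "D \<in> G" for C D
      using that add by (auto simp: G_def LQ.smult_r_distr LQ.smult_closed)
    show "c \<odot>\<^bsub>LQ\<^esub> C \<in> G" if "c \<in> carrier k" "C \<in> G" for c C
      using that by (auto simp: G_def LQ.smult_closed simp flip: LQ.smult_assoc)
  qed (auto simp: G_def)
  moreover have "lpure w \<in> G" if "w \<in> W" for w using that sm by (simp add: G_def lpure_closed)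
  ultimately have "G = carrier LQ"
    unfolding lpure_pgen by (intro presented_submodule[OF ltensor_rels_carrier]) auto
  then have "P (\<one>\<^bsub>k\<^esub> \<odot>\<^bsub>LQ\<^esub> t)" using assms(1) by (auto simp: G_def)
  then show ?thesis using assms(1) by (simp add: LQ.smult_one)
qed

text \<open>The outer factors decide who acts: every element of \<open>A\<close> for bar words, the
  elements of \<open>B\<close> for tensor powers including the power 0. Stability of the first and
  of the last factor treats these cases together.\<close>

definition lstable :: "'a \<Rightarrow> bool" where "lstable a \<longleftrightarrow> a \<in> carrier A \<and> (\<forall>x\<in>hd Ns. a \<otimes>\<^bsub>A\<^esub> x \<in> hd Ns)"
definition rstable :: "'a \<Rightarrow> bool" where "rstable a \<longleftrightarrow> a \<in> carrier A \<and> (\<forall>x\<in>last Ns. x \<otimes>\<^bsub>A\<^esub> a \<in> last Ns)"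

lemma W_lstable: "lstable a \<Longrightarrow> x # v \<in> W \<Longrightarrow> (a \<otimes>\<^bsub>A\<^esub> x) # v \<in> W"
  unfolding lstable_def by (cases Ns) (auto simp: set_Cons_def)

lemma W_rstable: "rstable a \<Longrightarrow> u @ [x] \<in> W \<Longrightarrow> u @ [x \<otimes>\<^bsub>A\<^esub> a] \<in> W"
  unfolding rstable_def listset_split by (force simp: listset_iff)

lemma smult_LT: "a \<odot>\<^bsub>LT\<^esub> t = lin_ext k LQ (\<lambda>w. lpure ((a \<otimes>\<^bsub>A\<^esub> hd w) # tl w)) t"
  by (simp add: ltensor_def ltensor_null_def presented_def Let_def)

lemma rsmult_LT: "t \<triangleleft>\<^bsub>LT\<^esub> a = lin_ext k LQ (\<lambda>w. lpure (butlast w @ [last w \<otimes>\<^bsub>A\<^esub> a])) t"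
  by (simp add: ltensor_def ltensor_null_def presented_def Let_def)

text \<open>The new factor \<open>a\<close> meets a relation only if that relation sits at the first
  letter, that is if \<open>u\<close> is empty; there distributivity, the scalar law or
  associativity in \<open>A\<close> restores it. Elsewhere the relation is untouched.\<close>

lemma lact_LT:
  assumes a: "lstable a"
  shows "linear_map k LQ LQ (\<lambda>t. a \<odot>\<^bsub>LT\<^esub> t)"
    and "x # v \<in> W \<Longrightarrow> a \<odot>\<^bsub>LT\<^esub> lpure (x # v) = lpure ((a \<otimes>\<^bsub>A\<^esub> x) # v)"
proof -
  have ac: "a \<in> carrier A" using a by (simp add: lstable_def)
  have st: "(a \<otimes>\<^bsub>A\<^esub> p) # u @ x # v \<in> W" if "p # u @ x # v \<in> W" for p u x v
    using W_lstable[OF a that] by simp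
  have bal: "balanced k A B Ns LQ (\<lambda>w. lpure ((a \<otimes>\<^bsub>A\<^esub> hd w) # tl w))"
  proof (rule balancedI)
    show "lpure ((a \<otimes>\<^bsub>A\<^esub> hd w) # tl w) \<in> carrier LQ" if "w \<in> W" for w
      using that W_nonempty[OF that] W_lstable[OF a, of "hd w" "tl w"] by (simp add: lpure_closed)
  next
    fix u x y v assume "u @ x # v \<in> W" "u @ y # v \<in> W"
    then show "lpure ((a \<otimes>\<^bsub>A\<^esub> hd (u @ (x \<oplus>\<^bsub>A\<^esub> y) # v)) # tl (u @ (x \<oplus>\<^bsub>A\<^esub> y) # v)) =
      lpure ((a \<otimes>\<^bsub>A\<^esub> hd (u @ x # v)) # tl (u @ x # v)) \<oplus>\<^bsub>LQ\<^esub> lpure ((a \<otimes>\<^bsub>A\<^esub> hd (u @ y # v)) # tl (u @ y # v))"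
      using ac W_carrier[of u x v] W_carrier[of u y v] lpure_rel(1)[of "[]"] W_lstable[OF a]
        lpure_rel(1)[of "(a \<otimes>\<^bsub>A\<^esub> hd u) # tl u" x v y] st
      by (cases u) (simp_all add: R.r_distr)
  next
    fix c u x v assume "c \<in> carrier k" "u @ x # v \<in> W"
    then show "lpure ((a \<otimes>\<^bsub>A\<^esub> hd (u @ (c \<odot>\<^bsub>A\<^esub> x) # v)) # tl (u @ (c \<odot>\<^bsub>A\<^esub> x) # v)) =
      c \<odot>\<^bsub>LQ\<^esub> lpure ((a \<otimes>\<^bsub>A\<^esub> hd (u @ x # v)) # tl (u @ x # v))"
      using ac W_carrier[of u x v] lpure_rel(2)[of c "[]" "a \<otimes>\<^bsub>A\<^esub> x" v] W_lstable[OF a, of x v]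
        lpure_rel(2)[of c "(a \<otimes>\<^bsub>A\<^esub> hd u) # tl u" x v] st
      by (cases u) (simp_all add: smult_mult)
  next
    fix b u x y v assume b: "b \<in> B" and "u @ x # y # v \<in> W"
    then show "lpure ((a \<otimes>\<^bsub>A\<^esub> hd (u @ (x \<otimes>\<^bsub>A\<^esub> b) # y # v)) # tl (u @ (x \<otimes>\<^bsub>A\<^esub> b) # y # v)) =
      lpure ((a \<otimes>\<^bsub>A\<^esub> hd (u @ x # (b \<otimes>\<^bsub>A\<^esub> y) # v)) # tl (u @ x # (b \<otimes>\<^bsub>A\<^esub> y) # v))"
      using ac W_carrier[of u x "y # v"] B_simps(1)[OF b] lpure_rel(3)[OF b, of "[]" "a \<otimes>\<^bsub>A\<^esub> x" y v]
        W_lstable[OF a, of x "y # v"] lpure_rel(3)[OF b, of "(a \<otimes>\<^bsub>A\<^esub> hd u) # tl u" x y v] st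
      by (cases u) (simp_all add: R.m_assoc[symmetric])
  qed
  note l = lift[OF LQ_left_module bal]
  show "linear_map k LQ LQ (\<lambda>t. a \<odot>\<^bsub>LT\<^esub> t)" unfolding smult_LT by (rule l(1))
  show "a \<odot>\<^bsub>LT\<^esub> lpure (x # v) = lpure ((a \<otimes>\<^bsub>A\<^esub> x) # v)" if "x # v \<in> W"
    unfolding smult_LT using l(2)[OF that] by simp
qed

lemma ract_LT:
  assumes a: "rstable a"
  shows "linear_map k LQ LQ (\<lambda>t. t \<triangleleft>\<^bsub>LT\<^esub> a)"
    and "u @ [x] \<in> W \<Longrightarrow> lpure (u @ [x]) \<triangleleft>\<^bsub>LT\<^esub> a = lpure (u @ [x \<otimes>\<^bsub>A\<^esub> a])"
proof -
  have ac: "a \<in> carrier A" using a by (simp add: rstable_def)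
  have st: "u @ x # v @ [p \<otimes>\<^bsub>A\<^esub> a] \<in> W" if "u @ x # v @ [p] \<in> W" for p u x v
    using W_rstable[OF a, of "u @ x # v" p] that by simp
  have bal: "balanced k A B Ns LQ (\<lambda>w. lpure (butlast w @ [last w \<otimes>\<^bsub>A\<^esub> a]))"
  proof (rule balancedI)
    show "lpure (butlast w @ [last w \<otimes>\<^bsub>A\<^esub> a]) \<in> carrier LQ" if "w \<in> W" for w
      using that W_nonempty[OF that] W_rstable[OF a, of "butlast w" "last w"] by (simp add: lpure_closed)
  next
    fix u x y v assume "u @ x # v \<in> W" "u @ y # v \<in> W"
    then show "lpure (butlast (u @ (x \<oplus>\<^bsub>A\<^esub> y) # v) @ [last (u @ (x \<oplus>\<^bsub>A\<^esub> y) # v) \<otimes>\<^bsub>A\<^esub> a]) =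
      lpure (butlast (u @ x # v) @ [last (u @ x # v) \<otimes>\<^bsub>A\<^esub> a]) \<oplus>\<^bsub>LQ\<^esub> lpure (butlast (u @ y # v) @ [last (u @ y # v) \<otimes>\<^bsub>A\<^esub> a])"
      using ac W_carrier[of u x v] W_carrier[of u y v] lpure_rel(1)[of u "x \<otimes>\<^bsub>A\<^esub> a" "[]" "y \<otimes>\<^bsub>A\<^esub> a"] W_rstable[OF a]
        lpure_rel(1)[of u x "butlast v @ [last v \<otimes>\<^bsub>A\<^esub> a]" y] st
      by (cases v rule: rev_cases) (simp_all add: R.l_distr butlast_append)
  next
    fix c u x v assume "c \<in> carrier k" "u @ x # v \<in> W"
    then show "lpure (butlast (u @ (c \<odot>\<^bsub>A\<^esub> x) # v) @ [last (u @ (c \<odot>\<^bsub>A\<^esub> x) # v) \<otimes>\<^bsub>A\<^esub> a]) =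
      c \<odot>\<^bsub>LQ\<^esub> lpure (butlast (u @ x # v) @ [last (u @ x # v) \<otimes>\<^bsub>A\<^esub> a])"
      using ac W_carrier[of u x v] lpure_rel(2)[of c u "x \<otimes>\<^bsub>A\<^esub> a" "[]"] W_rstable[OF a]
        lpure_rel(2)[of c u x "butlast v @ [last v \<otimes>\<^bsub>A\<^esub> a]"] st
      by (cases v rule: rev_cases) (simp_all add: smult_mult butlast_append)
  next
    fix b u x y v assume b: "b \<in> B" and w: "u @ x # y # v \<in> W"
    then show "lpure (butlast (u @ (x \<otimes>\<^bsub>A\<^esub> b) # y # v) @ [last (u @ (x \<otimes>\<^bsub>A\<^esub> b) # y # v) \<otimes>\<^bsub>A\<^esub> a]) =
      lpure (butlast (u @ x # (b \<otimes>\<^bsub>A\<^esub> y) # v) @ [last (u @ x # (b \<otimes>\<^bsub>A\<^esub> y) # v) \<otimes>\<^bsub>A\<^esub> a])"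
      using ac W_carrier[of "u @ [x]" y v] B_simps(1)[OF b] lpure_rel(3)[OF b, of u x "y \<otimes>\<^bsub>A\<^esub> a" "[]"]
        W_rstable[OF a, of "u @ [x]" y] lpure_rel(3)[OF b, of u x y "butlast v @ [last v \<otimes>\<^bsub>A\<^esub> a]"] st[of "u @ [x]" y]
      by (cases v rule: rev_cases) (simp_all add: R.m_assoc butlast_append)
  qed
  note l = lift[OF LQ_left_module bal]
  show "linear_map k LQ LQ (\<lambda>t. t \<triangleleft>\<^bsub>LT\<^esub> a)" unfolding rsmult_LT by (rule l(1))
  show "lpure (u @ [x]) \<triangleleft>\<^bsub>LT\<^esub> a = lpure (u @ [x \<otimes>\<^bsub>A\<^esub> a])" if "u @ [x] \<in> W"
    unfolding rsmult_LT using l(2)[OF that] by simp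
qed

lemma LT_abelian_group: "abelian_group LT"
  by (rule abelian_group_cong[OF LQ.N.abelian_group_axioms]) auto

text \<open>The subalgebra \<open>C\<close> will be \<open>A\<close> for the bar bimodules and
  \<open>B\<close> for the tensor powers of \<open>M\<close>.\<close>

lemma ltensor_bimodule:
  assumes C: "subring C A" "submodule C k A" and st: "\<And>c. c \<in> C \<Longrightarrow> lstable c \<and> rstable c"
  shows "is_bimodule k (subalg A C) LT"
proof -
  have CA: "c \<in> carrier A" if "c \<in> C" for c using st[OF that] by (simp add: lstable_def)
  note Cs = subringE[OF C(1)]
  have lst: "lstable c" "rstable c" if "c \<in> C" for c using st[OF that] by auto
  have Cring: "ring (subalg A C)" using R.subring_is_ring[OF C(1)] .
  have Cone: "c \<odot>\<^bsub>A\<^esub> \<one>\<^bsub>A\<^esub> \<in> C" if "c \<in> carrier k" for c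
    using Rk.submoduleD(4)[OF C(2) that] Cs(3) by blast
  note lD = linear_mapD[OF lact_LT(1)[OF lst(1)]] and rD = linear_mapD[OF ract_LT(1)[OF lst(2)]]
  have hdtl: "\<exists>x v. w = x # v" and bl: "\<exists>u x. w = u @ [x]" if "w \<in> W" for w
    using W_nonempty[OF that] by (cases w, auto, cases w rule: rev_cases, auto)
  have l_distr: "(c \<oplus>\<^bsub>A\<^esub> d) \<odot>\<^bsub>LT\<^esub> t = c \<odot>\<^bsub>LT\<^esub> t \<oplus>\<^bsub>LQ\<^esub> d \<odot>\<^bsub>LT\<^esub> t"
    and l_assoc: "(c \<otimes>\<^bsub>A\<^esub> d) \<odot>\<^bsub>LT\<^esub> t = c \<odot>\<^bsub>LT\<^esub> (d \<odot>\<^bsub>LT\<^esub> t)"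
    and r_distr: "t \<triangleleft>\<^bsub>LT\<^esub> (c \<oplus>\<^bsub>A\<^esub> d) = t \<triangleleft>\<^bsub>LT\<^esub> c \<oplus>\<^bsub>LQ\<^esub> t \<triangleleft>\<^bsub>LT\<^esub> d"
    and r_assoc: "t \<triangleleft>\<^bsub>LT\<^esub> (c \<otimes>\<^bsub>A\<^esub> d) = (t \<triangleleft>\<^bsub>LT\<^esub> c) \<triangleleft>\<^bsub>LT\<^esub> d"
    if cd: "c \<in> C" "d \<in> C" and t: "t \<in> carrier LQ" for c d t
    using t
  proof (induction rule: ltensor_induct)
    case (pure w)
    { case 1
      show ?case
        using hdtl[OF pure] pure cd W_carrier[of "[]"] lpure_rel(1)[of "[]"] W_lstable[OF lst(1)] Cs(7)
        by (auto simp: lact_LT(2)[OF lst(1)] R.l_distr CA)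
    next
      case 2
      show ?case
        using hdtl[OF pure] pure cd W_carrier[of "[]"] W_lstable[OF lst(1)] Cs(6)
        by (auto simp: lact_LT(2)[OF lst(1)] R.m_assoc CA)
    next
      case 3
      show ?case
        using bl[OF pure] pure cd W_carrier[of _ _ "[]"] lpure_rel(1)[of _ _ "[]"] W_rstable[OF lst(2)] Cs(7)
        by (auto simp: ract_LT(2)[OF lst(2)] R.r_distr CA)
    next
      case 4
      show ?case
        using bl[OF pure] pure cd W_carrier[of _ _ "[]"] W_rstable[OF lst(2)] Cs(6)
        by (auto simp: ract_LT(2)[OF lst(2)] R.m_assoc CA)
    }
  next
    case (add s t)
    { case 1 then show ?case using add cd Cs(7) by (simp add: lD LQ.N.a_ac)
    next case 2 then show ?case using add cd Cs(6) by (simp add: lD)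
    next case 3 then show ?case using add cd Cs(7) by (simp add: rD LQ.N.a_ac)
    next case 4 then show ?case using add cd Cs(6) by (simp add: rD) }
  qed
  have one: "\<one>\<^bsub>A\<^esub> \<odot>\<^bsub>LT\<^esub> t = t" "t \<triangleleft>\<^bsub>LT\<^esub> \<one>\<^bsub>A\<^esub> = t" if "t \<in> carrier LQ" for t
    using that
  proof (induction rule: ltensor_induct)
    case (pure w)
    { case 1 show ?case using hdtl[OF pure] pure W_carrier[of "[]"] Cs(3) by (auto simp: lact_LT(2)[OF lst(1)])
    next case 2 show ?case using bl[OF pure] pure W_carrier[of _ _ "[]"] Cs(3) by (auto simp: ract_LT(2)[OF lst(2)]) }
  next
    case (add s t)
    { case 1 then show ?case using add Cs(3) by (simp add: lD)
    next case 2 then show ?case using add Cs(3) by (simp add: rD) }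
  qed
  have lr: "(c \<odot>\<^bsub>LT\<^esub> t) \<triangleleft>\<^bsub>LT\<^esub> d = c \<odot>\<^bsub>LT\<^esub> (t \<triangleleft>\<^bsub>LT\<^esub> d)" if cd: "c \<in> C" "d \<in> C" and t: "t \<in> carrier LQ" for c d t
    using t
  proof (induction rule: ltensor_induct)
    case (pure w)
    obtain x v where w: "w = x # v" using hdtl[OF pure] by blast
    \<comment> \<open>In a word of one letter both actions meet the same letter and commute by
      associativity of \<open>A\<close>; in longer words they meet different letters.\<close>
    show ?case
    proof (cases v rule: rev_cases)
      case Nil
      then show ?thesis
        using pure w cd W_lstable[OF lst(1)[OF cd(1)], of x "[]"] W_rstable[OF lst(2)[OF cd(2)], of "[]" x]
          ract_LT(2)[OF lst(2)[OF cd(2)], of "[]"] lact_LT(2)[OF lst(1)[OF cd(1)], of _ "[]"] W_carrier[of "[]" x "[]"]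
        by (simp add: R.m_assoc CA)
    next
      case (snoc v' y)
      then show ?thesis
        using pure w cd W_lstable[OF lst(1)[OF cd(1)], of x v] W_rstable[OF lst(2)[OF cd(2)], of "x # v'" y]
          ract_LT(2)[OF lst(2)[OF cd(2)], of "_ # v'"] lact_LT(2)[OF lst(1)[OF cd(1)]]
        by simp
    qed
  next
    case (add s t)
    then show ?case using cd by (simp add: lD rD)
  qed
  have scal: "(c \<odot>\<^bsub>A\<^esub> \<one>\<^bsub>A\<^esub>) \<odot>\<^bsub>LT\<^esub> t = c \<odot>\<^bsub>LQ\<^esub> t" "t \<triangleleft>\<^bsub>LT\<^esub> (c \<odot>\<^bsub>A\<^esub> \<one>\<^bsub>A\<^esub>) = c \<odot>\<^bsub>LQ\<^esub> t"
    if c: "c \<in> carrier k" and t: "t \<in> carrier LQ" for c t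
    using t
  proof (induction rule: ltensor_induct)
    case (pure w)
    { case 1 show ?case
        using hdtl[OF pure] pure c W_carrier[of "[]"] lpure_rel(2)[OF c, of "[]"]
        by (auto simp: lact_LT(2)[OF lst(1)[OF Cone]] scalar_central)
    next case 2 show ?case
        using bl[OF pure] pure c W_carrier[of _ _ "[]"] lpure_rel(2)[OF c, of _ _ "[]"]
        by (auto simp: ract_LT(2)[OF lst(2)[OF Cone]] scalar_central) }
  next
    case (add s t)
    { case 1 then show ?case using add c Cone by (simp add: lD LQ.smult_r_distr)
    next case 2 then show ?case using add c Cone by (simp add: rD LQ.smult_r_distr) }
  qed
  have "left_module (subalg A C) LT"
    by (rule left_moduleI[OF Cring LT_abelian_group]) (simp_all add: lD l_distr l_assoc one)
  moreover have "left_module (opp (subalg A C)) (right_part LT)"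
    by (rule left_moduleI[OF ring_opp[OF Cring]])
      (simp_all add: rD r_distr r_assoc one abelian_group_cong[OF LQ.N.abelian_group_axioms])
  ultimately show ?thesis by (simp add: is_bimodule_def lr scal)
qed

lemma LT_scalar:
  assumes "lstable (c \<odot>\<^bsub>A\<^esub> \<one>\<^bsub>A\<^esub>)" "c \<in> carrier k" "t \<in> carrier LQ"
  shows "(c \<odot>\<^bsub>A\<^esub> \<one>\<^bsub>A\<^esub>) \<odot>\<^bsub>LT\<^esub> t = c \<odot>\<^bsub>LQ\<^esub> t"
  using assms(3)
proof (induction rule: ltensor_induct)
  case (pure w)
  then obtain x v where "w = x # v" using W_nonempty by (cases w) auto
  then show ?case
    using pure assms(1,2) W_carrier[of "[]"] lpure_rel(2)[OF assms(2), of "[]"]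
    by (auto simp: lact_LT(2) scalar_central)
next
  case (add s t)
  then show ?case using assms by (simp add: linear_mapD[OF lact_LT(1)] LQ.smult_r_distr)
qed

end

section \<open>The extension of enveloping algebras\<close>

lemma subalg_carrier [simp]: "subalg A (carrier A) = A" by simp

context sub_algebra
begin

lemma subalg_ring: "ring (subalg A B)" by (rule R.subring_is_ring[OF B(1)])

lemma subalg_algebra: "k_algebra k (subalg A B)"
  using subalg_ring Rk.left_module_carrier_update[OF B(2)] B_simps(1)
  by (simp add: k_algebra_def module_iff_left_module k.is_cring smult_mult)

sublocale EB: env_data k "subalg A B"
  by (intro env_data.intro base_algebraI subalg_algebra)

abbreviation "bpure \<equiv> tensor_pure k (ground k) (subalg A B) (opp (subalg A B))"
abbreviation "\<iota> \<equiv> env_incl k A B"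

lemma env_incl: "linear_map k EB.TA.AA.T TA.AA.T \<iota>"
  "\<lbrakk>b \<in> B; b' \<in> B\<rbrakk> \<Longrightarrow> \<iota> (bpure b b') = epure b b'"
proof -
  have "bilinear k (ground k) (subalg A B) (opp (subalg A B)) TA.AA.T epure"
    by (rule EB.TA.AA_bilinearI) (simp_all add: B_simps(1) epure_closed epure_add epure_smult)
  note l = EB.TA.AA.tensor_lift[OF TA.AA.tensor_left_module this]
  show "linear_map k EB.TA.AA.T TA.AA.T \<iota>" unfolding env_incl_def by (rule l(1))
  show "\<iota> (bpure b b') = epure b b'" if "b \<in> B" "b' \<in> B"
    unfolding env_incl_def using l(2) that by simp
qed

lemma env_incl_mult:
  assumes "C \<in> carrier EB.TA.AA.T" "D \<in> carrier EB.TA.AA.T"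
  shows "\<iota> (C \<otimes>\<^bsub>env k (subalg A B)\<^esub> D) = \<iota> C \<otimes>\<^bsub>env k A\<^esub> \<iota> D"
  using assms(1)
proof (induction rule: EB.TA.AA.tensor_induct)
  note iD = linear_mapD[OF env_incl(1)]
  note Bl = EB.env.R.l_distr[simplified] EB.env.R.r_distr[simplified] EB.env.R.m_closed[simplified]
  note Al = env.R.l_distr[simplified] env.R.r_distr[simplified] env.R.m_closed[simplified]
  case (pure b b')
  show ?case using assms(2)
  proof (induction rule: EB.TA.AA.tensor_induct)
    case (pure c c')
    then show ?case
      using \<open>b \<in> _\<close> \<open>b' \<in> _\<close> by (simp add: EB.epure_mult epure_mult env_incl(2) B_simps)
  next
    case (add D D')
    then show ?case
      using pure by (simp add: Bl Al iD EB.epure_closed)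
  qed
next
  case (add C C')
  then show ?case
    using assms(2) by (simp add: EB.env.R.l_distr[simplified] EB.env.R.m_closed[simplified]
        env.R.l_distr[simplified] linear_mapD[OF env_incl(1)])
qed

lemma env_rel_ext: "rel_ext k (env k A) (env k (subalg A B)) \<iota>"
proof (intro rel_ext.intro rel_ext_axioms.intro env.base_algebra_axioms EB.env.base_algebra_axioms)
  show "\<iota> \<in> ring_hom (env k (subalg A B)) (env k A)"
    by (rule ring_hom_memI) (simp_all add: linear_mapD[OF env_incl(1)] env_incl_mult env_incl(2) B_simps)
qed (simp add: linear_mapD[OF env_incl(1)])

lemma restrict_bimodule:
  assumes "is_bimodule k A X"
  shows "is_bimodule k (subalg A B) X"
proof -
  interpret X: bimod k A X by (intro bimod.intro bimod_axioms.intro env_data_axioms assms)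
  have "left_module (subalg A B) X"
    by (rule left_moduleI[OF subalg_ring X.L.N.abelian_group_axioms]) (simp_all add: B_simps(1) X.lact)
  moreover have "left_module (opp (subalg A B)) (right_part X)"
    by (rule left_moduleI[OF ring_opp[OF subalg_ring]])
      (simp_all add: B_simps(1) X.ract abelian_group_cong[OF X.L.N.abelian_group_axioms])
  ultimately show ?thesis by (simp add: is_bimodule_def B_simps(1) X.lract X.scalar_lr)
qed

end

lemma (in env_data) bimodI: "is_bimodule k A X \<Longrightarrow> bimod k A X"
  by (intro bimod.intro bimod_axioms.intro env_data_axioms)

locale restricted_bimod = sub_algebra k A B + X: bimod k A X
  for k :: "'k ring" and A :: "('k, 'a) module" and B and X :: "('a, 'x) bimodule"
begin

sublocale XB: bimod k "subalg A B" X by (intro EB.bimodI restrict_bimodule X.bimod)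

lemma kmod_subalg: "kmod (subalg A B) X = kmod A X"
  by (simp add: kmod_def)

text \<open>The actions of the two enveloping algebras are separate linear extensions; both sides
  are linear in \<open>C\<close> and agree on pure tensors.\<close>

lemma env_left_incl:
  assumes "C \<in> carrier EB.TA.AA.T" and x: "x \<in> carrier X"
  shows "C \<odot>\<^bsub>env_left k (subalg A B) X\<^esub> x = \<iota> C \<odot>\<^bsub>env_left k A X\<^esub> x"
  by (rule EB.TA.AA.tensor_ext[OF X.Xk.left_module_axioms XB.env_left_action_linear[OF x, unfolded kmod_subalg]
        linear_map_comp[OF env_incl(1) X.env_left_action_linear[OF x]] _ assms(1)])
    (use x in \<open>simp add: env_incl(2) XB.env_left_pure X.env_left_pure B_simps(1)\<close>)

lemma env_right_incl:
  assumes "C \<in> carrier EB.TA.AA.T" and x: "x \<in> carrier X"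
  shows "C \<odot>\<^bsub>env_right k (subalg A B) X\<^esub> x = \<iota> C \<odot>\<^bsub>env_right k A X\<^esub> x"
  by (rule EB.TA.AA.tensor_ext[OF X.Xk.left_module_axioms XB.env_right_action_linear[OF x, unfolded kmod_subalg]
        linear_map_comp[OF env_incl(1) X.env_right_action_linear[OF x]] _ assms(1)])
    (use x in \<open>simp add: env_incl(2) XB.env_right_pure X.env_right_pure B_simps(1)\<close>)

text \<open>A contracting homotopy has to be linear between restricted modules. As in
  \<open>env_linear_mapI\<close> this is tested on letters, now from \<open>B\<close> only.\<close>

lemma restricted_linear_mapI:
  assumes Z: "left_module (env k A) Z" and cl: "\<And>x. x \<in> carrier X \<Longrightarrow> f x \<in> carrier Z"
    and add: "\<And>x y. \<lbrakk>x \<in> carrier X; y \<in> carrier X\<rbrakk> \<Longrightarrow> f (x \<oplus>\<^bsub>X\<^esub> y) = f x \<oplus>\<^bsub>Z\<^esub> f y"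
    and act: "\<And>b b' x. \<lbrakk>b \<in> B; b' \<in> B; x \<in> carrier X\<rbrakk> \<Longrightarrow>
      f ((b \<odot>\<^bsub>X\<^esub> x) \<triangleleft>\<^bsub>X\<^esub> b') = epure b b' \<odot>\<^bsub>Z\<^esub> f x"
  shows "linear_map (env k (subalg A B)) (restrict_scalars \<iota> (env_left k A X)) (restrict_scalars \<iota> Z) f"
proof -
  interpret E: rel_ext k "env k A" "env k (subalg A B)" \<iota> by (rule env_rel_ext)
  have "linear_map (env k (subalg A B)) (env_left k (subalg A B) X) (restrict_scalars \<iota> Z) f"
    using cl add act by (intro XB.env_linear_mapI E.restrict_left_module Z) (simp_all add: env_incl(2))
  note D = linear_mapD[OF this]
  show ?thesis
    by (rule linear_mapI) (use D in \<open>simp_all add: env_left_incl\<close>)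
qed

end

section \<open>The reduced relative bar complex\<close>

text \<open>\<open>contract_at\<close> counts letters from one and lists count from zero: the
  argument \<open>Suc i\<close> merges the letters at list positions \<open>i\<close> and
  \<open>Suc i\<close>.\<close>

lemma contract_at_Suc:
  "Suc i < length w \<Longrightarrow> contract_at A w (Suc i) = take i w @ (w ! i \<otimes>\<^bsub>A\<^esub> w ! Suc i) # drop (i + 2) w"
  by (simp add: contract_at_def)

lemma contract_at_append:
  "Suc i < length u \<Longrightarrow> contract_at A (u @ v) (Suc i) = contract_at A u (Suc i) @ v"
  "contract_at A (u @ x # y # v) (Suc (length u)) = u @ (x \<otimes>\<^bsub>A\<^esub> y) # v"
  "contract_at A (u @ v) (Suc (length u + i)) = u @ contract_at A v (Suc i)"
  by (simp_all add: contract_at_def nth_append)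

lemma contract_at_Cons:
  "contract_at A (x # v) (Suc (Suc i)) = x # contract_at A v (Suc i)"
  "contract_at A (x # y # v) (Suc 0) = (x \<otimes>\<^bsub>A\<^esub> y) # v"
  by (simp_all add: contract_at_def)

lemma length_contract_at: "Suc i < length w \<Longrightarrow> length (contract_at A w (Suc i)) = length w - 1"
  by (simp add: contract_at_def)

lemma a_inv_cong:
  assumes "carrier N' = carrier N" "add N' = add N" "zero N' = zero N"
  shows "\<ominus>\<^bsub>N'\<^esub> x = \<ominus>\<^bsub>N\<^esub> x"
  by (simp add: a_inv_def m_inv_def assms)

text \<open>Sums and signs see a record only through carrier, addition and zero. The computations
  run in \<open>Bar.LQ\<close> or \<open>kmod A X\<close>, whereas the statement speaks of bimodules
  with the same additive group.\<close>

lemma finsum_record_cong: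
  assumes "carrier N' = carrier N" "add N' = add N" "zero N' = zero N"
  shows "finsum N' f I = finsum N f I"
  by (simp add: finsum_def finprod_def assms)

lemma alt_sign_record_cong:
  assumes "carrier N' = carrier N" "add N' = add N" "zero N' = zero N"
  shows "alt_sign N' i x = alt_sign N i x"
  by (simp add: alt_sign_def a_inv_cong[OF assms])

lemma (in abelian_group) alt_sign:
  "x \<in> carrier G \<Longrightarrow> alt_sign G i x \<in> carrier G"
  "x \<in> carrier G \<Longrightarrow> alt_sign G (Suc i) x = \<ominus> alt_sign G i x"
  "alt_sign G 0 x = x"
  "x \<in> carrier G \<Longrightarrow> y \<in> carrier G \<Longrightarrow> alt_sign G i (x \<oplus> y) = alt_sign G i x \<oplus> alt_sign G i y"
  by (auto simp: alt_sign_def minus_add)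

lemma (in abelian_group) finsum_uminus:
  assumes "finite I" "f \<in> I \<rightarrow> carrier G"
  shows "(\<Oplus>i\<in>I. \<ominus> f i) = \<ominus> (\<Oplus>i\<in>I. f i)"
proof -
  have z: "\<ominus> \<zero> = \<zero>" by (rule minus_equality) auto
  show ?thesis using assms by (induction I) (auto simp: minus_add Pi_iff finsum_insert z)
qed

lemma (in abelian_group) finsum_atMost_Suc_shift:
  assumes "\<And>i. i \<le> Suc n \<Longrightarrow> f i \<in> carrier G"
  shows "(\<Oplus>i\<in>{..Suc n}. f i) = f 0 \<oplus> (\<Oplus>i\<in>{..n}. f (Suc i))"
  using assms by (simp add: atMost_Suc_eq_insert_0 finsum_insert finsum_reindex Pi_iff)

lemma linear_map_alt_sign:
  assumes "linear_map R N N' f" "abelian_group N" "abelian_group N'" "x \<in> carrier N"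
  shows "f (alt_sign N i x) = alt_sign N' i (f x)"
  using linear_map_minus[OF assms] by (simp add: alt_sign_def)

lemma balanced_alt_sign:
  assumes "left_module k Z" "balanced k A B Ns Z \<phi>"
  shows "balanced k A B Ns Z (\<lambda>w. alt_sign Z i (\<phi> w))"
proof -
  interpret Z: left_module k Z by fact
  note D = balancedD[OF assms(2)]
  have sm: "alt_sign Z i (c \<odot>\<^bsub>Z\<^esub> x) = c \<odot>\<^bsub>Z\<^esub> alt_sign Z i x" if "c \<in> carrier k" "x \<in> carrier Z" for c x
    using that by (simp add: alt_sign_def Z.lmult_minus)
  show ?thesis
  proof (rule balancedI)
    fix u x y v assume w: "u @ x # v \<in> listset Ns" "u @ y # v \<in> listset Ns"
    then show "alt_sign Z i (\<phi> (u @ (x \<oplus>\<^bsub>A\<^esub> y) # v)) = alt_sign Z i (\<phi> (u @ x # v)) \<oplus>\<^bsub>Z\<^esub> alt_sign Z i (\<phi> (u @ y # v))"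
      using D(2)[OF w] D(1) by (simp add: Z.N.alt_sign)
  qed (auto simp: D Z.N.alt_sign sm)
qed

context base_ring
begin

lemma smult_linear:
  assumes "left_module k N" "c \<in> carrier k"
  shows "linear_map k N N (\<lambda>x. c \<odot>\<^bsub>N\<^esub> x)"
proof -
  interpret N: left_module k N by fact
  show ?thesis
    using assms(2) by (auto intro!: linear_mapI simp: N.smult_closed N.smult_r_distr k.m_comm simp flip: N.smult_assoc)
qed

text \<open>The hypothesis \<open>mult\<close> places the right-hand word of each exchange in the
  domain, where the summands are known to lie in the carrier.\<close>

lemma balanced_finsum:
  assumes "left_module k Z" "finite I" "\<And>i. i \<in> I \<Longrightarrow> balanced k A B Ns Z (\<phi> i)"
    and mult: "\<And>b u x y v. \<lbrakk>b \<in> B; u @ x # y # v \<in> listset Ns\<rbrakk> \<Longrightarrow> u @ x # (b \<otimes>\<^bsub>A\<^esub> y) # v \<in> listset Ns"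
  shows "balanced k A B Ns Z (\<lambda>w. \<Oplus>\<^bsub>Z\<^esub>i\<in>I. \<phi> i w)"
proof -
  interpret Z: left_module k Z by fact
  note D = balancedD[OF assms(3)]
  show ?thesis
  proof (rule balancedI)
    fix w assume w: "w \<in> listset Ns"
    show "(\<Oplus>\<^bsub>Z\<^esub>i\<in>I. \<phi> i w) \<in> carrier Z" by (rule Z.N.finsum_closed) (use D(1)[OF _ w] in auto)
  next
    fix u x y v assume w: "u @ x # v \<in> listset Ns" "u @ y # v \<in> listset Ns"
    have "(\<Oplus>\<^bsub>Z\<^esub>i\<in>I. \<phi> i (u @ (x \<oplus>\<^bsub>A\<^esub> y) # v)) = (\<Oplus>\<^bsub>Z\<^esub>i\<in>I. \<phi> i (u @ x # v) \<oplus>\<^bsub>Z\<^esub> \<phi> i (u @ y # v))"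
      by (rule Z.N.finsum_cong') (use D(1,2) w in auto)
    also have "\<dots> = (\<Oplus>\<^bsub>Z\<^esub>i\<in>I. \<phi> i (u @ x # v)) \<oplus>\<^bsub>Z\<^esub> (\<Oplus>\<^bsub>Z\<^esub>i\<in>I. \<phi> i (u @ y # v))"
      by (rule Z.N.finsum_addf) (use D(1) w in auto)
    finally show "(\<Oplus>\<^bsub>Z\<^esub>i\<in>I. \<phi> i (u @ (x \<oplus>\<^bsub>A\<^esub> y) # v)) =
        (\<Oplus>\<^bsub>Z\<^esub>i\<in>I. \<phi> i (u @ x # v)) \<oplus>\<^bsub>Z\<^esub> (\<Oplus>\<^bsub>Z\<^esub>i\<in>I. \<phi> i (u @ y # v))" .
  next
    fix c u x v assume c: "c \<in> carrier k" and w: "u @ x # v \<in> listset Ns"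
    have "(\<Oplus>\<^bsub>Z\<^esub>i\<in>I. \<phi> i (u @ (c \<odot>\<^bsub>A\<^esub> x) # v)) = (\<Oplus>\<^bsub>Z\<^esub>i\<in>I. c \<odot>\<^bsub>Z\<^esub> \<phi> i (u @ x # v))"
      by (rule Z.N.finsum_cong') (use D(1,3) c w in \<open>auto simp: Z.smult_closed\<close>)
    also have "\<dots> = c \<odot>\<^bsub>Z\<^esub> (\<Oplus>\<^bsub>Z\<^esub>i\<in>I. \<phi> i (u @ x # v))"
      by (rule linear_map_finsum[OF smult_linear[OF assms(1) c], symmetric])
        (use D(1) w assms(2) Z.N.abelian_group_axioms in auto)
    finally show "(\<Oplus>\<^bsub>Z\<^esub>i\<in>I. \<phi> i (u @ (c \<odot>\<^bsub>A\<^esub> x) # v)) = c \<odot>\<^bsub>Z\<^esub> (\<Oplus>\<^bsub>Z\<^esub>i\<in>I. \<phi> i (u @ x # v))" .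
  next
    fix b u x y v assume b: "b \<in> B" and w: "u @ x # y # v \<in> listset Ns"
    show "(\<Oplus>\<^bsub>Z\<^esub>i\<in>I. \<phi> i (u @ (x \<otimes>\<^bsub>A\<^esub> b) # y # v)) = (\<Oplus>\<^bsub>Z\<^esub>i\<in>I. \<phi> i (u @ x # (b \<otimes>\<^bsub>A\<^esub> y) # v))"
      by (rule Z.N.finsum_cong') (use D(4)[OF _ b w] D(1)[OF _ mult[OF b w]] in auto)
  qed
qed

end

locale split_ext = env_data k A for k :: "'k ring" and A :: "('k, 'a) module" +
  fixes B M :: "'a set"
  assumes split: "split_extension k A B M"
begin

sublocale sub_algebra k A B
  using split by (intro sub_algebra.intro sub_algebra_axioms.intro env_data_axioms) (auto simp: split_extension_def)

lemma M_ideal: "ideal M A" using split by (simp add: split_extension_def)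

sublocale M: ideal M A by (rule M_ideal)

lemma M_simps:
  "x \<in> M \<Longrightarrow> x \<in> carrier A" "\<zero>\<^bsub>A\<^esub> \<in> M" "\<lbrakk>x \<in> M; y \<in> M\<rbrakk> \<Longrightarrow> x \<oplus>\<^bsub>A\<^esub> y \<in> M"
  "\<lbrakk>a \<in> carrier A; x \<in> M\<rbrakk> \<Longrightarrow> a \<otimes>\<^bsub>A\<^esub> x \<in> M" "\<lbrakk>a \<in> carrier A; x \<in> M\<rbrakk> \<Longrightarrow> x \<otimes>\<^bsub>A\<^esub> a \<in> M"
  using M.a_subset M.I_l_closed M.I_r_closed M.a_closed M.zero_closed by auto

lemma M_smult: "\<lbrakk>c \<in> carrier k; x \<in> M\<rbrakk> \<Longrightarrow> c \<odot>\<^bsub>A\<^esub> x \<in> M"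
  using M_simps(4)[OF scalar_closed, of c x] scalar_central(1)[of c x] M_simps(1)[of x] by simp

lemma M_submodule: "submodule M k A"
  by (rule Rk.submoduleI') (use M_simps M_smult in auto)

lemma carrier_submodule: "submodule (carrier A) k A"
  by (rule Rk.submoduleI') (auto simp: Rk.smult_closed)

lemma factors: "factor M" "factor (carrier A)" "factor B"
  using M_submodule carrier_submodule B(2)
  by (auto simp: factor_def M_simps B_simps)

lemma split_sum: "M \<inter> B = {\<zero>\<^bsub>A\<^esub>}" "M <+>\<^bsub>A\<^esub> B = carrier A"
proof -
  have BM: "B \<inter> M = {\<zero>\<^bsub>A\<^esub>}" "B <+>\<^bsub>A\<^esub> M = carrier A"
    using split by (auto simp: split_extension_def)
  show "M \<inter> B = {\<zero>\<^bsub>A\<^esub>}" using BM by blast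
  have "M <+>\<^bsub>A\<^esub> B = B <+>\<^bsub>A\<^esub> M"
    using R.a_comm[OF M_simps(1) B_simps(1)] unfolding set_add_def' by (auto, metis+)
  then show "M <+>\<^bsub>A\<^esub> B = carrier A" using BM by simp
qed

text \<open>Characterised merely as a \<open>k\<close>-linear projection onto \<open>M\<close> along
  \<open>B\<close>, which determines it on \<open>A\<close>; linearity over \<open>B\<close> is
  derived in \<open>pM_mult\<close>.\<close>

definition pM :: "'a \<Rightarrow> 'a"
  where "pM = (SOME pr. linear_map k A (subalg A M) pr \<and> (\<forall>m\<in>M. \<forall>b\<in>B. pr (m \<oplus>\<^bsub>A\<^esub> b) = m))"

lemma pM: "linear_map k A (subalg A M) pM" "\<lbrakk>m \<in> M; b \<in> B\<rbrakk> \<Longrightarrow> pM (m \<oplus>\<^bsub>A\<^esub> b) = m"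
proof -
  have "\<exists>pr. linear_map k A (subalg A M) pr \<and> (\<forall>m\<in>M. \<forall>b\<in>B. pr (m \<oplus>\<^bsub>A\<^esub> b) = m)"
    using direct_sum_projection[OF Rk.left_module_axioms M_submodule B(2) split_sum] by metis
  from someI_ex[OF this, folded pM_def]
  show "linear_map k A (subalg A M) pM" "\<lbrakk>m \<in> M; b \<in> B\<rbrakk> \<Longrightarrow> pM (m \<oplus>\<^bsub>A\<^esub> b) = m" by auto
qed

lemmas pM_linear = linear_mapD[OF pM(1), simplified]

lemma decompose:
  assumes "x \<in> carrier A"
  obtains m b where "m \<in> M" "b \<in> B" "x = m \<oplus>\<^bsub>A\<^esub> b" "pM x = m"
  using assms pM(2) unfolding split_sum(2)[symmetric] set_add_def' by blast

lemma pM_M: "m \<in> M \<Longrightarrow> pM m = m"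
  using pM(2)[of m "\<zero>\<^bsub>A\<^esub>"] B_simps(3) M_simps(1) by simp

text \<open>Multiplication by \<open>b\<close> preserves both summands, \<open>M\<close> as an ideal
  and \<open>B\<close> as a subalgebra, and so commutes with the projection.\<close>

lemma pM_mult:
  assumes b: "b \<in> B" and x: "x \<in> carrier A"
  shows "pM (b \<otimes>\<^bsub>A\<^esub> x) = b \<otimes>\<^bsub>A\<^esub> pM x" "pM (x \<otimes>\<^bsub>A\<^esub> b) = pM x \<otimes>\<^bsub>A\<^esub> b"
proof -
  obtain m c where d: "m \<in> M" "c \<in> B" "x = m \<oplus>\<^bsub>A\<^esub> c" "pM x = m" using decompose[OF x] by blast
  have "b \<otimes>\<^bsub>A\<^esub> x = b \<otimes>\<^bsub>A\<^esub> m \<oplus>\<^bsub>A\<^esub> b \<otimes>\<^bsub>A\<^esub> c" "x \<otimes>\<^bsub>A\<^esub> b = m \<otimes>\<^bsub>A\<^esub> b \<oplus>\<^bsub>A\<^esub> c \<otimes>\<^bsub>A\<^esub> b"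
    using d b by (simp_all add: R.r_distr R.l_distr M_simps(1) B_simps(1))
  then show "pM (b \<otimes>\<^bsub>A\<^esub> x) = b \<otimes>\<^bsub>A\<^esub> pM x" "pM (x \<otimes>\<^bsub>A\<^esub> b) = pM x \<otimes>\<^bsub>A\<^esub> b"
    using d b by (simp_all add: pM M_simps B_simps)
qed

section \<open>Bar words and the merging of neighbouring letters\<close>

abbreviation "BF \<equiv> bar_factors A M"

lemma bar_factors_simps: "hd (BF n) = carrier A" "last (BF n) = carrier A" "BF n \<noteq> []"
  "length (BF n) = n + 2"
  "i < n + 2 \<Longrightarrow> BF n ! i = (if i = 0 \<or> i = Suc n then carrier A else M)"
  by (auto simp: bar_factors_def nth_Cons nth_append split: nat.split)

sublocale Bar: ltensor_data k A B "BF n" for n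
  by unfold_locales (auto simp: bar_factors_def factors split: if_splits)

lemma bar_W: "w \<in> listset (BF n) \<longleftrightarrow> length w = n + 2 \<and> (\<forall>i<n + 2. w ! i \<in> carrier A) \<and> (\<forall>i. 1 \<le> i \<longrightarrow> i \<le> n \<longrightarrow> w ! i \<in> M)"
proof -
  have "w ! i \<in> BF n ! i \<longleftrightarrow> w ! i \<in> carrier A \<and> (1 \<le> i \<and> i \<le> n \<longrightarrow> w ! i \<in> M)" if "i < n + 2" for i
    using that M_simps(1) by (auto simp: bar_factors_simps(5)[OF that])
  then show ?thesis
    unfolding listset_iff list_all2_conv_all_nth bar_factors_simps(4) by auto
qed

lemma bar_W_Cons: "a # ms @ [a'] \<in> listset (BF n) \<longleftrightarrow>
    a \<in> carrier A \<and> ms \<in> lists M \<and> length ms = n \<and> a' \<in> carrier A"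
proof -
  have "list_all2 (\<in>) (ms @ [a']) (replicate n M @ [carrier A]) \<longleftrightarrow>
      list_all2 (\<in>) ms (replicate n M) \<and> a' \<in> carrier A"
    by (cases "length ms = n") (auto simp: list_all2_append dest: list_all2_lengthD)
  moreover have "list_all2 (\<in>) ms (replicate n M) \<longleftrightarrow> ms \<in> lists M \<and> length ms = n"
    by (auto simp: list_all2_conv_all_nth in_set_conv_nth lists_eq_set subset_iff)
  ultimately show ?thesis unfolding listset_iff bar_factors_def by simp
qed

lemma bar_W_cases:
  assumes "w \<in> listset (BF n)"
  obtains a ms a' where "w = a # ms @ [a']" "a \<in> carrier A" "ms \<in> lists M" "length ms = n" "a' \<in> carrier A"
proof -
  have l: "length w = n + 2" using assms by (simp add: bar_W)
  obtain a v where "w = a # v" "length v = Suc n" using l by (cases w) auto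
  moreover obtain ms a' where "v = ms @ [a']" using calculation by (cases v rule: rev_cases) auto
  ultimately show ?thesis using assms that bar_W_Cons by simp
qed

lemma bar_stable: "a \<in> carrier A \<Longrightarrow> Bar.lstable n a" "a \<in> carrier A \<Longrightarrow> Bar.rstable n a"
  by (simp_all add: Bar.lstable_def Bar.rstable_def bar_factors_simps)

text \<open>A product of two inner letters stays in \<open>M\<close>. In the outer cases
  \<open>i = 0\<close> and \<open>i = Suc m\<close> the product becomes the new outer letter, where
  membership in \<open>A\<close> is enough.\<close>

lemma contract_closed:
  assumes w: "w \<in> listset (BF (Suc m))" and i: "i \<le> Suc m"
  shows "contract_at A w (Suc i) \<in> listset (BF m)"
proof -
  have l: "length w = m + 3" and A: "\<And>j. j < m + 3 \<Longrightarrow> w ! j \<in> carrier A"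
    and M: "\<And>j. 1 \<le> j \<Longrightarrow> j \<le> Suc m \<Longrightarrow> w ! j \<in> M"
    using w by (auto simp: bar_W)
  have nth: "contract_at A w (Suc i) ! j = (if j < i then w ! j else if j = i then w ! i \<otimes>\<^bsub>A\<^esub> w ! Suc i else w ! Suc j)"
    if "j < m + 2" for j
  proof (cases "i < j")
    case True
    then obtain r where "j = Suc (i + r)" using less_imp_Suc_add by blast
    then show ?thesis using that l i by (simp add: contract_at_Suc nth_append)
  qed (use that l i in \<open>auto simp: contract_at_Suc nth_append\<close>)
  show ?thesis
    unfolding bar_W
  proof (intro conjI allI impI)
    show "length (contract_at A w (Suc i)) = m + 2" using l i by (simp add: length_contract_at)
    show "contract_at A w (Suc i) ! j \<in> carrier A" if "j < m + 2" for j
      using that A i by (auto simp: nth)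
    show "contract_at A w (Suc i) ! j \<in> M" if "1 \<le> j" "j \<le> m" for j
      using that A M i by (auto simp: nth intro: M_simps)
  qed
qed

text \<open>Locates the merged pair relative to a marked letter \<open>z\<close>. In each case the
  outcome contains \<open>z\<close> in one visible place and holds uniformly in \<open>z\<close>, so
  a relation at \<open>z\<close> turns into a relation at that place.\<close>

lemma contract_letter:
  assumes "Suc i < length (u @ z # v)"
  obtains (before) u' where "Suc i < length u" "\<And>z v. contract_at A (u @ z # v) (Suc i) = u' @ z # v"
  | (left) u' s where "Suc i = length u" "u = u' @ [s]" "\<And>z v. contract_at A (u @ z # v) (Suc i) = u' @ (s \<otimes>\<^bsub>A\<^esub> z) # v"
  | (right) q v' where "i = length u" "v = q # v'" "\<And>z. contract_at A (u @ z # v) (Suc i) = u @ (z \<otimes>\<^bsub>A\<^esub> q) # v'"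
  | (after) v' where "length u < i" "\<And>z. contract_at A (u @ z # v) (Suc i) = u @ z # v'"
proof -
  consider "Suc i < length u" | "Suc i = length u" | "i = length u" | "length u < i" by linarith
  then show ?thesis
  proof cases
    case 1
    show ?thesis by (rule before[OF 1]) (rule contract_at_append(1)[OF 1])
  next
    case 2
    then obtain u' s where u: "u = u' @ [s]" by (cases u rule: rev_cases) auto
    have "contract_at A (u @ z # v) (Suc i) = u' @ (s \<otimes>\<^bsub>A\<^esub> z) # v" for z v
      using 2 contract_at_append(2)[of A u' s z v] by (simp add: u)
    then show ?thesis by (rule left[OF 2 u])
  next
    case 3
    then obtain q v' where v: "v = q # v'" using assms by (cases v) auto
    show ?thesis by (rule right[OF 3 v]) (simp add: 3 v contract_at_append(2))
  next
    case 4
    then obtain j where j: "i = Suc (length u + j)" using less_imp_Suc_add by blast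
    have "contract_at A (u @ z # v) (Suc i) = u @ z # contract_at A v (Suc j)" for z
      using contract_at_append(3)[of A "u @ [z]" v j] by (simp add: j)
    then show ?thesis by (rule after[OF 4])
  qed
qed

text \<open>Each face respects the relations separately, so the alternating sum never has to be
  examined as a whole.\<close>

lemma balanced_contract:
  assumes Z: "left_module k Z" and \<psi>: "balanced k A B (BF m) Z \<psi>" and i: "i \<le> Suc m"
  shows "balanced k A B (BF (Suc m)) Z (\<lambda>w. \<psi> (contract_at A w (Suc i)))"
proof -
  note D = balancedD[OF \<psi>]
  have len: "Suc i < length w" if "w \<in> listset (BF (Suc m))" for w
    using that i by (simp add: bar_W)
  have cA: "x \<in> carrier A" if "w \<in> listset (BF (Suc m))" "x \<in> set w" for w x
    using that by (rule Bar.W_letter)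
  show ?thesis
  proof (rule balancedI)
    show "\<psi> (contract_at A w (Suc i)) \<in> carrier Z" if "w \<in> listset (BF (Suc m))" for w
      by (rule D(1)[OF contract_closed[OF that i]])
  next
    fix u x y v assume w: "u @ x # v \<in> listset (BF (Suc m))" "u @ y # v \<in> listset (BF (Suc m))"
    note cl = contract_closed[OF w(1) i] contract_closed[OF w(2) i]
    note xy = cA[OF w(1)] cA[OF w(2), of y]
    from len[OF w(1)] show "\<psi> (contract_at A (u @ (x \<oplus>\<^bsub>A\<^esub> y) # v) (Suc i)) =
        \<psi> (contract_at A (u @ x # v) (Suc i)) \<oplus>\<^bsub>Z\<^esub> \<psi> (contract_at A (u @ y # v) (Suc i))"
      by (cases rule: contract_letter) (use cl D(2) xy in \<open>simp_all add: R.r_distr R.l_distr\<close>)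
  next
    fix c u x v assume c: "c \<in> carrier k" and w: "u @ x # v \<in> listset (BF (Suc m))"
    note cl = contract_closed[OF w i]
    note x = cA[OF w]
    from len[OF w] show "\<psi> (contract_at A (u @ (c \<odot>\<^bsub>A\<^esub> x) # v) (Suc i)) =
        c \<odot>\<^bsub>Z\<^esub> \<psi> (contract_at A (u @ x # v) (Suc i))"
      by (cases rule: contract_letter) (use cl D(3)[OF c] x c in \<open>simp_all add: smult_mult\<close>)
  next
    fix b u x y v assume b: "b \<in> B" and w: "u @ x # y # v \<in> listset (BF (Suc m))"
    note cl = contract_closed[OF w i]
    note xy = cA[OF w] and bA = B_simps(1)[OF b]
    from len[OF w] show "\<psi> (contract_at A (u @ (x \<otimes>\<^bsub>A\<^esub> b) # y # v) (Suc i)) =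
        \<psi> (contract_at A (u @ x # (b \<otimes>\<^bsub>A\<^esub> y) # v) (Suc i))"
    proof (cases rule: contract_letter)
      \<comment> \<open>The merged pair begins to the right of \<open>x\<close>, so its position
        relative to \<open>y\<close> matters as well.\<close>
      case (after v'')
      have "Suc i < length ((u @ [x]) @ y # v)" using len[OF w] by simp
      then show ?thesis
      proof (cases rule: contract_letter)
        case (left u' s)
        then show ?thesis using after by simp
      next
        case (right q v')
        show ?thesis
          using right(3)[of y] right(3)[of "b \<otimes>\<^bsub>A\<^esub> y"] contract_at_append(2)[of A "u @ [x \<otimes>\<^bsub>A\<^esub> b]" y q v'] right(1,2)
            cl D(4)[OF b, of u x "y \<otimes>\<^bsub>A\<^esub> q" v'] xy bA
          by (simp add: R.m_assoc)
      next
        case (after v')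
        obtain j where j: "i = length u + 2 + j" using less_imp_Suc_add[OF after(1)] by auto
        have "contract_at A (u @ x' # y' # v) (Suc i) = u @ x' # y' # contract_at A v (Suc j)" for x' y'
          using contract_at_append(3)[of A "u @ [x', y']" v j] by (simp add: j)
        then show ?thesis using cl D(4)[OF b] by simp
      qed (use after in simp_all)
    next
      \<comment> \<open>Here \<open>x\<close> and \<open>y\<close> themselves are merged, and
        \<open>(x b) y = x (b y)\<close> already holds before \<open>\<psi>\<close> is
        applied.\<close>
      case (right q v')
      then show ?thesis using xy bA by (simp add: contract_at_append(2) R.m_assoc)
    qed (use cl D(4)[OF b] xy bA in \<open>simp_all add: R.m_assoc[symmetric]\<close>)
  qed
qed

subsection \<open>The differential, the augmentation and the contracting homotopy\<close>

text \<open>The index \<open>m\<close> is the degree of the target and \<open>i\<close> counts from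
  zero; hence the differential out of degree \<open>m + 1\<close> sums over
  \<open>i \<le> m + 1\<close> and starts with a positive sign.\<close>

definition face :: "nat \<Rightarrow> nat \<Rightarrow> 'a list \<Rightarrow> ('a list \<Rightarrow> 'k) set"
  where "face m i w = alt_sign (Bar.LQ m) i (Bar.lpure m (contract_at A w (Suc i)))"

definition bar_d :: "nat \<Rightarrow> ('a list \<Rightarrow> 'k) set \<Rightarrow> ('a list \<Rightarrow> 'k) set"
  where "bar_d n = lin_ext k (Bar.LQ (n - 1)) (\<lambda>w. \<Oplus>\<^bsub>Bar.LQ (n - 1)\<^esub>i\<in>{..n}. face (n - 1) i w)"

definition bar_\<epsilon> :: "('a list \<Rightarrow> 'k) set \<Rightarrow> 'a"
  where "bar_\<epsilon> = lin_ext k A (\<lambda>w. hd w \<otimes>\<^bsub>A\<^esub> last w)"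

definition bar_\<eta> :: "'a \<Rightarrow> ('a list \<Rightarrow> 'k) set"
  where "bar_\<eta> a = Bar.lpure 0 [\<one>\<^bsub>A\<^esub>, a]"

definition shift_word :: "'a list \<Rightarrow> 'a list"
  where "shift_word w = \<one>\<^bsub>A\<^esub> # pM (hd w) # tl w"

definition bar_h :: "nat \<Rightarrow> ('a list \<Rightarrow> 'k) set \<Rightarrow> ('a list \<Rightarrow> 'k) set"
  where "bar_h n = lin_ext k (Bar.LQ (Suc n)) (\<lambda>w. Bar.lpure (Suc n) (shift_word w))"

lemma face_closed: "\<lbrakk>w \<in> listset (BF (Suc m)); i \<le> Suc m\<rbrakk> \<Longrightarrow> face m i w \<in> carrier (Bar.LQ m)"
  by (simp add: face_def Bar.LQ.N.alt_sign Bar.lpure_closed contract_closed)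

lemma bar_d: "linear_map k (Bar.LQ (Suc m)) (Bar.LQ m) (bar_d (Suc m))"
  "w \<in> listset (BF (Suc m)) \<Longrightarrow> bar_d (Suc m) (Bar.lpure (Suc m) w) = (\<Oplus>\<^bsub>Bar.LQ m\<^esub>i\<in>{..Suc m}. face m i w)"
proof -
  have "balanced k A B (BF (Suc m)) (Bar.LQ m) (\<lambda>w. \<Oplus>\<^bsub>Bar.LQ m\<^esub>i\<in>{..Suc m}. face m i w)"
    unfolding face_def
    by (intro balanced_finsum balanced_alt_sign balanced_contract Bar.LQ_left_module Bar.lpure_balanced Bar.W_mult_left2)
      auto
  note l = Bar.lift[OF Bar.LQ_left_module this]
  show "linear_map k (Bar.LQ (Suc m)) (Bar.LQ m) (bar_d (Suc m))"
    "w \<in> listset (BF (Suc m)) \<Longrightarrow> bar_d (Suc m) (Bar.lpure (Suc m) w) = (\<Oplus>\<^bsub>Bar.LQ m\<^esub>i\<in>{..Suc m}. face m i w)"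
    unfolding bar_d_def using l by simp_all
qed

lemma bar_\<epsilon>: "linear_map k (Bar.LQ 0) A bar_\<epsilon>"
  "\<lbrakk>a \<in> carrier A; a' \<in> carrier A\<rbrakk> \<Longrightarrow> bar_\<epsilon> (Bar.lpure 0 [a, a']) = a \<otimes>\<^bsub>A\<^esub> a'"
proof -
  have W0: "w \<in> listset (BF 0) \<longleftrightarrow> (\<exists>a a'. w = [a, a'] \<and> a \<in> carrier A \<and> a' \<in> carrier A)" for w
    using bar_W_cases[of w 0] bar_W_Cons[of _ "[]" _ 0] by (metis append_Nil length_0_conv lists.Nil)
  have "balanced k A B (BF 0) A (\<lambda>w. hd w \<otimes>\<^bsub>A\<^esub> last w)"
    by (rule balancedI) (auto simp: W0 Cons_eq_append_conv append_eq_Cons_conv R.l_distr R.r_distr smult_mult R.m_assoc B_simps)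
  note l = Bar.lift[OF Rk.left_module_axioms this]
  show "linear_map k (Bar.LQ 0) A bar_\<epsilon>" unfolding bar_\<epsilon>_def by (rule l(1))
  show "\<lbrakk>a \<in> carrier A; a' \<in> carrier A\<rbrakk> \<Longrightarrow> bar_\<epsilon> (Bar.lpure 0 [a, a']) = a \<otimes>\<^bsub>A\<^esub> a'"
    unfolding bar_\<epsilon>_def using l(2)[of "[a, a']"] by (simp add: W0)
qed

lemma shift_word_closed:
  assumes "w \<in> listset (BF n)" shows "shift_word w \<in> listset (BF (Suc n))"
proof -
  obtain a ms a' where "w = a # ms @ [a']" "a \<in> carrier A" "ms \<in> lists M" "length ms = n" "a' \<in> carrier A"
    using bar_W_cases[OF assms] by blast
  then show ?thesis
    using bar_W_Cons[of "\<one>\<^bsub>A\<^esub>" "pM a # ms" a' "Suc n"] by (simp add: shift_word_def pM_linear)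
qed

text \<open>A relation between the first two letters survives because
  \<open>pM (x b) = pM x b\<close>; linearity in the first letter is that of
  \<open>pM\<close>.\<close>

lemma bar_h: "linear_map k (Bar.LQ n) (Bar.LQ (Suc n)) (bar_h n)"
  "w \<in> listset (BF n) \<Longrightarrow> bar_h n (Bar.lpure n w) = Bar.lpure (Suc n) (shift_word w)"
proof -
  note rel = Bar.lpure_rel[where n = "Suc n"]
  have "balanced k A B (BF n) (Bar.LQ (Suc n)) (\<lambda>w. Bar.lpure (Suc n) (shift_word w))"
  proof (rule balancedI)
    fix u x y v assume w: "u @ x # v \<in> listset (BF n)" "u @ y # v \<in> listset (BF n)"
    then show "Bar.lpure (Suc n) (shift_word (u @ (x \<oplus>\<^bsub>A\<^esub> y) # v)) =
        Bar.lpure (Suc n) (shift_word (u @ x # v)) \<oplus>\<^bsub>Bar.LQ (Suc n)\<^esub> Bar.lpure (Suc n) (shift_word (u @ y # v))"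
      using shift_word_closed[OF w(1)] shift_word_closed[OF w(2)] rel(1)[of "[\<one>\<^bsub>A\<^esub>]" "pM x" v "pM y"]
        rel(1)[of "\<one>\<^bsub>A\<^esub> # pM (hd u) # tl u" x v y] Bar.W_carrier[OF w(1)] Bar.W_carrier[OF w(2)]
      by (cases u) (simp_all add: shift_word_def pM_linear)
  next
    fix c u x v assume c: "c \<in> carrier k" and w: "u @ x # v \<in> listset (BF n)"
    then show "Bar.lpure (Suc n) (shift_word (u @ (c \<odot>\<^bsub>A\<^esub> x) # v)) =
        c \<odot>\<^bsub>Bar.LQ (Suc n)\<^esub> Bar.lpure (Suc n) (shift_word (u @ x # v))"
      using shift_word_closed[OF w] rel(2)[OF c, of "[\<one>\<^bsub>A\<^esub>]" "pM x" v]
        rel(2)[OF c, of "\<one>\<^bsub>A\<^esub> # pM (hd u) # tl u" x v] Bar.W_carrier[OF w]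
      by (cases u) (simp_all add: shift_word_def pM_linear)
  next
    fix b u x y v assume b: "b \<in> B" and w: "u @ x # y # v \<in> listset (BF n)"
    then show "Bar.lpure (Suc n) (shift_word (u @ (x \<otimes>\<^bsub>A\<^esub> b) # y # v)) =
        Bar.lpure (Suc n) (shift_word (u @ x # (b \<otimes>\<^bsub>A\<^esub> y) # v))"
      using shift_word_closed[OF w] rel(3)[OF b, of "[\<one>\<^bsub>A\<^esub>]" "pM x" y v]
        rel(3)[OF b, of "\<one>\<^bsub>A\<^esub> # pM (hd u) # tl u" x y v] Bar.W_carrier[OF w] pM_mult(2)[OF b]
      by (cases u) (simp_all add: shift_word_def)
  qed (simp add: Bar.lpure_closed shift_word_closed)
  note l = Bar.lift[OF Bar.LQ_left_module this]
  show "linear_map k (Bar.LQ n) (Bar.LQ (Suc n)) (bar_h n)"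
    "w \<in> listset (BF n) \<Longrightarrow> bar_h n (Bar.lpure n w) = Bar.lpure (Suc n) (shift_word w)"
    unfolding bar_h_def using l by auto
qed

end

text \<open>The cancellation in both homotopy identities: \<open>p\<close> is the part with first
  letter in \<open>M\<close>, \<open>q\<close> the part with first letter in \<open>B\<close>, and
  \<open>z\<close> occurs in the two summands with opposite signs.\<close>

lemma (in abelian_group) add_uminus_cancel:
  assumes "p \<in> carrier G" "z \<in> carrier G" "q \<in> carrier G"
  shows "p \<oplus> \<ominus> z \<oplus> (z \<oplus> q) = p \<oplus> q"
proof -
  have "p \<oplus> \<ominus> z \<oplus> (z \<oplus> q) = p \<oplus> ((\<ominus> z \<oplus> z) \<oplus> q)" using assms by (simp add: a_assoc)
  then show ?thesis using assms by (simp add: l_neg)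
qed

section \<open>Linearity over the enveloping algebras\<close>

context split_ext
begin

lemma bar_bimodule: "is_bimodule k A (Bar.LT n)"
  using Bar.ltensor_bimodule[OF R.carrier_is_subring carrier_submodule, of n] bar_stable by simp

sublocale BarX: restricted_bimod k A B "Bar.LT n" for n
  by (intro restricted_bimod.intro sub_algebra_axioms bimodI bar_bimodule)

lemma self_bimodule_simps [simp]:
  "carrier (self_bimodule A) = carrier A" "add (self_bimodule A) = add A" "zero (self_bimodule A) = zero A"
  "smult (self_bimodule A) = mult A" "rsmult (self_bimodule A) = mult A"
  by (simp_all add: self_bimodule_def)

lemma self_bimodule: "is_bimodule k A (self_bimodule A)"
proof -
  have "left_module A (self_bimodule A)"
    by (rule left_moduleI) (auto simp: R.l_distr R.r_distr R.m_assoc R.ring_axioms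
        intro: abelian_group_cong[OF R.abelian_group_axioms])
  moreover have "left_module (opp A) (right_part (self_bimodule A))"
    by (rule left_moduleI) (auto simp: R.l_distr R.r_distr R.m_assoc ring_opp R.ring_axioms
        intro: abelian_group_cong[OF R.abelian_group_axioms])
  ultimately show ?thesis by (simp add: is_bimodule_def R.m_assoc scalar_central)
qed

sublocale SelfX: restricted_bimod k A B "self_bimodule A"
  by (intro restricted_bimod.intro sub_algebra_axioms bimodI self_bimodule)

lemmas bar_lact_linear = Bar.lact_LT(1)[OF bar_stable(1)]
  and bar_lact = Bar.lact_LT(2)[OF bar_stable(1)]
  and bar_ract_linear = Bar.ract_LT(1)[OF bar_stable(2)]
  and bar_ract = Bar.ract_LT(2)[OF bar_stable(2)]

lemma bar_W_Cons2:
  "a # y # ms @ [a'] \<in> listset (BF (Suc n)) \<longleftrightarrow>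
    a \<in> carrier A \<and> y \<in> M \<and> ms \<in> lists M \<and> length ms = n \<and> a' \<in> carrier A"
  "a # y # z # ms @ [a'] \<in> listset (BF (Suc (Suc n))) \<longleftrightarrow>
    a \<in> carrier A \<and> y \<in> M \<and> z \<in> M \<and> ms \<in> lists M \<and> length ms = n \<and> a' \<in> carrier A"
  using bar_W_Cons[of a "y # ms" a' "Suc n"] bar_W_Cons[of a "y # z # ms" a' "Suc (Suc n)"] by auto

lemma bar_W_0: "[a, a'] \<in> listset (BF 0) \<longleftrightarrow> a \<in> carrier A \<and> a' \<in> carrier A"
  using bar_W_Cons[of a "[]" a' 0] by simp

lemma bar_W_1: "[a, y, a'] \<in> listset (BF (Suc 0)) \<longleftrightarrow> a \<in> carrier A \<and> y \<in> M \<and> a' \<in> carrier A"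
  using bar_W_Cons2(1)[of a y "[]" a' 0] by simp

text \<open>Only the face \<open>i = 0\<close> touches the first letter, and there the claim is
  associativity.\<close>

lemma face_lact:
  assumes a: "a \<in> carrier A" and w: "x # v \<in> listset (BF (Suc m))" and i: "i \<le> Suc m"
  shows "face m i ((a \<otimes>\<^bsub>A\<^esub> x) # v) = a \<odot>\<^bsub>Bar.LT m\<^esub> face m i (x # v)"
proof -
  have "x \<in> carrier A" using Bar.W_carrier[of "[]" x v "Suc m"] w by simp
  have "Bar.lpure m (contract_at A ((a \<otimes>\<^bsub>A\<^esub> x) # v) (Suc i)) =
      a \<odot>\<^bsub>Bar.LT m\<^esub> Bar.lpure m (contract_at A (x # v) (Suc i))"
  proof (cases i)
    case 0
    obtain y v' where "v = y # v'" using w by (cases v) (auto simp: bar_W)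
    moreover have "y \<in> carrier A" using Bar.W_carrier[of "[x]" y v' "Suc m"] w calculation by simp
    ultimately show ?thesis
      using contract_closed[OF w i] bar_lact[OF a] 0 \<open>x \<in> carrier A\<close> a by (simp add: contract_at_Cons R.m_assoc)
  next
    case (Suc j)
    then show ?thesis using contract_closed[OF w i] bar_lact[OF a] by (simp add: contract_at_Cons)
  qed
  then show ?thesis
    using linear_map_alt_sign[OF bar_lact_linear[OF a] Bar.LQ.N.abelian_group_axioms Bar.LQ.N.abelian_group_axioms
        Bar.lpure_closed[OF contract_closed[OF w i]]]
    by (simp add: face_def)
qed

lemma face_ract:
  assumes a: "a \<in> carrier A" and w: "u @ [x] \<in> listset (BF (Suc m))" and i: "i \<le> Suc m"
  shows "face m i (u @ [x \<otimes>\<^bsub>A\<^esub> a]) = face m i (u @ [x]) \<triangleleft>\<^bsub>Bar.LT m\<^esub> a"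
proof -
  have len: "length u = m + 2" using w by (simp add: bar_W)
  have "x \<in> carrier A" using Bar.W_carrier[OF w] .
  have "Bar.lpure m (contract_at A (u @ [x \<otimes>\<^bsub>A\<^esub> a]) (Suc i)) =
      Bar.lpure m (contract_at A (u @ [x]) (Suc i)) \<triangleleft>\<^bsub>Bar.LT m\<^esub> a"
  proof (cases "Suc i < length u")
    case True
    then show ?thesis
      using contract_closed[OF w i] bar_ract[OF a] by (simp add: contract_at_append(1))
  next
    case False
    then have "Suc i = length u" using i len by simp
    moreover obtain u' s where u: "u = u' @ [s]" using len by (cases u rule: rev_cases) auto
    moreover have "s \<in> carrier A" using Bar.W_carrier[of u' s "[x]" "Suc m"] w u by simp
    ultimately show ?thesis
      using contract_closed[OF w i] bar_ract[OF a, where u = u' and x = "s \<otimes>\<^bsub>A\<^esub> x"] \<open>x \<in> carrier A\<close> a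
      by (simp add: contract_at_append(2) R.m_assoc)
  qed
  then show ?thesis
    using linear_map_alt_sign[OF bar_ract_linear[OF a] Bar.LQ.N.abelian_group_axioms Bar.LQ.N.abelian_group_axioms
        Bar.lpure_closed[OF contract_closed[OF w i]]]
    by (simp add: face_def)
qed

lemma bar_d_lact:
  assumes a: "a \<in> carrier A" and t: "t \<in> carrier (Bar.LQ (Suc m))"
  shows "bar_d (Suc m) (a \<odot>\<^bsub>Bar.LT (Suc m)\<^esub> t) = a \<odot>\<^bsub>Bar.LT m\<^esub> bar_d (Suc m) t"
proof (rule Bar.ltensor_ext[OF Bar.LQ_left_module linear_map_comp[OF bar_lact_linear[OF a] bar_d(1)]
      linear_map_comp[OF bar_d(1) bar_lact_linear[OF a]] _ t])
  fix w assume w: "w \<in> listset (BF (Suc m))"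
  obtain x v where xv: "w = x # v" using Bar.W_nonempty[OF w] by (cases w) auto
  have aw: "(a \<otimes>\<^bsub>A\<^esub> x) # v \<in> listset (BF (Suc m))" using Bar.W_lstable[OF bar_stable(1)[OF a]] w xv by simp
  have "bar_d (Suc m) (a \<odot>\<^bsub>Bar.LT (Suc m)\<^esub> Bar.lpure (Suc m) w) =
      (\<Oplus>\<^bsub>Bar.LQ m\<^esub>i\<in>{..Suc m}. face m i ((a \<otimes>\<^bsub>A\<^esub> x) # v))"
    using w aw by (simp add: xv bar_lact[OF a] bar_d(2))
  also have "\<dots> = (\<Oplus>\<^bsub>Bar.LQ m\<^esub>i\<in>{..Suc m}. a \<odot>\<^bsub>Bar.LT m\<^esub> face m i w)"
    by (rule Bar.LQ.N.finsum_cong')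
      (use w a xv face_lact[OF a] face_closed[OF w] linear_mapD(1)[OF bar_lact_linear[OF a]] in auto)
  also have "\<dots> = a \<odot>\<^bsub>Bar.LT m\<^esub> bar_d (Suc m) (Bar.lpure (Suc m) w)"
    unfolding bar_d(2)[OF w]
    by (rule linear_map_finsum[OF bar_lact_linear[OF a], symmetric])
      (use face_closed[OF w] Bar.LQ.N.abelian_group_axioms in auto)
  finally show "bar_d (Suc m) (a \<odot>\<^bsub>Bar.LT (Suc m)\<^esub> Bar.lpure (Suc m) w) =
    a \<odot>\<^bsub>Bar.LT m\<^esub> bar_d (Suc m) (Bar.lpure (Suc m) w)" .
qed

lemma bar_d_ract:
  assumes a: "a \<in> carrier A" and t: "t \<in> carrier (Bar.LQ (Suc m))"
  shows "bar_d (Suc m) (t \<triangleleft>\<^bsub>Bar.LT (Suc m)\<^esub> a) = bar_d (Suc m) t \<triangleleft>\<^bsub>Bar.LT m\<^esub> a"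
proof (rule Bar.ltensor_ext[OF Bar.LQ_left_module linear_map_comp[OF bar_ract_linear[OF a] bar_d(1)]
      linear_map_comp[OF bar_d(1) bar_ract_linear[OF a]] _ t])
  fix w assume w: "w \<in> listset (BF (Suc m))"
  obtain u x where ux: "w = u @ [x]" using Bar.W_nonempty[OF w] by (cases w rule: rev_cases) auto
  have aw: "u @ [x \<otimes>\<^bsub>A\<^esub> a] \<in> listset (BF (Suc m))" using Bar.W_rstable[OF bar_stable(2)[OF a]] w ux by simp
  have "bar_d (Suc m) (Bar.lpure (Suc m) w \<triangleleft>\<^bsub>Bar.LT (Suc m)\<^esub> a) =
      (\<Oplus>\<^bsub>Bar.LQ m\<^esub>i\<in>{..Suc m}. face m i (u @ [x \<otimes>\<^bsub>A\<^esub> a]))"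
    using w aw by (simp add: ux bar_ract[OF a] bar_d(2))
  also have "\<dots> = (\<Oplus>\<^bsub>Bar.LQ m\<^esub>i\<in>{..Suc m}. face m i w \<triangleleft>\<^bsub>Bar.LT m\<^esub> a)"
    by (rule Bar.LQ.N.finsum_cong')
      (use w a ux face_ract[OF a] face_closed[OF w] linear_mapD(1)[OF bar_ract_linear[OF a]] in auto)
  also have "\<dots> = bar_d (Suc m) (Bar.lpure (Suc m) w) \<triangleleft>\<^bsub>Bar.LT m\<^esub> a"
    unfolding bar_d(2)[OF w]
    by (rule linear_map_finsum[OF bar_ract_linear[OF a], symmetric])
      (use face_closed[OF w] Bar.LQ.N.abelian_group_axioms in auto)
  finally show "bar_d (Suc m) (Bar.lpure (Suc m) w \<triangleleft>\<^bsub>Bar.LT (Suc m)\<^esub> a) =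
    bar_d (Suc m) (Bar.lpure (Suc m) w) \<triangleleft>\<^bsub>Bar.LT m\<^esub> a" .
qed

abbreviation "BarE n \<equiv> env_left k A (Bar.LT n)"
abbreviation "SelfE \<equiv> env_left k A (self_bimodule A)"

lemma bar_d_env_linear: "linear_map (env k A) (BarE (Suc m)) (BarE m) (bar_d (Suc m))"
  by (rule BarX.X.env_linear_mapI[OF BarX.X.env_left_module])
    (simp_all add: linear_mapD[OF bar_d(1)] bar_d_lact bar_d_ract linear_mapD(1)[OF bar_lact_linear]
      BarX.X.env_left_pure)

lemma bar_\<epsilon>_act:
  assumes a: "a \<in> carrier A" and t: "t \<in> carrier (Bar.LQ 0)"
  shows "bar_\<epsilon> (a \<odot>\<^bsub>Bar.LT 0\<^esub> t) = a \<otimes>\<^bsub>A\<^esub> bar_\<epsilon> t"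
    "bar_\<epsilon> (t \<triangleleft>\<^bsub>Bar.LT 0\<^esub> a) = bar_\<epsilon> t \<otimes>\<^bsub>A\<^esub> a"
proof -
  have lin: "linear_map k A A (\<lambda>x. a \<otimes>\<^bsub>A\<^esub> x)" "linear_map k A A (\<lambda>x. x \<otimes>\<^bsub>A\<^esub> a)"
    using a by (auto intro!: linear_mapI simp: R.l_distr R.r_distr smult_mult)
  show "bar_\<epsilon> (a \<odot>\<^bsub>Bar.LT 0\<^esub> t) = a \<otimes>\<^bsub>A\<^esub> bar_\<epsilon> t"
  proof (rule Bar.ltensor_ext[OF Rk.left_module_axioms linear_map_comp[OF bar_lact_linear[OF a] bar_\<epsilon>(1)]
        linear_map_comp[OF bar_\<epsilon>(1) lin(1)] _ t])
    fix w assume w: "w \<in> listset (BF 0)"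
    then obtain x y where "w = [x, y]" "x \<in> carrier A" "y \<in> carrier A"
      using bar_W_cases[OF w] by (metis append_Nil length_0_conv)
    then show "bar_\<epsilon> (a \<odot>\<^bsub>Bar.LT 0\<^esub> Bar.lpure 0 w) = a \<otimes>\<^bsub>A\<^esub> bar_\<epsilon> (Bar.lpure 0 w)"
      using w a by (simp add: bar_lact bar_\<epsilon>(2) R.m_assoc)
  qed
  show "bar_\<epsilon> (t \<triangleleft>\<^bsub>Bar.LT 0\<^esub> a) = bar_\<epsilon> t \<otimes>\<^bsub>A\<^esub> a"
  proof (rule Bar.ltensor_ext[OF Rk.left_module_axioms linear_map_comp[OF bar_ract_linear[OF a] bar_\<epsilon>(1)]
        linear_map_comp[OF bar_\<epsilon>(1) lin(2)] _ t])
    fix w assume w: "w \<in> listset (BF 0)"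
    then obtain x y where "w = [x, y]" "x \<in> carrier A" "y \<in> carrier A"
      using bar_W_cases[OF w] by (metis append_Nil length_0_conv)
    then show "bar_\<epsilon> (Bar.lpure 0 w \<triangleleft>\<^bsub>Bar.LT 0\<^esub> a) = bar_\<epsilon> (Bar.lpure 0 w) \<otimes>\<^bsub>A\<^esub> a"
      using w a bar_ract[OF a, where n = 0 and u = "[x]" and x = y] by (simp add: bar_\<epsilon>(2) R.m_assoc)
  qed
qed

lemma bar_\<epsilon>_env_linear: "linear_map (env k A) (BarE 0) SelfE bar_\<epsilon>"
  by (rule BarX.X.env_linear_mapI[OF SelfX.X.env_left_module])
    (simp_all add: linear_mapD[OF bar_\<epsilon>(1)] bar_\<epsilon>_act linear_mapD(1)[OF bar_lact_linear] SelfX.X.env_left_pure)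

lemma bar_\<eta>: "linear_map k A (Bar.LQ 0) bar_\<eta>"
proof (rule linear_mapI)
  note rel = Bar.lpure_rel[where n = 0 and u = "[\<one>\<^bsub>A\<^esub>]" and v = "[]", simplified]
  show "bar_\<eta> x \<in> carrier (Bar.LQ 0)" if "x \<in> carrier A" for x
    using that by (simp add: bar_\<eta>_def Bar.lpure_closed bar_W_0)
  show "bar_\<eta> (x \<oplus>\<^bsub>A\<^esub> y) = bar_\<eta> x \<oplus>\<^bsub>Bar.LQ 0\<^esub> bar_\<eta> y" if "x \<in> carrier A" "y \<in> carrier A" for x y
    using that rel(1) by (simp add: bar_\<eta>_def bar_W_0)
  show "bar_\<eta> (c \<odot>\<^bsub>A\<^esub> x) = c \<odot>\<^bsub>Bar.LQ 0\<^esub> bar_\<eta> x" if "c \<in> carrier k" "x \<in> carrier A" for c x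
    using that rel(2) by (simp add: bar_\<eta>_def bar_W_0)
qed

text \<open>The equation \<open>1 \<otimes> b x b' = b \<otimes> x b'\<close> moves \<open>b\<close>
  across the tensor sign, a relation for elements of \<open>B\<close>.\<close>

lemma bar_\<eta>_act:
  assumes "b \<in> B" "b' \<in> B" "x \<in> carrier A"
  shows "bar_\<eta> (b \<otimes>\<^bsub>A\<^esub> x \<otimes>\<^bsub>A\<^esub> b') = (b \<odot>\<^bsub>Bar.LT 0\<^esub> bar_\<eta> x) \<triangleleft>\<^bsub>Bar.LT 0\<^esub> b'"
  using assms Bar.lpure_rel(3)[where n = 0, OF assms(1), of "[]" "\<one>\<^bsub>A\<^esub>" "x \<otimes>\<^bsub>A\<^esub> b'" "[]"]
    bar_ract[where n = 0 and a = b' and u = "[b]" and x = x]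
  by (simp add: bar_\<eta>_def bar_lact bar_W_0 B_simps(1) R.m_assoc)

lemma bar_\<eta>_env_linear:
  "linear_map (env k (subalg A B)) (restrict_scalars \<iota> SelfE) (restrict_scalars \<iota> (BarE 0)) bar_\<eta>"
  by (rule SelfX.restricted_linear_mapI[OF BarX.X.env_left_module])
    (simp_all add: linear_mapD[OF bar_\<eta>] bar_\<eta>_act BarX.X.env_left_pure B_simps(1))

text \<open>On the left,
  \<open>1 \<otimes> pM (b x) = 1 \<otimes> b pM x = b \<otimes> pM x\<close>. On the right the
  first letter is not involved, since a bar word has at least two letters.\<close>

lemma bar_h_act:
  assumes b: "b \<in> B" and t: "t \<in> carrier (Bar.LQ n)"
  shows "bar_h n (b \<odot>\<^bsub>Bar.LT n\<^esub> t) = b \<odot>\<^bsub>Bar.LT (Suc n)\<^esub> bar_h n t"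
    "bar_h n (t \<triangleleft>\<^bsub>Bar.LT n\<^esub> b) = bar_h n t \<triangleleft>\<^bsub>Bar.LT (Suc n)\<^esub> b"
proof -
  have bA: "b \<in> carrier A" by (rule B_simps(1)[OF b])
  show "bar_h n (b \<odot>\<^bsub>Bar.LT n\<^esub> t) = b \<odot>\<^bsub>Bar.LT (Suc n)\<^esub> bar_h n t"
  proof (rule Bar.ltensor_ext[OF Bar.LQ_left_module linear_map_comp[OF bar_lact_linear[OF bA] bar_h(1)]
        linear_map_comp[OF bar_h(1) bar_lact_linear[OF bA]] _ t])
    fix w assume w: "w \<in> listset (BF n)"
    obtain x v where xv: "w = x # v" using Bar.W_nonempty[OF w] by (cases w) auto
    have "(b \<otimes>\<^bsub>A\<^esub> x) # v \<in> listset (BF n)" using Bar.W_lstable[OF bar_stable(1)[OF bA]] w xv by simp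
    moreover have "x \<in> carrier A" using Bar.W_carrier[of "[]" x v n] w xv by simp
    moreover have "\<one>\<^bsub>A\<^esub> # pM x # v \<in> listset (BF (Suc n))" using shift_word_closed[OF w] xv by (simp add: shift_word_def)
    ultimately show "bar_h n (b \<odot>\<^bsub>Bar.LT n\<^esub> Bar.lpure n w) =
        b \<odot>\<^bsub>Bar.LT (Suc n)\<^esub> bar_h n (Bar.lpure n w)"
      using w bA Bar.lpure_rel(3)[where n = "Suc n", OF b, of "[]" "\<one>\<^bsub>A\<^esub>" "pM x" v]
      by (simp add: xv bar_lact bar_h(2) shift_word_def pM_mult[OF b])
  qed
  show "bar_h n (t \<triangleleft>\<^bsub>Bar.LT n\<^esub> b) = bar_h n t \<triangleleft>\<^bsub>Bar.LT (Suc n)\<^esub> b"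
  proof (rule Bar.ltensor_ext[OF Bar.LQ_left_module linear_map_comp[OF bar_ract_linear[OF bA] bar_h(1)]
        linear_map_comp[OF bar_h(1) bar_ract_linear[OF bA]] _ t])
    fix w assume w: "w \<in> listset (BF n)"
    obtain a ms x where ax: "w = a # ms @ [x]" using bar_W_cases[OF w] by metis
    have "a # ms @ [x \<otimes>\<^bsub>A\<^esub> b] \<in> listset (BF n)"
      using Bar.W_rstable[OF bar_stable(2)[OF bA], of "a # ms" x n] w ax by simp
    moreover have "\<one>\<^bsub>A\<^esub> # pM a # ms @ [x] \<in> listset (BF (Suc n))"
      using shift_word_closed[OF w] ax by (simp add: shift_word_def)
    ultimately show "bar_h n (Bar.lpure n w \<triangleleft>\<^bsub>Bar.LT n\<^esub> b) =
        bar_h n (Bar.lpure n w) \<triangleleft>\<^bsub>Bar.LT (Suc n)\<^esub> b"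
      using w bA bar_ract[OF bA, where n = n and u = "a # ms" and x = x]
        bar_ract[OF bA, where n = "Suc n" and u = "\<one>\<^bsub>A\<^esub> # pM a # ms" and x = x]
      by (simp add: ax bar_h(2) shift_word_def)
  qed
qed

lemma bar_h_env_linear:
  "linear_map (env k (subalg A B)) (restrict_scalars \<iota> (BarE n)) (restrict_scalars \<iota> (BarE (Suc n))) (bar_h n)"
  by (rule BarX.restricted_linear_mapI[OF BarX.X.env_left_module])
    (simp_all add: linear_mapD[OF bar_h(1)] bar_h_act BarX.X.env_left_pure B_simps(1)
      linear_mapD(1)[OF bar_lact_linear])

section \<open>The homotopy identities and \<open>d d = 0\<close>\<close>

lemma face_0: "\<lbrakk>x # y # v \<in> listset (BF (Suc m))\<rbrakk> \<Longrightarrow> face m 0 (x # y # v) = Bar.lpure m ((x \<otimes>\<^bsub>A\<^esub> y) # v)"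
  by (simp add: face_def contract_at_Cons alt_sign_def)

lemma face_Suc:
  assumes "x # v \<in> listset (BF (Suc m))" "Suc i \<le> Suc m"
  shows "face m (Suc i) (x # v) = \<ominus>\<^bsub>Bar.LQ m\<^esub> alt_sign (Bar.LQ m) i (Bar.lpure m (x # contract_at A v (Suc i)))"
  using Bar.lpure_closed[OF contract_closed[OF assms]]
  by (simp add: face_def contract_at_Cons Bar.LQ.N.alt_sign)

text \<open>For \<open>x = m + b\<close> one finds
  \<open>d h (x \<otimes> y) = m \<otimes> y - 1 \<otimes> m y\<close> and \<open>\<eta> \<epsilon>
  (x \<otimes> y) = 1 \<otimes> m y + b \<otimes> y\<close>.\<close>

lemma bar_homotopy_0:
  assumes "t \<in> carrier (Bar.LQ 0)"
  shows "bar_d (Suc 0) (bar_h 0 t) \<oplus>\<^bsub>Bar.LQ 0\<^esub> bar_\<eta> (bar_\<epsilon> t) = t"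
proof (rule Bar.ltensor_ext[OF Bar.LQ_left_module linear_map_add[OF Bar.LQ_left_module
        linear_map_comp[OF bar_h(1) bar_d(1)] linear_map_comp[OF bar_\<epsilon>(1) bar_\<eta>]] linear_map_id _ assms])
  fix w assume w: "w \<in> listset (BF 0)"
  then obtain x y where xy: "w = [x, y]" "x \<in> carrier A" "y \<in> carrier A"
    using bar_W_cases[OF w] by (metis append_Nil length_0_conv)
  obtain m b where d: "m \<in> M" "b \<in> B" "x = m \<oplus>\<^bsub>A\<^esub> b" "pM x = m" using decompose[OF xy(2)] by blast
  have mA: "m \<in> carrier A" and bA: "b \<in> carrier A" using d M_simps(1) B_simps(1) by auto
  note rel = Bar.lpure_rel[where n = 0]
  let ?p = "\<lambda>x y. Bar.lpure 0 [x, y]"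
  have cl: "?p x y \<in> carrier (Bar.LQ 0)" if "x \<in> carrier A" "y \<in> carrier A" for x y
    using that by (simp add: Bar.lpure_closed bar_W_0)
  have W1: "[\<one>\<^bsub>A\<^esub>, m, y] \<in> listset (BF (Suc 0))" using d xy by (simp add: bar_W_1)
  have "bar_d (Suc 0) (bar_h 0 (Bar.lpure 0 w)) = (\<Oplus>\<^bsub>Bar.LQ 0\<^esub>i\<in>{..Suc 0}. face 0 i [\<one>\<^bsub>A\<^esub>, m, y])"
    using w W1 by (simp add: bar_h(2) bar_d(2) shift_word_def xy(1) d(4))
  also have "\<dots> = face 0 0 [\<one>\<^bsub>A\<^esub>, m, y] \<oplus>\<^bsub>Bar.LQ 0\<^esub> face 0 (Suc 0) [\<one>\<^bsub>A\<^esub>, m, y]"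
    using face_closed[OF W1] by (subst Bar.LQ.N.finsum_atMost_Suc_shift) auto
  also have "\<dots> = ?p m y \<ominus>\<^bsub>Bar.LQ 0\<^esub> ?p \<one>\<^bsub>A\<^esub> (m \<otimes>\<^bsub>A\<^esub> y)"
    using face_0[OF W1] face_Suc[OF W1, of 0] mA by (simp add: contract_at_Cons alt_sign_def a_minus_def)
  finally have 1: "bar_d (Suc 0) (bar_h 0 (Bar.lpure 0 w)) = ?p m y \<ominus>\<^bsub>Bar.LQ 0\<^esub> ?p \<one>\<^bsub>A\<^esub> (m \<otimes>\<^bsub>A\<^esub> y)" .
  have "bar_\<eta> (bar_\<epsilon> (Bar.lpure 0 w)) = ?p \<one>\<^bsub>A\<^esub> (m \<otimes>\<^bsub>A\<^esub> y \<oplus>\<^bsub>A\<^esub> b \<otimes>\<^bsub>A\<^esub> y)"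
    using xy mA bA by (simp add: bar_\<epsilon>(2) bar_\<eta>_def d(3) R.l_distr)
  also have "\<dots> = ?p \<one>\<^bsub>A\<^esub> (m \<otimes>\<^bsub>A\<^esub> y) \<oplus>\<^bsub>Bar.LQ 0\<^esub> ?p b y"
    using rel(1)[of "[\<one>\<^bsub>A\<^esub>]" "m \<otimes>\<^bsub>A\<^esub> y" "[]" "b \<otimes>\<^bsub>A\<^esub> y"] rel(3)[OF d(2), of "[]" "\<one>\<^bsub>A\<^esub>" y "[]"] mA bA xy
    by (simp add: bar_W_0)
  finally have 2: "bar_\<eta> (bar_\<epsilon> (Bar.lpure 0 w)) = ?p \<one>\<^bsub>A\<^esub> (m \<otimes>\<^bsub>A\<^esub> y) \<oplus>\<^bsub>Bar.LQ 0\<^esub> ?p b y" .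
  have 3: "Bar.lpure 0 w = ?p m y \<oplus>\<^bsub>Bar.LQ 0\<^esub> ?p b y"
    using rel(1)[of "[]" m "[y]" b] mA bA xy by (simp add: bar_W_0 d(3))
  show "bar_d (Suc 0) (bar_h 0 (Bar.lpure 0 w)) \<oplus>\<^bsub>Bar.LQ 0\<^esub> bar_\<eta> (bar_\<epsilon> (Bar.lpure 0 w)) = Bar.lpure 0 w"
    unfolding 1 2 using Bar.LQ.N.add_uminus_cancel[OF cl[OF mA xy(3)] cl[of "\<one>\<^bsub>A\<^esub>" "m \<otimes>\<^bsub>A\<^esub> y"] cl[OF bA xy(3)]]
      3 mA xy(3) by (simp add: a_minus_def)
qed

text \<open>For \<open>w = x y v\<close> with \<open>x = mx + b\<close> the bookkeeping is
  \<open>d h w = mx y v - (T 0 + S)\<close> and \<open>h d w = U 0 + S\<close>, where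
  \<open>S\<close> collects the faces that leave the first letter alone. What remains is
  \<open>U 0 = T 0 + b y v\<close>.\<close>

lemma bar_homotopy_Suc:
  assumes "t \<in> carrier (Bar.LQ (Suc m))"
  shows "bar_d (Suc (Suc m)) (bar_h (Suc m) t) \<oplus>\<^bsub>Bar.LQ (Suc m)\<^esub> bar_h m (bar_d (Suc m) t) = t"
proof (rule Bar.ltensor_ext[OF Bar.LQ_left_module linear_map_add[OF Bar.LQ_left_module
        linear_map_comp[OF bar_h(1) bar_d(1)] linear_map_comp[OF bar_d(1) bar_h(1)]] linear_map_id _ assms])
  fix w assume w: "w \<in> listset (BF (Suc m))"
  obtain x ms z where "w = x # ms @ [z]" and x: "x \<in> carrier A" and ms: "ms \<in> lists M" "length ms = Suc m"
    and z: "z \<in> carrier A" using bar_W_cases[OF w] by blast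
  moreover obtain y ns where "ms = y # ns" using ms(2) by (cases ms) auto
  ultimately have weq: "w = x # y # ns @ [z]" and y: "y \<in> M" and ns: "ns \<in> lists M" "length ns = m" by auto
  define v where "v = ns @ [z]"
  have weq': "w = x # y # v" by (simp add: weq v_def)
  obtain mx b where d: "mx \<in> M" "b \<in> B" "x = mx \<oplus>\<^bsub>A\<^esub> b" "pM x = mx" using decompose[OF x] by blast
  have mA: "mx \<in> carrier A" and bA: "b \<in> carrier A" and yA: "y \<in> carrier A"
    using d y M_simps(1) B_simps(1) by auto
  have Wc: "a # y' # v \<in> listset (BF (Suc m))" if "a \<in> carrier A" "y' \<in> M" for a y'
    using that ns z by (simp add: v_def bar_W_Cons2)
  have W2: "\<one>\<^bsub>A\<^esub> # mx # y # v \<in> listset (BF (Suc (Suc m)))" using ns z y d by (simp add: v_def bar_W_Cons2)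
  let ?Q = "Bar.LQ (Suc m)" and ?p = "Bar.lpure (Suc m)"
  note rel = Bar.lpure_rel[where n = "Suc m"]
  \<comment> \<open>\<open>T i\<close> carries the sign of the face \<open>i\<close> of
    \<open>mx # y # v\<close>; being the face \<open>i + 1\<close> of the shifted word, it enters
    \<open>d h\<close> with the opposite sign.\<close>
  define T where "T i = alt_sign ?Q i (?p (\<one>\<^bsub>A\<^esub> # contract_at A (mx # y # v) (Suc i)))" for i
  define S where "S = (\<Oplus>\<^bsub>?Q\<^esub>i\<in>{..m}. T (Suc i))"
  have Tcl: "T i \<in> carrier ?Q" if "i \<le> Suc m" for i
    using contract_closed[OF W2, of "Suc i"] that by (simp add: T_def contract_at_Cons Bar.LQ.N.alt_sign Bar.lpure_closed)
  have Scl: "S \<in> carrier ?Q" unfolding S_def by (rule Bar.LQ.N.finsum_closed) (auto intro: Tcl)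
  have Tsum: "(\<Oplus>\<^bsub>?Q\<^esub>i\<in>{..Suc m}. T i) = T 0 \<oplus>\<^bsub>?Q\<^esub> S"
    unfolding S_def by (rule Bar.LQ.N.finsum_atMost_Suc_shift) (rule Tcl)
  have "bar_d (Suc (Suc m)) (bar_h (Suc m) (?p w)) = (\<Oplus>\<^bsub>?Q\<^esub>i\<in>{..Suc (Suc m)}. face (Suc m) i (\<one>\<^bsub>A\<^esub> # mx # y # v))"
    using w W2 by (simp add: bar_h(2) bar_d(2) shift_word_def weq' d(4))
  also have "\<dots> = face (Suc m) 0 (\<one>\<^bsub>A\<^esub> # mx # y # v) \<oplus>\<^bsub>?Q\<^esub> (\<Oplus>\<^bsub>?Q\<^esub>i\<in>{..Suc m}. face (Suc m) (Suc i) (\<one>\<^bsub>A\<^esub> # mx # y # v))"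
    by (rule Bar.LQ.N.finsum_atMost_Suc_shift) (rule face_closed[OF W2])
  also have "(\<Oplus>\<^bsub>?Q\<^esub>i\<in>{..Suc m}. face (Suc m) (Suc i) (\<one>\<^bsub>A\<^esub> # mx # y # v)) = (\<Oplus>\<^bsub>?Q\<^esub>i\<in>{..Suc m}. \<ominus>\<^bsub>?Q\<^esub> T i)"
    by (rule Bar.LQ.N.finsum_cong') (use Tcl face_Suc[OF W2] in \<open>auto simp: T_def\<close>)
  also have "\<dots> = \<ominus>\<^bsub>?Q\<^esub> (T 0 \<oplus>\<^bsub>?Q\<^esub> S)"
    unfolding Tsum[symmetric] by (rule Bar.LQ.N.finsum_uminus) (auto intro: Tcl)
  finally have 1: "bar_d (Suc (Suc m)) (bar_h (Suc m) (?p w)) = ?p (mx # y # v) \<oplus>\<^bsub>?Q\<^esub> \<ominus>\<^bsub>?Q\<^esub> (T 0 \<oplus>\<^bsub>?Q\<^esub> S)"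
    using face_0[OF W2] mA by simp
  define U where "U i = alt_sign ?Q i (?p (shift_word (contract_at A w (Suc i))))" for i
  have Ucl: "U i \<in> carrier ?Q" if "i \<le> Suc m" for i
    using that by (simp add: U_def Bar.LQ.N.alt_sign Bar.lpure_closed shift_word_closed contract_closed[OF w])
  have "bar_h m (bar_d (Suc m) (?p w)) = bar_h m (\<Oplus>\<^bsub>Bar.LQ m\<^esub>i\<in>{..Suc m}. face m i w)"
    using w by (simp add: bar_d(2))
  also have "\<dots> = (\<Oplus>\<^bsub>?Q\<^esub>i\<in>{..Suc m}. bar_h m (face m i w))"
    by (rule linear_map_finsum[OF bar_h(1)]) (use face_closed[OF w] Bar.LQ.N.abelian_group_axioms in auto)
  also have "\<dots> = (\<Oplus>\<^bsub>?Q\<^esub>i\<in>{..Suc m}. U i)"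
  proof (rule Bar.LQ.N.finsum_cong')
    fix i assume "i \<in> {..Suc m}"
    then have c: "contract_at A w (Suc i) \<in> listset (BF m)" using contract_closed[OF w] by simp
    show "bar_h m (face m i w) = U i"
      using linear_map_alt_sign[OF bar_h(1) Bar.LQ.N.abelian_group_axioms Bar.LQ.N.abelian_group_axioms Bar.lpure_closed[OF c]]
      by (simp add: face_def U_def bar_h(2)[OF c])
  qed (auto intro: Ucl)
  also have "\<dots> = U 0 \<oplus>\<^bsub>?Q\<^esub> (\<Oplus>\<^bsub>?Q\<^esub>i\<in>{..m}. U (Suc i))"
    by (rule Bar.LQ.N.finsum_atMost_Suc_shift) (rule Ucl)
  also have "(\<Oplus>\<^bsub>?Q\<^esub>i\<in>{..m}. U (Suc i)) = S"
  proof -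
    \<comment> \<open>These faces keep the first letter and therefore commute with the
      shift.\<close>
    have "U (Suc i) = T (Suc i)" for i
      by (simp add: U_def T_def weq' contract_at_Cons shift_word_def d(4))
    then show ?thesis unfolding S_def by simp
  qed
  finally have 2: "bar_h m (bar_d (Suc m) (?p w)) = U 0 \<oplus>\<^bsub>?Q\<^esub> S" .
  \<comment> \<open>The product \<open>x y\<close> lies in the ideal \<open>M\<close>, hence is
    fixed by \<open>pM\<close>.\<close>
  have U0: "U 0 = ?p (\<one>\<^bsub>A\<^esub> # (x \<otimes>\<^bsub>A\<^esub> y) # v)"
    using pM_M[OF M_simps(4)[OF x y]] by (simp add: U_def alt_sign_def weq' contract_at_Cons shift_word_def)
  have T0: "T 0 = ?p (\<one>\<^bsub>A\<^esub> # (mx \<otimes>\<^bsub>A\<^esub> y) # v)" by (simp add: T_def alt_sign_def contract_at_Cons)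
  have 3: "U 0 = T 0 \<oplus>\<^bsub>?Q\<^esub> ?p (b # y # v)"
    using rel(1)[of "[\<one>\<^bsub>A\<^esub>]" "mx \<otimes>\<^bsub>A\<^esub> y" v "b \<otimes>\<^bsub>A\<^esub> y"] rel(3)[OF d(2), of "[]" "\<one>\<^bsub>A\<^esub>" y v]
      Wc[of "\<one>\<^bsub>A\<^esub>"] M_simps(4)[OF mA y] M_simps(4)[OF bA y] y mA bA yA
    by (simp add: U0 T0 d(3) R.l_distr)
  have 4: "?p w = ?p (mx # y # v) \<oplus>\<^bsub>?Q\<^esub> ?p (b # y # v)"
    using rel(1)[of "[]" mx "y # v" b] Wc[OF mA y] Wc[OF bA y] by (simp add: weq' d(3))
  have cl: "?p (mx # y # v) \<in> carrier ?Q" "?p (b # y # v) \<in> carrier ?Q"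
    using Wc[OF mA y] Wc[OF bA y] by (auto intro: Bar.lpure_closed)
  have "U 0 \<oplus>\<^bsub>?Q\<^esub> S = (T 0 \<oplus>\<^bsub>?Q\<^esub> S) \<oplus>\<^bsub>?Q\<^esub> ?p (b # y # v)"
    using cl Tcl[of 0] Scl by (simp add: 3 Bar.LQ.N.a_ac)
  then show "bar_d (Suc (Suc m)) (bar_h (Suc m) (?p w)) \<oplus>\<^bsub>?Q\<^esub> bar_h m (bar_d (Suc m) (?p w)) = ?p w"
    unfolding 1 2 using Bar.LQ.N.add_uminus_cancel[OF cl(1) _ cl(2), of "T 0 \<oplus>\<^bsub>?Q\<^esub> S"] Tcl[of 0] Scl 4 by simp
qed

lemma bar_d_\<epsilon>:
  assumes "t \<in> carrier (Bar.LQ (Suc 0))"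
  shows "bar_\<epsilon> (bar_d (Suc 0) t) = \<zero>\<^bsub>A\<^esub>"
proof (rule Bar.ltensor_ext[OF Rk.left_module_axioms linear_map_comp[OF bar_d(1) bar_\<epsilon>(1)]
      linear_map_const_zero[OF Rk.left_module_axioms] _ assms])
  fix w assume w: "w \<in> listset (BF (Suc 0))"
  obtain a ms z where "w = a # ms @ [z]" "a \<in> carrier A" "ms \<in> lists M" "length ms = Suc 0" "z \<in> carrier A"
    using bar_W_cases[OF w] by blast
  then obtain y where weq: "w = [a, y, z]" and a: "a \<in> carrier A" and y: "y \<in> carrier A" and z: "z \<in> carrier A"
    using M_simps(1) by (auto simp: length_Suc_conv)
  have "bar_d (Suc 0) (Bar.lpure (Suc 0) w) = face 0 0 w \<oplus>\<^bsub>Bar.LQ 0\<^esub> face 0 (Suc 0) w"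
    using face_closed[OF w] by (subst bar_d(2)[OF w], subst Bar.LQ.N.finsum_atMost_Suc_shift) auto
  also have "\<dots> = Bar.lpure 0 [a \<otimes>\<^bsub>A\<^esub> y, z] \<ominus>\<^bsub>Bar.LQ 0\<^esub> Bar.lpure 0 [a, y \<otimes>\<^bsub>A\<^esub> z]"
    using face_0[of a y "[z]" 0] face_Suc[of a "[y, z]" 0 0] w
    by (simp add: weq contract_at_Cons alt_sign_def a_minus_def)
  finally show "bar_\<epsilon> (bar_d (Suc 0) (Bar.lpure (Suc 0) w)) = \<zero>\<^bsub>A\<^esub>"
    using linear_map_diff[OF bar_\<epsilon>(1) Bar.LQ.N.abelian_group_axioms R.abelian_group_axioms] a y z
    by (simp add: Bar.lpure_closed bar_W_0 bar_\<epsilon>(2) R.m_assoc)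
qed

text \<open>The left \<open>A\<close>-module \<open>Bar (n + 2)\<close> is generated by the image of the contracting homotopy \<open>h\<close>,
  and \<open>d d h = d (1 - h d) = d - (1 - h d) d = h d d\<close>.\<close>

lemma bar_d_d:
  assumes "t \<in> carrier (Bar.LQ (Suc (Suc n)))"
  shows "bar_d (Suc n) (bar_d (Suc (Suc n)) t) = \<zero>\<^bsub>Bar.LQ n\<^esub>"
  using assms
proof (induction n arbitrary: t)
  \<comment> \<open>The assumption \<open>dh\<close> is \<open>d h d = d\<close> for the outer of
    the two differentials. It will come from \<open>\<epsilon> d = 0\<close> in degree 0 and from
    the induction hypothesis in higher degrees.\<close>
  have key: "bar_d (Suc n) (bar_d (Suc (Suc n)) t) = \<zero>\<^bsub>Bar.LQ n\<^esub>"
    if t: "t \<in> carrier (Bar.LQ (Suc (Suc n)))"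
      and dh: "\<And>z. z \<in> carrier (Bar.LQ (Suc n)) \<Longrightarrow> bar_d (Suc n) (bar_h n (bar_d (Suc n) z)) = bar_d (Suc n) z"
    for n t
  proof (rule Bar.ltensor_ext[OF Bar.LQ_left_module linear_map_comp[OF bar_d(1) bar_d(1)]
        linear_map_const_zero[OF Bar.LQ_left_module] _ t])
    fix w assume w: "w \<in> listset (BF (Suc (Suc n)))"
    obtain a ms z where "w = a # ms @ [z]" and a: "a \<in> carrier A" and ms: "ms \<in> lists M" "length ms = Suc (Suc n)"
      "z \<in> carrier A" using bar_W_cases[OF w] by blast
    moreover obtain y ns where y: "ms = y # ns" using ms(2) by (cases ms) auto
    ultimately have weq: "w = a # y # ns @ [z]" by simp
    have yM: "y \<in> M" and yW: "y # ns @ [z] \<in> listset (BF (Suc n))"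
      using ms y M_simps(1) by (auto simp: bar_W_Cons)
    \<comment> \<open>The letter \<open>y\<close> of \<open>M\<close> is read as an outer letter in
      \<open>A\<close>. As \<open>pM y = y\<close>, the given word is \<open>a\<close> times the
      shift of this shorter word.\<close>
    define q where "q = Bar.lpure (Suc n) (y # ns @ [z])"
    have q: "q \<in> carrier (Bar.LQ (Suc n))" unfolding q_def by (rule Bar.lpure_closed[OF yW])
    have hq: "bar_h (Suc n) q \<in> carrier (Bar.LQ (Suc (Suc n)))" by (rule linear_mapD(1)[OF bar_h(1) q])
    have dq: "bar_d (Suc n) q \<in> carrier (Bar.LQ n)" by (rule linear_mapD(1)[OF bar_d(1) q])
    have hdq: "bar_h n (bar_d (Suc n) q) \<in> carrier (Bar.LQ (Suc n))" by (rule linear_mapD(1)[OF bar_h(1) dq])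
    have dhq: "bar_d (Suc (Suc n)) (bar_h (Suc n) q) \<in> carrier (Bar.LQ (Suc n))" by (rule linear_mapD(1)[OF bar_d(1) hq])
    have "shift_word (y # ns @ [z]) \<in> listset (BF (Suc (Suc n)))" by (rule shift_word_closed[OF yW])
    then have weq': "Bar.lpure (Suc (Suc n)) w = a \<odot>\<^bsub>Bar.LT (Suc (Suc n))\<^esub> bar_h (Suc n) q"
      using a by (simp add: q_def bar_h(2)[OF yW] shift_word_def bar_lact pM_M[OF yM] weq)
    have "bar_d (Suc n) (bar_d (Suc (Suc n)) (bar_h (Suc n) q) \<oplus>\<^bsub>Bar.LQ (Suc n)\<^esub> bar_h n (bar_d (Suc n) q)) = bar_d (Suc n) q"
      by (simp add: bar_homotopy_Suc[OF q])
    then have "bar_d (Suc n) (bar_d (Suc (Suc n)) (bar_h (Suc n) q)) \<oplus>\<^bsub>Bar.LQ n\<^esub> bar_d (Suc n) q = bar_d (Suc n) q"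
      by (simp add: linear_mapD(2)[OF bar_d(1)] dhq hdq dh[OF q])
    then have "bar_d (Suc n) (bar_d (Suc (Suc n)) (bar_h (Suc n) q)) = \<zero>\<^bsub>Bar.LQ n\<^esub>"
      using linear_mapD(1)[OF bar_d(1) dhq] dq Bar.LQ.N.add.r_cancel_one by simp
    then show "bar_d (Suc n) (bar_d (Suc (Suc n)) (Bar.lpure (Suc (Suc n)) w)) = \<zero>\<^bsub>Bar.LQ n\<^esub>"
      using a hq dhq linear_map_zero[OF bar_lact_linear[OF a] Bar.LQ.N.abelian_group_axioms Bar.LQ.N.abelian_group_axioms]
      by (simp add: weq' bar_d_lact)
  qed
  { case 0
    show ?case
    proof (rule key[OF 0])
      fix z assume z: "z \<in> carrier (Bar.LQ (Suc 0))"
      have dz: "bar_d (Suc 0) z \<in> carrier (Bar.LQ 0)" by (rule linear_mapD(1)[OF bar_d(1) z])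
      have "bar_\<eta> \<zero>\<^bsub>A\<^esub> = \<zero>\<^bsub>Bar.LQ 0\<^esub>"
        by (rule linear_map_zero[OF bar_\<eta> R.abelian_group_axioms Bar.LQ.N.abelian_group_axioms])
      then show "bar_d (Suc 0) (bar_h 0 (bar_d (Suc 0) z)) = bar_d (Suc 0) z"
        using bar_homotopy_0[OF dz] bar_d_\<epsilon>[OF z] linear_mapD(1)[OF bar_d(1) linear_mapD(1)[OF bar_h(1) dz]] by simp
    qed
  next
    case (Suc n)
    show ?case
    proof (rule key[OF Suc.prems])
      fix z assume z: "z \<in> carrier (Bar.LQ (Suc (Suc n)))"
      have dz: "bar_d (Suc (Suc n)) z \<in> carrier (Bar.LQ (Suc n))" by (rule linear_mapD(1)[OF bar_d(1) z])
      have "bar_h n \<zero>\<^bsub>Bar.LQ n\<^esub> = \<zero>\<^bsub>Bar.LQ (Suc n)\<^esub>"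
        by (rule linear_map_zero[OF bar_h(1) Bar.LQ.N.abelian_group_axioms Bar.LQ.N.abelian_group_axioms])
      then show "bar_d (Suc (Suc n)) (bar_h (Suc n) (bar_d (Suc (Suc n)) z)) = bar_d (Suc (Suc n)) z"
        using bar_homotopy_Suc[OF dz] Suc.IH[OF z] linear_mapD(1)[OF bar_d(1) linear_mapD(1)[OF bar_h(1) dz]] by simp
    qed }
qed

end

section \<open>The bar bimodules are induced\<close>

context split_ext
begin

abbreviation "PF \<equiv> pow_factors B M"

sublocale Tp: ltensor_data k A B "PF n" for n
  by unfold_locales (auto simp: pow_factors_def factors split: if_splits)

lemma tp_W_0: "w \<in> listset (PF 0) \<longleftrightarrow> (\<exists>b\<in>B. w = [b])"
  by (auto simp: pow_factors_def listset_iff list_all2_Cons2)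

lemma tp_W: "n > 0 \<Longrightarrow> w \<in> listset (PF n) \<longleftrightarrow> w \<in> lists M \<and> length w = n"
  by (auto simp: pow_factors_def listset_iff list_all2_conv_all_nth in_set_conv_nth lists_eq_set subset_iff)

lemma tp_stable: "b \<in> B \<Longrightarrow> Tp.lstable n b" "b \<in> B \<Longrightarrow> Tp.rstable n b"
  unfolding Tp.lstable_def Tp.rstable_def
  by (simp_all add: pow_factors_def B_simps M_simps)

lemma tp_bimodule: "is_bimodule k (subalg A B) (Tp.LT n)"
  by (rule Tp.ltensor_bimodule[OF B]) (simp add: tp_stable)

sublocale TpX: bimod k "subalg A B" "Tp.LT n" for n
  by (rule EB.bimodI[OF tp_bimodule])

sublocale E: rel_ext k "env k A" "env k (subalg A B)" \<iota> by (rule env_rel_ext)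

abbreviation "TpE n \<equiv> env_left k (subalg A B) (Tp.LT n)"

sublocale Ind: induced k "env k A" "env k (subalg A B)" \<iota> "TpE n" for n
  by (rule E.inducedI[OF TpX.env_left_module])

lemmas tp_lact_linear = Tp.lact_LT(1)[OF tp_stable(1)]
  and tp_lact = Tp.lact_LT(2)[OF tp_stable(1)]
  and tp_ract_linear = Tp.ract_LT(1)[OF tp_stable(2)]
  and tp_ract = Tp.ract_LT(2)[OF tp_stable(2)]

text \<open>The map \<open>t \<mapsto> 1 \<otimes> t \<otimes> 1\<close> on words. In degree 0 the
  word \<open>[b]\<close> stands for an element of \<open>B\<close> and yields the two letters of
  \<open>b \<otimes> 1 = 1 \<otimes> b\<close>.\<close>

definition ext_word :: "nat \<Rightarrow> 'a list \<Rightarrow> 'a list"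
  where "ext_word n v = (if n = 0 then [hd v, \<one>\<^bsub>A\<^esub>] else \<one>\<^bsub>A\<^esub> # v @ [\<one>\<^bsub>A\<^esub>])"

definition bar_j :: "nat \<Rightarrow> ('a list \<Rightarrow> 'k) set \<Rightarrow> ('a list \<Rightarrow> 'k) set"
  where "bar_j n = lin_ext k (Bar.LQ n) (\<lambda>v. Bar.lpure n (ext_word n v))"

lemma ext_word_closed: "v \<in> listset (PF n) \<Longrightarrow> ext_word n v \<in> listset (BF n)"
  by (cases "n = 0") (auto simp: ext_word_def tp_W_0 tp_W bar_W_0 bar_W_Cons B_simps)

lemma bar_j: "linear_map k (Tp.LQ n) (Bar.LQ n) (bar_j n)"
  "v \<in> listset (PF n) \<Longrightarrow> bar_j n (Tp.lpure n v) = Bar.lpure n (ext_word n v)"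
proof -
  have "balanced k A B (PF n) (Bar.LQ n) (\<lambda>v. Bar.lpure n (ext_word n v))"
  proof (cases "n = 0")
    case True
    note rel = Bar.lpure_rel[where n = 0 and u = "[]" and v = "[\<one>\<^bsub>A\<^esub>]", simplified]
    show ?thesis
      by (rule balancedI)
        (auto simp: True tp_W_0 ext_word_def Cons_eq_append_conv append_eq_Cons_conv bar_W_0 B_simps rel
          intro!: Bar.lpure_closed)
  next
    case False
    have W: "\<one>\<^bsub>A\<^esub> # v @ [\<one>\<^bsub>A\<^esub>] \<in> listset (BF n)" if "v \<in> listset (PF n)" for v
      using ext_word_closed[OF that] False by (simp add: ext_word_def)
    note rel = Bar.lpure_rel[where n = n]
    show ?thesis
    proof (rule balancedI)
      show "Bar.lpure n (ext_word n v) \<in> carrier (Bar.LQ n)" if "v \<in> listset (PF n)" for v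
        by (rule Bar.lpure_closed[OF ext_word_closed[OF that]])
    next
      fix u x y v assume "u @ x # v \<in> listset (PF n)" "u @ y # v \<in> listset (PF n)"
      then show "Bar.lpure n (ext_word n (u @ (x \<oplus>\<^bsub>A\<^esub> y) # v)) =
          Bar.lpure n (ext_word n (u @ x # v)) \<oplus>\<^bsub>Bar.LQ n\<^esub> Bar.lpure n (ext_word n (u @ y # v))"
        using W[of "u @ x # v"] W[of "u @ y # v"] rel(1)[of "\<one>\<^bsub>A\<^esub> # u" x "v @ [\<one>\<^bsub>A\<^esub>]" y] False by (simp add: ext_word_def)
    next
      fix c u x v assume "c \<in> carrier k" "u @ x # v \<in> listset (PF n)"
      then show "Bar.lpure n (ext_word n (u @ (c \<odot>\<^bsub>A\<^esub> x) # v)) = c \<odot>\<^bsub>Bar.LQ n\<^esub> Bar.lpure n (ext_word n (u @ x # v))"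
        using W[of "u @ x # v"] rel(2)[of c "\<one>\<^bsub>A\<^esub> # u" x "v @ [\<one>\<^bsub>A\<^esub>]"] False by (simp add: ext_word_def)
    next
      fix b u x y v assume "b \<in> B" "u @ x # y # v \<in> listset (PF n)"
      then show "Bar.lpure n (ext_word n (u @ (x \<otimes>\<^bsub>A\<^esub> b) # y # v)) = Bar.lpure n (ext_word n (u @ x # (b \<otimes>\<^bsub>A\<^esub> y) # v))"
        using W[of "u @ x # y # v"] rel(3)[of b "\<one>\<^bsub>A\<^esub> # u" x y "v @ [\<one>\<^bsub>A\<^esub>]"] False by (simp add: ext_word_def)
    qed
  qed
  note l = Tp.lift[OF Bar.LQ_left_module this]
  show "linear_map k (Tp.LQ n) (Bar.LQ n) (bar_j n)"
    "v \<in> listset (PF n) \<Longrightarrow> bar_j n (Tp.lpure n v) = Bar.lpure n (ext_word n v)"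
    unfolding bar_j_def using l by auto
qed

text \<open>For a positive exponent a factor \<open>b\<close> at either end of the word passes
  across the tensor sign to the neighbouring \<open>1\<close>.\<close>

lemma bar_j_act:
  assumes b: "b \<in> B" and t: "t \<in> carrier (Tp.LQ n)"
  shows "bar_j n (b \<odot>\<^bsub>Tp.LT n\<^esub> t) = b \<odot>\<^bsub>Bar.LT n\<^esub> bar_j n t"
    "bar_j n (t \<triangleleft>\<^bsub>Tp.LT n\<^esub> b) = bar_j n t \<triangleleft>\<^bsub>Bar.LT n\<^esub> b"
proof -
  have bA: "b \<in> carrier A" by (rule B_simps(1)[OF b])
  note rel = Bar.lpure_rel(3)[where n = n, OF b]
  show "bar_j n (b \<odot>\<^bsub>Tp.LT n\<^esub> t) = b \<odot>\<^bsub>Bar.LT n\<^esub> bar_j n t"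
  proof (rule Tp.ltensor_ext[OF Bar.LQ_left_module linear_map_comp[OF tp_lact_linear[OF b] bar_j(1)]
        linear_map_comp[OF bar_j(1) bar_lact_linear[OF bA]] _ t])
    fix w assume w: "w \<in> listset (PF n)"
    obtain x v where xv: "w = x # v" using Tp.W_nonempty[OF w] by (cases w) auto
    have bw: "(b \<otimes>\<^bsub>A\<^esub> x) # v \<in> listset (PF n)" using Tp.W_lstable[OF tp_stable(1)[OF b]] w xv by simp
    show "bar_j n (b \<odot>\<^bsub>Tp.LT n\<^esub> Tp.lpure n w) = b \<odot>\<^bsub>Bar.LT n\<^esub> bar_j n (Tp.lpure n w)"
      using w bw ext_word_closed[OF w] rel[of "[]" "\<one>\<^bsub>A\<^esub>" x "v @ [\<one>\<^bsub>A\<^esub>]"] bA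
      by (cases "n = 0") (simp_all add: xv tp_lact[OF b] bar_j(2) ext_word_def bar_lact[OF bA])
  qed
  show "bar_j n (t \<triangleleft>\<^bsub>Tp.LT n\<^esub> b) = bar_j n t \<triangleleft>\<^bsub>Bar.LT n\<^esub> b"
  proof (rule Tp.ltensor_ext[OF Bar.LQ_left_module linear_map_comp[OF tp_ract_linear[OF b] bar_j(1)]
        linear_map_comp[OF bar_j(1) bar_ract_linear[OF bA]] _ t])
    fix w assume w: "w \<in> listset (PF n)"
    obtain u x where ux: "w = u @ [x]" using Tp.W_nonempty[OF w] by (cases w rule: rev_cases) auto
    have bw: "u @ [x \<otimes>\<^bsub>A\<^esub> b] \<in> listset (PF n)" using Tp.W_rstable[OF tp_stable(2)[OF b]] w ux by simp
    have xA: "x \<in> carrier A" using Tp.W_letter[OF w] ux by simp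
    show "bar_j n (Tp.lpure n w \<triangleleft>\<^bsub>Tp.LT n\<^esub> b) = bar_j n (Tp.lpure n w) \<triangleleft>\<^bsub>Bar.LT n\<^esub> b"
    proof (cases "n = 0")
      \<comment> \<open>In degree 0 the claim is
        \<open>x b \<otimes> 1 = x \<otimes> b\<close>.\<close>
      case True
      then have "u = []" using w ux by (auto simp: tp_W_0)
      then show ?thesis
        using w bw ext_word_closed[OF w] rel[of "[]" x "\<one>\<^bsub>A\<^esub>" "[]"] bA True bar_ract[OF bA, where n = 0 and u = "[x]" and x = "\<one>\<^bsub>A\<^esub>"]
        by (simp add: ux tp_ract[OF b, where u = "[]", simplified] bar_j(2) ext_word_def)
    next
      case False
      then show ?thesis
        using w bw ext_word_closed[OF w] rel[of "\<one>\<^bsub>A\<^esub> # u" x "\<one>\<^bsub>A\<^esub>" "[]"] bA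
          bar_ract[OF bA, where n = n and u = "\<one>\<^bsub>A\<^esub> # u @ [x]" and x = "\<one>\<^bsub>A\<^esub>"]
        by (simp add: ux tp_ract[OF b] bar_j(2) ext_word_def)
    qed
  qed
qed

lemma bar_j_env_linear: "linear_map (env k (subalg A B)) (TpE n) (restrict_scalars \<iota> (BarE n)) (bar_j n)"
  by (rule TpX.env_linear_mapI[OF E.restrict_left_module[OF BarX.X.env_left_module]])
    (simp_all add: linear_mapD[OF bar_j(1)] bar_j_act linear_mapD(1)[OF tp_lact_linear]
      env_incl(2) BarX.X.env_left_pure B_simps(1))

section \<open>The isomorphism of a bar bimodule with an induced module\<close>

definition bar_\<theta> where "bar_\<theta> n = Ind.iext (BarE n) (bar_j n)"

lemmas bar_\<theta>_pure = Ind.iext_pure[OF BarX.X.env_left_module bar_j_env_linear, folded bar_\<theta>_def]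
  and bar_\<theta>_linear = Ind.iext_linear[OF BarX.X.env_left_module bar_j_env_linear, folded bar_\<theta>_def]

text \<open>Pure tensors in all powers at once: the empty word denotes the unit of \<open>B\<close>,
  the power of exponent 0.\<close>

definition tp :: "nat \<Rightarrow> 'a list \<Rightarrow> ('a list \<Rightarrow> 'k) set"
  where "tp n ms = Tp.lpure n (if ms = [] then [\<one>\<^bsub>A\<^esub>] else ms)"

lemma tp_closed: "\<lbrakk>ms \<in> lists M; length ms = n\<rbrakk> \<Longrightarrow> tp n ms \<in> carrier (Tp.LQ n)"
  unfolding tp_def by (rule Tp.lpure_closed) (cases ms; auto simp: tp_W_0 tp_W B_simps)

lemma bar_j_tp: "\<lbrakk>ms \<in> lists M; length ms = n\<rbrakk> \<Longrightarrow> bar_j n (tp n ms) = Bar.lpure n (\<one>\<^bsub>A\<^esub> # ms @ [\<one>\<^bsub>A\<^esub>])"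
  unfolding tp_def by (cases "n = 0"; subst bar_j(2)) (auto simp: tp_W_0 tp_W B_simps ext_word_def)

text \<open>The balancing relation for the element \<open>b \<otimes> 1\<close> of the smaller
  enveloping algebra: a factor \<open>b\<close> beside the tensor power moves into it.\<close>

lemma ipure_left:
  assumes b: "b \<in> B" and x: "x \<in> carrier A" and y: "y \<in> carrier A" and t: "t \<in> carrier (Tp.LQ n)"
  shows "Ind.ipure n (epure (x \<otimes>\<^bsub>A\<^esub> b) y) t = Ind.ipure n (epure x y) (b \<odot>\<^bsub>Tp.LT n\<^esub> t)"
  using Ind.IT.tensor_pure_balanced[of "bpure b \<one>\<^bsub>A\<^esub>" "epure x y" t] assms
    TpX.ract(5)[of "b \<odot>\<^bsub>Tp.LT n\<^esub> t" n] linear_mapD(1)[OF tp_lact_linear[OF b] t]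
  by (simp add: B_simps EB.epure_closed epure_closed env_incl(2) epure_mult TpX.env_left_pure)

lemma ipure_right:
  assumes b: "b \<in> B" and x: "x \<in> carrier A" and y: "y \<in> carrier A" and t: "t \<in> carrier (Tp.LQ n)"
  shows "Ind.ipure n (epure x (b \<otimes>\<^bsub>A\<^esub> y)) t = Ind.ipure n (epure x y) (t \<triangleleft>\<^bsub>Tp.LT n\<^esub> b)"
  using Ind.IT.tensor_pure_balanced[of "bpure \<one>\<^bsub>A\<^esub> b" "epure x y" t] assms TpX.lact(5)[of t n]
  by (simp add: B_simps EB.epure_closed epure_closed env_incl(2) epure_mult TpX.env_left_pure)

lemma ipure_scalar:
  assumes "c \<in> carrier k" "r \<in> carrier TA.AA.T" "t \<in> carrier (Tp.LQ n)"
  shows "Ind.ipure n r (c \<odot>\<^bsub>Tp.LQ n\<^esub> t) = c \<odot>\<^bsub>Ind.IT.T n\<^esub> Ind.ipure n r t"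
proof -
  have "c \<odot>\<^bsub>A\<^esub> \<one>\<^bsub>A\<^esub> \<in> B" using assms(1) by (simp add: B_simps)
  then show ?thesis
    using Ind.IT.tensor_pure_scalar[where n = n, of c r t] TpX.env_left_scalar[of c t n] Tp.LT_scalar[OF tp_stable(1), of c t n] assms
    by simp
qed

lemma ipure_add_right:
  assumes "r \<in> carrier TA.AA.T" "t \<in> carrier (Tp.LQ n)" "t' \<in> carrier (Tp.LQ n)"
  shows "Ind.ipure n r (t \<oplus>\<^bsub>Tp.LQ n\<^esub> t') = Ind.ipure n r t \<oplus>\<^bsub>Ind.IT.T n\<^esub> Ind.ipure n r t'"
  using Ind.IT.tensor_pure_add_right[of r t n t'] assms by simp

lemma ipure_add_left:
  assumes "r \<in> carrier TA.AA.T" "r' \<in> carrier TA.AA.T" "t \<in> carrier (Tp.LQ n)"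
  shows "Ind.ipure n (r \<oplus>\<^bsub>TA.AA.T\<^esub> r') t = Ind.ipure n r t \<oplus>\<^bsub>Ind.IT.T n\<^esub> Ind.ipure n r' t"
  using Ind.ipure_add_left[where n = n, of r r' t] assms by simp

text \<open>The inverse of \<open>bar_\<theta>\<close>: it separates the outer letters from the
  inner ones, \<open>a \<otimes> t \<otimes> a' \<mapsto> (a \<otimes> a') \<otimes>
  t\<close>.\<close>

definition bar_\<rho> where
  "bar_\<rho> n = lin_ext k (Ind.IT.T n) (\<lambda>w. Ind.ipure n (epure (hd w) (last w)) (tp n (butlast (tl w))))"

text \<open>Outer letters enter through the enveloping algebra and inner ones through the tensor
  power, so every relation is examined according to the position of its letters.\<close>

lemma bar_\<rho>: "linear_map k (Bar.LQ n) (Ind.IT.T n) (bar_\<rho> n)"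
  "a # ms @ [a'] \<in> listset (BF n) \<Longrightarrow> bar_\<rho> n (Bar.lpure n (a # ms @ [a'])) = Ind.ipure n (epure a a') (tp n ms)"
proof -
  let ?T = "Ind.IT.T n" and ?i = "Ind.ipure n"
  have cl: "?i (epure a a') (tp n ms) \<in> carrier ?T" if "a # ms @ [a'] \<in> listset (BF n)" for a ms a'
    using that unfolding bar_W_Cons by (intro Ind.ipure_closed) (simp_all add: epure_closed tp_closed[simplified])
  have one: "[\<one>\<^bsub>A\<^esub>] \<in> listset (PF 0)" by (simp add: tp_W_0 B_simps)
  have ends: "(\<exists>v' z. v = v' @ [z]) \<or> v = []" "(\<exists>a u'. u = a # u') \<or> u = []" for u v :: "'a list"
    by (cases v rule: rev_cases; auto) (cases u; auto)
  have short: "u \<noteq> [] \<or> v \<noteq> []" if "u @ x # v \<in> listset (BF n)" for u x v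
    using that by (auto simp: bar_W)
  have bal: "balanced k A B (BF n) ?T (\<lambda>w. ?i (epure (hd w) (last w)) (tp n (butlast (tl w))))"
  proof (rule balancedI)
    fix w assume w: "w \<in> listset (BF n)"
    then obtain a ms a' where "w = a # ms @ [a']" using bar_W_cases by blast
    then show "?i (epure (hd w) (last w)) (tp n (butlast (tl w))) \<in> carrier ?T"
      using cl[of a ms a'] w by simp
  next
    fix u x y v assume w: "u @ x # v \<in> listset (BF n)" "u @ y # v \<in> listset (BF n)"
    consider v' z where "u = []" "v = v' @ [z]" | a u' where "u = a # u'" "v = []"
      | a u' v' z where "u = a # u'" "v = v' @ [z]"
      using short[OF w(1)] ends(1)[of v] ends(2)[of u] by blast
    then show "?i (epure (hd (u @ (x \<oplus>\<^bsub>A\<^esub> y) # v)) (last (u @ (x \<oplus>\<^bsub>A\<^esub> y) # v))) (tp n (butlast (tl (u @ (x \<oplus>\<^bsub>A\<^esub> y) # v)))) =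
        ?i (epure (hd (u @ x # v)) (last (u @ x # v))) (tp n (butlast (tl (u @ x # v)))) \<oplus>\<^bsub>?T\<^esub>
        ?i (epure (hd (u @ y # v)) (last (u @ y # v))) (tp n (butlast (tl (u @ y # v))))"
    proof cases
      case 1
      then show ?thesis
        using w bar_W_Cons[of x v' z n] bar_W_Cons[of y v' z n]
        by (simp add: epure_add epure_closed tp_closed ipure_add_left)
    next
      case 2
      then show ?thesis
        using w bar_W_Cons[of a u' x n] bar_W_Cons[of a u' y n]
        by (simp add: epure_add epure_closed tp_closed ipure_add_left)
    next
      case 3
      have m: "u' @ x # v' \<in> lists M" "length (u' @ x # v') = n" "u' @ y # v' \<in> lists M" "a \<in> carrier A" "z \<in> carrier A"
        using w bar_W_Cons[of a "u' @ x # v'" z n] bar_W_Cons[of a "u' @ y # v'" z n] 3 by simp_all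
      then have "tp n (u' @ (x \<oplus>\<^bsub>A\<^esub> y) # v') = tp n (u' @ x # v') \<oplus>\<^bsub>Tp.LQ n\<^esub> tp n (u' @ y # v')"
        using Tp.lpure_rel(1)[where n = n, of u' x v' y] by (simp add: tp_def tp_W)
      then show ?thesis
        using m 3 tp_closed[OF m(1,2)] tp_closed[OF m(3)] by (simp add: ipure_add_right epure_closed butlast_append)
    qed
  next
    fix c u x v assume c: "c \<in> carrier k" and w: "u @ x # v \<in> listset (BF n)"
    \<comment> \<open>A scalar on an outer letter is multiplication by an element of
      \<open>B\<close>; as such it moves into the tensor power and is taken out there.\<close>
    have cB: "c \<odot>\<^bsub>A\<^esub> \<one>\<^bsub>A\<^esub> \<in> B" using c by (simp add: B_simps)
    consider v' z where "u = []" "v = v' @ [z]" | a u' where "u = a # u'" "v = []"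
      | a u' v' z where "u = a # u'" "v = v' @ [z]"
      using short[OF w] ends(1)[of v] ends(2)[of u] by blast
    then show "?i (epure (hd (u @ (c \<odot>\<^bsub>A\<^esub> x) # v)) (last (u @ (c \<odot>\<^bsub>A\<^esub> x) # v))) (tp n (butlast (tl (u @ (c \<odot>\<^bsub>A\<^esub> x) # v)))) =
        c \<odot>\<^bsub>?T\<^esub> ?i (epure (hd (u @ x # v)) (last (u @ x # v))) (tp n (butlast (tl (u @ x # v))))"
    proof cases
      case 1
      have m: "x \<in> carrier A" "z \<in> carrier A" "tp n v' \<in> carrier (Tp.LQ n)"
        using w bar_W_Cons[of x v' z n] 1 tp_closed by simp_all
      have "?i (epure (x \<otimes>\<^bsub>A\<^esub> (c \<odot>\<^bsub>A\<^esub> \<one>\<^bsub>A\<^esub>)) z) (tp n v') = c \<odot>\<^bsub>?T\<^esub> ?i (epure x z) (tp n v')"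
        using m c by (simp add: ipure_left[OF cB] Tp.LT_scalar[OF tp_stable(1)[OF cB]] ipure_scalar epure_closed)
      then show ?thesis using 1 c m by (simp add: scalar_central)
    next
      case 2
      have m: "x \<in> carrier A" "a \<in> carrier A" "tp n u' \<in> carrier (Tp.LQ n)"
        using w bar_W_Cons[of a u' x n] 2 tp_closed by simp_all
      have "?i (epure a ((c \<odot>\<^bsub>A\<^esub> \<one>\<^bsub>A\<^esub>) \<otimes>\<^bsub>A\<^esub> x)) (tp n u') = c \<odot>\<^bsub>?T\<^esub> ?i (epure a x) (tp n u')"
        using m c TpX.scalar_lr[of c "tp n u'" n]
        by (simp add: ipure_right[OF cB] Tp.LT_scalar[OF tp_stable(1)[OF cB]] ipure_scalar epure_closed)
      then show ?thesis using 2 c m by (simp add: scalar_central)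
    next
      case 3
      have m: "u' @ x # v' \<in> lists M" "length (u' @ x # v') = n" "a \<in> carrier A" "z \<in> carrier A"
        using w bar_W_Cons[of a "u' @ x # v'" z n] 3 by simp_all
      then have "tp n (u' @ (c \<odot>\<^bsub>A\<^esub> x) # v') = c \<odot>\<^bsub>Tp.LQ n\<^esub> tp n (u' @ x # v')"
        using Tp.lpure_rel(2)[where n = n, OF c, of u' x v'] by (simp add: tp_def tp_W)
      then show ?thesis
        using m 3 tp_closed[OF m(1,2)] c by (simp add: ipure_scalar epure_closed butlast_append)
    qed
  next
    fix b u x y v assume b: "b \<in> B" and w: "u @ x # y # v \<in> listset (BF n)"
    consider "u = []" "v = []" | v' z where "u = []" "v = v' @ [z]" | a u' where "u = a # u'" "v = []"
      | a u' v' z where "u = a # u'" "v = v' @ [z]"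
      using ends(1)[of v] ends(2)[of u] by blast
    then show "?i (epure (hd (u @ (x \<otimes>\<^bsub>A\<^esub> b) # y # v)) (last (u @ (x \<otimes>\<^bsub>A\<^esub> b) # y # v)))
          (tp n (butlast (tl (u @ (x \<otimes>\<^bsub>A\<^esub> b) # y # v)))) =
        ?i (epure (hd (u @ x # (b \<otimes>\<^bsub>A\<^esub> y) # v)) (last (u @ x # (b \<otimes>\<^bsub>A\<^esub> y) # v)))
          (tp n (butlast (tl (u @ x # (b \<otimes>\<^bsub>A\<^esub> y) # v))))"
    proof cases
      \<comment> \<open>A word of two letters, degree 0: \<open>b\<close> passes from the left outer
        letter to the right one through the middle factor \<open>B\<close>, where
        \<open>b 1 = 1 b\<close>.\<close>
      case 1
      have m: "x \<in> carrier A" "y \<in> carrier A" "n = 0" using w bar_W_Cons[of x "[]" y n] 1 by simp_all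
      have "b \<odot>\<^bsub>Tp.LT 0\<^esub> tp 0 [] = tp 0 [] \<triangleleft>\<^bsub>Tp.LT 0\<^esub> b"
        using one B_simps(1)[OF b] by (simp add: tp_def tp_lact[OF b] tp_ract[OF b, where u = "[]", simplified])
      then show ?thesis
        using m 1 tp_closed[of "[]" 0] by (simp add: ipure_left[OF b] ipure_right[OF b])
    next
      case 2
      have m: "y # v' \<in> lists M" "length (y # v') = n" "x \<in> carrier A" "z \<in> carrier A"
        using w bar_W_Cons[of x "y # v'" z n] 2 by simp_all
      then have "b \<odot>\<^bsub>Tp.LT n\<^esub> tp n (y # v') = tp n ((b \<otimes>\<^bsub>A\<^esub> y) # v')"
        using tp_W[of n "y # v'"] by (auto simp: tp_def tp_lact[OF b])
      then show ?thesis
        using m 2 tp_closed[OF m(1,2)] by (simp add: ipure_left[OF b])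
    next
      case 3
      have m: "u' @ [x] \<in> lists M" "length (u' @ [x]) = n" "a \<in> carrier A" "y \<in> carrier A"
        using w bar_W_Cons[of a "u' @ [x]" y n] 3 by simp_all
      then have "tp n (u' @ [x]) \<triangleleft>\<^bsub>Tp.LT n\<^esub> b = tp n (u' @ [x \<otimes>\<^bsub>A\<^esub> b])"
        using tp_W[of n "u' @ [x]"] by (auto simp: tp_def tp_ract[OF b])
      then show ?thesis
        using m 3 tp_closed[OF m(1,2)] by (simp add: ipure_right[OF b] butlast_append)
    next
      case 4
      have m: "u' @ x # y # v' \<in> lists M" "length (u' @ x # y # v') = n"
        using w bar_W_Cons[of a "u' @ x # y # v'" z n] 4 by simp_all
      then have "tp n (u' @ (x \<otimes>\<^bsub>A\<^esub> b) # y # v') = tp n (u' @ x # (b \<otimes>\<^bsub>A\<^esub> y) # v')"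
        using Tp.lpure_rel(3)[where n = n, OF b, of u' x y v'] by (simp add: tp_def tp_W)
      then show ?thesis using 4 by (simp add: butlast_append)
    qed
  qed
  note l = Bar.lift[OF Ind.IT.tensor_left_module bal]
  show "linear_map k (Bar.LQ n) ?T (bar_\<rho> n)" unfolding bar_\<rho>_def by (rule l(1))
  show "bar_\<rho> n (Bar.lpure n (a # ms @ [a'])) = ?i (epure a a') (tp n ms)" if "a # ms @ [a'] \<in> listset (BF n)"
    unfolding bar_\<rho>_def using l(2)[OF that] by simp
qed

lemma bar_\<rho>_env_linear: "linear_map (env k A) (BarE n) (Ind.IM n) (bar_\<rho> n)"
proof (rule BarX.X.env_linear_mapI[OF Ind.IM_left_module])
  fix a a' t assume a: "a \<in> carrier A" "a' \<in> carrier A" and "t \<in> carrier (Bar.LT n)"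
  then have t: "t \<in> carrier (Bar.LQ n)" by simp
  have e: "epure a a' \<in> carrier (env k A)" using a by (simp add: epure_closed)
  show "bar_\<rho> n ((a \<odot>\<^bsub>Bar.LT n\<^esub> t) \<triangleleft>\<^bsub>Bar.LT n\<^esub> a') = epure a a' \<odot>\<^bsub>Ind.IM n\<^esub> bar_\<rho> n t"
  proof (rule Bar.ltensor_ext[OF Ind.IT.tensor_left_module
        linear_map_comp[OF linear_map_comp[OF bar_lact_linear[OF a(1)] bar_ract_linear[OF a(2)]] bar_\<rho>(1)]
        linear_map_comp[OF bar_\<rho>(1) Ind.IM_action_linear[OF e]] _ t])
    fix w assume w: "w \<in> listset (BF n)"
    obtain x ms z where weq: "w = x # ms @ [z]" and m: "x \<in> carrier A" "ms \<in> lists M" "length ms = n" "z \<in> carrier A"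
      using bar_W_cases[OF w] by blast
    have "(a \<otimes>\<^bsub>A\<^esub> x) # ms @ [z] \<in> listset (BF n)" "(a \<otimes>\<^bsub>A\<^esub> x) # ms @ [z \<otimes>\<^bsub>A\<^esub> a'] \<in> listset (BF n)"
      using m a by (simp_all add: bar_W_Cons)
    then show "bar_\<rho> n ((a \<odot>\<^bsub>Bar.LT n\<^esub> Bar.lpure n w) \<triangleleft>\<^bsub>Bar.LT n\<^esub> a') =
        epure a a' \<odot>\<^bsub>Ind.IM n\<^esub> bar_\<rho> n (Bar.lpure n w)"
      using w m a tp_closed[OF m(2,3)] bar_ract[OF a(2), where n = n and u = "(a \<otimes>\<^bsub>A\<^esub> x) # ms" and x = z]
      by (simp add: weq bar_lact[OF a(1)] bar_\<rho>(2) Ind.IM_action_pure epure_closed epure_mult)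
  qed
qed (simp_all add: linear_mapD[OF bar_\<rho>(1)])

text \<open>By generation it is enough to test \<open>1 \<otimes> t\<close>, and then only for the
  class \<open>t\<close> of a single word.\<close>

lemma bar_\<rho>_\<theta>:
  assumes "C \<in> carrier (Ind.IM n)"
  shows "bar_\<rho> n (bar_\<theta> n C) = C"
proof (rule Ind.IM_ext[OF Ind.IM_left_module linear_map_comp[OF bar_\<theta>_linear bar_\<rho>_env_linear] linear_map_id _ assms])
  fix t assume "t \<in> carrier (TpE n)"
  then have t: "t \<in> carrier (Tp.LQ n)" by simp
  have e: "epure \<one>\<^bsub>A\<^esub> \<one>\<^bsub>A\<^esub> \<in> carrier TA.AA.T" by (simp add: epure_closed)
  have lin: "linear_map k (Tp.LQ n) (Ind.IT.T n) (\<lambda>t. Ind.ipure n (epure \<one>\<^bsub>A\<^esub> \<one>\<^bsub>A\<^esub>) t)"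
    by (rule linear_mapI) (use e in \<open>simp_all add: Ind.ipure_closed ipure_add_right ipure_scalar\<close>)
  have "bar_\<rho> n (bar_j n t) = Ind.ipure n (epure \<one>\<^bsub>A\<^esub> \<one>\<^bsub>A\<^esub>) t"
  proof (rule Tp.ltensor_ext[OF Ind.IT.tensor_left_module linear_map_comp[OF bar_j(1) bar_\<rho>(1)] lin _ t])
    fix v assume v: "v \<in> listset (PF n)"
    show "bar_\<rho> n (bar_j n (Tp.lpure n v)) = Ind.ipure n (epure \<one>\<^bsub>A\<^esub> \<one>\<^bsub>A\<^esub>) (Tp.lpure n v)"
    proof (cases "n = 0")
      \<comment> \<open>In degree 0 \<open>bar_j\<close> has put \<open>b\<close> into the outer
        letter, and \<open>ipure_left\<close> brings it back into the middle factor.\<close>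
      case True
      then obtain b where b: "b \<in> B" "v = [b]" using v by (auto simp: tp_W_0)
      have bA: "b \<in> carrier A" by (rule B_simps(1)[OF b(1)])
      have "b \<odot>\<^bsub>Tp.LT 0\<^esub> tp 0 [] = Tp.lpure 0 [b]"
        using bA tp_lact[OF b(1), of "\<one>\<^bsub>A\<^esub>" "[]" 0] by (simp add: tp_def tp_W_0 B_simps)
      then show ?thesis
        using v b bA bar_\<rho>(2)[of b "[]" "\<one>\<^bsub>A\<^esub>" 0] ipure_left[OF b(1), of "\<one>\<^bsub>A\<^esub>" "\<one>\<^bsub>A\<^esub>" "tp 0 []" 0] tp_closed[of "[]" 0]
        by (simp add: True bar_j(2) ext_word_def bar_W_0)
    next
      case False
      then show ?thesis
        using v ext_word_closed[OF v] bar_\<rho>(2)[of "\<one>\<^bsub>A\<^esub>" v "\<one>\<^bsub>A\<^esub>" n] Tp.W_nonempty[OF v]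
        by (simp add: bar_j(2) ext_word_def tp_def)
    qed
  qed
  moreover have "bar_\<theta> n (Ind.ipure n \<one>\<^bsub>env k A\<^esub> t) = bar_j n t"
    using bar_\<theta>_pure[of "\<one>\<^bsub>env k A\<^esub>" t n] t e linear_mapD(1)[OF bar_j(1) t]
      left_module.smult_one[OF BarX.X.env_left_module, of "bar_j n t" n] by simp
  ultimately show "bar_\<rho> n (bar_\<theta> n (Ind.ipure n \<one>\<^bsub>env k A\<^esub> t)) = Ind.ipure n \<one>\<^bsub>env k A\<^esub> t" by simp
qed

text \<open>Exhibits a bar word as the outer action on \<open>1 \<otimes> ms \<otimes> 1\<close>,
  the form in which the base change maps can be evaluated.\<close>

lemma lpure_eq_action:
  assumes "a \<in> carrier A" "ms \<in> lists M" "length ms = n" "a' \<in> carrier A"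
  shows "Bar.lpure n (a # ms @ [a']) = epure a a' \<odot>\<^bsub>BarE n\<^esub> bar_j n (tp n ms)"
  using assms bar_ract[OF assms(4), where n = n and u = "a # ms" and x = "\<one>\<^bsub>A\<^esub>"]
    bar_lact[OF assms(1), where n = n and x = "\<one>\<^bsub>A\<^esub>" and v = "ms @ [\<one>\<^bsub>A\<^esub>]"]
    linear_mapD(1)[OF bar_j(1) tp_closed[OF assms(2,3)]]
  by (simp add: BarX.X.env_left_pure bar_j_tp bar_W_Cons)

lemma bar_\<theta>_\<rho>:
  assumes "t \<in> carrier (Bar.LQ n)"
  shows "bar_\<theta> n (bar_\<rho> n t) = t"
  using assms
proof (induction rule: Bar.ltensor_induct)
  case (pure w)
  obtain x ms z where weq: "w = x # ms @ [z]" and m: "x \<in> carrier A" "ms \<in> lists M" "length ms = n" "z \<in> carrier A"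
    using bar_W_cases[OF pure] by blast
  have "bar_\<rho> n (Bar.lpure n w) = Ind.ipure n (epure x z) (tp n ms)" using pure weq bar_\<rho>(2) by simp
  then show ?case
    using m tp_closed[OF m(2,3)] bar_\<theta>_pure[of "epure x z" "tp n ms" n] lpure_eq_action[OF m]
    by (simp add: weq epure_closed)
next
  case (add s t)
  then show ?case
    using linear_mapD(1,2)[OF bar_\<rho>(1)] linear_mapD(2)[OF bar_\<theta>_linear] by simp
qed

sublocale BI: induced_iso k "env k A" "env k (subalg A B)" \<iota> "TpE n" "BarE n" "bar_\<theta> n" for n
proof (intro induced_iso.intro induced_iso_axioms.intro Ind.induced_axioms BarX.X.env_left_module bar_\<theta>_linear)
  show "bij_betw (bar_\<theta> n) (carrier (Ind.IM n)) (carrier (BarE n))"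
    using linear_mapD(1)[OF bar_\<theta>_linear] linear_mapD(1)[OF bar_\<rho>_env_linear]
    by (intro bij_betw_byWitness[where f' = "bar_\<rho> n"]) (auto simp: bar_\<rho>_\<theta>[simplified] bar_\<theta>_\<rho>)
qed

lemma unit_eq:
  assumes "t \<in> carrier (Tp.LQ n)" shows "BI.unit n t = bar_j n t"
  using bar_\<theta>_pure[of "\<one>\<^bsub>env k A\<^esub>" t n] assms linear_mapD(1)[OF bar_j(1) assms]
    left_module.smult_one[OF BarX.X.env_left_module, of "bar_j n t" n]
  by (simp add: BI.unit_def epure_closed)

theorem bar_resolution: "Hochschild_resolution k A B (\<lambda>n. env_left k A (bar_bimodule k A B M n)) bar_d bar_\<epsilon>"
  unfolding Hochschild_resolution_def rel_projective_resolution_def bar_bimodule_def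
proof (intro conjI allI)
  show "rel_projective k (env k A) (env k (subalg A B)) \<iota> (BarE n)" for n
  proof (rule E.rel_projective_iso[OF BarX.X.env_left_module TpX.env_left_module])
    show "module_iso (env k A) (BarE n) (Ind.IM n)"
      using linear_mapD(1)[OF bar_\<theta>_linear]
      by (intro module_isoI[OF bar_\<rho>_env_linear, where g = "bar_\<theta> n"]) (simp_all add: bar_\<theta>_\<rho> bar_\<rho>_\<theta>)
  qed
  show "\<exists>\<eta> h.
       linear_map (env k (subalg A B)) (restrict_scalars \<iota> SelfE) (restrict_scalars \<iota> (BarE 0)) \<eta> \<and>
       (\<forall>n. linear_map (env k (subalg A B)) (restrict_scalars \<iota> (BarE n)) (restrict_scalars \<iota> (BarE (Suc n))) (h n)) \<and>
       (\<forall>y\<in>carrier SelfE. bar_\<epsilon> (\<eta> y) = y) \<and>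
       (\<forall>x\<in>carrier (BarE 0). bar_d 1 (h 0 x) \<oplus>\<^bsub>BarE 0\<^esub> \<eta> (bar_\<epsilon> x) = x) \<and>
       (\<forall>n. \<forall>x\<in>carrier (BarE (Suc n)).
          bar_d (Suc (Suc n)) (h (Suc n) x) \<oplus>\<^bsub>BarE (Suc n)\<^esub> h n (bar_d (Suc n) x) = x)"
  proof (intro exI[of _ bar_\<eta>] exI[of _ bar_h] conjI allI ballI)
    show "bar_\<epsilon> (bar_\<eta> y) = y" if "y \<in> carrier SelfE" for y
      using that by (simp add: bar_\<eta>_def bar_\<epsilon>(2))
  qed (simp_all add: bar_\<eta>_env_linear bar_h_env_linear bar_homotopy_0[simplified] bar_homotopy_Suc)
qed (simp_all add: bar_\<epsilon>_env_linear bar_d_env_linear bar_d_\<epsilon> bar_d_d)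

section \<open>Evaluation of the differential on pure tensors\<close>

lemma contract_at_word:
  assumes "ms \<in> lists M" "length ms = Suc m" "1 \<le> i" "i \<le> m"
  shows "contract_at A ms i \<in> lists M" "length (contract_at A ms i) = m"
proof -
  have "ms ! (i - 1) \<in> M" "ms ! i \<in> M" using assms by auto
  then show "contract_at A ms i \<in> lists M"
    using assms(1) by (auto simp: contract_at_def M_simps dest: in_set_takeD in_set_dropD)
  show "length (contract_at A ms i) = m" using assms by (simp add: contract_at_def)
qed

text \<open>One computation behind three formulas: \<open>G\<close> will be the identity for the bar
  complex, \<open>t \<mapsto> \<Psi> (x \<otimes> t)\<close> for chains, and the extension of a
  cochain for cochains. The function \<open>g\<close> lists the values of \<open>G\<close> on bar
  words, so that the sum is formed in the target.\<close>

lemma bar_d_pure: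
  fixes Z :: "('k, 'z, 'j) module_scheme"
  assumes Z: "abelian_group Z" and G: "\<And>t. t \<in> carrier (Bar.LQ m) \<Longrightarrow> G t \<in> carrier Z"
      "\<And>s t. \<lbrakk>s \<in> carrier (Bar.LQ m); t \<in> carrier (Bar.LQ m)\<rbrakk> \<Longrightarrow> G (s \<oplus>\<^bsub>Bar.LQ m\<^esub> t) = G s \<oplus>\<^bsub>Z\<^esub> G t"
    and g: "\<And>a ms a'. \<lbrakk>a \<in> carrier A; ms \<in> lists M; length ms = m; a' \<in> carrier A\<rbrakk> \<Longrightarrow>
      G (Bar.lpure m (a # ms @ [a'])) = g a ms a'"
    and ms: "ms \<in> lists M" "length ms = Suc m" and a: "a \<in> carrier A" "a' \<in> carrier A"
  shows "G (bar_d (Suc m) (Bar.lpure (Suc m) (a # ms @ [a']))) =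
    g (a \<otimes>\<^bsub>A\<^esub> hd ms) (tl ms) a' \<oplus>\<^bsub>Z\<^esub>
    (\<Oplus>\<^bsub>Z\<^esub>i\<in>{1..m}. alt_sign Z i (g a (contract_at A ms i) a')) \<oplus>\<^bsub>Z\<^esub>
    alt_sign Z (Suc m) (g a (butlast ms) (last ms \<otimes>\<^bsub>A\<^esub> a'))"
proof -
  interpret Z: abelian_group Z by fact
  \<comment> \<open>\<open>G\<close> is merely additive. Over scalars with empty carrier additivity
    is linearity, so the lemmas on linear maps apply.\<close>
  have lin: "linear_map (k\<lparr>carrier := {}\<rparr>) (Bar.LQ m) Z G" using G by (auto intro: linear_mapI)
  have w: "a # ms @ [a'] \<in> listset (BF (Suc m))" using ms a by (simp add: bar_W_Cons)
  define F where "F i = alt_sign Z i (G (Bar.lpure m (contract_at A (a # ms @ [a']) (Suc i))))" for i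
  have Fcl: "F i \<in> carrier Z" if "i \<le> Suc m" for i
    unfolding F_def using that by (intro Z.alt_sign(1) G(1) Bar.lpure_closed contract_closed[OF w])
  have GF: "G (face m i (a # ms @ [a'])) = F i" if "i \<le> Suc m" for i
    unfolding face_def F_def
    by (rule linear_map_alt_sign[OF lin Bar.LQ.N.abelian_group_axioms Z Bar.lpure_closed[OF contract_closed[OF w that]]])
  have "G (bar_d (Suc m) (Bar.lpure (Suc m) (a # ms @ [a']))) = (\<Oplus>\<^bsub>Z\<^esub>i\<in>{..Suc m}. G (face m i (a # ms @ [a'])))"
    unfolding bar_d(2)[OF w] using face_closed[OF w]
    by (intro linear_map_finsum[OF lin Bar.LQ.N.abelian_group_axioms Z]) auto
  also have "\<dots> = (\<Oplus>\<^bsub>Z\<^esub>i\<in>{..Suc m}. F i)"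
    by (rule Z.finsum_cong') (use Fcl GF in auto)
  \<comment> \<open>The last and the zeroth face are split off, since they alone change the outer
    letters.\<close>
  also have "\<dots> = F (Suc m) \<oplus>\<^bsub>Z\<^esub> (\<Oplus>\<^bsub>Z\<^esub>i\<in>{..m}. F i)" by (rule Z.finsum_Suc) (use Fcl in auto)
  also have "{..m} = insert 0 {1..m}" by auto
  also have "(\<Oplus>\<^bsub>Z\<^esub>i\<in>insert 0 {1..m}. F i) = F 0 \<oplus>\<^bsub>Z\<^esub> (\<Oplus>\<^bsub>Z\<^esub>i\<in>{1..m}. F i)"
    by (rule Z.finsum_insert) (use Fcl in auto)
  also have "F (Suc m) \<oplus>\<^bsub>Z\<^esub> (F 0 \<oplus>\<^bsub>Z\<^esub> (\<Oplus>\<^bsub>Z\<^esub>i\<in>{1..m}. F i)) =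
      F 0 \<oplus>\<^bsub>Z\<^esub> (\<Oplus>\<^bsub>Z\<^esub>i\<in>{1..m}. F i) \<oplus>\<^bsub>Z\<^esub> F (Suc m)"
    by (rule Z.a_comm) (use Fcl in \<open>auto intro!: Z.a_closed Z.finsum_closed\<close>)
  also have "F 0 = g (a \<otimes>\<^bsub>A\<^esub> hd ms) (tl ms) a'"
    using ms a g[of "a \<otimes>\<^bsub>A\<^esub> hd ms" "tl ms" a'] by (cases ms) (simp_all add: F_def contract_at_Cons alt_sign_def M_simps)
  also have "(\<Oplus>\<^bsub>Z\<^esub>i\<in>{1..m}. F i) = (\<Oplus>\<^bsub>Z\<^esub>i\<in>{1..m}. alt_sign Z i (g a (contract_at A ms i) a'))"
  proof -
    have eq: "F i = alt_sign Z i (g a (contract_at A ms i) a')" if "i \<in> {1..m}" for i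
    proof -
      obtain j where j: "i = Suc j" using \<open>i \<in> {1..m}\<close> by (cases i) auto
      then have "Suc j < length ms" using that ms by simp
      then show ?thesis using a that g[OF a(1) contract_at_word[OF ms, of i] a(2)]
        by (simp add: F_def j contract_at_Cons contract_at_append(1))
    qed
    moreover have "alt_sign Z i (g a (contract_at A ms i) a') \<in> carrier Z" if "i \<in> {1..m}" for i
      using Fcl[of i] eq[OF that] that by simp
    ultimately show ?thesis by (intro Z.finsum_cong') blast+
  qed
  also have "F (Suc m) = alt_sign Z (Suc m) (g a (butlast ms) (last ms \<otimes>\<^bsub>A\<^esub> a'))"
  proof -
    obtain u x where "ms = u @ [x]" using ms by (cases ms rule: rev_cases) auto
    then show ?thesis
      using ms a contract_at_append(2)[of A u x a' "[]"] g[of a u "x \<otimes>\<^bsub>A\<^esub> a'"]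
      by (simp add: F_def contract_at_Cons M_simps)
  qed
  finally show ?thesis .
qed

end

section \<open>The complexes with coefficients\<close>

context split_ext
begin

lemma tpow_pure_eq: "length ms = n \<Longrightarrow> tpow_pure k A B M ms = tp n ms"
  by (auto simp: tpow_pure_def tp_def)

lemma bar_pure_eq: "length ms = n \<Longrightarrow> bar_pure k A B M a ms a' = Bar.lpure n (a # ms @ [a'])"
  by (auto simp: bar_pure_def)

lemma unit_tp: "\<lbrakk>ms \<in> lists M; length ms = n\<rbrakk> \<Longrightarrow> BI.unit n (tp n ms) = Bar.lpure n (\<one>\<^bsub>A\<^esub> # ms @ [\<one>\<^bsub>A\<^esub>])"
  by (simp add: unit_eq[OF tp_closed] bar_j_tp)

lemma lpure_unit:
  "\<lbrakk>a \<in> carrier A; ms \<in> lists M; length ms = n; a' \<in> carrier A\<rbrakk> \<Longrightarrow>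
    Bar.lpure n (a # ms @ [a']) = epure a a' \<odot>\<^bsub>BarE n\<^esub> BI.unit n (tp n ms)"
  by (simp add: lpure_eq_action unit_eq[OF tp_closed])

lemma bar_d_bar_pure:
  assumes ms: "ms \<in> lists M" "length ms = n" and n: "n \<ge> 1" and a: "a \<in> carrier A" "a' \<in> carrier A"
  shows "bar_d n (bar_pure k A B M a ms a') =
    bar_pure k A B M (a \<otimes>\<^bsub>A\<^esub> hd ms) (tl ms) a' \<oplus>\<^bsub>bar_bimodule k A B M (n - 1)\<^esub>
    (\<Oplus>\<^bsub>bar_bimodule k A B M (n - 1)\<^esub>i\<in>{1..n - 1}.
       alt_sign (bar_bimodule k A B M (n - 1)) i (bar_pure k A B M a (contract_at A ms i) a')) \<oplus>\<^bsub>bar_bimodule k A B M (n - 1)\<^esub>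
    alt_sign (bar_bimodule k A B M (n - 1)) n (bar_pure k A B M a (butlast ms) (last ms \<otimes>\<^bsub>A\<^esub> a'))"
proof -
  obtain m where m: "n = Suc m" using n by (cases n) auto
  have "bar_d (Suc m) (Bar.lpure (Suc m) (a # ms @ [a'])) =
      bar_pure k A B M (a \<otimes>\<^bsub>A\<^esub> hd ms) (tl ms) a' \<oplus>\<^bsub>Bar.LQ m\<^esub>
      (\<Oplus>\<^bsub>Bar.LQ m\<^esub>i\<in>{1..m}. alt_sign (Bar.LQ m) i (bar_pure k A B M a (contract_at A ms i) a')) \<oplus>\<^bsub>Bar.LQ m\<^esub>
      alt_sign (Bar.LQ m) (Suc m) (bar_pure k A B M a (butlast ms) (last ms \<otimes>\<^bsub>A\<^esub> a'))"
    by (rule bar_d_pure[OF Bar.LQ.N.abelian_group_axioms, where G = "\<lambda>t. t"])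
      (use ms a m in \<open>simp_all add: bar_pure_eq\<close>)
  then show ?thesis
    using ms by (simp add: m bar_bimodule_def bar_pure_eq[of ms] finsum_record_cong[of "Bar.LT m" "Bar.LQ m"]
        alt_sign_record_cong[of "Bar.LT m" "Bar.LQ m"])
qed

end

section \<open>Coefficients in a bimodule\<close>

locale split_ext_bimod = split_ext k A B M
  for k :: "'k ring" and A :: "('k, 'a) module" and B M +
  fixes X :: "('a, 'x) bimodule"
  assumes X: "is_bimodule k A X"
begin

sublocale X: restricted_bimod k A B X
  by (intro restricted_bimod.intro sub_algebra_axioms bimodI X)

abbreviation "XR \<equiv> env_right k A X"
abbreviation "XL \<equiv> env_left k A X"

sublocale TB: tensor_base_change k "env k A" "env k (subalg A B)" \<iota> "TpE n" "BarE n" "bar_\<theta> n"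
    XR "env_right k (subalg A B) X" for n
  by (intro tensor_base_change.intro tensor_base_change_axioms.intro BI.induced_iso_axioms
      X.X.env_right_module X.XB.env_right_module) (simp_all add: X.env_right_incl)

sublocale HB: hom_base_change k "env k A" "env k (subalg A B)" \<iota> "TpE n" "BarE n" "bar_\<theta> n"
    XL "env_left k (subalg A B) X" for n
  by (intro hom_base_change.intro hom_base_change_axioms.intro BI.induced_iso_axioms
      X.X.env_left_module X.XB.env_left_module) (simp_all add: X.env_left_incl)

text \<open>The differential \<open>1 \<otimes> d\<close> conjugated by base change, in the shape
  produced by \<open>chain_complex_transport\<close>.\<close>

definition chain_b where
  "chain_b n z = TB.\<Psi> (n - 1) (tmap k (env k A) XR (BarE (n - 1)) (bar_d n) (TB.\<Phi> n z))"

definition cochain_b where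
  "cochain_b n f = HB.\<Phi>\<^sub>h (Suc n) (hmap (BarE (Suc n)) (bar_d (Suc n)) (HB.\<Psi>\<^sub>h n f))"

lemma rel_chains_eq: "rel_chains k A B M X = (\<lambda>n. TB.XN.T n)"
  by (simp add: rel_chains_def tpow_def fun_eq_iff)

lemma rel_cochains_eq:
  "rel_cochains k A B M X = (\<lambda>n. hom_module (env k (subalg A B)) (TpE n) (env_left k (subalg A B) X))"
  by (simp add: rel_cochains_def tpow_def fun_eq_iff)

lemma chain_pure_eq: "length ms = n \<Longrightarrow> chain_pure k A B M X x ms = TB.XN.tpure n x (tp n ms)"
  by (simp add: chain_pure_def tpow_def tpow_pure_eq)

lemmas bar_res = bar_resolution[unfolded Hochschild_resolution_def bar_bimodule_def]
  and bar_aug = E.resolution_aug_complex[OF bar_resolution[unfolded Hochschild_resolution_def bar_bimodule_def] SelfX.X.env_left_module]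

lemma chain_b_complex: "chain_complex k (rel_chains k A B M X) chain_b"
  and chain_b_homology:
    "module_iso k (homology (rel_chains k A B M X) chain_b n) (Tor_via k (env k A) XR BarE bar_d n)"
proof -
  note D = env.tensor_chain_complex[OF X.X.env_right_module bar_aug]
  note C = chain_complex_transport[OF D TB.XN.tensor_left_module TB.\<Phi>(1) TB.\<Psi>(1) TB.\<Psi>\<Phi> TB.\<Phi>\<Psi>]
  show "chain_complex k (rel_chains k A B M X) chain_b"
    using C(1) by (simp add: rel_chains_eq chain_b_def[abs_def])
  show "module_iso k (homology (rel_chains k A B M X) chain_b n) (Tor_via k (env k A) XR BarE bar_d n)"
    using C(2)[of n] by (simp add: rel_chains_eq chain_b_def[abs_def] Tor_via_def tmap_def)
qed

lemma cochain_b_complex: "cochain_complex k (rel_cochains k A B M X) cochain_b"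
  and cochain_b_cohomology:
    "module_iso k (cohomology (rel_cochains k A B M X) cochain_b n) (Ext_via (env k A) BarE bar_d XL n)"
proof -
  note D = env.hom_cochain_complex[OF X.X.env_left_module bar_aug]
  note C = cochain_complex_transport[where C = "\<lambda>n. hom_module (env k (subalg A B)) (TpE n) (env_left k (subalg A B) X)"
      and u = "\<lambda>n. HB.\<Psi>\<^sub>h n" and v = "\<lambda>n. HB.\<Phi>\<^sub>h n", OF D EB.env.hom_left_module[OF TpX.env_left_module X.XB.env_left_module]
      HB.\<Psi>\<^sub>h_linear HB.\<Phi>\<^sub>h_linear HB.\<Psi>\<^sub>h(3) HB.\<Psi>\<^sub>h\<Phi>\<^sub>h]
  show "cochain_complex k (rel_cochains k A B M X) cochain_b"
    using C(1) by (simp add: rel_cochains_eq cochain_b_def[abs_def])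
  show "module_iso k (cohomology (rel_cochains k A B M X) cochain_b n) (Ext_via (env k A) BarE bar_d XL n)"
    using C(2)[of n] by (simp add: rel_cochains_eq cochain_b_def[abs_def] Ext_via_def hmap_def[abs_def])
qed

text \<open>\<open>\<Phi>\<close> sends \<open>x \<otimes> ms\<close> to
  \<open>x \<otimes> (1 \<otimes> ms \<otimes> 1)\<close>, and \<open>\<Psi>\<close> sends
  \<open>x \<otimes> (a \<otimes> ms \<otimes> a')\<close> to \<open>a' x a \<otimes> ms\<close>.
  Hence the zeroth face multiplies \<open>x\<close> on the right and the last one on the left, which
  is the cyclic term.\<close>

lemma chain_b_pure:
  assumes x: "x \<in> carrier X" and ms: "ms \<in> lists M" "length ms = n" and n: "n \<ge> 1"
  shows "chain_b n (chain_pure k A B M X x ms) =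
    chain_pure k A B M X (x \<triangleleft>\<^bsub>X\<^esub> hd ms) (tl ms) \<oplus>\<^bsub>rel_chains k A B M X (n - 1)\<^esub>
    (\<Oplus>\<^bsub>rel_chains k A B M X (n - 1)\<^esub>i\<in>{1..n - 1}.
       alt_sign (rel_chains k A B M X (n - 1)) i (chain_pure k A B M X x (contract_at A ms i)))
    \<oplus>\<^bsub>rel_chains k A B M X (n - 1)\<^esub>
    alt_sign (rel_chains k A B M X (n - 1)) n (chain_pure k A B M X (last ms \<odot>\<^bsub>X\<^esub> x) (butlast ms))"
proof -
  obtain m where m: "n = Suc m" using n by (cases n) auto
  let ?G = "\<lambda>t. TB.\<Psi> m (TB.XP.tpure m x t)"
  have w: "\<one>\<^bsub>A\<^esub> # ms @ [\<one>\<^bsub>A\<^esub>] \<in> listset (BF (Suc m))" using ms m by (simp add: bar_W_Cons)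
  have t: "tp (Suc m) ms \<in> carrier (Tp.LQ (Suc m))" using tp_closed ms m by simp
  have hl: "hd ms \<in> carrier A" "last ms \<in> carrier A"
    using ms m M_simps(1) by (cases ms; auto)+
  have "chain_b n (chain_pure k A B M X x ms) = ?G (bar_d (Suc m) (Bar.lpure (Suc m) (\<one>\<^bsub>A\<^esub> # ms @ [\<one>\<^bsub>A\<^esub>])))"
    using x t ms m w
    by (simp add: chain_b_def chain_pure_eq TB.\<Phi>(2) unit_tp Bar.lpure_closed
        env.tmap_pure[OF X.X.env_right_module BarX.X.env_left_module BarX.X.env_left_module bar_d_env_linear])
  also have "\<dots> = chain_pure k A B M X ((\<one>\<^bsub>A\<^esub> \<odot>\<^bsub>X\<^esub> x) \<triangleleft>\<^bsub>X\<^esub> (\<one>\<^bsub>A\<^esub> \<otimes>\<^bsub>A\<^esub> hd ms)) (tl ms) \<oplus>\<^bsub>TB.XN.T m\<^esub>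
    (\<Oplus>\<^bsub>TB.XN.T m\<^esub>i\<in>{1..m}. alt_sign (TB.XN.T m) i (chain_pure k A B M X ((\<one>\<^bsub>A\<^esub> \<odot>\<^bsub>X\<^esub> x) \<triangleleft>\<^bsub>X\<^esub> \<one>\<^bsub>A\<^esub>) (contract_at A ms i)))
    \<oplus>\<^bsub>TB.XN.T m\<^esub> alt_sign (TB.XN.T m) (Suc m)
      (chain_pure k A B M X (((last ms \<otimes>\<^bsub>A\<^esub> \<one>\<^bsub>A\<^esub>) \<odot>\<^bsub>X\<^esub> x) \<triangleleft>\<^bsub>X\<^esub> \<one>\<^bsub>A\<^esub>) (butlast ms))"
  proof (rule bar_d_pure[where G = ?G and g = "\<lambda>a ms a'. chain_pure k A B M X ((a' \<odot>\<^bsub>X\<^esub> x) \<triangleleft>\<^bsub>X\<^esub> a) ms"])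
    show "abelian_group (TB.XN.T m)" by (rule TB.XN.T.N.abelian_group_axioms)
    fix a ms a' assume "a \<in> carrier A" "ms \<in> lists M" "length ms = m" "a' \<in> carrier A"
    then show "?G (Bar.lpure m (a # ms @ [a'])) = chain_pure k A B M X ((a' \<odot>\<^bsub>X\<^esub> x) \<triangleleft>\<^bsub>X\<^esub> a) ms"
      using x tp_closed[of ms m]
      by (simp add: lpure_unit TB.\<Psi>_pure epure_closed X.X.env_right_pure chain_pure_eq)
  qed (use x ms m in \<open>simp_all add: TB.XP.tensor_pure_closed TB.XP.tensor_pure_add_right[simplified] linear_mapD[OF TB.\<Psi>(1)]\<close>)
  also have "\<dots> = chain_pure k A B M X (x \<triangleleft>\<^bsub>X\<^esub> hd ms) (tl ms) \<oplus>\<^bsub>TB.XN.T m\<^esub>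
    (\<Oplus>\<^bsub>TB.XN.T m\<^esub>i\<in>{1..m}. alt_sign (TB.XN.T m) i (chain_pure k A B M X x (contract_at A ms i)))
    \<oplus>\<^bsub>TB.XN.T m\<^esub> alt_sign (TB.XN.T m) (Suc m) (chain_pure k A B M X (last ms \<odot>\<^bsub>X\<^esub> x) (butlast ms))"
    using x hl by (simp add: X.X.lact X.X.ract)
  finally show ?thesis by (simp add: m rel_chains_eq)
qed

text \<open>The extension of \<open>f\<close> takes \<open>a \<otimes> ms \<otimes> a'\<close> to
  \<open>a f(ms) a'\<close>, so outer letters come out as the two actions on \<open>X\<close>.
  Degree 0 is included, with an empty middle sum.\<close>

lemma cochain_b_pure:
  assumes f: "f \<in> carrier (rel_cochains k A B M X n)" and ms: "ms \<in> lists M" "length ms = Suc n"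
  shows "cochain_b n f (tpow_pure k A B M ms) =
    hd ms \<odot>\<^bsub>X\<^esub> f (tpow_pure k A B M (tl ms)) \<oplus>\<^bsub>X\<^esub>
    (\<Oplus>\<^bsub>X\<^esub>i\<in>{1..n}. alt_sign X i (f (tpow_pure k A B M (contract_at A ms i)))) \<oplus>\<^bsub>X\<^esub>
    alt_sign X (Suc n) (f (tpow_pure k A B M (butlast ms)) \<triangleleft>\<^bsub>X\<^esub> last ms)"
proof -
  \<comment> \<open>The target in \<open>bar_d_pure\<close> is a record over \<open>k\<close>;
    \<open>kmod A X\<close> has the additive group of \<open>X\<close>, and the final step returns
    to \<open>X\<close> itself.\<close>
  let ?f = "\<lambda>ms. f (tpow_pure k A B M ms)" and ?Z = "kmod A X"
  note f' = f[unfolded rel_cochains_eq]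
  have G: "linear_map (env k A) (BarE n) XL (HB.\<Psi>\<^sub>h n f)" using HB.\<Psi>\<^sub>h(1)[OF f'] by simp
  have cl: "?f ms \<in> carrier X" if "ms \<in> lists M" "length ms = n" for ms
    using f' linear_mapD(1)[of "env k (subalg A B)" "TpE n" "env_left k (subalg A B) X" f] tp_closed[OF that]
    by (simp add: tpow_pure_eq[OF that(2)])
  have w: "\<one>\<^bsub>A\<^esub> # ms @ [\<one>\<^bsub>A\<^esub>] \<in> listset (BF (Suc n))" using ms by (simp add: bar_W_Cons)
  have hl: "hd ms \<in> carrier A" "last ms \<in> carrier A" "tl ms \<in> lists M" "butlast ms \<in> lists M"
    using ms M_simps(1) by (cases ms; auto dest: in_set_butlastD)+
  have "cochain_b n f (tpow_pure k A B M ms) = HB.\<Psi>\<^sub>h n f (bar_d (Suc n) (Bar.lpure (Suc n) (\<one>\<^bsub>A\<^esub> # ms @ [\<one>\<^bsub>A\<^esub>])))"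
    using tp_closed[OF ms] Bar.lpure_closed[OF w]
    by (simp add: cochain_b_def HB.\<Phi>\<^sub>h_def hmap_def tpow_pure_eq[OF ms(2)] unit_tp[OF ms])
  also have "\<dots> = ((\<one>\<^bsub>A\<^esub> \<otimes>\<^bsub>A\<^esub> hd ms) \<odot>\<^bsub>X\<^esub> ?f (tl ms)) \<triangleleft>\<^bsub>X\<^esub> \<one>\<^bsub>A\<^esub> \<oplus>\<^bsub>?Z\<^esub>
    (\<Oplus>\<^bsub>?Z\<^esub>i\<in>{1..n}. alt_sign ?Z i ((\<one>\<^bsub>A\<^esub> \<odot>\<^bsub>X\<^esub> ?f (contract_at A ms i)) \<triangleleft>\<^bsub>X\<^esub> \<one>\<^bsub>A\<^esub>)) \<oplus>\<^bsub>?Z\<^esub>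
    alt_sign ?Z (Suc n) ((\<one>\<^bsub>A\<^esub> \<odot>\<^bsub>X\<^esub> ?f (butlast ms)) \<triangleleft>\<^bsub>X\<^esub> (last ms \<otimes>\<^bsub>A\<^esub> \<one>\<^bsub>A\<^esub>))"
  proof (rule bar_d_pure[where G = "HB.\<Psi>\<^sub>h n f" and g = "\<lambda>a ms a'. (a \<odot>\<^bsub>X\<^esub> ?f ms) \<triangleleft>\<^bsub>X\<^esub> a'"])
    show "abelian_group ?Z" by (rule X.X.Xk.N.abelian_group_axioms)
    fix a ms a' assume "a \<in> carrier A" "ms \<in> lists M" "length ms = n" "a' \<in> carrier A"
    then show "HB.\<Psi>\<^sub>h n f (Bar.lpure n (a # ms @ [a'])) = (a \<odot>\<^bsub>X\<^esub> ?f ms) \<triangleleft>\<^bsub>X\<^esub> a'"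
      using tp_closed[of ms n] cl[of ms] HB.\<Psi>\<^sub>h(2)[OF f', of "epure a a'" "tp n ms"]
      by (simp add: lpure_unit epure_closed X.X.env_left_pure tpow_pure_eq)
  qed (use ms linear_mapD[OF G] in simp_all)
  also have "\<dots> = hd ms \<odot>\<^bsub>X\<^esub> ?f (tl ms) \<oplus>\<^bsub>?Z\<^esub>
    (\<Oplus>\<^bsub>?Z\<^esub>i\<in>{1..n}. alt_sign ?Z i (?f (contract_at A ms i))) \<oplus>\<^bsub>?Z\<^esub> alt_sign ?Z (Suc n) (?f (butlast ms) \<triangleleft>\<^bsub>X\<^esub> last ms)"
  proof -
    have "?f (contract_at A ms i) \<in> carrier X" if "i \<in> {1..n}" for i
      using that contract_at_word[OF ms, of i] by (intro cl) auto
    then have "(\<Oplus>\<^bsub>?Z\<^esub>i\<in>{1..n}. alt_sign ?Z i ((\<one>\<^bsub>A\<^esub> \<odot>\<^bsub>X\<^esub> ?f (contract_at A ms i)) \<triangleleft>\<^bsub>X\<^esub> \<one>\<^bsub>A\<^esub>)) =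
        (\<Oplus>\<^bsub>?Z\<^esub>i\<in>{1..n}. alt_sign ?Z i (?f (contract_at A ms i)))"
      by (intro X.X.Xk.N.finsum_cong') (auto simp: X.X.lact X.X.ract intro!: X.X.Xk.N.alt_sign(1)[simplified])
    then show ?thesis using hl cl[of "tl ms"] cl[of "butlast ms"] ms by (simp add: X.X.lact X.X.ract)
  qed
  finally show ?thesis
    by (simp add: finsum_record_cong[of "kmod A X" X] alt_sign_record_cong[of "kmod A X" X])
qed

lemma chain_b_Hochschild: "is_rel_Hochschild_homology TYPE('p) k A B X (homology (rel_chains k A B M X) chain_b)"
  unfolding is_rel_Hochschild_homology_def Hochschild_resolution_def
  by (intro allI impI module_iso_trans[OF chain_b_homology]
      E.Tor_independent[OF bar_res _ SelfX.X.env_left_module X.X.env_right_module])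

lemma cochain_b_Hochschild: "is_rel_Hochschild_cohomology TYPE('p) k A B X (cohomology (rel_cochains k A B M X) cochain_b)"
  unfolding is_rel_Hochschild_cohomology_def Hochschild_resolution_def
  by (intro allI impI module_iso_trans[OF cochain_b_cohomology]
      E.Ext_independent[OF bar_res _ SelfX.X.env_left_module X.X.env_left_module])

end

section \<open>From the locales to the three assertions\<close>

lemma split_extI:
  assumes k: "field k" and split: "split_extension k A B M"
  shows "split_ext k A B M"
proof -
  interpret field k by fact
  have "base_ring k" by (intro base_ring.intro cring_axioms)
  then show ?thesis
    using split by (intro split_ext.intro split_ext_axioms.intro env_data.intro base_ring.base_algebraI)
      (simp_all add: split_extension_def)
qed

theorem theorem2p3:
  fixes k :: "'k ring" and A :: "('k, 'a) module" and B M :: "'a set"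
  assumes "field k" and "split_extension k A B M"
  shows
    "(\<exists>d \<epsilon>.
       Hochschild_resolution k A B (\<lambda>n. env_left k A (bar_bimodule k A B M n)) d \<epsilon> \<and>
       (\<forall>a\<in>carrier A. \<forall>a'\<in>carrier A. \<epsilon> (bar_pure k A B M a [] a') = a \<otimes>\<^bsub>A\<^esub> a') \<and>
       (\<forall>n\<ge>1. \<forall>a\<in>carrier A. \<forall>a'\<in>carrier A. \<forall>ms\<in>lists M. length ms = n \<longrightarrow>
          d n (bar_pure k A B M a ms a') =
            bar_pure k A B M (a \<otimes>\<^bsub>A\<^esub> hd ms) (tl ms) a'
            \<oplus>\<^bsub>bar_bimodule k A B M (n - 1)\<^esub>
            (\<Oplus>\<^bsub>bar_bimodule k A B M (n - 1)\<^esub>i\<in>{1..n - 1}.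
               alt_sign (bar_bimodule k A B M (n - 1)) i (bar_pure k A B M a (contract_at A ms i) a'))
            \<oplus>\<^bsub>bar_bimodule k A B M (n - 1)\<^esub>
            alt_sign (bar_bimodule k A B M (n - 1)) n (bar_pure k A B M a (butlast ms) (last ms \<otimes>\<^bsub>A\<^esub> a')))) \<and>
    (\<forall>X :: ('a, 'x) bimodule. is_bimodule k A X \<longrightarrow>
       (\<exists>b. chain_complex k (rel_chains k A B M X) b \<and>
         (\<forall>n\<ge>1. \<forall>x\<in>carrier X. \<forall>ms\<in>lists M. length ms = n \<longrightarrow>
            b n (chain_pure k A B M X x ms) =
              chain_pure k A B M X (x \<triangleleft>\<^bsub>X\<^esub> hd ms) (tl ms)
              \<oplus>\<^bsub>rel_chains k A B M X (n - 1)\<^esub>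
              (\<Oplus>\<^bsub>rel_chains k A B M X (n - 1)\<^esub>i\<in>{1..n - 1}.
                 alt_sign (rel_chains k A B M X (n - 1)) i (chain_pure k A B M X x (contract_at A ms i)))
              \<oplus>\<^bsub>rel_chains k A B M X (n - 1)\<^esub>
              alt_sign (rel_chains k A B M X (n - 1)) n
                (chain_pure k A B M X (last ms \<odot>\<^bsub>X\<^esub> x) (butlast ms))) \<and>
         is_rel_Hochschild_homology TYPE('p) k A B X (homology (rel_chains k A B M X) b))) \<and>
    (\<forall>X :: ('a, 'x) bimodule. is_bimodule k A X \<longrightarrow>
       (\<exists>b. cochain_complex k (rel_cochains k A B M X) b \<and>
         (\<forall>f\<in>carrier (rel_cochains k A B M X 0). \<forall>m\<in>M.
            b 0 f (tpow_pure k A B M [m]) =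
              m \<odot>\<^bsub>X\<^esub> f (tpow_pure k A B M []) \<ominus>\<^bsub>X\<^esub> f (tpow_pure k A B M []) \<triangleleft>\<^bsub>X\<^esub> m) \<and>
         (\<forall>n\<ge>1. \<forall>f\<in>carrier (rel_cochains k A B M X n). \<forall>ms\<in>lists M. length ms = n + 1 \<longrightarrow>
            b n f (tpow_pure k A B M ms) =
              hd ms \<odot>\<^bsub>X\<^esub> f (tpow_pure k A B M (tl ms))
              \<oplus>\<^bsub>X\<^esub> (\<Oplus>\<^bsub>X\<^esub>i\<in>{1..n}. alt_sign X i (f (tpow_pure k A B M (contract_at A ms i))))
              \<oplus>\<^bsub>X\<^esub> alt_sign X (n + 1) (f (tpow_pure k A B M (butlast ms)) \<triangleleft>\<^bsub>X\<^esub> last ms)) \<and>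
         is_rel_Hochschild_cohomology TYPE('p) k A B X (cohomology (rel_cochains k A B M X) b)))"
proof (intro conjI allI impI, goal_cases)
  case 1
  interpret split_ext k A B M by (rule split_extI) fact+
  have "bar_\<epsilon> (bar_pure k A B M a [] a') = a \<otimes>\<^bsub>A\<^esub> a'" if "a \<in> carrier A" "a' \<in> carrier A" for a a'
    using that by (simp add: bar_pure_eq bar_\<epsilon>(2))
  then show ?case
    by (intro exI[of _ bar_d] exI[of _ bar_\<epsilon>] conjI allI ballI impI bar_resolution bar_d_bar_pure)
next
  case (2 X)
  then interpret split_ext_bimod k A B M X
    by (intro split_ext_bimod.intro split_ext_bimod_axioms.intro split_extI assms)
  show ?case
    by (intro exI[of _ chain_b] conjI allI ballI impI chain_b_complex chain_b_Hochschild chain_b_pure)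
next
  case (3 X)
  then interpret split_ext_bimod k A B M X
    by (intro split_ext_bimod.intro split_ext_bimod_axioms.intro split_extI assms)
  \<comment> \<open>The general formula for \<open>n = 0\<close>: no inner products occur, and the
    sign of the last face is negative.\<close>
  have "cochain_b 0 f (tpow_pure k A B M [m]) =
      m \<odot>\<^bsub>X\<^esub> f (tpow_pure k A B M []) \<ominus>\<^bsub>X\<^esub> f (tpow_pure k A B M []) \<triangleleft>\<^bsub>X\<^esub> m"
    if f: "f \<in> carrier (rel_cochains k A B M X 0)" and m: "m \<in> M" for f m
  proof -
    have "f (tpow_pure k A B M []) \<in> carrier X"
      using f linear_mapD(1)[of "env k (subalg A B)" "TpE 0" "env_left k (subalg A B) X" f] tp_closed[of "[]" 0]
      by (simp add: rel_cochains_eq tpow_pure_eq)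
    then show ?thesis
      using cochain_b_pure[OF f, of "[m]"] m by (simp add: alt_sign_def a_minus_def M_simps X.X.lact)
  qed
  moreover have "cochain_b n f (tpow_pure k A B M ms) =
      hd ms \<odot>\<^bsub>X\<^esub> f (tpow_pure k A B M (tl ms)) \<oplus>\<^bsub>X\<^esub>
      (\<Oplus>\<^bsub>X\<^esub>i\<in>{1..n}. alt_sign X i (f (tpow_pure k A B M (contract_at A ms i)))) \<oplus>\<^bsub>X\<^esub>
      alt_sign X (n + 1) (f (tpow_pure k A B M (butlast ms)) \<triangleleft>\<^bsub>X\<^esub> last ms)"
    if "f \<in> carrier (rel_cochains k A B M X n)" "ms \<in> lists M" "length ms = n + 1" for n f ms
    using cochain_b_pure[of f n ms] that by simp
  ultimately show ?case
    by (intro exI[of _ cochain_b] conjI allI ballI impI cochain_b_complex cochain_b_Hochschild)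
qed

end
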